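(* Let $b\ge 2$ be an integer, $\gamma\in(0,1)$, and let $\phi:\mathbb{R}\to\mathbb{R}$ be a $\mathbb{Z}$-periodic real analytic function. Let $\omega$ be the SRB measure of the map $T:[0,1)\times\mathbb{R}\to[0,1)\times\mathbb{R}$, $T(x,y)=(bx \bmod 1,\ \gamma y+\phi(x))$, and let $F^{\phi}_{b,\gamma}$ be the support of $\omega$. Then $\omega$ is exact dimensional and exactly one of the following holds: (i) $F^{\phi}_{b,\gamma}$ is the graph of a real analytic function; (ii) $\dim_H(F^{\phi}_{b,\gamma})=\dim(\omega)=\min\{2,\ 1+\frac{\log b}{\log(1/\gamma)}\}$. Moreover, for fixed $b$ and non-constant $\phi$, alternative (i) holds for only finitely many $\gamma\in(0,1)$.
   Context: The SRB measure $\omega$ of $T$ is the ergodic Borel probability measure on $[0,1)\times\mathbb{R}$ such that Lebesgue-almost every point $z$ satisfies $\frac1n\sum_{k=0}^{n-1}\delta_{T^k(z)}\to\omega$ weakly. A Borel probability measure $\mu$ on a metric space is exact dimensional if there is $\beta\ge0$ with $\lim_{r\to0}\frac{\log\mu(B(x,r))}{\log r}=\beta$ for $\mu$-a.e. $x$; then $\dim(\mu):=\beta$. $\dim_H$ denotes Hausdorff dimension. *)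

theory Defs
  imports "HOL-Analysis.Analysis" "HOL-Probability.Probability"
begin

definition real_analytic_on :: "(real \<Rightarrow> real) \<Rightarrow> real set \<Rightarrow> bool" where
  "real_analytic_on f S \<longleftrightarrow>
     (\<forall>x0\<in>S. \<exists>r>0. \<exists>a::nat \<Rightarrow> real.
        \<forall>y. \<bar>y - x0\<bar> < r \<longrightarrow> (\<lambda>n. a n * (y - x0) ^ n) sums f y)"

definition dom01 :: "(real \<times> real) set" where
  "dom01 = {0..<1} \<times> UNIV"

definition skewT :: "nat \<Rightarrow> real \<Rightarrow> (real \<Rightarrow> real) \<Rightarrow> real \<times> real \<Rightarrow> real \<times> real" where
  "skewT b \<gamma> \<phi> z = (frac (real b * fst z), \<gamma> * snd z + \<phi> (fst z))"

definition invariant_measure :: "(real \<times> real) measure \<Rightarrow> (real \<times> real \<Rightarrow> real \<times> real) \<Rightarrow> bool" where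
  "invariant_measure M T \<longleftrightarrow> T \<in> M \<rightarrow>\<^sub>M M \<and> distr M M T = M"

definition ergodic_measure :: "(real \<times> real) measure \<Rightarrow> (real \<times> real \<Rightarrow> real \<times> real) \<Rightarrow> bool" where
  "ergodic_measure M T \<longleftrightarrow> invariant_measure M T \<and>
     (\<forall>A\<in>sets M. T -` A \<inter> space M = A \<longrightarrow> measure M A = 0 \<or> measure M A = 1)"

definition borel_prob_on_dom :: "(real \<times> real) measure \<Rightarrow> bool" where
  "borel_prob_on_dom M \<longleftrightarrow> prob_space M \<and> sets M = sets borel \<and> emeasure M dom01 = 1"

definition empirical_weak_conv ::
  "(real \<times> real \<Rightarrow> real \<times> real) \<Rightarrow> real \<times> real \<Rightarrow> (real \<times> real) measure \<Rightarrow> bool" where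
  "empirical_weak_conv T z M \<longleftrightarrow>
     (\<forall>f :: real \<times> real \<Rightarrow> real. continuous_on dom01 f \<and> bounded (f ` dom01) \<longrightarrow>
        (\<lambda>n. (\<Sum>k<n. f ((T ^^ k) z)) / real n) \<longlonglongrightarrow> (\<integral>x. indicator dom01 x * f x \<partial>M))"

definition SRB_measure :: "(real \<times> real \<Rightarrow> real \<times> real) \<Rightarrow> (real \<times> real) measure \<Rightarrow> bool" where
  "SRB_measure T M \<longleftrightarrow> borel_prob_on_dom M \<and> ergodic_measure M T \<and>
     (AE z in lborel. z \<in> dom01 \<longrightarrow> empirical_weak_conv T z M)"

definition support_on_dom :: "(real \<times> real) measure \<Rightarrow> (real \<times> real) set" where
  "support_on_dom M = {z \<in> dom01. \<forall>r>0. emeasure M (ball z r) > 0}"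

definition exact_dimensional_with :: "(real \<times> real) measure \<Rightarrow> real \<Rightarrow> bool" where
  "exact_dimensional_with M \<beta> \<longleftrightarrow> \<beta> \<ge> 0 \<and>
     (AE x in M. ((\<lambda>r. ln (measure M (ball x r)) / ln r) \<longlongrightarrow> \<beta>) (at_right 0))"

definition exact_dimensional :: "(real \<times> real) measure \<Rightarrow> bool" where
  "exact_dimensional M \<longleftrightarrow> (\<exists>\<beta>. exact_dimensional_with M \<beta>)"

definition measure_dim :: "(real \<times> real) measure \<Rightarrow> real" where
  "measure_dim M = (THE \<beta>. exact_dimensional_with M \<beta>)"

definition hausdorff_pre :: "real \<Rightarrow> real \<Rightarrow> 'a::metric_space set \<Rightarrow> ennreal" where
  "hausdorff_pre s \<delta> F = (INF C \<in> {C :: nat \<Rightarrow> 'a set. F \<subseteq> (\<Union>n. C n) \<and>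
        (\<forall>n. bounded (C n) \<and> diameter (C n) \<le> \<delta>)}. (\<Sum>n. ennreal (diameter (C n) powr s)))"

definition hausdorff_measure :: "real \<Rightarrow> 'a::metric_space set \<Rightarrow> ennreal" where
  "hausdorff_measure s F = (SUP \<delta> \<in> {0<..}. hausdorff_pre s \<delta> F)"

definition hausdorff_dim :: "'a::metric_space set \<Rightarrow> real" where
  "hausdorff_dim F = Inf {s. s > 0 \<and> hausdorff_measure s F = 0}"

end

theory Submission
  imports Defs "HOL-Real_Asymp.Real_Asymp" "HOL-Complex_Analysis.Complex_Analysis"
begin

text \<open>
  With \<open>H\<^sub>q t = (\<Sum>n<q. \<gamma>\<^sup>n \<phi> (t / b\<^sup>n\<^sup>+\<^sup>1))\<close>, the SRB measure is the weak limit of the laws of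
  \<open>(frac t, H\<^sub>q t)\<close> for \<open>t\<close> uniform in \<open>[0, b\<^sup>q)\<close>. For \<open>k\<close> not divisible by \<open>b\<close> put
  \<open>S k = (\<Sum>j. \<gamma>\<^sup>j a (k b\<^sup>j))\<close>, where \<open>a\<close> denotes the Fourier coefficients of \<open>\<phi>\<close>.

  If all \<open>S k\<close> vanish, then \<open>\<phi> t = g (b t) - \<gamma> g t\<close> for a continuous periodic \<open>g\<close>. Then \<open>H\<^sub>q\<close> converges to
  \<open>g\<close> together with all derivatives, so \<open>g\<close> is analytic and the measure lives on its graph.

  If some \<open>S k\<close> is nonzero, the functions \<open>H\<^sub>q\<close> and \<open>H\<^sub>q (\<cdot> + k)\<close> stay apart uniformly in \<open>q\<close> and in \<open>k\<close> not
  divisible by \<open>b\<close>, and by analyticity so do their jets of a fixed order \<open>N\<close>. A descent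
  from order \<open>N\<close> to order 1 shows that tangencies between branches are rare: branches whose jets of order \<open>l + 1\<close>
  differ spend little time with equal jets of order \<open>l\<close>, and the few bad branches are suppressed by
  weights. The resulting bound on the number of close pairs gives the lower local dimension, and counting
  boxes gives the upper one.

  For fixed \<open>k\<close> the sum \<open>S k\<close> is a power series in \<open>\<gamma>\<close> with radius of convergence larger than 1, so it has only
  finitely many zeros in the unit interval unless it vanishes identically.
\<close>

section \<open>Averages over unions of unit intervals\<close>

text \<open>Two branches may touch at some points, so no uniform transversality bound is available.
  The substitute is a recursion in blocks of \<open>p\<close> digits. A pair close to order
  \<open>l\<close> either has clearly different derivatives of order \<open>l + 1\<close>, and then
  it is close only on a short set of abscissas, or it is close to order \<open>l + 1\<close> already
  after one block. In the latter case few leading digits are possible, and the other digits form a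
  rescaled copy of the problem. The resulting rate is \<open>max (lam l) (1 / real b)\<close> with
  \<open>lam l = \<gamma> / real b ^ l\<close>. For \<open>l \<ge> 1\<close> it equals
  \<open>1 / real b\<close>, so a typical branch has subexponentially many close partners, which is
  the input for the next lower order. For \<open>l = 0\<close> it equals
  \<open>max \<gamma> (1 / real b)\<close>, and this number times \<open>\<gamma>\<close> is
  \<open>\<gamma>\<close> to the power of the claimed dimension. Weights are needed because bad
  leading digits are rare but recur along the orbit of \<open>t\<close> under division by
  \<open>b ^ p\<close>: discarding every branch that ever meets them would leave almost nothing,
  whereas a penalty per visit costs a typical branch only a small exponential factor.\<close>

definition U01 :: "real measure" where
  "U01 = density lborel (\<lambda>x. ennreal (indicator {0..<1} x))"

lemma sets_U01 [simp, measurable_cong]: "sets U01 = sets borel"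
  by (simp add: U01_def)

lemma space_U01 [simp]: "space U01 = UNIV"
  by (simp add: U01_def)

lemma emeasure_U01: "A \<in> sets borel \<Longrightarrow> emeasure U01 A = emeasure lborel (A \<inter> {0..<1})"
  unfolding U01_def
  by (subst emeasure_density) (auto simp: ennreal_indicator nn_integral_indicator simp flip: indicator_inter_arith
     intro!: arg_cong[where f="emeasure lborel"])

interpretation U01: prob_space U01
  by (rule prob_spaceI) (simp add: emeasure_U01)

lemma measure_U01: "A \<in> sets borel \<Longrightarrow> measure U01 A = measure lborel (A \<inter> {0..<1})"
  by (simp add: measure_def emeasure_U01)

lemma AE_U01: "AE x in U01. 0 \<le> x \<and> x < 1"
proof -
  have "emeasure U01 (- {0..<1}) = 0" by (subst emeasure_U01) auto
  then show ?thesis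
    by (intro AE_I[where N="- {0..<1}"]) auto
qed

lemma integral_U01:
  fixes f :: "real \<Rightarrow> real"
  assumes "f \<in> borel_measurable borel"
  shows "integral\<^sup>L U01 f = (\<integral>x. indicator {0..<1} x * f x \<partial>lborel)"
  unfolding U01_def by (subst integral_density) (use assms in auto)

text \<open>Bounded Borel functions are closed under the operations used below and always integrable
  for \<open>U01\<close>, so one set of rules settles the integrability side conditions.\<close>

definition bbd :: "(real \<Rightarrow> real) \<Rightarrow> bool" where
  "bbd F \<longleftrightarrow> F \<in> borel_measurable borel \<and> (\<exists>B. \<forall>x. \<bar>F x\<bar> \<le> B)"

lemma bbdI: "F \<in> borel_measurable borel \<Longrightarrow> (\<And>x. \<bar>F x\<bar> \<le> B) \<Longrightarrow> bbd F"
  unfolding bbd_def by blast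

lemma bbd_measurable [measurable_dest]: "bbd F \<Longrightarrow> F \<in> borel_measurable borel"
  unfolding bbd_def by blast

lemma bbd_integrable: "bbd F \<Longrightarrow> integrable U01 F"
proof -
  assume F: "bbd F"
  then obtain B where "\<forall>x. \<bar>F x\<bar> \<le> B" unfolding bbd_def by blast
  then show ?thesis using F by (intro U01.integrable_const_bound[of _ B]) (auto simp: bbd_def)
qed

lemma bbd_comp: "bbd F \<Longrightarrow> g \<in> borel_measurable borel \<Longrightarrow> bbd (\<lambda>x. F (g x))"
  unfolding bbd_def by auto

lemma bbd_const [simp]: "bbd (\<lambda>x. c)"
  by (rule bbdI[where B="\<bar>c\<bar>"]) auto

lemma bbd_add: "bbd F \<Longrightarrow> bbd G \<Longrightarrow> bbd (\<lambda>x. F x + G x)"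
proof -
  assume F: "bbd F" and G: "bbd G"
  obtain A B where "\<forall>x. \<bar>F x\<bar> \<le> A" "\<forall>x. \<bar>G x\<bar> \<le> B" using F G unfolding bbd_def by blast
  then have "\<bar>F x + G x\<bar> \<le> A + B" for x
    by (meson abs_triangle_ineq add_mono order_trans)
  then show ?thesis using F G by (intro bbdI) (auto simp: bbd_def)
qed

lemma bbd_mult: "bbd F \<Longrightarrow> bbd G \<Longrightarrow> bbd (\<lambda>x. F x * G x)"
proof -
  assume F: "bbd F" and G: "bbd G"
  obtain A B where AB: "\<forall>x. \<bar>F x\<bar> \<le> A" "\<forall>x. \<bar>G x\<bar> \<le> B" using F G unfolding bbd_def by blast
  have "\<bar>F x * G x\<bar> \<le> A * B" for x
    unfolding abs_mult using AB by (intro mult_mono) (auto intro: order_trans[OF abs_ge_zero])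
  then show ?thesis using F G by (intro bbdI) (auto simp: bbd_def)
qed

lemma bbd_sum: "(\<And>i. i \<in> I \<Longrightarrow> bbd (F i)) \<Longrightarrow> bbd (\<lambda>x. \<Sum>i\<in>I. F i x)"
  by (induction I rule: infinite_finite_induct) (auto intro: bbd_add)

lemma bbd_prod: "(\<And>i. i \<in> I \<Longrightarrow> bbd (F i)) \<Longrightarrow> bbd (\<lambda>x. \<Prod>i\<in>I. F i x)"
  by (induction I rule: infinite_finite_induct) (auto intro: bbd_mult)

lemma bbd_of_bool: "Measurable.pred borel P \<Longrightarrow> bbd (\<lambda>x. of_bool (P x))"
  by (intro bbdI[where B=1]) auto

lemma bbd_divide: "bbd F \<Longrightarrow> bbd (\<lambda>x. F x / c)"
  using bbd_mult[OF _ bbd_const[of "1/c"], of F] by (simp add: field_simps)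

lemmas bbd_intros = bbd_const bbd_add bbd_mult bbd_sum bbd_prod bbd_of_bool bbd_divide

section \<open>Digit splitting and averages over pairs of lifts\<close>

lemma sum_lessThan_split:
  fixes f :: "nat \<Rightarrow> 'a::comm_monoid_add"
  shows "(\<Sum>k<N * M. f k) = (\<Sum>u<M. \<Sum>w<N. f (w + N * u))"
proof -
  have "(\<Sum>k<N * M. f k) = (\<Sum>u<M. sum f {u*N..<u*N+N})"
    using sum.nat_group[of f N M] by (simp add: mult.commute)
  also have "\<dots> = (\<Sum>u<M. \<Sum>w<N. f (w + N * u))"
  proof (rule sum.cong[OF refl])
    fix u
    show "sum f {u*N..<u*N+N} = (\<Sum>w<N. f (w + N * u))"
      using sum.shift_bounds_nat_ivl[of f 0 "u*N" N]
      by (simp add: lessThan_atLeast0 add.commute mult.commute)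
  qed
  finally show ?thesis .
qed

text \<open>The unit interval is the disjoint union of \<open>N\<close> intervals of length
  \<open>1 / N\<close>, each an affine image of the whole; this is the invariance of Lebesgue
  measure under multiplication by \<open>N\<close> modulo 1.\<close>

lemma U01_split:
  fixes F :: "real \<Rightarrow> real"
  assumes F: "bbd F" and N: "N > 0"
  shows "(\<Sum>w<N. \<integral>x. F ((x + real w) / real N) \<partial>U01) = real N * integral\<^sup>L U01 F"
proof -
  have [measurable]: "F \<in> borel_measurable borel" using F by (rule bbd_measurable)
  obtain B where B: "\<bar>F x\<bar> \<le> B" for x using F unfolding bbd_def by blast
  let ?I = "\<lambda>w x. indicator {real w / real N..<(real w + 1) / real N} x :: real"
  have each: "(\<integral>x. F ((x + real w) / real N) \<partial>U01) = real N * (\<integral>x. ?I w x * F x \<partial>lborel)" for w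
  proof -
    have "(\<integral>x. ?I w x * F x \<partial>lborel)
        = \<bar>1 / real N\<bar> *\<^sub>R (\<integral>x. ?I w (real w / real N + 1 / real N * x) * F (real w / real N + 1 / real N * x) \<partial>lborel)"
      by (rule lborel_integral_real_affine) (use N in auto)
    also have "(\<lambda>x. ?I w (real w / real N + 1 / real N * x) * F (real w / real N + 1 / real N * x))
         = (\<lambda>x. indicator {0..<1} x * F ((x + real w) / real N))"
      using N by (auto simp: fun_eq_iff indicator_def field_simps)
    finally show ?thesis using N by (subst integral_U01) auto
  qed
  have int: "integrable lborel (\<lambda>x. ?I w x * F x)" for w
  proof (rule Bochner_Integration.integrable_bound[of lborel "\<lambda>x. B * indicator {real w / real N..<(real w + 1) / real N} x"])
    show "integrable lborel (\<lambda>x. B * indicator {real w / real N..<(real w + 1) / real N} x)"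
      using N by (intro integrable_mult_right integrable_real_indicator) (auto simp: divide_right_mono)
    show "AE x in lborel. norm (?I w x * F x) \<le> norm (B * indicator {real w / real N..<(real w + 1) / real N} x)"
      using B by (auto simp: indicator_def intro!: AE_I2 intro: order_trans[OF _ abs_ge_self])
  qed simp
  have sumI: "(\<Sum>w<N. ?I w x) = indicator {0..<1} x" for x
  proof (cases "0 \<le> x \<and> x < 1")
    case True
    define v where "v = nat \<lfloor>x * real N\<rfloor>"
    have x0: "0 \<le> x * real N" "x * real N < real N" using True N by auto
    have v: "real v \<le> x * real N" "x * real N < real v + 1"
      using x0 unfolding v_def by (auto simp: of_nat_nat)
    have vN: "v < N" using v x0 by linarith
    have "?I w x = (if w = v then 1 else 0)" for w
    proof -
      have "x \<in> {real w / real N..<(real w + 1) / real N} \<longleftrightarrow> real w \<le> x * real N \<and> x * real N < real w + 1"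
        using N by (auto simp: field_simps)
      also have "\<dots> \<longleftrightarrow> w = v" using v by auto
      finally show ?thesis by (simp add: indicator_def)
    qed
    then have "(\<Sum>w<N. ?I w x) = (\<Sum>w<N. if w = v then 1 else 0)" by (intro sum.cong) auto
    also have "\<dots> = 1" using vN by simp
    finally show ?thesis using True by simp
  next
    case False
    have "?I w x = 0" if "w < N" for w
    proof -
      have "(real w + 1) / real N \<le> 1" using that N by (auto simp: field_simps)
      moreover have "0 \<le> real w / real N" by simp
      ultimately have "\<not> (real w / real N \<le> x \<and> x < (real w + 1) / real N)" using False by linarith
      then show ?thesis by (simp add: indicator_def)
    qed
    then show ?thesis using False by (auto simp: indicator_def intro!: sum.neutral)
  qed
  have "(\<Sum>w<N. \<integral>x. F ((x + real w) / real N) \<partial>U01) = real N * (\<Sum>w<N. \<integral>x. ?I w x * F x \<partial>lborel)"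
    by (simp add: each sum_distrib_left)
  also have "(\<Sum>w<N. \<integral>x. ?I w x * F x \<partial>lborel) = (\<integral>x. (\<Sum>w<N. ?I w x * F x) \<partial>lborel)"
    by (subst Bochner_Integration.integral_sum) (use int in auto)
  also have "(\<lambda>x. \<Sum>w<N. ?I w x * F x) = (\<lambda>x. indicator {0..<1} x * F x)"
    by (simp only: sum_distrib_right[symmetric] sumI)
  finally show ?thesis by (subst integral_U01) auto
qed

definition Av :: "nat \<Rightarrow> (real \<Rightarrow> real) \<Rightarrow> real" where
  "Av N F = (\<Sum>k<N. \<integral>x. F (x + real k) \<partial>U01) / real N"

text \<open>The two arguments are lifts of one uniformly chosen abscissa \<open>x\<close>, so
  \<open>PA N\<close> is a mean over pairs of branches above a common base point; the diagonal
  \<open>k = k'\<close> is included.\<close>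

definition PA :: "nat \<Rightarrow> (real \<Rightarrow> real \<Rightarrow> real) \<Rightarrow> real" where
  "PA N \<Phi> = (\<integral>x. (\<Sum>k<N. \<Sum>k'<N. \<Phi> (x + real k) (x + real k')) \<partial>U01) / (real N)\<^sup>2"

lemma bbd_shift: "bbd F \<Longrightarrow> bbd (\<lambda>x. F (x + c))"
  by (rule bbd_comp) auto

lemma bbd_scale: "bbd F \<Longrightarrow> bbd (\<lambda>x. F (x / c))"
  by (rule bbd_comp) auto

lemma Av_mono:
  assumes "bbd F" "bbd G" "\<And>x. F x \<le> G x"
  shows "Av N F \<le> Av N G"
  unfolding Av_def using assms
  by (intro divide_right_mono sum_mono integral_mono bbd_integrable bbd_shift) auto

lemma Av_const: "N > 0 \<Longrightarrow> Av N (\<lambda>x. c) = c"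
  using U01.prob_space by (simp add: Av_def)

lemma Av_add:
  assumes "bbd F" "bbd G" shows "Av N (\<lambda>x. F x + G x) = Av N F + Av N G"
  unfolding Av_def using assms
  by (simp add: Bochner_Integration.integral_add bbd_integrable bbd_shift sum.distrib add_divide_distrib)

lemma Av_cmult: "Av N (\<lambda>x. c * F x) = c * Av N F"
  unfolding Av_def by (simp add: sum_distrib_left)

lemma Av_sum:
  assumes "\<And>i. i \<in> I \<Longrightarrow> bbd (F i)"
  shows "Av N (\<lambda>x. \<Sum>i\<in>I. F i x) = (\<Sum>i\<in>I. Av N (F i))"
  using assms
proof (induction I rule: infinite_finite_induct)
  case (insert i I)
  then show ?case by (simp add: Av_add bbd_sum)
qed (auto simp: Av_def)

lemma Av_eq_integral_sum:
  assumes "bbd F" shows "Av N F = (\<integral>x. (\<Sum>k<N. F (x + real k)) \<partial>U01) / real N"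
  unfolding Av_def using assms
  by (subst Bochner_Integration.integral_sum) (auto intro!: bbd_integrable bbd_shift)

lemma Av_markov:
  assumes F: "bbd F" "\<And>x. 0 \<le> F x" and c: "c > 0"
  shows "Av N (\<lambda>x. of_bool (F x > c)) \<le> Av N F / c"
proof -
  have [measurable]: "F \<in> borel_measurable borel" using F by (simp add: bbd_measurable)
  have "Av N (\<lambda>x. of_bool (F x > c)) \<le> Av N (\<lambda>x. (1/c) * F x)"
    using F c by (intro Av_mono bbd_intros) (auto simp: of_bool_def field_simps)
  then show ?thesis unfolding Av_cmult by simp
qed

text \<open>When \<open>t\<close> is uniform in \<open>[0, N * M)\<close>, \<open>t / N\<close> is
  uniform in \<open>[0, M)\<close>. This is why passing to the next block of digits preserves
  averages.\<close>

lemma Av_scale: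
  assumes F: "bbd F" and N: "N > 0"
  shows "Av (N * M) (\<lambda>t. F (t / real N)) = Av M F"
proof -
  have "(\<Sum>k<N * M. \<integral>x. F ((x + real k) / real N) \<partial>U01)
      = (\<Sum>u<M. \<Sum>w<N. \<integral>x. F ((x + real w) / real N + real u) \<partial>U01)"
    unfolding sum_lessThan_split using N by (simp add: field_simps)
  also have "\<dots> = (\<Sum>u<M. real N * \<integral>x. F (x + real u) \<partial>U01)"
    by (intro sum.cong refl U01_split[OF bbd_shift[OF F] N])
  finally show ?thesis using N by (simp add: Av_def sum_distrib_left[symmetric])
qed

lemma periodic_mult_nat:
  fixes F :: "real \<Rightarrow> 'a" and c :: real
  assumes "\<And>t. F (t + c) = F t" shows "F (t + c * real u) = F t"
proof (induction u)
  case (Suc u)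
  have "F (t + c * real (Suc u)) = F ((t + c * real u) + c)" by (simp add: algebra_simps)
  then show ?case using assms Suc by simp
qed simp

lemma Av_periodic:
  assumes per: "\<And>t. F (t + real N) = F t" and M: "M > 0"
  shows "Av (N * M) F = Av N F"
proof -
  have "(\<Sum>k<N * M. \<integral>x. F (x + real k) \<partial>U01) = (\<Sum>u<M. \<Sum>w<N. \<integral>x. F (x + real w) \<partial>U01)"
    unfolding sum_lessThan_split
    using periodic_mult_nat[of F "real N", OF per] by (simp add: add.assoc[symmetric])
  then show ?thesis using M by (simp add: Av_def)
qed

lemma sum_periodic_shift:
  fixes F :: "real \<Rightarrow> real"
  assumes per: "\<And>t. F (t + real N) = F t"
  shows "(\<Sum>k<N. F (t + real m + real k)) = (\<Sum>k<N. F (t + real k))"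
proof (induction m)
  case (Suc m)
  have "(\<Sum>k<N. F (t + real (Suc m) + real k)) = (\<Sum>k<N. F (t + real m + real (Suc k)))"
    by (intro sum.cong refl arg_cong[of _ _ F]) simp
  also have "\<dots> = (\<Sum>k<Suc N. F (t + real m + real k)) - F (t + real m)"
    unfolding sum.lessThan_Suc_shift by simp
  also have "\<dots> = (\<Sum>k<N. F (t + real m + real k))"
    using per[of "t + real m"] by (simp add: add.assoc)
  finally show ?case using Suc by simp
qed simp

text \<open>Periodicity in the second argument lets the partner run cyclically as
  \<open>t + k\<close>. The pair average thereby becomes the mean number of partners of a point, to
  which Markov's inequality can be applied.\<close>

lemma Av_pairs:
  assumes bb: "\<And>k. bbd (\<lambda>t. \<Phi> t (t + real k))" and per: "\<And>t t'. \<Phi> t (t' + real N) = \<Phi> t t'"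
    and N: "N > 0"
  shows "Av N (\<lambda>t. \<Sum>k<N. \<Phi> t (t + real k)) = real N * PA N \<Phi>"
proof -
  have "(\<Sum>k<N. \<Sum>k'<N. \<Phi> (x + real k) (x + real k')) = (\<Sum>k<N. \<Sum>k'<N. \<Phi> (x + real k) (x + real k + real k'))" for x
    using sum_periodic_shift[of "\<Phi> (x + real k)" N x k for k, OF per] by simp
  then have "PA N \<Phi> = (\<integral>x. (\<Sum>k<N. \<Sum>k'<N. \<Phi> (x + real k) (x + real k + real k')) \<partial>U01) / (real N)\<^sup>2"
    by (simp add: PA_def)
  moreover have "Av N (\<lambda>t. \<Sum>k<N. \<Phi> t (t + real k)) = (\<integral>x. (\<Sum>k<N. \<Sum>k'<N. \<Phi> (x + real k) (x + real k + real k')) \<partial>U01) / real N"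
    by (rule Av_eq_integral_sum) (auto intro: bbd_sum bb)
  ultimately show ?thesis using N by (simp add: power2_eq_square)
qed

lemma PA_mono:
  assumes "\<And>k k'. bbd (\<lambda>x. \<Phi> (x + real k) (x + real k'))" "\<And>k k'. bbd (\<lambda>x. \<Psi> (x + real k) (x + real k'))"
    and "\<And>x y. \<Phi> x y \<le> \<Psi> x y"
  shows "PA N \<Phi> \<le> PA N \<Psi>"
  unfolding PA_def using assms
  by (intro divide_right_mono integral_mono bbd_integrable bbd_sum sum_mono) auto

lemma PA_cmult: "PA N (\<lambda>x y. c * \<Phi> x y) = c * PA N \<Phi>"
  unfolding PA_def by (simp add: sum_distrib_left[symmetric])

lemma PA_nonneg: "(\<And>x y. 0 \<le> \<Phi> x y) \<Longrightarrow> 0 \<le> PA N \<Phi>"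
  unfolding PA_def by (intro divide_nonneg_nonneg integral_nonneg_AE AE_I2 sum_nonneg) auto

text \<open>If \<open>A c\<close> and \<open>A' c\<close> are the masses of the two families in cell
  \<open>c\<close>, the left side is the sum of \<open>A c * A' c\<close>, and the
  arithmetic-geometric mean inequality splits it into the two self-interactions.\<close>

lemma same_cell_bound:
  fixes g g' :: "nat \<Rightarrow> real" and a a' :: "nat \<Rightarrow> 'c"
  shows "(\<Sum>u<M. \<Sum>v<M. g u * g' v * of_bool (a u = a' v))
     \<le> ((\<Sum>u<M. \<Sum>v<M. g u * g v * of_bool (a u = a v)) + (\<Sum>u<M. \<Sum>v<M. g' u * g' v * of_bool (a' u = a' v))) / 2"
proof -
  define C where "C = a ` {..<M} \<union> a' ` {..<M}"
  have fin: "finite C" by (simp add: C_def)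
  define A where "A c = (\<Sum>u<M. g u * of_bool (a u = c))" for c
  define A' where "A' c = (\<Sum>u<M. g' u * of_bool (a' u = c))" for c
  have gen: "(\<Sum>u<M. \<Sum>v<M. h u * h' v * of_bool (d u = d' v))
      = (\<Sum>c\<in>C. (\<Sum>u<M. h u * of_bool (d u = c)) * (\<Sum>v<M. h' v * of_bool (d' v = c)))"
    if "d ` {..<M} \<subseteq> C" for h h' :: "nat \<Rightarrow> real" and d d'
  proof -
    have "(\<Sum>c\<in>C. (\<Sum>u<M. h u * of_bool (d u = c)) * (\<Sum>v<M. h' v * of_bool (d' v = c)))
       = (\<Sum>c\<in>C. \<Sum>u<M. \<Sum>v<M. (h u * h' v) * (of_bool (d u = c) * of_bool (d' v = c)))"
      unfolding sum_product by (intro sum.cong refl) (simp only: mult_ac)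
    also have "\<dots> = (\<Sum>u<M. \<Sum>v<M. \<Sum>c\<in>C. (h u * h' v) * (of_bool (d u = c) * of_bool (d' v = c)))"
      by (subst sum.swap, rule sum.cong[OF refl], subst sum.swap, rule refl)
    also have "\<dots> = (\<Sum>u<M. \<Sum>v<M. h u * h' v * of_bool (d u = d' v))"
    proof (intro sum.cong refl)
      fix u v assume "u \<in> {..<M}"
      then have "d u \<in> C" using that by auto
      then have "(\<Sum>c\<in>C. of_bool (d u = c) * of_bool (d' v = c)) = (of_bool (d u = d' v) :: real)"
        using fin by (subst sum.remove[of C "d u"]) (auto intro!: sum.neutral)
      then show "(\<Sum>c\<in>C. (h u * h' v) * (of_bool (d u = c) * of_bool (d' v = c))) = h u * h' v * of_bool (d u = d' v)"
        by (simp add: sum_distrib_left[symmetric])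
    qed
    finally show ?thesis by simp
  qed
  have "(\<Sum>u<M. \<Sum>v<M. g u * g' v * of_bool (a u = a' v)) = (\<Sum>c\<in>C. A c * A' c)"
    unfolding A_def A'_def by (rule gen) (auto simp: C_def)
  also have "\<dots> \<le> (\<Sum>c\<in>C. (A c * A c + A' c * A' c) / 2)"
  proof (rule sum_mono)
    fix c
    have "0 \<le> (A c - A' c)\<^sup>2" by simp
    then have "A c * A' c * 2 \<le> A c * A c + A' c * A' c" by (simp add: power2_eq_square algebra_simps)
    then show "A c * A' c \<le> (A c * A c + A' c * A' c) / 2" by simp
  qed
  also have "\<dots> = ((\<Sum>c\<in>C. A c * A c) + (\<Sum>c\<in>C. A' c * A' c)) / 2"
    by (simp add: sum.distrib sum_divide_distrib[symmetric])
  also have "(\<Sum>c\<in>C. A c * A c) = (\<Sum>u<M. \<Sum>v<M. g u * g v * of_bool (a u = a v))"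
    unfolding A_def by (rule gen[symmetric]) (auto simp: C_def)
  also have "(\<Sum>c\<in>C. A' c * A' c) = (\<Sum>u<M. \<Sum>v<M. g' u * g' v * of_bool (a' u = a' v))"
    unfolding A'_def by (rule gen[symmetric]) (auto simp: C_def)
  finally show ?thesis .
qed

text \<open>An offset \<open>\<delta>\<close> between two families can raise the number of close
  pairs only by a constant factor. The axes are cut into cells of length \<open>\<tau> j\<close>;
  closeness forces the cell indices to differ by -1, 0 or 1 in each of the \<open>l + 1\<close>
  coordinates, which gives \<open>3 ^ Suc l\<close> patterns, and each pattern is a same-cell
  count.\<close>

lemma close_pairs_bound:
  fixes g g' :: "nat \<Rightarrow> real" and X X' :: "nat \<Rightarrow> nat \<Rightarrow> real" and \<delta> \<tau> :: "nat \<Rightarrow> real"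
  assumes g: "\<And>u. 0 \<le> g u" "\<And>u. 0 \<le> g' u" and \<tau>: "\<And>j. 0 < \<tau> j"
  shows "(\<Sum>u<M. \<Sum>v<M. g u * g' v * of_bool (\<forall>j\<le>l. \<bar>\<delta> j + X j u - X' j v\<bar> \<le> \<tau> j))
    \<le> 3 ^ Suc l * (((\<Sum>u<M. \<Sum>v<M. g u * g v * of_bool (\<forall>j\<le>l. \<bar>X j u - X j v\<bar> \<le> \<tau> j))
              + (\<Sum>u<M. \<Sum>v<M. g' u * g' v * of_bool (\<forall>j\<le>l. \<bar>X' j u - X' j v\<bar> \<le> \<tau> j))) / 2)"
    (is "?L \<le> _ * ((?V + ?V') / 2)")
proof -
  define S where "S = {..l} \<rightarrow>\<^sub>E {-1, 0, 1::int}"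
  have finS: "finite S" unfolding S_def by (intro finite_PiE) auto
  have cardS: "real (card S) = 3 ^ Suc l"
    unfolding S_def by (subst card_PiE) auto
  \<comment> \<open>The offset and the pattern \<open>s\<close> are absorbed into the cell labels,
    so that every pattern becomes equality of two labels.\<close>
  define a where "a u = (\<lambda>j\<in>{..l}. \<lfloor>(\<delta> j + X j u) / \<tau> j\<rfloor>)" for u
  define a' where "a' s u = (\<lambda>j\<in>{..l}. \<lfloor>X' j u / \<tau> j\<rfloor> + s j)" for s u
  have near: "\<lfloor>y\<rfloor> - \<lfloor>z\<rfloor> \<in> {-1, 0, 1}" if "\<bar>y - z\<bar> \<le> 1" for y z :: real
  proof -
    have "\<lfloor>y\<rfloor> - \<lfloor>z\<rfloor> < 2" "\<lfloor>y\<rfloor> - \<lfloor>z\<rfloor> > -2" using that by linarith+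
    then show ?thesis by auto
  qed
  have samefl: "\<bar>y - z\<bar> \<le> \<tau> j" if "\<lfloor>y / \<tau> j\<rfloor> = \<lfloor>z / \<tau> j\<rfloor>" for y z j
  proof -
    have "\<bar>y / \<tau> j - z / \<tau> j\<bar> \<le> 1" using that by linarith
    then have "\<bar>(y - z) / \<tau> j\<bar> \<le> 1" by (simp add: diff_divide_distrib)
    then show ?thesis using \<tau>[of j] by (simp add: field_simps)
  qed
  have cover: "of_bool (\<forall>j\<le>l. \<bar>\<delta> j + X j u - X' j v\<bar> \<le> \<tau> j) \<le> (\<Sum>s\<in>S. of_bool (a u = a' s v) :: real)" for u v
  proof (cases "\<forall>j\<le>l. \<bar>\<delta> j + X j u - X' j v\<bar> \<le> \<tau> j")
    case True
    define s where "s = (\<lambda>j\<in>{..l}. \<lfloor>(\<delta> j + X j u) / \<tau> j\<rfloor> - \<lfloor>X' j v / \<tau> j\<rfloor>)"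
    have "s \<in> S" unfolding S_def s_def
    proof (rule restrict_PiE_iff[THEN iffD2], intro ballI)
      fix j assume "j \<in> {..l}"
      then have "\<bar>(\<delta> j + X j u) - X' j v\<bar> / \<tau> j \<le> 1" using True \<tau>[of j] by (simp add: field_simps)
      then have "\<bar>(\<delta> j + X j u) / \<tau> j - X' j v / \<tau> j\<bar> \<le> 1"
        using \<tau>[of j] by (simp add: diff_divide_distrib[symmetric])
      then show "\<lfloor>(\<delta> j + X j u) / \<tau> j\<rfloor> - \<lfloor>X' j v / \<tau> j\<rfloor> \<in> {-1,0,1}" by (rule near)
    qed
    moreover have "a u = a' s v" unfolding a_def a'_def s_def by (auto simp: fun_eq_iff)
    ultimately have "(1::real) \<le> (\<Sum>s\<in>S. of_bool (a u = a' s v))"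
      using finS by (subst sum.remove[of S s]) (auto intro!: sum_nonneg)
    then show ?thesis using True by simp
  qed (auto intro!: sum_nonneg)
  have "?L \<le> (\<Sum>u<M. \<Sum>v<M. g u * g' v * (\<Sum>s\<in>S. of_bool (a u = a' s v)))"
    by (intro sum_mono mult_left_mono cover) (use g in auto)
  also have "\<dots> = (\<Sum>s\<in>S. \<Sum>u<M. \<Sum>v<M. g u * g' v * of_bool (a u = a' s v))"
    unfolding sum_distrib_left
    by (subst (2) sum.swap, subst sum.swap, rule refl)
  also have "\<dots> \<le> (\<Sum>s\<in>S. (?V + ?V') / 2)"
  proof (rule sum_mono)
    fix s
    have 1: "(\<Sum>u<M. \<Sum>v<M. g u * g v * of_bool (a u = a v)) \<le> ?V"
    proof (intro sum_mono mult_left_mono)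
      fix u v
      show "of_bool (a u = a v) \<le> (of_bool (\<forall>j\<le>l. \<bar>X j u - X j v\<bar> \<le> \<tau> j) :: real)"
      proof (cases "a u = a v")
        case True
        have "\<bar>X j u - X j v\<bar> \<le> \<tau> j" if "j \<le> l" for j
          using fun_cong[OF True, of j] that samefl[of "\<delta> j + X j u" j "\<delta> j + X j v"] by (simp add: a_def)
        then show ?thesis using True by simp
      qed simp
    qed (use g in auto)
    have 2: "(\<Sum>u<M. \<Sum>v<M. g' u * g' v * of_bool (a' s u = a' s v)) \<le> ?V'"
    proof (intro sum_mono mult_left_mono)
      fix u v
      show "of_bool (a' s u = a' s v) \<le> (of_bool (\<forall>j\<le>l. \<bar>X' j u - X' j v\<bar> \<le> \<tau> j) :: real)"
      proof (cases "a' s u = a' s v")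
        case True
        have "\<bar>X' j u - X' j v\<bar> \<le> \<tau> j" if "j \<le> l" for j
          using fun_cong[OF True, of j] that samefl[of "X' j u" j "X' j v"] by (simp add: a'_def)
        then show ?thesis using True by simp
      qed simp
    qed (use g in auto)
    show "(\<Sum>u<M. \<Sum>v<M. g u * g' v * of_bool (a u = a' s v)) \<le> (?V + ?V') / 2"
      by (rule order_trans[OF same_cell_bound divide_right_mono[OF add_mono[OF 1 2]]]) simp
  qed
  also have "\<dots> = 3 ^ Suc l * ((?V + ?V') / 2)" using cardS by simp
  finally show ?thesis .
qed

text \<open>On a piece of length at most \<open>c / (2 * K)\<close> the derivative moves by at most
  \<open>c / 2\<close>. If the piece contains a point with \<open>\<bar>f'\<bar> > c\<close>, then
  \<open>\<bar>f'\<bar> \<ge> c / 2\<close> on all of it, so its points with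
  \<open>\<bar>f\<bar> \<le> r\<close> lie within \<open>4 * r / c\<close> of each other.\<close>

lemma transversal_measure:
  fixes f f' f'' :: "real \<Rightarrow> real"
  assumes f: "\<And>x. (f has_real_derivative f' x) (at x)" "\<And>x. (f' has_real_derivative f'' x) (at x)"
    and K: "\<And>x. \<bar>f'' x\<bar> \<le> K" "K > 0" and c: "c > 0" and r: "r \<ge> 0"
  shows "measure U01 {x. \<bar>f x\<bar> \<le> r \<and> \<bar>f' x\<bar> > c} \<le> (2 * K / c + 2) * (8 / c) * r"
proof -
  have cf: "continuous_on UNIV f" "continuous_on UNIV f'"
    using f by (auto intro!: continuous_at_imp_continuous_on DERIV_isCont)
  then have [measurable]: "f \<in> borel_measurable borel" "f' \<in> borel_measurable borel"
    by (auto intro: borel_measurable_continuous_onI)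
  define S where "S = {x. \<bar>f x\<bar> \<le> r \<and> \<bar>f' x\<bar> > c}"
  have S [measurable]: "S \<in> sets borel" unfolding S_def by measurable
  \<comment> \<open>At least \<open>2 * K / c\<close> pieces are needed for the derivative bound;
    the rounding costs the summand 2 in the claim.\<close>
  define n where "n = nat \<lceil>2 * K / c\<rceil> + 1"
  have n: "real n \<ge> 2 * K / c" "n > 0" "real n \<le> 2 * K / c + 2"
  proof -
    have "0 \<le> 2 * K / c" using K c by simp
    then have "real n = of_int \<lceil>2 * K / c\<rceil> + 1" unfolding n_def by (simp add: of_nat_nat)
    then show "real n \<ge> 2 * K / c" "real n \<le> 2 * K / c + 2" by linarith+
  qed (simp add: n_def)
  define I where "I i = S \<inter> {real i / real n..<(real i + 1) / real n}" for i
  have Im [measurable]: "I i \<in> sets borel" for i unfolding I_def by measurable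
  have sub: "S \<inter> {0..<1} \<subseteq> (\<Union>i<n. I i)"
  proof
    fix x assume x: "x \<in> S \<inter> {0..<1}"
    define v where "v = nat \<lfloor>x * real n\<rfloor>"
    have x0: "0 \<le> x * real n" "x * real n < real n" using x n by auto
    have v: "real v \<le> x * real n" "x * real n < real v + 1"
      using x0 unfolding v_def by (auto simp: of_nat_nat)
    then have "v < n" using x0 by linarith
    moreover have "x \<in> I v" using x v n(2) by (auto simp: I_def field_simps)
    ultimately show "x \<in> (\<Union>i<n. I i)" by blast
  qed
  have each: "I i \<in> fmeasurable lborel \<and> measure lborel (I i) \<le> 8 / c * r" for i
  proof (cases "I i = {}")
    case False
    then obtain x0 where x0: "x0 \<in> I i" by blast
    have "I i \<subseteq> {x0 - 4 * r / c..x0 + 4 * r / c}"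
    proof
      fix x assume x: "x \<in> I i"
      show "x \<in> {x0 - 4 * r / c..x0 + 4 * r / c}"
      proof (cases "x = x0")
        case False
        define lo where "lo = min x x0" define hi where "hi = max x x0"
        have lohi: "lo < hi" "hi - lo = \<bar>x - x0\<bar>" using False by (auto simp: lo_def hi_def)
        obtain z where z: "lo < z" "z < hi" "f hi - f lo = (hi - lo) * f' z"
          using MVT2[OF lohi(1), of f f'] f(1) by blast
        have zx: "\<bar>z - x0\<bar> \<le> 1 / real n"
        proof -
          have "x \<in> {real i / real n..<(real i + 1) / real n}" "x0 \<in> {real i / real n..<(real i + 1) / real n}"
            using x x0 by (auto simp: I_def)
          then have "\<bar>x - x0\<bar> \<le> 1 / real n" by (auto simp: add_divide_distrib abs_le_iff)
          then show ?thesis using z by (auto simp: lo_def hi_def)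
        qed
        have "\<bar>f' z - f' x0\<bar> \<le> K * \<bar>z - x0\<bar>"
        proof -
          have "norm (f' z - f' x0) \<le> K * norm (z - x0)"
            by (rule field_differentiable_bound[of UNIV f' f'']) (use f K in auto)
          then show ?thesis by simp
        qed
        also have "\<dots> \<le> K * (1 / real n)" using zx K by (intro mult_left_mono) auto
        also have "\<dots> \<le> c / 2" using n c K by (simp add: field_simps)
        finally have "\<bar>f' z - f' x0\<bar> \<le> c / 2" .
        moreover have "\<bar>f' x0\<bar> > c" using x0 by (simp add: I_def S_def)
        ultimately have "\<bar>f' z\<bar> \<ge> c / 2" by linarith
        then have "\<bar>x - x0\<bar> * (c / 2) \<le> \<bar>f hi - f lo\<bar>"
          unfolding z(3) abs_mult using lohi c by (intro mult_mono) auto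
        also have "\<dots> \<le> 2 * r" using x x0 by (auto simp: I_def S_def lo_def hi_def min_def max_def)
        finally have "\<bar>x - x0\<bar> \<le> 4 * r / c" using c by (simp add: field_simps)
        then show ?thesis by (simp add: abs_le_iff)
      qed (use r c in auto)
    qed
    moreover have "{x0 - 4 * r / c..x0 + 4 * r / c} \<in> fmeasurable lborel"
      using r c by (simp add: fmeasurable_def)
    moreover have "measure lborel {x0 - 4 * r / c..x0 + 4 * r / c} = 8 / c * r"
      using r c by simp
    ultimately show ?thesis
      using measure_mono_fmeasurable[of "I i" _ lborel] fmeasurableI2[of _ lborel "I i"] by (metis Im sets_lborel)
  qed (use r c in \<open>auto simp: fmeasurable_def\<close>)
  have "measure U01 S = measure lborel (S \<inter> {0..<1})" by (simp add: measure_U01)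
  also have "\<dots> \<le> measure lborel (\<Union>i<n. I i)"
    using sub each by (intro measure_mono_fmeasurable fmeasurable.finite_UN) auto
  also have "\<dots> \<le> (\<Sum>i<n. measure lborel (I i))"
    using each by (intro measure_UNION_le) (auto dest: fmeasurableD)
  also have "\<dots> \<le> (\<Sum>i<n. 8 / c * r)" using each by (intro sum_mono) auto
  also have "\<dots> = real n * (8 / c * r)" by simp
  also have "\<dots> \<le> (2 * K / c + 2) * (8 / c * r)" using n r c by (intro mult_right_mono) auto
  finally show ?thesis unfolding S_def by (simp only: mult.assoc)
qed

section \<open>The curves and the tangency estimate\<close>

text \<open>\<open>f j\<close> plays the role of the \<open>j\<close>-th derivative of the driving
  function \<open>f 0\<close>. At this stage only smoothness with bounds \<open>Bd j\<close> is
  assumed; analyticity enters with \<open>skew_analytic\<close>, where \<open>Bd\<close> becomes a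
  Cauchy bound.\<close>

locale skew_family =
  fixes b :: nat and \<gamma> :: real and f :: "nat \<Rightarrow> real \<Rightarrow> real" and Bd :: "nat \<Rightarrow> real"
  assumes b2: "b \<ge> 2" and \<gamma>0: "0 < \<gamma>" and \<gamma>1: "\<gamma> < 1"
    and per: "\<And>j t. f j (t + 1) = f j t"
    and der: "\<And>j t. (f j has_real_derivative f (Suc j) t) (at t)"
    and bd: "\<And>j t. \<bar>f j t\<bar> \<le> Bd j"
begin

lemma b0 [simp]: "Suc 0 \<le> b" "b > 0" "b \<noteq> 0" "real b \<ge> 2" "real b > 0" "real b \<noteq> 0"
  using b2 by auto

lemma bpow [simp]: "b ^ n > 0" "real b ^ n > 0" "real b ^ n \<noteq> 0" "1 \<le> real b ^ n"
  using b2 by auto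

definition lam :: "nat \<Rightarrow> real" where "lam j = \<gamma> / real b ^ j"

lemma lam_pos [simp]: "0 < lam j" and lam_less1: "lam j < 1"
proof -
  have "\<gamma> / real b ^ j \<le> \<gamma> / 1"
    using \<gamma>0 bpow(4)[of j] by (intro divide_left_mono) auto
  then show "lam j < 1" unfolding lam_def using \<gamma>1 by linarith
qed (use \<gamma>0 in \<open>simp add: lam_def\<close>)

lemma lam_ne0 [simp]: "lam j \<noteq> 0"
  using lam_pos[of j] by linarith

lemma lam_pow_pos [simp]: "0 < lam j ^ n" "lam j ^ n \<noteq> 0" "0 \<le> lam j ^ n"
  using lam_pos[of j] zero_less_power[OF lam_pos, of j n] by linarith+

text \<open>\<open>HH j q\<close> is the \<open>j\<close>-th derivative of \<open>HH 0 q\<close>. The points \<open>(frac t, HH 0 q t)\<close>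
  with \<open>t \<in> [0, b\<^sup>q)\<close> form the image of the unit interval at height 0 under the \<open>q\<close>-th iterate of the
  skew product; \<open>t + k\<close> runs through the branches above \<open>frac t\<close>.\<close>

definition HH :: "nat \<Rightarrow> nat \<Rightarrow> real \<Rightarrow> real" where
  "HH j q t = (\<Sum>n<q. \<gamma> ^ n / real b ^ (j * Suc n) * f j (t / real b ^ Suc n))"

definition Cb :: "nat \<Rightarrow> real" where "Cb j = Bd j / (1 - \<gamma>)"

lemma Bd_nonneg: "0 \<le> Bd j"
  using bd[of j 0] by linarith

lemma Cb_nonneg: "0 \<le> Cb j"
  using Bd_nonneg[of j] \<gamma>1 by (simp add: Cb_def)

lemma HH_0 [simp]: "HH j 0 t = 0"
  by (simp add: HH_def)

text \<open>Self-similarity behind every renormalisation below: the tail after \<open>p\<close>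
  terms is the same function evaluated at \<open>t / b ^ p\<close>, contracted by
  \<open>lam j ^ p\<close>, while the head depends on \<open>t\<close> only modulo
  \<open>b ^ p\<close>.\<close>

lemma HH_add: "HH j (p + q) t = HH j p t + lam j ^ p * HH j q (t / real b ^ p)"
proof -
  have "(\<Sum>n<p + q. \<gamma> ^ n / real b ^ (j * Suc n) * f j (t / real b ^ Suc n))
     = (\<Sum>n<p. \<gamma> ^ n / real b ^ (j * Suc n) * f j (t / real b ^ Suc n))
      + (\<Sum>n<q. \<gamma> ^ (p + n) / real b ^ (j * Suc (p + n)) * f j (t / real b ^ Suc (p + n)))"
    by (induction q) auto
  also have "(\<Sum>n<q. \<gamma> ^ (p + n) / real b ^ (j * Suc (p + n)) * f j (t / real b ^ Suc (p + n)))
     = (\<Sum>n<q. lam j ^ p * (\<gamma> ^ n / real b ^ (j * Suc n) * f j (t / real b ^ p / real b ^ Suc n)))"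
  proof (rule sum.cong[OF refl])
    fix n
    have "real b ^ (j * Suc (p + n)) = (real b ^ j) ^ p * real b ^ (j * Suc n)"
      by (simp add: power_add[symmetric] power_mult[symmetric] algebra_simps)
    then have "\<gamma> ^ (p + n) / real b ^ (j * Suc (p + n)) = lam j ^ p * (\<gamma> ^ n / real b ^ (j * Suc n))"
      by (simp add: lam_def power_divide power_add)
    moreover have "t / real b ^ Suc (p + n) = t / real b ^ p / real b ^ Suc n"
      by (simp add: power_add)
    ultimately show "\<gamma> ^ (p + n) / real b ^ (j * Suc (p + n)) * f j (t / real b ^ Suc (p + n))
      = lam j ^ p * (\<gamma> ^ n / real b ^ (j * Suc n) * f j (t / real b ^ p / real b ^ Suc n))"
      by (simp only: mult.assoc)
  qed
  finally show ?thesis by (simp add: HH_def sum_distrib_left)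
qed

lemma per_nat: "f j (t + real k) = f j t"
  using periodic_mult_nat[of "f j" 1, OF per] by simp

lemma HH_per: "HH j q (t + real b ^ q) = HH j q t"
  unfolding HH_def
proof (intro sum.cong refl)
  fix n assume "n \<in> {..<q}"
  then have "q = Suc n + (q - Suc n)" by simp
  then have "real b ^ q = real b ^ Suc n * real b ^ (q - Suc n)" by (metis power_add)
  then have "(t + real b ^ q) / real b ^ Suc n = t / real b ^ Suc n + real (b ^ (q - Suc n))"
    by (simp add: add_divide_distrib)
  then show "\<gamma> ^ n / real b ^ (j * Suc n) * f j ((t + real b ^ q) / real b ^ Suc n)
     = \<gamma> ^ n / real b ^ (j * Suc n) * f j (t / real b ^ Suc n)" by (simp only: per_nat)
qed

lemma HH_per_mult: "HH j q (t + real b ^ q * real k) = HH j q t"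
  by (rule periodic_mult_nat) (rule HH_per)

lemma HH_bound: "\<bar>HH j q t\<bar> \<le> Cb j"
proof -
  have "\<bar>HH j q t\<bar> \<le> (\<Sum>n<q. \<bar>\<gamma> ^ n / real b ^ (j * Suc n) * f j (t / real b ^ Suc n)\<bar>)"
    unfolding HH_def by (rule sum_abs)
  also have "\<dots> \<le> (\<Sum>n<q. \<gamma> ^ n * Bd j)"
  proof (rule sum_mono)
    fix n
    have "\<bar>\<gamma> ^ n / real b ^ (j * Suc n)\<bar> \<le> \<gamma> ^ n / 1"
      unfolding abs_divide using \<gamma>0 bpow(4)[of "j * Suc n"] by (intro frac_le) auto
    then show "\<bar>\<gamma> ^ n / real b ^ (j * Suc n) * f j (t / real b ^ Suc n)\<bar> \<le> \<gamma> ^ n * Bd j"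
      unfolding abs_mult using bd by (intro mult_mono) (use \<gamma>0 in auto)
  qed
  also have "\<dots> = (\<Sum>n<q. \<gamma> ^ n) * Bd j" by (simp add: sum_distrib_right)
  also have "\<dots> \<le> (1 / (1 - \<gamma>)) * Bd j"
  proof (rule mult_right_mono[OF _ Bd_nonneg])
    have "(\<Sum>n<q. \<gamma> ^ n) = (1 - \<gamma> ^ q) / (1 - \<gamma>)" using \<gamma>1 by (simp add: sum_gp_strict)
    also have "\<dots> \<le> 1 / (1 - \<gamma>)" using \<gamma>0 \<gamma>1 by (intro divide_right_mono) auto
    finally show "(\<Sum>n<q. \<gamma> ^ n) \<le> 1 / (1 - \<gamma>)" .
  qed
  finally show ?thesis by (simp add: Cb_def)
qed

lemma HH_deriv: "(HH j q has_real_derivative HH (Suc j) q t) (at t)"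
proof -
  have "((\<lambda>t. f j (t / real b ^ Suc n)) has_real_derivative f (Suc j) (t / real b ^ Suc n) * (1 / real b ^ Suc n)) (at t)" for n
    by (rule DERIV_chain2[OF der]) (auto intro!: derivative_eq_intros)
  then have "((\<lambda>t. \<gamma> ^ n / real b ^ (j * Suc n) * f j (t / real b ^ Suc n))
      has_real_derivative \<gamma> ^ n / real b ^ (j * Suc n) * (f (Suc j) (t / real b ^ Suc n) * (1 / real b ^ Suc n))) (at t)" for n
    by (rule DERIV_cmult)
  then have "(HH j q has_real_derivative
     (\<Sum>n<q. \<gamma> ^ n / real b ^ (j * Suc n) * (f (Suc j) (t / real b ^ Suc n) * (1 / real b ^ Suc n)))) (at t)"
    unfolding HH_def[abs_def] by (intro DERIV_sum) auto
  also have "(\<Sum>n<q. \<gamma> ^ n / real b ^ (j * Suc n) * (f (Suc j) (t / real b ^ Suc n) * (1 / real b ^ Suc n))) = HH (Suc j) q t"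
    unfolding HH_def by (intro sum.cong refl) (simp add: power_add field_simps)
  finally show ?thesis .
qed

lemma HH_cont: "continuous_on A (HH j q)"
  using HH_deriv by (auto intro!: continuous_at_imp_continuous_on DERIV_isCont)

lemma HH_measurable [measurable]: "HH j q \<in> borel_measurable borel"
  by (intro borel_measurable_continuous_onI HH_cont)

text \<open>The tolerance \<open>lam j ^ q\<close> is the size of all terms beyond the
  \<open>q\<close>-th in derivative order \<open>j\<close>. Hence branches whose longer sums agree
  at this scale are already \<open>Close\<close> after \<open>q\<close> terms, with a larger
  \<open>C\<close>.\<close>

definition Close :: "nat \<Rightarrow> real \<Rightarrow> nat \<Rightarrow> real \<Rightarrow> real \<Rightarrow> bool" where
  "Close l C q t t' \<longleftrightarrow> (\<forall>j\<le>l. \<bar>HH j q t - HH j q t'\<bar> \<le> C * lam j ^ q)"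

lemma Close_sym: "Close l C q t t' = Close l C q t' t"
  unfolding Close_def by (simp add: abs_minus_commute)

lemma Close_per: "Close l C q t (t' + real b ^ q) = Close l C q t t'"
  unfolding Close_def by (simp add: HH_per)

lemma Close_per_mult: "Close l C q (t + real b ^ q * real k) (t' + real b ^ q * real k') = Close l C q t t'"
  unfolding Close_def by (simp add: HH_per_mult)

lemma Close_measurable [measurable (raw)]:
  assumes g: "g \<in> borel_measurable M" and h: "h \<in> borel_measurable M"
  shows "Measurable.pred M (\<lambda>x. Close l C q (g x) (h x))"
proof -
  have [measurable]: "(\<lambda>x. HH j q (g x)) \<in> borel_measurable M" "(\<lambda>x. HH j q (h x)) \<in> borel_measurable M" for j
    using measurable_compose[OF g HH_measurable] measurable_compose[OF h HH_measurable] by auto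
  have "Measurable.pred M (\<lambda>x. \<bar>HH j q (g x) - HH j q (h x)\<bar> \<le> C * lam j ^ q)" for j
    by measurable
  then have "Measurable.pred M (\<lambda>x. \<forall>j\<in>{..l}. \<bar>HH j q (g x) - HH j q (h x)\<bar> \<le> C * lam j ^ q)"
    by (intro pred_intros_finite) auto
  then show ?thesis by (simp add: Close_def Ball_def)
qed

section \<open>Weighted counts of close pairs\<close>

definition Ew :: "(real \<Rightarrow> real) \<Rightarrow> nat \<Rightarrow> nat \<Rightarrow> real \<Rightarrow> real" where
  "Ew \<sigma> p m t = (\<Prod>i<m. \<sigma> (t / real b ^ (i * p)))"

lemma Ew_Suc: "Ew \<sigma> p (Suc m) t = \<sigma> t * Ew \<sigma> p m (t / real b ^ p)"
  unfolding Ew_def prod.lessThan_Suc_shift by (simp add: power_add)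

lemma Ew_bounds:
  assumes "\<And>t. 0 \<le> \<sigma> t \<and> \<sigma> t \<le> 1" shows "0 \<le> Ew \<sigma> p m t" "Ew \<sigma> p m t \<le> 1"
  unfolding Ew_def using assms by (auto intro!: prod_nonneg prod_le_1)

lemma bbd_Ew: "bbd \<sigma> \<Longrightarrow> bbd (Ew \<sigma> p m)"
  unfolding Ew_def[abs_def] by (intro bbd_prod bbd_scale)

definition W :: "nat \<Rightarrow> real \<Rightarrow> (real \<Rightarrow> real) \<Rightarrow> nat \<Rightarrow> nat \<Rightarrow> real" where
  "W l C \<sigma> p m = PA (b ^ (m * p)) (\<lambda>t t'. Ew \<sigma> p m t * Ew \<sigma> p m t' * of_bool (Close l C (m * p) t t'))"

text \<open>A pair counted on the left falls into one of two classes. If the jets of order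
  \<open>l + 1\<close> already differ after one block, only the derivative of order
  \<open>l + 1\<close> can be responsible, and \<open>transversal_measure\<close> bounds the
  abscissas. If they are close after one block, \<open>row\<close> leaves total weight 2 for the
  leading digits of the partner, and the remaining \<open>m\<close> blocks reproduce
  \<open>W l C \<sigma> p m\<close> up to an offset, at the price \<open>3 ^ Suc l\<close> of
  \<open>close_pairs_bound\<close>.\<close>

lemma W_step:
  assumes \<sigma>: "bbd \<sigma>" "\<And>t. 0 \<le> \<sigma> t \<and> \<sigma> t \<le> 1" "\<And>t. \<sigma> (t + real b ^ p) = \<sigma> t" and C: "C > 0"
    and D: "\<And>j. j \<le> Suc l \<Longrightarrow> 2 * Cb j \<le> D"
    and row: "\<And>t. (\<Sum>k<b ^ p. \<sigma> t * \<sigma> (t + real k) * of_bool (Close (Suc l) (C + D) p t (t + real k))) \<le> 2"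
    and c: "c = C * lam (Suc l) ^ p" and K: "K = 2 * Cb (Suc (Suc l)) + 1"
  shows "W l C \<sigma> p (Suc m) \<le> (2 * K / c + 2) * (8 / c) * C * lam l ^ (Suc m * p) + 2 * 3 ^ Suc l / real b ^ p * W l C \<sigma> p m"
proof -
  define q where "q = Suc m * p"
  have q: "q = p + m * p" by (simp add: q_def)
  define N where "N = b ^ p" define M where "M = b ^ (m * p)"
  have NM: "b ^ q = N * M" by (simp add: q N_def M_def power_add)
  have Npos: "N > 0" "M > 0" and rN: "real N = real b ^ p" and rM: "real M = real b ^ (m * p)"
    by (auto simp: N_def M_def)
  define E where "E = Ew \<sigma> p (Suc m)" define E0 where "E0 = Ew \<sigma> p m"
  have E01: "0 \<le> E t" "E t \<le> 1" "0 \<le> E0 t" "E0 t \<le> 1" for t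
    unfolding E_def E0_def using \<sigma>(2) by (auto intro!: Ew_bounds)
  have bE: "bbd E" "bbd E0" unfolding E_def E0_def by (intro bbd_Ew \<sigma>)+
  define Tr where "Tr t t' \<longleftrightarrow> \<bar>HH l q t - HH l q t'\<bar> \<le> C * lam l ^ q \<and> \<bar>HH (Suc l) q t - HH (Suc l) q t'\<bar> > c" for t t'
  \<comment> \<open>\<open>NT\<close> marks pairs that are still nearly tangent after one block; the
    surplus \<open>D\<close> dominates what the later blocks can change.\<close>
  define NT where "NT = Close (Suc l) (C + D) p"
  define R where "R t t' = E t * E t' * of_bool (Close l C q t t')" for t t'
  have bR: "bbd (\<lambda>x. R (x + k) (x + k'))" for k k'
    unfolding R_def by (intro bbd_mult bbd_shift bE bbd_of_bool) measurable
  have bNT: "bbd (\<lambda>x. of_bool (NT (x + k) (x + k')))" for k k'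
    unfolding NT_def by (intro bbd_of_bool) measurable
  have mTr: "Measurable.pred borel (\<lambda>x. Tr (x + k) (x + k'))" for k k'
    unfolding Tr_def by measurable
  have pw: "R t t' \<le> of_bool (Tr t t') + of_bool (NT t t') * R t t'" for t t'
  proof (cases "NT t t' \<or> \<not> Close l C q t t'")
    case True
    then show ?thesis by (auto simp: R_def)
  next
    case False
    then obtain j where j: "j \<le> Suc l" "\<bar>HH j p t - HH j p t'\<bar> > (C + D) * lam j ^ p"
      unfolding NT_def Close_def by (auto simp: not_le)
    have "\<bar>lam j ^ p * HH j (m * p) s\<bar> \<le> lam j ^ p * Cb j" for s
      unfolding abs_mult using HH_bound[of j "m*p" s] by (intro mult_mono) auto
    from this[of "t / real b ^ p"] this[of "t' / real b ^ p"]
    have "\<bar>HH j q t - HH j q t'\<bar> > (C + D) * lam j ^ p - lam j ^ p * (2 * Cb j)"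
      using j(2) unfolding q HH_add by linarith
    moreover have "(C + D) * lam j ^ p - lam j ^ p * (2 * Cb j) \<ge> C * lam j ^ p"
      using D[OF j(1)] mult_left_mono[OF D[OF j(1)], of "lam j ^ p"] by (simp add: algebra_simps)
    ultimately have big: "\<bar>HH j q t - HH j q t'\<bar> > C * lam j ^ p" by linarith
    \<comment> \<open>A gap of order at most \<open>l\<close> opened at depth \<open>p\<close> would
      survive to depth \<open>q\<close>, where closeness demands the smaller tolerance
      \<open>C * lam j ^ q\<close>.\<close>
    have "\<not> j \<le> l"
    proof
      assume "j \<le> l"
      then have "\<bar>HH j q t - HH j q t'\<bar> \<le> C * lam j ^ q" using False by (auto simp: Close_def)
      moreover have "lam j ^ q \<le> lam j ^ p"
        using lam_less1[of j] lam_pos[of j] q by (intro power_decreasing) (auto intro: less_imp_le)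
      then have "C * lam j ^ q \<le> C * lam j ^ p" using C by (intro mult_left_mono) auto
      ultimately show False using big by linarith
    qed
    then have "j = Suc l" using j by simp
    then have "Tr t t'" using big False by (auto simp: Tr_def c Close_def)
    moreover have "R t t' \<le> 1" unfolding R_def using E01 by (simp add: of_bool_def mult_le_one)
    moreover have "0 \<le> of_bool (NT t t') * R t t'" unfolding R_def using E01 by simp
    ultimately show ?thesis by simp
  qed
  have cpos: "c > 0" using C by (simp add: c)
  have Kpos: "K > 0" using Cb_nonneg[of "Suc (Suc l)"] by (simp add: K)
  have TrM: "measure U01 {x. Tr (x + k) (x + k')} \<le> (2 * K / c + 2) * (8 / c) * (C * lam l ^ q)" for k k'
  proof -
    let ?h = "\<lambda>j x. HH j q (x + k) - HH j q (x + k')"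
    have d: "(?h j has_real_derivative ?h (Suc j) x) (at x)" for j x
    proof -
      have "((\<lambda>x. HH j q (x + a)) has_real_derivative HH (Suc j) q (x + a) * 1) (at x)" for a
        by (rule DERIV_chain2[OF HH_deriv]) (auto intro!: derivative_eq_intros)
      then show ?thesis by (auto intro!: derivative_eq_intros)
    qed
    have "\<bar>?h (Suc (Suc l)) x\<bar> \<le> K" for x
      using HH_bound[of "Suc (Suc l)" q "x + k"] HH_bound[of "Suc (Suc l)" q "x + k'"] unfolding K by linarith
    then show ?thesis unfolding Tr_def
      by (intro transversal_measure[of "?h l" "?h (Suc l)" "?h (Suc (Suc l))"] d) (use Kpos cpos C in auto)
  qed
  define V where "V s = (\<Sum>u<M. \<Sum>v<M. E0 (s + real u) * E0 (s + real v) * of_bool (Close l C (m * p) (s + real u) (s + real v)))" for s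
  have bV: "bbd V" unfolding V_def[abs_def]
    by (intro bbd_sum bbd_mult bbd_shift bE bbd_of_bool) measurable
  have Vnn: "0 \<le> V s" for s unfolding V_def using E01 by (intro sum_nonneg) auto
  \<comment> \<open>\<open>A\<close> is a symmetric matrix with row sums at most 2, so the mixed
    terms \<open>V (s w) + V (s w')\<close> below can be summed row by row without a factor
    \<open>N\<close>.\<close>
  define A where "A t t' = \<sigma> t * \<sigma> t' * of_bool (NT t t')" for t t'
  have Ann: "0 \<le> A t t'" for t t' unfolding A_def using \<sigma>(2) by simp
  have Asym: "A t t' = A t' t" for t t' unfolding A_def NT_def using Close_sym by (simp add: mult_ac)
  have arow: "(\<Sum>w'<N. A (x + real w) (x + real w')) \<le> 2" for x w
  proof -
    have "(\<Sum>w'<N. A (x + real w) (x + real w')) = (\<Sum>w'<N. A (x + real w) (x + real w + real w'))"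
      using sum_periodic_shift[of "A (x + real w)" N x w] unfolding A_def NT_def rN
      by (simp add: \<sigma>(3) Close_per)
    also have "\<dots> \<le> 2" using row unfolding A_def NT_def N_def by simp
    finally show ?thesis .
  qed
  have NTx: "(\<Sum>k<N*M. \<Sum>k'<N*M. of_bool (NT (x + real k) (x + real k')) * R (x + real k) (x + real k'))
     \<le> 2 * 3 ^ Suc l * (\<Sum>w<N. V ((x + real w) / real N))" for x
  proof -
    define s where "s w = (x + real w) / real N" for w
    \<comment> \<open>Head difference in units of \<open>lam j ^ p\<close>: after division by the
      contraction of the block, comparing two branches amounts to comparing their tails with offset
      \<open>\<delta>\<close>.\<close>
    define \<delta> where "\<delta> w w' j = (HH j p (x + real w) - HH j p (x + real w')) / lam j ^ p" for w w' j
    define X where "X w j u = HH j (m * p) (s w + real u)" for w j u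
    define \<tau> where "\<tau> j = C * lam j ^ (m * p)" for j
    have tm: "of_bool (NT (x + real (w + N * u)) (x + real (w' + N * u'))) * R (x + real (w + N * u)) (x + real (w' + N * u'))
       = A (x + real w) (x + real w') * (E0 (s w + real u) * E0 (s w' + real u') * of_bool (\<forall>j\<le>l. \<bar>\<delta> w w' j + X w j u - X w' j u'\<bar> \<le> \<tau> j))" for w u w' u'
    proof -
      have t: "x + real (w + N * u) = (x + real w) + real b ^ p * real u" for w u by (simp add: rN)
      have sw: "(x + real w + real b ^ p * real u) / real b ^ p = s w + real u" for w u
        by (simp add: s_def rN add_divide_distrib)
      have e: "E ((x + real w) + real b ^ p * real u) = \<sigma> (x + real w) * E0 (s w + real u)" for w u
        unfolding E_def E0_def Ew_Suc sw using periodic_mult_nat[of \<sigma>, OF \<sigma>(3)] by simp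
      have cl: "Close l C q (x + real w + real b ^ p * real u) (x + real w' + real b ^ p * real u')
          = (\<forall>j\<le>l. \<bar>\<delta> w w' j + X w j u - X w' j u'\<bar> \<le> \<tau> j)"
        unfolding Close_def
      proof (intro all_cong)
        fix j
        have "lam j ^ p * \<delta> w w' j = HH j p (x + real w) - HH j p (x + real w')" by (simp add: \<delta>_def)
        then have "HH j q (x + real w + real b ^ p * real u) - HH j q (x + real w' + real b ^ p * real u')
           = lam j ^ p * (\<delta> w w' j + X w j u - X w' j u')"
          unfolding q HH_add sw HH_per_mult by (simp add: X_def algebra_simps)
        then have "\<bar>HH j q (x + real w + real b ^ p * real u) - HH j q (x + real w' + real b ^ p * real u')\<bar>
           = lam j ^ p * \<bar>\<delta> w w' j + X w j u - X w' j u'\<bar>" by (simp add: abs_mult less_imp_le)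
        moreover have "C * lam j ^ q = lam j ^ p * \<tau> j" by (simp add: \<tau>_def q power_add)
        ultimately show "(\<bar>HH j q (x + real w + real b ^ p * real u) - HH j q (x + real w' + real b ^ p * real u')\<bar> \<le> C * lam j ^ q)
           = (\<bar>\<delta> w w' j + X w j u - X w' j u'\<bar> \<le> \<tau> j)" by simp
      qed
      show ?thesis unfolding t R_def cl e A_def NT_def Close_per_mult by (simp add: mult_ac)
    qed
    have "(\<Sum>k<N*M. \<Sum>k'<N*M. of_bool (NT (x + real k) (x + real k')) * R (x + real k) (x + real k'))
       = (\<Sum>u<M. \<Sum>w<N. \<Sum>u'<M. \<Sum>w'<N. A (x + real w) (x + real w') * (E0 (s w + real u) * E0 (s w' + real u') * of_bool (\<forall>j\<le>l. \<bar>\<delta> w w' j + X w j u - X w' j u'\<bar> \<le> \<tau> j)))"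
      unfolding sum_lessThan_split tm ..
    also have "\<dots> = (\<Sum>w<N. \<Sum>u<M. \<Sum>u'<M. \<Sum>w'<N. A (x + real w) (x + real w') * (E0 (s w + real u) * E0 (s w' + real u') * of_bool (\<forall>j\<le>l. \<bar>\<delta> w w' j + X w j u - X w' j u'\<bar> \<le> \<tau> j)))"
      by (rule sum.swap)
    also have "\<dots> = (\<Sum>w<N. \<Sum>u<M. \<Sum>w'<N. \<Sum>u'<M. A (x + real w) (x + real w') * (E0 (s w + real u) * E0 (s w' + real u') * of_bool (\<forall>j\<le>l. \<bar>\<delta> w w' j + X w j u - X w' j u'\<bar> \<le> \<tau> j)))"
      by (intro sum.cong refl sum.swap)
    also have "\<dots> = (\<Sum>w<N. \<Sum>w'<N. \<Sum>u<M. \<Sum>u'<M. A (x + real w) (x + real w') * (E0 (s w + real u) * E0 (s w' + real u') * of_bool (\<forall>j\<le>l. \<bar>\<delta> w w' j + X w j u - X w' j u'\<bar> \<le> \<tau> j)))"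
      by (intro sum.cong refl sum.swap)
    also have "\<dots> = (\<Sum>w<N. \<Sum>w'<N. A (x + real w) (x + real w') * (\<Sum>u<M. \<Sum>u'<M. E0 (s w + real u) * E0 (s w' + real u') * of_bool (\<forall>j\<le>l. \<bar>\<delta> w w' j + X w j u - X w' j u'\<bar> \<le> \<tau> j)))"
      by (simp only: sum_distrib_left)
    also have "\<dots> \<le> (\<Sum>w<N. \<Sum>w'<N. A (x + real w) (x + real w') * (3 ^ Suc l * ((V (s w) + V (s w')) / 2)))"
    proof (intro sum_mono mult_left_mono Ann)
      fix w w'
      have Vw: "V (s w) = (\<Sum>u<M. \<Sum>v<M. E0 (s w + real u) * E0 (s w + real v) * of_bool (\<forall>j\<le>l. \<bar>X w j u - X w j v\<bar> \<le> \<tau> j))" for w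
        unfolding V_def Close_def X_def \<tau>_def ..
      show "(\<Sum>u<M. \<Sum>u'<M. E0 (s w + real u) * E0 (s w' + real u') * of_bool (\<forall>j\<le>l. \<bar>\<delta> w w' j + X w j u - X w' j u'\<bar> \<le> \<tau> j))
          \<le> 3 ^ Suc l * ((V (s w) + V (s w')) / 2)"
        unfolding Vw by (rule close_pairs_bound) (use E01 C in \<open>auto simp: \<tau>_def\<close>)
    qed
    also have "\<dots> = 3 ^ Suc l / 2 * ((\<Sum>w<N. \<Sum>w'<N. A (x + real w) (x + real w') * V (s w)) + (\<Sum>w<N. \<Sum>w'<N. A (x + real w) (x + real w') * V (s w')))"
      by (simp add: sum.distrib[symmetric] sum_distrib_left algebra_simps add_divide_distrib)
    also have "(\<Sum>w<N. \<Sum>w'<N. A (x + real w) (x + real w') * V (s w')) = (\<Sum>w<N. \<Sum>w'<N. A (x + real w) (x + real w') * V (s w))"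
      by (subst sum.swap) (simp add: Asym)
    also have "(\<Sum>w<N. \<Sum>w'<N. A (x + real w) (x + real w') * V (s w)) = (\<Sum>w<N. (\<Sum>w'<N. A (x + real w) (x + real w')) * V (s w))"
      by (simp add: sum_distrib_right)
    also have "3 ^ Suc l / 2 * ((\<Sum>w<N. (\<Sum>w'<N. A (x + real w) (x + real w')) * V (s w)) + (\<Sum>w<N. (\<Sum>w'<N. A (x + real w) (x + real w')) * V (s w)))
       \<le> 3 ^ Suc l / 2 * ((\<Sum>w<N. 2 * V (s w)) + (\<Sum>w<N. 2 * V (s w)))"
      by (intro mult_left_mono add_mono sum_mono mult_right_mono arow Vnn) auto
    also have "\<dots> = 2 * 3 ^ Suc l * (\<Sum>w<N. V (s w))"
      by (simp add: sum_distrib_left[symmetric])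
    finally show ?thesis by (simp add: s_def)
  qed
  have "(\<integral>x. (\<Sum>k<N*M. \<Sum>k'<N*M. R (x + real k) (x + real k')) \<partial>U01)
     \<le> (\<integral>x. (\<Sum>k<N*M. \<Sum>k'<N*M. of_bool (Tr (x + real k) (x + real k'))) + 2 * 3 ^ Suc l * (\<Sum>w<N. V ((x + real w) / real N)) \<partial>U01)"
  proof (intro integral_mono bbd_integrable)
    show "bbd (\<lambda>x. (\<Sum>k<N*M. \<Sum>k'<N*M. of_bool (Tr (x + real k) (x + real k'))) + 2 * 3 ^ Suc l * (\<Sum>w<N. V ((x + real w) / real N)))"
      by (intro bbd_add bbd_sum bbd_of_bool mTr bbd_mult bbd_const bbd_comp[OF bV]) measurable
    fix x
    have "(\<Sum>k<N*M. \<Sum>k'<N*M. R (x + real k) (x + real k')) \<le>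
      (\<Sum>k<N*M. \<Sum>k'<N*M. of_bool (Tr (x + real k) (x + real k')) + of_bool (NT (x + real k) (x + real k')) * R (x + real k) (x + real k'))"
      by (intro sum_mono pw)
    also have "\<dots> = (\<Sum>k<N*M. \<Sum>k'<N*M. of_bool (Tr (x + real k) (x + real k'))) + (\<Sum>k<N*M. \<Sum>k'<N*M. of_bool (NT (x + real k) (x + real k')) * R (x + real k) (x + real k'))"
      by (simp only: sum.distrib)
    finally show "(\<Sum>k<N*M. \<Sum>k'<N*M. R (x + real k) (x + real k')) \<le> (\<Sum>k<N*M. \<Sum>k'<N*M. of_bool (Tr (x + real k) (x + real k'))) + 2 * 3 ^ Suc l * (\<Sum>w<N. V ((x + real w) / real N))"
      using NTx[of x] by linarith
  qed (intro bbd_sum bR)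
  also have "\<dots> = (\<integral>x. (\<Sum>k<N*M. \<Sum>k'<N*M. of_bool (Tr (x + real k) (x + real k'))) \<partial>U01) + 2 * 3 ^ Suc l * (\<integral>x. (\<Sum>w<N. V ((x + real w) / real N)) \<partial>U01)"
  proof -
    have 1: "bbd (\<lambda>x. \<Sum>k<N*M. \<Sum>k'<N*M. of_bool (Tr (x + real k) (x + real k')))"
      by (intro bbd_sum bbd_of_bool mTr)
    have 2: "bbd (\<lambda>x. 2 * 3 ^ Suc l * (\<Sum>w<N. V ((x + real w) / real N)))"
      by (intro bbd_mult bbd_const bbd_sum bbd_comp[OF bV]) measurable
    show ?thesis unfolding Bochner_Integration.integral_add[OF bbd_integrable[OF 1] bbd_integrable[OF 2]]
      by (simp only: integral_mult_right_zero)
  qed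
  finally have s1: "(\<integral>x. (\<Sum>k<N*M. \<Sum>k'<N*M. R (x + real k) (x + real k')) \<partial>U01) \<le>
      (\<integral>x. (\<Sum>k<N*M. \<Sum>k'<N*M. of_bool (Tr (x + real k) (x + real k'))) \<partial>U01) + 2 * 3 ^ Suc l * (\<integral>x. (\<Sum>w<N. V ((x + real w) / real N)) \<partial>U01)" .
  have "(\<integral>x. (\<Sum>k<N*M. \<Sum>k'<N*M. of_bool (Tr (x + real k) (x + real k'))) \<partial>U01) = (\<Sum>k<N*M. \<Sum>k'<N*M. measure U01 {x. Tr (x + real k) (x + real k')})"
  proof -
    have 1: "(\<integral>x. of_bool (Tr (x + real k) (x + real k')) \<partial>U01) = measure U01 {x. Tr (x + real k) (x + real k')}" for k k'
    proof -
      have "{x. Tr (x + real k) (x + real k')} \<in> sets borel" using mTr[of "real k" "real k'"] by simp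
      moreover have "(\<lambda>x. of_bool (Tr (x + real k) (x + real k')) :: real) = indicator {x. Tr (x + real k) (x + real k')}"
        by (auto simp: fun_eq_iff indicator_def)
      ultimately show ?thesis by simp
    qed
    have "(\<integral>x. (\<Sum>k<N*M. \<Sum>k'<N*M. (of_bool (Tr (x + real k) (x + real k')) :: real)) \<partial>U01)
        = (\<Sum>k<N*M. \<integral>x. (\<Sum>k'<N*M. (of_bool (Tr (x + real k) (x + real k')) :: real)) \<partial>U01)"
      by (intro Bochner_Integration.integral_sum bbd_integrable bbd_sum bbd_of_bool mTr)
    also have "\<dots> = (\<Sum>k<N*M. \<Sum>k'<N*M. \<integral>x. (of_bool (Tr (x + real k) (x + real k')) :: real) \<partial>U01)"
      by (intro sum.cong refl Bochner_Integration.integral_sum bbd_integrable bbd_of_bool mTr)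
    finally show ?thesis by (simp only: 1)
  qed
  also have "\<dots> \<le> (\<Sum>k<N*M. \<Sum>k'<N*M. (2 * K / c + 2) * (8 / c) * (C * lam l ^ q))"
    by (intro sum_mono TrM)
  also have "\<dots> = (real (N*M))\<^sup>2 * ((2 * K / c + 2) * (8 / c) * (C * lam l ^ q))"
    by (simp add: power2_eq_square)
  finally have s2: "(\<integral>x. (\<Sum>k<N*M. \<Sum>k'<N*M. of_bool (Tr (x + real k) (x + real k'))) \<partial>U01)
      \<le> (real (N*M))\<^sup>2 * ((2 * K / c + 2) * (8 / c) * (C * lam l ^ q))" .
  have "bbd (\<lambda>x. V ((x + real w) / real N))" for w by (intro bbd_comp[OF bV]) measurable
  then have "(\<integral>x. (\<Sum>w<N. V ((x + real w) / real N)) \<partial>U01) = (\<Sum>w<N. \<integral>x. V ((x + real w) / real N) \<partial>U01)"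
    by (intro Bochner_Integration.integral_sum bbd_integrable)
  also have "\<dots> = real N * integral\<^sup>L U01 V" by (rule U01_split[OF bV Npos(1)])
  finally have s3: "(\<integral>x. (\<Sum>w<N. V ((x + real w) / real N)) \<partial>U01) = real N * integral\<^sup>L U01 V" .
  have main: "(\<integral>x. (\<Sum>k<N*M. \<Sum>k'<N*M. R (x + real k) (x + real k')) \<partial>U01)
     \<le> (real (N*M))\<^sup>2 * ((2 * K / c + 2) * (8 / c) * (C * lam l ^ q)) + 2 * 3 ^ Suc l * (real N * integral\<^sup>L U01 V)"
    by (rule order_trans[OF s1[unfolded s3] add_right_mono[OF s2]])
  have "W l C \<sigma> p (Suc m) = (\<integral>x. (\<Sum>k<N*M. \<Sum>k'<N*M. R (x + real k) (x + real k')) \<partial>U01) / (real (N*M))\<^sup>2"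
    unfolding W_def PA_def R_def E_def NM[symmetric] q_def ..
  also have "\<dots> \<le> ((real (N*M))\<^sup>2 * ((2 * K / c + 2) * (8 / c) * (C * lam l ^ q)) + 2 * 3 ^ Suc l * (real N * integral\<^sup>L U01 V)) / (real (N*M))\<^sup>2"
    by (intro divide_right_mono main) auto
  \<comment> \<open>Of the \<open>N * N\<close> pairs of leading digits only a weight of at most
    \<open>2 * N\<close> survives, which leaves the factor \<open>1 / N\<close> in front of the
    previous count.\<close>
  also have "\<dots> = (2 * K / c + 2) * (8 / c) * (C * lam l ^ q) + 2 * 3 ^ Suc l / real N * (integral\<^sup>L U01 V / (real M)\<^sup>2)"
  proof -
    have aux: "((n * k)\<^sup>2 * X + Y * (n * Z)) / (n * k)\<^sup>2 = X + Y / n * (Z / k\<^sup>2)" if "n > 0" "k > 0" for n k X Y Z :: real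
      using that by (simp add: field_simps power2_eq_square)
    show ?thesis unfolding of_nat_mult by (rule aux) (use Npos in auto)
  qed
  also have "integral\<^sup>L U01 V / (real M)\<^sup>2 = W l C \<sigma> p m"
    unfolding W_def PA_def V_def[abs_def] M_def E0_def ..
  finally show ?thesis by (simp only: rN q_def mult.assoc)
qed

end

section \<open>Descent on the order of contact\<close>

lemma exp_decay_small:
  fixes Q \<kappa> c :: real
  assumes "c > 0" "\<kappa> > 0"
  shows "\<exists>m\<ge>m0. (Q * real m + 1) * exp (- c * real m) \<le> \<kappa>"
proof -
  have "((\<lambda>x::real. (Q * x + 1) * exp (- c * x)) \<longlongrightarrow> 0) at_top"
    using assms by real_asymp
  then have "(\<lambda>m. (Q * real m + 1) * exp (- c * real m)) \<longlonglongrightarrow> 0"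
    by (rule filterlim_compose[OF _ filterlim_real_sequentially])
  then have "eventually (\<lambda>m. (Q * real m + 1) * exp (- c * real m) < \<kappa>) sequentially"
    using assms by (auto dest: order_tendstoD)
  then obtain M where "\<forall>m\<ge>M. (Q * real m + 1) * exp (- c * real m) < \<kappa>"
    unfolding eventually_sequentially by blast
  then show ?thesis by (intro exI[of _ "max M m0"]) (auto intro: less_imp_le)
qed

context skew_family
begin

text \<open>Outside a set of small measure only subexponentially many branches over a point agree, up to the
  natural scales \<open>lam j ^ p\<close>, in all their derivatives of order at most \<open>l\<close>.\<close>

definition Full :: "nat \<Rightarrow> real \<Rightarrow> bool" where
  "Full l C \<longleftrightarrow> (\<forall>\<epsilon>>0. \<forall>p0. \<exists>p\<ge>p0. p > 0 \<and> (\<exists>G\<in>sets borel. (\<forall>t. (t + real b ^ p \<in> G) = (t \<in> G))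
     \<and> Av (b ^ p) (\<lambda>t. of_bool (t \<notin> G)) \<le> \<epsilon>
     \<and> (\<forall>t\<in>G. (\<Sum>k<b ^ p. of_bool (t + real k \<in> G \<and> Close l C p t (t + real k))) \<le> exp (\<epsilon> * real p))))"

text \<open>Birkhoff sum of the cost \<open>\<rho>\<close> along \<open>t\<close>,
  \<open>t / b ^ p\<close>, and so on; for \<open>\<sigma> = exp (- \<rho>)\<close> the weight
  \<open>Ew \<sigma> p m\<close> is \<open>exp (- Lsum \<rho> p m)\<close>.\<close>

definition Lsum :: "(real \<Rightarrow> real) \<Rightarrow> nat \<Rightarrow> nat \<Rightarrow> real \<Rightarrow> real" where
  "Lsum \<rho> p m t = (\<Sum>i<m. \<rho> (t / real b ^ (i * p)))"

lemma Lsum_per: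
  assumes "\<And>t. \<rho> (t + real b ^ p) = \<rho> t"
  shows "Lsum \<rho> p m (t + real b ^ (m * p)) = Lsum \<rho> p m t"
  unfolding Lsum_def
proof (intro sum.cong refl)
  fix i assume "i \<in> {..<m}"
  then have "m = i + 1 + (m - Suc i)" by simp
  then have "m * p = i * p + p + (m - Suc i) * p" by (metis add_mult_distrib mult_1)
  then have "real b ^ (m * p) = real b ^ (i * p) * (real b ^ p * real b ^ ((m - Suc i) * p))"
    by (simp add: power_add)
  then have "(t + real b ^ (m * p)) / real b ^ (i * p) = t / real b ^ (i * p) + real b ^ p * real (b ^ ((m - Suc i) * p))"
    by (simp add: add_divide_distrib)
  then show "\<rho> ((t + real b ^ (m * p)) / real b ^ (i * p)) = \<rho> (t / real b ^ (i * p))"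
    using periodic_mult_nat[of \<rho>, OF assms] by (simp only:)
qed

text \<open>Deleting \<open>i\<close> blocks of digits leaves the law of the next block unchanged:
  rescaling removes the blocks before it, periodicity those after it.\<close>

lemma Av_shifted_level:
  assumes "bbd \<rho>" and "\<And>t. \<rho> (t + real b ^ p) = \<rho> t" and "i < m"
  shows "Av (b ^ (m * p)) (\<lambda>t. \<rho> (t / real b ^ (i * p))) = Av (b ^ p) \<rho>"
proof -
  have e: "m * p = i * p + (p + (m - Suc i) * p)"
  proof -
    have "m = i + (1 + (m - Suc i))" using assms(3) by simp
    then show ?thesis by (metis add_mult_distrib mult_1)
  qed
  have "Av (b ^ (m * p)) (\<lambda>t. \<rho> (t / real b ^ (i * p))) = Av (b ^ (i * p) * (b ^ p * b ^ ((m - Suc i) * p))) (\<lambda>t. \<rho> (t / real (b ^ (i * p))))"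
    unfolding e power_add of_nat_power ..
  also have "\<dots> = Av (b ^ p * b ^ ((m - Suc i) * p)) \<rho>" by (rule Av_scale) (use assms in auto)
  also have "\<dots> = Av (b ^ p) \<rho>" by (rule Av_periodic) (use assms in auto)
  finally show ?thesis .
qed

lemma bbd_Lsum: "bbd \<rho> \<Longrightarrow> bbd (Lsum \<rho> p m)"
  unfolding Lsum_def[abs_def] by (intro bbd_sum bbd_scale)

lemma Av_Lsum:
  assumes "bbd \<rho>" "\<And>t. \<rho> (t + real b ^ p) = \<rho> t"
  shows "Av (b ^ (m * p)) (Lsum \<rho> p m) = real m * Av (b ^ p) \<rho>"
proof -
  have "Av (b ^ (m * p)) (Lsum \<rho> p m) = (\<Sum>i<m. Av (b ^ (m * p)) (\<lambda>t. \<rho> (t / real b ^ (i * p))))"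
    unfolding Lsum_def[abs_def] by (rule Av_sum) (intro bbd_scale assms)
  also have "\<dots> = (\<Sum>i<m. Av (b ^ p) \<rho>)" by (intro sum.cong refl Av_shifted_level assms) auto
  finally show ?thesis by simp
qed

text \<open>Weights \<open>exp (- \<rho>)\<close> that decay where many branches agree to order \<open>l + 1\<close> make the remaining
  pairs transversal to order \<open>l\<close>, so that the weighted number of close pairs contracts in each step.\<close>

lemma Full_weights:
  assumes F: "\<And>C. C > 0 \<Longrightarrow> Full (Suc l) C" and C: "C > 0" and \<eta>: "\<eta> > 0"
  shows "\<exists>p \<rho> Q. p > 0 \<and> bbd \<rho> \<and> (\<forall>t. 0 \<le> \<rho> t) \<and> (\<forall>t. \<rho> (t + real b ^ p) = \<rho> t) \<and> Av (b ^ p) \<rho> \<le> \<eta> * real p \<and> 0 \<le> Q \<and>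
    (\<forall>m. PA (b ^ (m * p)) (\<lambda>t t'. exp (- Lsum \<rho> p m t) * exp (- Lsum \<rho> p m t') * of_bool (Close l C (m * p) t t'))
        \<le> (Q * real m + 1) * (max (lam l) (1 / real b) * exp \<eta>) ^ (m * p))"
proof -
  define D where "D = (\<Sum>j\<le>Suc l. 2 * Cb j)"
  have D: "2 * Cb j \<le> D" if "j \<le> Suc l" for j
    unfolding D_def using that Cb_nonneg by (intro member_le_sum) auto
  have D0: "D \<ge> 0" unfolding D_def using Cb_nonneg by (intro sum_nonneg) auto
  have lnb: "ln (real b) > 0" using b2 by simp
  \<comment> \<open>Chosen so that the mean cost, at most \<open>\<epsilon> * p / 2\<close> on
    \<open>G\<close> plus \<open>p * ln b\<close> off \<open>G\<close> with frequency
    \<open>\<epsilon>\<close>, stays below \<open>\<eta> * p\<close>.\<close>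
  define \<epsilon> where "\<epsilon> = \<eta> / (1 + ln (real b))"
  have \<epsilon>: "\<epsilon> > 0" "\<epsilon> / 2 + \<epsilon> * ln (real b) \<le> \<eta>"
  proof -
    have l1: "1 + ln (real b) > 0" using lnb by linarith
    show e: "\<epsilon> > 0" unfolding \<epsilon>_def using \<eta> l1 by (rule divide_pos_pos)
    have "\<epsilon> * (1 + ln (real b)) = \<eta>" unfolding \<epsilon>_def using l1 by (simp only: nonzero_eq_divide_eq[symmetric] less_imp_neq[THEN not_sym] not_False_eq_True)
    then show "\<epsilon> / 2 + \<epsilon> * ln (real b) \<le> \<eta>" using e by (simp add: algebra_simps)
  qed
  \<comment> \<open>From this block length on, the combinatorial factor \<open>2 * 3 ^ Suc l\<close>
    of \<open>W_step\<close> is at most \<open>exp (\<eta> * p)\<close>.\<close>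
  define p0 where "p0 = nat \<lceil>ln (2 * 3 ^ Suc l) / \<eta>\<rceil>"
  obtain p G where p: "p \<ge> p0" "p > 0" and G: "G \<in> sets borel" "\<And>t. (t + real b ^ p \<in> G) = (t \<in> G)"
     "Av (b ^ p) (\<lambda>t. of_bool (t \<notin> G)) \<le> \<epsilon>"
     "\<forall>t\<in>G. (\<Sum>k<b ^ p. of_bool (t + real k \<in> G \<and> Close (Suc l) (C + D) p t (t + real k))) \<le> exp (\<epsilon> * real p)"
    using F[of "C + D", OF add_pos_nonneg[OF C D0], unfolded Full_def, rule_format, OF \<epsilon>(1), of p0] by blast
  have [measurable]: "G \<in> sets borel" by (rule G)
  \<comment> \<open>Two points of \<open>G\<close> together receive the weight
    \<open>exp (- (\<epsilon> * p))\<close>, which cancels the bound on the number of close partners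
    in \<open>G\<close>; off \<open>G\<close> the weight \<open>1 / b ^ p\<close> cancels the
    trivial count of all \<open>b ^ p\<close> digits.\<close>
  define \<rho> where "\<rho> t = (if t \<in> G then \<epsilon> * real p / 2 else real p * ln (real b))" for t
  define \<sigma> where "\<sigma> t = exp (- \<rho> t)" for t
  have l0: "0 \<le> \<rho> t" for t using \<epsilon> lnb by (auto simp: \<rho>_def)
  have bl: "bbd \<rho>"
  proof (rule bbdI)
    show "\<rho> \<in> borel_measurable borel" unfolding \<rho>_def[abs_def] by measurable
    show "\<bar>\<rho> t\<bar> \<le> \<epsilon> * real p + real p * ln (real b)" for t
      using \<epsilon> lnb by (auto simp: \<rho>_def)
  qed
  have pl: "\<rho> (t + real b ^ p) = \<rho> t" for t by (simp add: \<rho>_def G(2))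
  have avl: "Av (b ^ p) \<rho> \<le> \<eta> * real p"
  proof -
    have "Av (b ^ p) \<rho> \<le> Av (b ^ p) (\<lambda>t. \<epsilon> * real p / 2 + real p * ln (real b) * of_bool (t \<notin> G))"
      using \<epsilon> lnb by (intro Av_mono bl bbd_intros) (auto simp: \<rho>_def)
    also have "\<dots> = \<epsilon> * real p / 2 + real p * ln (real b) * Av (b ^ p) (\<lambda>t. of_bool (t \<notin> G))"
      by (subst Av_add) (auto intro!: bbd_intros simp: Av_const Av_cmult)
    also have "\<dots> \<le> \<epsilon> * real p / 2 + real p * ln (real b) * \<epsilon>"
      using G(3) lnb by (intro add_left_mono mult_left_mono) auto
    also have "\<dots> = (\<epsilon> / 2 + \<epsilon> * ln (real b)) * real p" by (simp add: algebra_simps)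
    also have "\<dots> \<le> \<eta> * real p" using \<epsilon>(2) by (intro mult_right_mono) auto
    finally show ?thesis .
  qed
  have bs: "bbd \<sigma>"
    by (rule bbdI[where B=1]) (use bl l0 in \<open>auto simp: \<sigma>_def[abs_def] bbd_def\<close>)
  have s01: "0 \<le> \<sigma> t \<and> \<sigma> t \<le> 1" for t using l0 by (simp add: \<sigma>_def)
  have ps: "\<sigma> (t + real b ^ p) = \<sigma> t" for t by (simp add: \<sigma>_def pl)
  have sG: "\<sigma> t = exp (- (\<epsilon> * real p / 2))" if "t \<in> G" for t using that by (simp add: \<sigma>_def \<rho>_def)
  have sB: "\<sigma> t = 1 / real b ^ p" if "t \<notin> G" for t
  proof -
    have "exp (real p * ln (real b)) = real b ^ p" by (simp add: exp_of_nat_mult)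
    then show ?thesis using that by (simp add: \<sigma>_def \<rho>_def exp_minus divide_inverse)
  qed
  \<comment> \<open>For \<open>t\<close> in \<open>G\<close> one unit comes from partners in
    \<open>G\<close>, the other from all partners outside \<open>G\<close> together.\<close>
  have row: "(\<Sum>k<b ^ p. \<sigma> t * \<sigma> (t + real k) * of_bool (Close (Suc l) (C + D) p t (t + real k))) \<le> 2" for t
  proof (cases "t \<in> G")
    case True
    have "(\<Sum>k<b ^ p. \<sigma> t * \<sigma> (t + real k) * of_bool (Close (Suc l) (C + D) p t (t + real k)))
       \<le> (\<Sum>k<b ^ p. exp (- (\<epsilon> * real p)) * of_bool (t + real k \<in> G \<and> Close (Suc l) (C + D) p t (t + real k)) + 1 / real b ^ p)"
    proof (rule sum_mono)
      fix k
      show "\<sigma> t * \<sigma> (t + real k) * of_bool (Close (Suc l) (C + D) p t (t + real k))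
        \<le> exp (- (\<epsilon> * real p)) * of_bool (t + real k \<in> G \<and> Close (Suc l) (C + D) p t (t + real k)) + 1 / real b ^ p"
      proof (cases "t + real k \<in> G")
        case True2: True
        have "\<sigma> t * \<sigma> (t + real k) = exp (- (\<epsilon> * real p))"
          unfolding sG[OF True] sG[OF True2] by (simp flip: exp_add)
        then show ?thesis using True2 by (simp add: less_imp_le)
      next
        case False
        have "\<sigma> t * \<sigma> (t + real k) * of_bool (Close (Suc l) (C + D) p t (t + real k)) \<le> 1 * \<sigma> (t + real k) * 1"
          using s01 by (intro mult_mono) auto
        then show ?thesis using False by (simp add: sB)
      qed
    qed
    also have "\<dots> = exp (- (\<epsilon> * real p)) * (\<Sum>k<b ^ p. of_bool (t + real k \<in> G \<and> Close (Suc l) (C + D) p t (t + real k))) + 1"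
      by (simp only: sum.distrib sum_distrib_left) simp
    also have "\<dots> \<le> exp (- (\<epsilon> * real p)) * exp (\<epsilon> * real p) + 1"
      by (intro add_right_mono mult_left_mono G(4)[rule_format] True) auto
    also have "\<dots> = 2" by (simp flip: exp_add)
    finally show ?thesis .
  next
    case False
    have "(\<Sum>k<b ^ p. \<sigma> t * \<sigma> (t + real k) * of_bool (Close (Suc l) (C + D) p t (t + real k))) \<le> (\<Sum>k<b ^ p. 1 / real b ^ p)"
    proof (rule sum_mono)
      fix k
      have "\<sigma> t * \<sigma> (t + real k) * of_bool (Close (Suc l) (C + D) p t (t + real k)) \<le> \<sigma> t * 1 * 1"
        using s01 by (intro mult_mono) auto
      then show "\<sigma> t * \<sigma> (t + real k) * of_bool (Close (Suc l) (C + D) p t (t + real k)) \<le> 1 / real b ^ p"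
        using False by (simp add: sB)
    qed
    then show ?thesis by simp
  qed
  define c where "c = C * lam (Suc l) ^ p"
  define K where "K = 2 * Cb (Suc (Suc l)) + 1"
  define Q where "Q = (2 * K / c + 2) * (8 / c) * C"
  have Q0: "Q \<ge> 0" unfolding Q_def c_def K_def using C Cb_nonneg[of "Suc (Suc l)"] by auto
  \<comment> \<open>\<open>z\<close> bounds both the transversal rate per block and the recursive
    factor of \<open>W_step\<close>. Equal rates in the recursion produce the linear factor
    \<open>Q * m + 1\<close>.\<close>
  define z where "z = (max (lam l) (1 / real b) * exp \<eta>) ^ p"
  have z1: "lam l ^ p \<le> z"
    unfolding z_def
  proof (rule power_mono)
    have "lam l * 1 \<le> max (lam l) (1 / real b) * exp \<eta>" using \<eta> lam_pos[of l]
      by (intro mult_mono) (auto simp: le_max_iff_disj less_imp_le)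
    then show "lam l \<le> max (lam l) (1 / real b) * exp \<eta>" by simp
  qed (simp add: less_imp_le)
  have z2: "2 * 3 ^ Suc l / real b ^ p \<le> z"
  proof -
    have "ln (2 * 3 ^ Suc l) / \<eta> \<le> real p" using p(1) unfolding p0_def by linarith
    then have "ln (2 * 3 ^ Suc l) \<le> \<eta> * real p" using \<eta> by (simp add: field_simps)
    then have "exp (ln (2 * 3 ^ Suc l)) \<le> exp (\<eta> * real p)" by (simp only: exp_le_cancel_iff)
    then have "2 * 3 ^ Suc l \<le> exp (\<eta> * real p)" by simp
    then have "2 * 3 ^ Suc l / real b ^ p \<le> exp (\<eta> * real p) / real b ^ p" by (intro divide_right_mono) auto
    also have "\<dots> = (1 / real b * exp \<eta>) ^ p"
      by (simp add: power_mult_distrib power_divide exp_of_nat_mult[symmetric] mult.commute)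
    also have "\<dots> \<le> z" unfolding z_def by (intro power_mono mult_right_mono) auto
    finally show ?thesis .
  qed
  have z0: "z \<ge> 0" using z1 lam_pow_pos(3)[of l p] by linarith
  have Wm: "W l C \<sigma> p m \<le> (Q * real m + 1) * z ^ m" for m
  proof (induction m)
    case 0
    have "W l C \<sigma> p 0 = (\<integral>x. of_bool (Close l C 0 x x) \<partial>U01)"
      by (simp add: W_def PA_def Ew_def)
    also have "\<dots> \<le> (\<integral>x. 1 \<partial>U01)"
      by (intro integral_mono bbd_integrable bbd_of_bool bbd_const) auto
    finally show ?case using U01.prob_space by simp
  next
    case (Suc m)
    have "W l C \<sigma> p (Suc m) \<le> Q * lam l ^ (Suc m * p) + 2 * 3 ^ Suc l / real b ^ p * W l C \<sigma> p m"
      unfolding Q_def by (rule W_step[OF bs s01 ps C D row c_def K_def])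
    also have "Q * lam l ^ (Suc m * p) \<le> Q * z ^ Suc m"
    proof -
      have "lam l ^ (Suc m * p) = (lam l ^ p) ^ Suc m" by (metis power_mult mult.commute)
      also have "\<dots> \<le> z ^ Suc m" by (intro power_mono z1) simp
      finally show ?thesis using Q0 by (intro mult_left_mono)
    qed
    also have "2 * 3 ^ Suc l / real b ^ p * W l C \<sigma> p m \<le> z * ((Q * real m + 1) * z ^ m)"
    proof (rule mult_mono[OF z2 Suc z0])
      show "0 \<le> W l C \<sigma> p m" unfolding W_def
        by (intro PA_nonneg mult_nonneg_nonneg Ew_bounds) (use s01 in auto)
    qed
    also have "Q * z ^ Suc m + z * ((Q * real m + 1) * z ^ m) = (Q * real (Suc m) + 1) * z ^ Suc m"
      by (simp add: algebra_simps)
    finally show ?case by simp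
  qed
  have E: "Ew \<sigma> p m t = exp (- Lsum \<rho> p m t)" for m t
    unfolding Ew_def \<sigma>_def Lsum_def by (simp add: exp_sum sum_negf[symmetric])
  have "PA (b ^ (m * p)) (\<lambda>t t'. exp (- Lsum \<rho> p m t) * exp (- Lsum \<rho> p m t') * of_bool (Close l C (m * p) t t'))
        \<le> (Q * real m + 1) * (max (lam l) (1 / real b) * exp \<eta>) ^ (m * p)" for m
  proof -
    have "z ^ m = (max (lam l) (1 / real b) * exp \<eta>) ^ (m * p)" unfolding z_def by (metis power_mult mult.commute)
    then show ?thesis using Wm[of m] unfolding W_def E by simp
  qed
  then show ?thesis using p(2) bl l0 pl avl Q0 by blast
qed

text \<open>Where both costs are at most \<open>a\<close>, the product of the two weights is at
  least \<open>exp (- 2 * a)\<close>, so dropping the weights costs only the reciprocal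
  factor.\<close>

lemma pair_count_good:
  assumes bl: "bbd \<rho>" and PAb: "PA (b ^ (m * p)) (\<lambda>t t'. exp (- Lsum \<rho> p m t) * exp (- Lsum \<rho> p m t') * of_bool (Close l C (m * p) t t')) \<le> X"
  shows "PA (b ^ (m * p)) (\<lambda>t t'. of_bool (Lsum \<rho> p m t \<le> a \<and> Lsum \<rho> p m t' \<le> a \<and> Close l C (m * p) t t')) \<le> exp (2 * a) * X"
proof -
  have [measurable]: "Lsum \<rho> p m \<in> borel_measurable borel" by (intro bbd_measurable bbd_Lsum bl)
  have bx: "bbd (\<lambda>x. of_bool (Lsum \<rho> p m (x + k) \<le> a) * exp (- Lsum \<rho> p m (x + k)))" for k
  proof -
    obtain B where B: "\<bar>Lsum \<rho> p m x\<bar> \<le> B" for x using bbd_Lsum[OF bl, of p m] unfolding bbd_def by blast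
    show ?thesis
    proof (rule bbdI[where B="exp B"])
      show "\<bar>of_bool (Lsum \<rho> p m (x + k) \<le> a) * exp (- Lsum \<rho> p m (x + k))\<bar> \<le> exp B" for x
        using B[of "x + k"] by (auto simp: abs_mult)
    qed measurable
  qed
  have be: "bbd (\<lambda>x. exp (- Lsum \<rho> p m (x + k)))" for k
  proof -
    obtain B where B: "\<bar>Lsum \<rho> p m x\<bar> \<le> B" for x using bbd_Lsum[OF bl, of p m] unfolding bbd_def by blast
    show ?thesis
    proof (rule bbdI[where B="exp B"])
      show "\<bar>exp (- Lsum \<rho> p m (x + k))\<bar> \<le> exp B" for x
        using B[of "x + k"] by (auto simp: abs_mult)
    qed measurable
  qed
  have "PA (b ^ (m * p)) (\<lambda>t t'. of_bool (Lsum \<rho> p m t \<le> a \<and> Lsum \<rho> p m t' \<le> a \<and> Close l C (m * p) t t'))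
     \<le> PA (b ^ (m * p)) (\<lambda>t t'. exp (2 * a) * (exp (- Lsum \<rho> p m t) * exp (- Lsum \<rho> p m t') * of_bool (Close l C (m * p) t t')))"
  proof (rule PA_mono)
    show "bbd (\<lambda>x. of_bool (Lsum \<rho> p m (x + real k) \<le> a \<and> Lsum \<rho> p m (x + real k') \<le> a \<and> Close l C (m * p) (x + real k) (x + real k')))" for k k'
      by (intro bbd_of_bool) measurable
    show "bbd (\<lambda>x. exp (2 * a) * (exp (- Lsum \<rho> p m (x + real k)) * exp (- Lsum \<rho> p m (x + real k')) * of_bool (Close l C (m * p) (x + real k) (x + real k'))))" for k k'
      by (intro bbd_mult bbd_const be bbd_of_bool) measurable
    fix t t'
    show "of_bool (Lsum \<rho> p m t \<le> a \<and> Lsum \<rho> p m t' \<le> a \<and> Close l C (m * p) t t')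
      \<le> exp (2 * a) * (exp (- Lsum \<rho> p m t) * exp (- Lsum \<rho> p m t') * of_bool (Close l C (m * p) t t'))"
    proof (cases "Lsum \<rho> p m t \<le> a \<and> Lsum \<rho> p m t' \<le> a")
      case True
      have "(1::real) \<le> exp (2 * a + (- Lsum \<rho> p m t - Lsum \<rho> p m t'))" using True by simp
      also have "\<dots> = exp (2 * a) * (exp (- Lsum \<rho> p m t) * exp (- Lsum \<rho> p m t'))" by (simp flip: exp_add)
      finally show ?thesis by (simp add: of_bool_def)
    qed auto
  qed
  also have "\<dots> = exp (2 * a) * PA (b ^ (m * p)) (\<lambda>t t'. exp (- Lsum \<rho> p m t) * exp (- Lsum \<rho> p m t') * of_bool (Close l C (m * p) t t'))"
    by (rule PA_cmult)
  also have "\<dots> \<le> exp (2 * a) * X" using PAb by (intro mult_left_mono) auto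
  finally show ?thesis .
qed

text \<open>For \<open>l \<ge> 1\<close> the rate \<open>max (lam l) (1 / b)\<close> equals
  \<open>1 / b\<close>, the reciprocal of the number of branches per digit. The mean number of close
  partners among branches of low cost is then subexponential, and Markov's inequality, applied to
  the cost and to the partner count, yields the good set.\<close>

lemma Full_step:
  assumes F: "\<And>C. C > 0 \<Longrightarrow> Full (Suc l) C" and l: "l \<ge> 1" and C: "C > 0"
  shows "Full l C"
  unfolding Full_def
proof (intro allI impI)
  fix \<epsilon> :: real and p0 assume \<epsilon>: "\<epsilon> > 0"
  define \<kappa> where "\<kappa> = min (\<epsilon> / 4) (1 / 4)"
  have \<kappa>: "\<kappa> > 0" "\<kappa> \<le> \<epsilon> / 4" "\<kappa> \<le> 1 / 4" using \<epsilon> by (auto simp: \<kappa>_def)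
  \<comment> \<open>The square of \<open>\<kappa>\<close>: the cost has mean at most
    \<open>\<eta> * q\<close>, so against the threshold \<open>\<kappa> * q\<close> Markov's
    inequality leaves a proportion \<open>\<kappa>\<close>.\<close>
  define \<eta> where "\<eta> = \<kappa> * \<kappa>"
  have \<eta>: "\<eta> > 0" "\<eta> \<le> \<kappa>" using \<kappa> mult_left_mono[of \<kappa> 1 \<kappa>] by (auto simp: \<eta>_def)
  obtain p \<rho> Q where p: "p > 0" and bl: "bbd \<rho>" and l0: "\<And>t. 0 \<le> \<rho> t" and pl: "\<And>t. \<rho> (t + real b ^ p) = \<rho> t"
    and avl: "Av (b ^ p) \<rho> \<le> \<eta> * real p" and Q: "0 \<le> Q"
    and Wm: "\<And>m. PA (b ^ (m * p)) (\<lambda>t t'. exp (- Lsum \<rho> p m t) * exp (- Lsum \<rho> p m t') * of_bool (Close l C (m * p) t t'))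
        \<le> (Q * real m + 1) * (max (lam l) (1 / real b) * exp \<eta>) ^ (m * p)"
    using Full_weights[OF F C \<eta>(1)] by blast
  have mx: "max (lam l) (1 / real b) = 1 / real b"
  proof -
    have "real b ^ 1 \<le> real b ^ l" using l by (intro power_increasing) auto
    then have "\<gamma> / real b ^ l \<le> 1 / real b" using \<gamma>0 \<gamma>1 by (intro frac_le) auto
    then show ?thesis by (simp add: lam_def)
  qed
  have "\<epsilon> * real p - 2 * \<kappa> * real p - \<eta> * real p > 0"
  proof -
    have "2 * \<kappa> + \<eta> < \<epsilon>" using \<kappa> \<eta> \<epsilon> by linarith
    then have "(2 * \<kappa> + \<eta>) * real p < \<epsilon> * real p" using p by simp
    then show ?thesis by (simp add: algebra_simps)
  qed
  from exp_decay_small[OF this \<kappa>(1), of "max p0 1" Q]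
  obtain m where m: "m \<ge> max p0 1" "(Q * real m + 1) * exp (- (\<epsilon> * real p - 2 * \<kappa> * real p - \<eta> * real p) * real m) \<le> \<kappa>" by blast
  define q where "q = m * p"
  have qge: "q \<ge> p0" "q > 0" using m(1) p mult_le_mono[of p0 m 1 p] by (auto simp: q_def)
  define L where "L = Lsum \<rho> p m"
  have bL: "bbd L" unfolding L_def by (rule bbd_Lsum[OF bl])
  have [measurable]: "L \<in> borel_measurable borel" using bL by (rule bbd_measurable)
  have pL: "L (t + real b ^ q) = L t" for t unfolding L_def q_def by (rule Lsum_per) (rule pl)
  have L0: "0 \<le> L t" for t unfolding L_def Lsum_def by (intro sum_nonneg l0)
  define a where "a = \<kappa> * real q"
  have a0: "a > 0" using \<kappa> qge by (simp add: a_def)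
  define \<Phi> where "\<Phi> t t' = (of_bool (L t \<le> a \<and> L t' \<le> a \<and> Close l C q t t') :: real)" for t t'
  have b\<Phi>: "bbd (\<lambda>t. \<Phi> t (t + k))" for k unfolding \<Phi>_def by (intro bbd_of_bool) measurable
  define Nn where "Nn t = (\<Sum>k<b ^ q. \<Phi> t (t + real k))" for t
  have bN: "bbd Nn" unfolding Nn_def[abs_def] by (intro bbd_sum b\<Phi>)
  have [measurable]: "Nn \<in> borel_measurable borel" using bN by (rule bbd_measurable)
  have N0: "0 \<le> Nn t" for t unfolding Nn_def \<Phi>_def by (intro sum_nonneg) auto
  have p\<Phi>: "\<Phi> t (t' + real b ^ q) = \<Phi> t t'" "\<Phi> (t + real b ^ q) t' = \<Phi> t t'" for t t'
    unfolding \<Phi>_def by (simp_all add: pL Close_per Close_def HH_per)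
  have pN: "Nn (t + real b ^ q) = Nn t" for t
  proof -
    have "t + real b ^ q + real k = (t + real k) + real b ^ q" for k by simp
    then show ?thesis unfolding Nn_def by (simp only: p\<Phi>)
  qed
  have avN: "Av (b ^ q) Nn \<le> (Q * real m + 1) * exp ((2 * \<kappa> + \<eta>) * real q)"
  proof -
    have "Av (b ^ q) Nn = real (b ^ q) * PA (b ^ q) \<Phi>"
      unfolding Nn_def[abs_def] by (rule Av_pairs) (use b\<Phi> p\<Phi> in auto)
    also have "PA (b ^ q) \<Phi> \<le> exp (2 * a) * ((Q * real m + 1) * (1 / real b * exp \<eta>) ^ q)"
      unfolding \<Phi>_def L_def q_def by (rule pair_count_good[OF bl Wm[unfolded mx]])
    also have "real (b ^ q) * (exp (2 * a) * ((Q * real m + 1) * (1 / real b * exp \<eta>) ^ q)) = (Q * real m + 1) * (exp (2 * a) * exp (real q * \<eta>))"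
      by (simp add: power_mult_distrib power_divide exp_of_nat_mult)
    also have "\<dots> = (Q * real m + 1) * exp ((2 * \<kappa> + \<eta>) * real q)"
      by (simp add: a_def exp_add[symmetric] algebra_simps)
    finally show ?thesis by simp
  qed
  define G where "G = {t. L t \<le> a \<and> Nn t \<le> exp (\<epsilon> * real q)}"
  have "G \<in> sets borel" unfolding G_def by measurable
  moreover have "\<forall>t. (t + real b ^ q \<in> G) = (t \<in> G)" by (simp add: G_def pL pN)
  moreover have "Av (b ^ q) (\<lambda>t. of_bool (t \<notin> G)) \<le> \<epsilon>"
  proof -
    have "Av (b ^ q) (\<lambda>t. of_bool (t \<notin> G)) \<le> Av (b ^ q) (\<lambda>t. of_bool (L t > a) + of_bool (Nn t > exp (\<epsilon> * real q)))"
      by (intro Av_mono bbd_add bbd_of_bool) (auto simp: G_def)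
    also have "\<dots> = Av (b ^ q) (\<lambda>t. of_bool (L t > a)) + Av (b ^ q) (\<lambda>t. of_bool (Nn t > exp (\<epsilon> * real q)))"
      by (intro Av_add bbd_of_bool) auto
    also have "\<dots> \<le> Av (b ^ q) L / a + Av (b ^ q) Nn / exp (\<epsilon> * real q)"
      by (intro add_mono Av_markov bL bN L0 N0 a0) auto
    also have "Av (b ^ q) L / a \<le> \<kappa>"
    proof -
      have "Av (b ^ q) L = real m * Av (b ^ p) \<rho>" unfolding L_def q_def by (rule Av_Lsum[OF bl pl])
      also have "\<dots> \<le> real m * (\<eta> * real p)" using avl by (intro mult_left_mono) auto
      also have "\<dots> = \<kappa> * a" by (simp add: \<eta>_def a_def q_def)
      finally show ?thesis using a0 by (simp add: divide_le_eq)
    qed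
    also have "Av (b ^ q) Nn / exp (\<epsilon> * real q) \<le> \<kappa>"
    proof -
      have "Av (b ^ q) Nn / exp (\<epsilon> * real q) \<le> ((Q * real m + 1) * exp ((2 * \<kappa> + \<eta>) * real q)) / exp (\<epsilon> * real q)"
        by (intro divide_right_mono avN) auto
      also have "\<dots> = (Q * real m + 1) * exp ((2 * \<kappa> + \<eta>) * real q - \<epsilon> * real q)" by (simp add: exp_diff)
      also have "(2 * \<kappa> + \<eta>) * real q - \<epsilon> * real q = - (\<epsilon> * real p - 2 * \<kappa> * real p - \<eta> * real p) * real m"
        by (simp add: q_def algebra_simps)
      finally show ?thesis using m(2) by linarith
    qed
    finally show ?thesis using \<kappa> by linarith
  qed
  moreover have "\<forall>t\<in>G. (\<Sum>k<b ^ q. of_bool (t + real k \<in> G \<and> Close l C q t (t + real k))) \<le> exp (\<epsilon> * real q)"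
  proof
    fix t assume t: "t \<in> G"
    have "(\<Sum>k<b ^ q. of_bool (t + real k \<in> G \<and> Close l C q t (t + real k))) \<le> Nn t"
      unfolding Nn_def \<Phi>_def using t by (intro sum_mono) (auto simp: G_def)
    then show "(\<Sum>k<b ^ q. of_bool (t + real k \<in> G \<and> Close l C q t (t + real k))) \<le> exp (\<epsilon> * real q)"
      using t by (simp add: G_def)
  qed
  ultimately show "\<exists>p\<ge>p0. p > 0 \<and> (\<exists>G\<in>sets borel. (\<forall>t. (t + real b ^ p \<in> G) = (t \<in> G))
     \<and> Av (b ^ p) (\<lambda>t. of_bool (t \<notin> G)) \<le> \<epsilon>
     \<and> (\<forall>t\<in>G. (\<Sum>k<b ^ p. of_bool (t + real k \<in> G \<and> Close l C p t (t + real k))) \<le> exp (\<epsilon> * real p)))"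
    using qge by blast
qed

text \<open>The descent halts at order 1. At order 0 the contraction \<open>lam 0 = \<gamma>\<close>
  may exceed \<open>1 / b\<close>, so that step gives a rate instead of a subexponential count; it
  is carried out in \<open>good_sets\<close>.\<close>

lemma Full_one:
  assumes "\<And>C. C > 0 \<Longrightarrow> Full (Suc N) C" and "C > 0"
  shows "Full 1 C"
  using assms
proof (induction N arbitrary: C)
  case (Suc N)
  have "Full (Suc N) C" if "C > 0" for C
    by (rule Full_step[OF Suc.prems(1)]) (use that in auto)
  then show ?case using Suc by blast
qed auto

end

section \<open>Maximal inequality and mass of cells\<close>

text \<open>Covering argument from left to right: if the leftmost index starts an interval with
  average above \<open>c\<close>, the whole interval is skipped, its length being paid for by its
  sum; otherwise the scan advances by one.\<close>

lemma maximal_discrete: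
  fixes a :: "nat \<Rightarrow> real"
  assumes "\<And>i. 0 \<le> a i" "c \<ge> 0"
  shows "c * real (card {i. i < n \<and> (\<exists>m\<ge>1. i + m \<le> n \<and> sum a {i..<i+m} > c * real m)}) \<le> sum a {..<n}"
  using assms(1)
proof (induction n arbitrary: a rule: less_induct)
  case (less n)
  define B where "B n a = {i. i < n \<and> (\<exists>m\<ge>1. i + m \<le> n \<and> sum a {i..<i+m} > c * real m)}" for n and a :: "nat \<Rightarrow> real"
  have fin: "finite (B n a)" for n a unfolding B_def by auto
  have shift: "B n a \<inter> {d..} \<subseteq> (\<lambda>i. i + d) ` B (n - d) (\<lambda>i. a (i + d))" for d
  proof
    fix i assume i: "i \<in> B n a \<inter> {d..}"
    then obtain m where m: "m \<ge> 1" "i + m \<le> n" "sum a {i..<i+m} > c * real m" by (auto simp: B_def)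
    have "sum (\<lambda>i. a (i + d)) {i - d..<i - d + m} = sum a {i - d + d..<i - d + m + d}"
      by (rule sum.shift_bounds_nat_ivl[symmetric])
    also have "\<dots> = sum a {i..<i+m}" using i by simp
    finally have "i - d \<in> B (n - d) (\<lambda>i. a (i + d))"
      using i m by (auto simp: B_def intro!: exI[of _ m])
    then show "i \<in> (\<lambda>i. i + d) ` B (n - d) (\<lambda>i. a (i + d))" using i by (intro image_eqI[of _ _ "i - d"]) auto
  qed
  have crd: "card (B n a) \<le> card (B n a \<inter> {..<d}) + card (B (n - d) (\<lambda>i. a (i + d)))" for d
  proof -
    have "B n a = (B n a \<inter> {..<d}) \<union> (B n a \<inter> {d..})" by auto
    then have "card (B n a) \<le> card (B n a \<inter> {..<d}) + card (B n a \<inter> {d..})" by (metis card_Un_le)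
    also have "card (B n a \<inter> {d..}) \<le> card ((\<lambda>i. i + d) ` B (n - d) (\<lambda>i. a (i + d)))"
      by (intro card_mono shift finite_imageI fin)
    also have "\<dots> \<le> card (B (n - d) (\<lambda>i. a (i + d)))" by (intro card_image_le fin)
    finally show ?thesis by simp
  qed
  have sm: "sum a {..<n} = sum a {..<d} + sum (\<lambda>i. a (i + d)) {..<n - d}" if "d \<le> n" for d
  proof -
    have "sum (\<lambda>i. a (i + d)) {..<n - d} = sum a {d..<n}"
      using sum.shift_bounds_nat_ivl[of a 0 d "n - d"] that by (simp add: lessThan_atLeast0)
    then show ?thesis using that by (simp add: lessThan_atLeast0 sum.atLeastLessThan_concat)
  qed
  have "c * real (card (B n a)) \<le> sum a {..<n}"
  proof (cases "n = 0")
    case False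
    show ?thesis
    proof (cases "0 \<in> B n a")
      case True
      then obtain m where m: "m \<ge> 1" "m \<le> n" "sum a {0..<m} > c * real m" by (auto simp: B_def)
      have "card (B n a \<inter> {..<m}) \<le> card {..<m}" by (intro card_mono) auto
      then have "card (B n a) \<le> m + card (B (n - m) (\<lambda>i. a (i + m)))" using crd[of m] by simp
      then have "c * real (card (B n a)) \<le> c * real m + c * real (card (B (n - m) (\<lambda>i. a (i + m))))"
        using assms(2) by (metis distrib_left mult_left_mono of_nat_add of_nat_mono)
      also have "\<dots> \<le> sum a {..<m} + sum (\<lambda>i. a (i + m)) {..<n - m}"
        using m less.IH[of "n - m" "\<lambda>i. a (i + m)"] less.prems False
        by (intro add_mono) (auto simp: B_def lessThan_atLeast0)
      finally show ?thesis using sm[OF m(2)] by simp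
    next
      case F: False
      then have "B n a \<inter> {..<1} = {}" by auto
      then have "card (B n a) \<le> card (B (n - 1) (\<lambda>i. a (i + 1)))" using crd[of 1] by simp
      then have "c * real (card (B n a)) \<le> c * real (card (B (n - 1) (\<lambda>i. a (i + 1))))"
        using assms(2) by (intro mult_left_mono) auto
      also have "\<dots> \<le> sum (\<lambda>i. a (i + 1)) {..<n - 1}"
        using less.IH[of "n - 1" "\<lambda>i. a (i + 1)"] less.prems False by (auto simp: B_def)
      also have "\<dots> \<le> sum a {..<n}" using sm[of 1] False less.prems[of 0] by simp
      finally show ?thesis .
    qed
  qed (auto simp: B_def)
  then show ?case by (simp add: B_def)
qed

lemma PA_periodic:
  assumes per: "\<And>t t'. \<Phi> (t + real N) t' = \<Phi> t t'" "\<And>t t'. \<Phi> t (t' + real N) = \<Phi> t t'" and M: "M > 0" "N > 0"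
  shows "PA (N * M) \<Phi> = PA N \<Phi>"
proof -
  have 1: "\<Phi> (x + real (w + N * u)) (x + real (w' + N * u')) = \<Phi> (x + real w) (x + real w')" for x w u w' u'
  proof -
    have "\<Phi> (x + real (w + N * u)) (x + real (w' + N * u')) = \<Phi> ((x + real w) + real N * real u) ((x + real w') + real N * real u')"
      by (simp add: add.assoc)
    also have "\<dots> = \<Phi> (x + real w) ((x + real w') + real N * real u')"
      using periodic_mult_nat[of "\<lambda>t. \<Phi> t ((x + real w') + real N * real u')" "real N"] per by simp
    also have "\<dots> = \<Phi> (x + real w) (x + real w')"
      using periodic_mult_nat[of "\<Phi> (x + real w)" "real N"] per by simp
    finally show ?thesis .
  qed
  have "(\<Sum>k<N*M. \<Sum>k'<N*M. \<Phi> (x + real k) (x + real k')) = (real M)\<^sup>2 * (\<Sum>k<N. \<Sum>k'<N. \<Phi> (x + real k) (x + real k'))" for x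
    unfolding sum_lessThan_split 1 by (simp add: power2_eq_square sum_distrib_left mult_ac)
  then show ?thesis using M by (simp add: PA_def power_mult_distrib)
qed

text \<open>The estimate \<open>A \<le> 1/(2\<theta>) + \<theta> A\<^sup>2/2\<close> replaces Cauchy-Schwarz; it bounds the mass of a family of
  square cells by their number and the probability that two points over the same abscissa are close.\<close>

lemma cells_bound:
  fixes H :: "real \<Rightarrow> real" and S :: "(int \<times> int) set"
  assumes [measurable]: "G \<in> sets borel" "H \<in> borel_measurable borel"
    and S: "finite S" and r: "r > 0" and \<theta>: "\<theta> > 0" and N: "N > 0"
  shows "Av N (\<lambda>t. of_bool (t \<in> G \<and> (\<lfloor>frac t / r\<rfloor>, \<lfloor>H t / r\<rfloor>) \<in> S))
     \<le> real (card S) * r / (2 * \<theta>) + \<theta> / 2 * PA N (\<lambda>t t'. of_bool (t \<in> G \<and> t' \<in> G \<and> \<bar>H t - H t'\<bar> \<le> r))"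
proof -
  define n where "n x = (\<Sum>k<N. of_bool (x + real k \<in> G \<and> (\<lfloor>x / r\<rfloor>, \<lfloor>H (x + real k) / r\<rfloor>) \<in> S) :: real)" for x
  define P where "P x = (\<Sum>k<N. \<Sum>k'<N. of_bool (x + real k \<in> G \<and> x + real k' \<in> G \<and> \<bar>H (x + real k) - H (x + real k')\<bar> \<le> r) :: real)" for x
  have mS: "Measurable.pred borel (\<lambda>t. (\<lfloor>g t / r\<rfloor>, \<lfloor>h t / r\<rfloor>) \<in> S)" if [measurable]: "g \<in> borel_measurable borel" "h \<in> borel_measurable borel" for g h :: "real \<Rightarrow> real"
  proof -
    have "(\<lambda>t. (\<lfloor>g t / r\<rfloor>, \<lfloor>h t / r\<rfloor>) \<in> S) = (\<lambda>t. \<exists>s\<in>S. \<lfloor>g t / r\<rfloor> = fst s \<and> \<lfloor>h t / r\<rfloor> = snd s)"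
      by (force simp: fun_eq_iff)
    moreover have "Measurable.pred borel (\<lambda>t. \<exists>s\<in>S. \<lfloor>g t / r\<rfloor> = fst s \<and> \<lfloor>h t / r\<rfloor> = snd s)"
      using S by (intro pred_intros_finite) measurable
    ultimately show ?thesis by simp
  qed
  have frac_meas [measurable]: "(frac :: real \<Rightarrow> real) \<in> borel_measurable borel"
    unfolding frac_def[abs_def] by measurable
  have [measurable]: "Measurable.pred borel (\<lambda>t. (\<lfloor>frac t / r\<rfloor>, \<lfloor>H t / r\<rfloor>) \<in> S)" by (rule mS) measurable
  have bn: "bbd n" unfolding n_def[abs_def]
  proof (intro bbd_sum bbd_of_bool)
    fix k
    have [measurable]: "Measurable.pred borel (\<lambda>x. (\<lfloor>x / r\<rfloor>, \<lfloor>H (x + real k) / r\<rfloor>) \<in> S)" by (rule mS) measurable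
    show "Measurable.pred borel (\<lambda>x. x + real k \<in> G \<and> (\<lfloor>x / r\<rfloor>, \<lfloor>H (x + real k) / r\<rfloor>) \<in> S)" by measurable
  qed
  have bP: "bbd P" unfolding P_def[abs_def] by (intro bbd_sum bbd_of_bool) measurable
  have "Av N (\<lambda>t. of_bool (t \<in> G \<and> (\<lfloor>frac t / r\<rfloor>, \<lfloor>H t / r\<rfloor>) \<in> S))
     = (\<integral>x. (\<Sum>k<N. of_bool (x + real k \<in> G \<and> (\<lfloor>frac (x + real k) / r\<rfloor>, \<lfloor>H (x + real k) / r\<rfloor>) \<in> S)) \<partial>U01) / real N"
    by (rule Av_eq_integral_sum) (intro bbd_of_bool, measurable)
  also have "(\<integral>x. (\<Sum>k<N. of_bool (x + real k \<in> G \<and> (\<lfloor>frac (x + real k) / r\<rfloor>, \<lfloor>H (x + real k) / r\<rfloor>) \<in> S)) \<partial>U01) = (\<integral>x. n x \<partial>U01)"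
  proof (rule integral_cong_AE)
    show "AE x in U01. (\<Sum>k<N. of_bool (x + real k \<in> G \<and> (\<lfloor>frac (x + real k) / r\<rfloor>, \<lfloor>H (x + real k) / r\<rfloor>) \<in> S)) = n x"
      using AE_U01
    proof eventually_elim
      case (elim x)
      have "frac (x + real k) = x" for k using elim by (simp add: frac_def floor_eq_iff)
      then show ?case by (simp only: n_def)
    qed
    show "(\<lambda>x. \<Sum>k<N. of_bool (x + real k \<in> G \<and> (\<lfloor>frac (x + real k) / r\<rfloor>, \<lfloor>H (x + real k) / r\<rfloor>) \<in> S) :: real) \<in> borel_measurable U01"
    proof -
      have "bbd (\<lambda>t. of_bool (t \<in> G \<and> (\<lfloor>frac t / r\<rfloor>, \<lfloor>H t / r\<rfloor>) \<in> S))" by (intro bbd_of_bool) measurable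
      from bbd_sum[OF bbd_shift[OF this], THEN bbd_measurable]
      show ?thesis by (simp add: measurable_cong_sets[OF sets_U01 refl])
    qed
    show "n \<in> borel_measurable U01" using bbd_measurable[OF bn] by (simp add: measurable_cong_sets[OF sets_U01 refl])
  qed
  also have "\<dots> / real N = (\<integral>x. n x / real N \<partial>U01)" by simp
  also have "\<dots> \<le> (\<integral>x. (\<Sum>s\<in>S. of_bool (\<lfloor>x / r\<rfloor> = fst s)) / (2 * \<theta>) + \<theta> / 2 * (P x / (real N)\<^sup>2) \<partial>U01)"
  proof (intro integral_mono bbd_integrable bbd_divide bn bbd_add bbd_mult bbd_const bP bbd_sum bbd_of_bool)
    fix x
    define J where "J = {j. (\<lfloor>x / r\<rfloor>, j) \<in> S}"
    have fJ: "finite J"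
    proof (rule finite_subset[OF _ finite_imageI[OF S, of snd]])
      show "J \<subseteq> snd ` S" unfolding J_def by force
    qed
    define cl where "cl k = \<lfloor>H (x + real k) / r\<rfloor>" for k
    define A where "A j = (\<Sum>k<N. of_bool (x + real k \<in> G \<and> cl k = j) :: real)" for j
    have nA: "n x = (\<Sum>j\<in>J. A j)"
    proof -
      have "of_bool (x + real k \<in> G \<and> cl k \<in> J) = (\<Sum>j\<in>J. of_bool (x + real k \<in> G \<and> cl k = j) :: real)" for k
      proof (cases "cl k \<in> J")
        case True
        then have "(\<Sum>j\<in>J. of_bool (x + real k \<in> G \<and> cl k = j) :: real) = of_bool (x + real k \<in> G)"
          using fJ by (subst sum.remove[of J "cl k"]) (auto intro!: sum.neutral)
        then show ?thesis using True by simp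
      next
        case False
        then have "(\<Sum>j\<in>J. of_bool (x + real k \<in> G \<and> cl k = j) :: real) = 0" by (intro sum.neutral) auto
        then show ?thesis using False by simp
      qed
      then have "n x = (\<Sum>k<N. \<Sum>j\<in>J. of_bool (x + real k \<in> G \<and> cl k = j))"
        unfolding n_def by (intro sum.cong refl) (simp only: J_def cl_def mem_Collect_eq)
      also have "\<dots> = (\<Sum>j\<in>J. \<Sum>k<N. of_bool (x + real k \<in> G \<and> cl k = j))" by (rule sum.swap)
      finally show ?thesis by (simp only: A_def)
    qed
    \<comment> \<open>Two lifts counted in the same cell of the column above \<open>x\<close> differ
      in height by at most \<open>r\<close>, so the squared cell counts are dominated by the close
      pairs.\<close>
    have AP: "(\<Sum>j\<in>J. A j * A j) \<le> P x"
    proof -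
      have "(\<Sum>j\<in>J. A j * A j) = (\<Sum>j\<in>J. \<Sum>k<N. \<Sum>k'<N. of_bool (x + real k \<in> G \<and> cl k = j) * of_bool (x + real k' \<in> G \<and> cl k' = j))"
        unfolding A_def sum_product ..
      also have "\<dots> = (\<Sum>k<N. \<Sum>k'<N. \<Sum>j\<in>J. of_bool (x + real k \<in> G \<and> cl k = j) * of_bool (x + real k' \<in> G \<and> cl k' = j))"
        by (subst sum.swap, rule sum.cong[OF refl], rule sum.swap)
      also have "\<dots> \<le> P x" unfolding P_def
      proof (intro sum_mono)
        fix k k'
        show "(\<Sum>j\<in>J. of_bool (x + real k \<in> G \<and> cl k = j) * of_bool (x + real k' \<in> G \<and> cl k' = j))
          \<le> (of_bool (x + real k \<in> G \<and> x + real k' \<in> G \<and> \<bar>H (x + real k) - H (x + real k')\<bar> \<le> r) :: real)"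
        proof (cases "x + real k \<in> G \<and> x + real k' \<in> G \<and> cl k = cl k' \<and> cl k \<in> J")
          case True
          then have "\<bar>H (x + real k) / r - H (x + real k') / r\<bar> \<le> 1" unfolding cl_def by linarith
          then have "\<bar>(H (x + real k) - H (x + real k')) / r\<bar> \<le> 1" by (simp add: diff_divide_distrib)
          then have 1: "\<bar>H (x + real k) - H (x + real k')\<bar> \<le> r" using r by (simp add: field_simps)
          have "(\<Sum>j\<in>J. of_bool (x + real k \<in> G \<and> cl k = j) * of_bool (x + real k' \<in> G \<and> cl k' = j) :: real) = 1"
            using True fJ by (subst sum.remove[of J "cl k"]) (auto intro!: sum.neutral)
          then show ?thesis using 1 True by simp
        next
          case False
          then have "(\<Sum>j\<in>J. of_bool (x + real k \<in> G \<and> cl k = j) * of_bool (x + real k' \<in> G \<and> cl k' = j) :: real) = 0"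
            by (intro sum.neutral) auto
          then show ?thesis by simp
        qed
      qed
      finally show ?thesis .
    qed
    have amgm: "y \<le> 1 / (2 * \<theta>) + \<theta> / 2 * (y * y)" for y
    proof -
      have "0 \<le> (\<theta> * y - 1)\<^sup>2" by simp
      then have "2 * \<theta> * y \<le> 1 + \<theta> * \<theta> * (y * y)" by (simp add: power2_eq_square algebra_simps)
      then show ?thesis using \<theta> by (simp add: field_simps)
    qed
    have cJ: "real (card J) = (\<Sum>s\<in>S. of_bool (\<lfloor>x / r\<rfloor> = fst s))"
    proof -
      have "card J = card (S \<inter> {s. \<lfloor>x / r\<rfloor> = fst s})"
        by (rule bij_betw_same_card[of "\<lambda>j. (\<lfloor>x / r\<rfloor>, j)"])
           (auto simp: J_def bij_betw_def inj_on_def image_iff)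
      then show ?thesis using S by simp
    qed
    have "n x / real N = (\<Sum>j\<in>J. A j / real N)" by (simp add: nA sum_divide_distrib)
    also have "\<dots> \<le> (\<Sum>j\<in>J. 1 / (2 * \<theta>) + \<theta> / 2 * (A j / real N * (A j / real N)))" by (intro sum_mono amgm)
    also have "\<dots> = real (card J) / (2 * \<theta>) + \<theta> / 2 * ((\<Sum>j\<in>J. A j * A j) / (real N)\<^sup>2)"
    proof -
      have "\<theta> / 2 * (A j / real N * (A j / real N)) = \<theta> / 2 * ((A j * A j) / (real N)\<^sup>2)" for j
        by (simp add: power2_eq_square)
      then show ?thesis
        by (simp only: sum.distrib sum_distrib_left[symmetric] sum_divide_distrib[symmetric] sum_constant times_divide_eq_right mult_1_right)
    qed
    also have "\<dots> \<le> real (card J) / (2 * \<theta>) + \<theta> / 2 * (P x / (real N)\<^sup>2)"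
      using \<theta> AP by (intro add_left_mono mult_left_mono divide_right_mono) auto
    finally show "n x / real N \<le> (\<Sum>s\<in>S. of_bool (\<lfloor>x / r\<rfloor> = fst s)) / (2 * \<theta>) + \<theta> / 2 * (P x / (real N)\<^sup>2)"
      by (simp only: cJ)
  qed measurable
  also have "\<dots> = (\<integral>x. (\<Sum>s\<in>S. of_bool (\<lfloor>x / r\<rfloor> = fst s)) \<partial>U01) / (2 * \<theta>) + \<theta> / 2 * ((\<integral>x. P x \<partial>U01) / (real N)\<^sup>2)"
  proof -
    have 1: "bbd (\<lambda>x. (\<Sum>s\<in>S. of_bool (\<lfloor>x / r\<rfloor> = fst s)) / (2 * \<theta>))" by (intro bbd_divide bbd_sum bbd_of_bool) measurable
    have 2: "bbd (\<lambda>x. \<theta> / 2 * (P x / (real N)\<^sup>2))" by (intro bbd_mult bbd_const bbd_divide bP)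
    show ?thesis unfolding Bochner_Integration.integral_add[OF bbd_integrable[OF 1] bbd_integrable[OF 2]]
      by (simp only: integral_mult_right_zero integral_divide_zero)
  qed
  also have "(\<integral>x. P x \<partial>U01) / (real N)\<^sup>2 = PA N (\<lambda>t t'. of_bool (t \<in> G \<and> t' \<in> G \<and> \<bar>H t - H t'\<bar> \<le> r))"
    unfolding PA_def P_def ..
  \<comment> \<open>A single cell contributes only while \<open>x\<close> runs through its base, an
    interval of length \<open>r\<close>.\<close>
  also have "(\<integral>x. (\<Sum>s\<in>S. of_bool (\<lfloor>x / r\<rfloor> = fst s)) \<partial>U01) \<le> real (card S) * r"
  proof -
    have m: "Measurable.pred borel (\<lambda>x::real. \<lfloor>x / r\<rfloor> = i)" for i by measurable
    have "(\<integral>x. (\<Sum>s\<in>S. of_bool (\<lfloor>x / r\<rfloor> = fst s) :: real) \<partial>U01) = (\<Sum>s\<in>S. \<integral>x. (of_bool (\<lfloor>x / r\<rfloor> = fst s) :: real) \<partial>U01)"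
      by (intro Bochner_Integration.integral_sum bbd_integrable bbd_of_bool m)
    also have "\<dots> \<le> (\<Sum>s\<in>S. r)"
    proof (rule sum_mono)
      fix s :: "int \<times> int"
      define I where "I = {x::real. \<lfloor>x / r\<rfloor> = fst s}"
      have Im: "I \<in> sets borel" unfolding I_def using m by simp
      have sub: "I \<subseteq> {of_int (fst s) * r..of_int (fst s) * r + r}"
      proof
        fix x assume "x \<in> I"
        then have "of_int (fst s) \<le> x / r" "x / r \<le> of_int (fst s) + 1" unfolding I_def by (auto simp: floor_eq_iff)
        then show "x \<in> {of_int (fst s) * r..of_int (fst s) * r + r}" using r by (simp add: field_simps)
      qed
      have "(\<integral>x. (of_bool (\<lfloor>x / r\<rfloor> = fst s) :: real) \<partial>U01) = (\<integral>x. indicator I x \<partial>U01)"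
        by (intro Bochner_Integration.integral_cong) (auto simp: I_def indicator_def)
      also have "\<dots> = measure lborel (I \<inter> {0..<1})" using Im by (simp add: measure_U01)
      also have "\<dots> \<le> measure lborel {of_int (fst s) * r..of_int (fst s) * r + r}"
        using sub Im r by (intro measure_mono_fmeasurable) (auto simp: fmeasurable_def)
      also have "\<dots> = r" using r by simp
      finally show "(\<integral>x. (of_bool (\<lfloor>x / r\<rfloor> = fst s) :: real) \<partial>U01) \<le> r" .
    qed
    finally show ?thesis by simp
  qed
  finally show ?thesis using \<theta> by (simp add: divide_right_mono)
qed

context skew_family
begin

text \<open>Transference: \<open>maximal_discrete\<close> is applied along the orbit
  \<open>t / b ^ (i * p)\<close> for \<open>i < R + M\<close> and averaged over \<open>t\<close>.
  All positions have the same law, the boundary costs \<open>M\<close> positions, and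
  \<open>R\<close> tends to infinity, so the bound does not depend on \<open>M\<close>.\<close>

lemma Av_maximal:
  assumes b\<rho>: "bbd \<rho>" and \<rho>0: "\<And>t. 0 \<le> \<rho> t" and p\<rho>: "\<And>t. \<rho> (t + real b ^ p) = \<rho> t" and c: "c > 0"
  shows "Av (b ^ (M * p)) (\<lambda>t. of_bool (\<exists>m\<in>{1..M}. Lsum \<rho> p m t > c * real m)) \<le> Av (b ^ p) \<rho> / c"
proof -
  have mL [measurable]: "Lsum \<rho> p m \<in> borel_measurable borel" for m by (intro bbd_measurable bbd_Lsum b\<rho>)
  define X where "X t = (of_bool (\<exists>m\<in>{1..M}. Lsum \<rho> p m t > c * real m) :: real)" for t
  have bX: "bbd X" unfolding X_def[abs_def] by (intro bbd_of_bool pred_intros_finite) (auto)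
  have pLm: "Lsum \<rho> p m (t + real b ^ (M * p)) = Lsum \<rho> p m t" if "m \<le> M" for m t
  proof -
    have "M * p = m * p + (M - m) * p" using that by (simp add: add_mult_distrib[symmetric])
    then have "real b ^ (M * p) = real b ^ (m * p) * real (b ^ ((M - m) * p))" by (simp add: power_add)
    then show ?thesis using periodic_mult_nat[of "Lsum \<rho> p m" "real b ^ (m * p)", OF Lsum_per] p\<rho> by (simp only:)
  qed
  have pX: "X (t + real b ^ (M * p)) = X t" for t unfolding X_def by (intro arg_cong[of _ _ of_bool] bex_cong refl) (simp add: pLm)
  define A where "A = Av (b ^ (M * p)) X"
  define R0 where "R0 = Av (b ^ p) \<rho>"
  have key: "c * (real R * A) \<le> (real R + real M) * R0" for R
  proof -
    have pt: "c * (\<Sum>i<R. X (t / real b ^ (i * p))) \<le> Lsum \<rho> p (R + M) t" for t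
    proof -
      define a where "a i = \<rho> (t / real b ^ (i * p))" for i
      define B where "B = {i. i < R + M \<and> (\<exists>m\<ge>1. i + m \<le> R + M \<and> sum a {i..<i+m} > c * real m)}"
      have fB: "finite B" unfolding B_def by auto
      have "(\<Sum>i<R. X (t / real b ^ (i * p))) \<le> (\<Sum>i<R. of_bool (i \<in> B))"
      proof (rule sum_mono)
        fix i assume i: "i \<in> {..<R}"
        show "X (t / real b ^ (i * p)) \<le> of_bool (i \<in> B)"
        proof (cases "\<exists>m\<in>{1..M}. Lsum \<rho> p m (t / real b ^ (i * p)) > c * real m")
          case True
          then obtain m where m: "m \<in> {1..M}" "Lsum \<rho> p m (t / real b ^ (i * p)) > c * real m" by blast
          have "Lsum \<rho> p m (t / real b ^ (i * p)) = (\<Sum>j<m. a (j + i))"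
            unfolding Lsum_def a_def by (simp add: add_mult_distrib power_add mult.commute[of "real b ^ (i * p)"])
          also have "\<dots> = sum a {i..<i+m}"
            using sum.shift_bounds_nat_ivl[of a 0 i m] by (simp add: lessThan_atLeast0 add.commute)
          finally have "i \<in> B" using m i unfolding B_def by (auto intro!: exI[of _ m])
          then show ?thesis by (simp add: X_def)
        qed (simp add: X_def)
      qed
      also have "\<dots> = real (card ({..<R} \<inter> B))" by simp
      also have "\<dots> \<le> real (card B)" using fB by (intro of_nat_mono card_mono) auto
      finally have "c * (\<Sum>i<R. X (t / real b ^ (i * p))) \<le> c * real (card B)" using c by (intro mult_left_mono) auto
      also have "\<dots> \<le> sum a {..<R + M}"
        unfolding B_def by (rule maximal_discrete) (use c \<rho>0 in \<open>auto simp: a_def\<close>)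
      finally show ?thesis by (simp add: Lsum_def a_def)
    qed
    have "Av (b ^ ((R + M) * p)) (\<lambda>t. c * (\<Sum>i<R. X (t / real b ^ (i * p)))) \<le> Av (b ^ ((R + M) * p)) (Lsum \<rho> p (R + M))"
      by (intro Av_mono bbd_mult bbd_const bbd_sum bbd_scale bX bbd_Lsum b\<rho> pt)
    also have "\<dots> = real (R + M) * R0" unfolding R0_def by (rule Av_Lsum[OF b\<rho> p\<rho>])
    also have "Av (b ^ ((R + M) * p)) (\<lambda>t. c * (\<Sum>i<R. X (t / real b ^ (i * p)))) = c * (\<Sum>i<R. Av (b ^ ((R + M) * p)) (\<lambda>t. X (t / real b ^ (i * p))))"
      unfolding Av_cmult by (subst Av_sum) (auto intro: bbd_scale bX)
    also have "(\<Sum>i<R. Av (b ^ ((R + M) * p)) (\<lambda>t. X (t / real b ^ (i * p)))) = (\<Sum>i<R. A)"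
    proof (intro sum.cong refl)
      fix i assume i: "i \<in> {..<R}"
      have e: "(R + M) * p = i * p + (M * p + (R - i) * p)" using i by (simp add: add_mult_distrib[symmetric])
      have "Av (b ^ ((R + M) * p)) (\<lambda>t. X (t / real b ^ (i * p))) = Av (b ^ (i * p) * (b ^ (M * p) * b ^ ((R - i) * p))) (\<lambda>t. X (t / real (b ^ (i * p))))"
        unfolding e power_add of_nat_power ..
      also have "\<dots> = Av (b ^ (M * p) * b ^ ((R - i) * p)) X" by (rule Av_scale) (use bX in auto)
      also have "\<dots> = A" unfolding A_def by (rule Av_periodic) (use pX in auto)
      finally show "Av (b ^ ((R + M) * p)) (\<lambda>t. X (t / real b ^ (i * p))) = A" .
    qed
    finally show ?thesis by simp
  qed
  have "c * A \<le> R0"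
  proof (rule ccontr)
    assume "\<not> c * A \<le> R0"
    then have d: "c * A - R0 > 0" by simp
    obtain R :: nat where R: "real R * (c * A - R0) > real M * R0" using d ex_less_of_nat_mult by blast
    then show False using key[of R] by (simp add: algebra_simps)
  qed
  then have "A \<le> R0 / c" using c by (simp add: field_simps)
  then show ?thesis unfolding A_def X_def[abs_def] R0_def .
qed

text \<open>Local dimension needs all radii \<open>\<gamma> ^ (m * p)\<close> at once on one large
  set. Markov's inequality scale by scale would lose a fixed proportion each time; the maximal
  inequality controls the cost at all depths \<open>m \<le> M\<close> outside a single set of
  proportion \<open>\<delta>\<close>, with \<open>p\<close> and \<open>Q\<close> independent of
  \<open>M\<close>.\<close>

lemma good_sets:
  assumes F: "\<And>C. C > 0 \<Longrightarrow> Full 1 C" and \<eta>: "\<eta> > 0" and \<delta>: "\<delta> > 0"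
  shows "\<exists>p Q. p > 0 \<and> 0 \<le> Q \<and> (\<forall>M. \<exists>G\<in>sets borel. Av (b ^ (M * p)) (\<lambda>t. of_bool (t \<notin> G)) \<le> \<delta> \<and>
     (\<forall>m\<in>{1..M}. PA (b ^ (M * p)) (\<lambda>t t'. of_bool (t \<in> G \<and> t' \<in> G \<and> \<bar>HH 0 (M * p) t - HH 0 (M * p) t'\<bar> \<le> \<gamma> ^ (m * p)))
         \<le> (Q * real m + 1) * (max \<gamma> (1 / real b) * exp \<eta>) ^ (m * p)))"
proof -
  \<comment> \<open>The surplus \<open>2 * Cb 0\<close> pays for the terms between depth
    \<open>m * p\<close> and the full depth \<open>M * p\<close>.\<close>
  define C where "C = 1 + 2 * Cb 0"
  have C: "C > 0" using Cb_nonneg[of 0] by (simp add: C_def)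
  define \<eta>2 where "\<eta>2 = \<eta> / 4"
  \<comment> \<open>Two budgets: the exponents satisfy
    \<open>2 * \<eta>2 + \<eta>1 \<le> \<eta>\<close>, and
    \<open>\<eta>1 / \<eta>2 \<le> \<delta>\<close> bounds the exceptional set.\<close>
  define \<eta>1 where "\<eta>1 = min (\<eta> / 2) (\<delta> * \<eta>2)"
  have e: "\<eta>2 > 0" "\<eta>1 > 0" "\<eta>1 \<le> \<eta> / 2" "\<eta>1 \<le> \<delta> * \<eta>2" using \<eta> \<delta> by (auto simp: \<eta>1_def \<eta>2_def)
  have F': "Full (Suc 0) C" if "C > 0" for C using F[OF that] by simp
  obtain p \<rho> Q where p: "p > 0" and b\<rho>: "bbd \<rho>" and \<rho>0: "\<And>t. 0 \<le> \<rho> t" and p\<rho>: "\<And>t. \<rho> (t + real b ^ p) = \<rho> t"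
    and av: "Av (b ^ p) \<rho> \<le> \<eta>1 * real p" and Q: "0 \<le> Q"
    and Wm: "\<And>m. PA (b ^ (m * p)) (\<lambda>t t'. exp (- Lsum \<rho> p m t) * exp (- Lsum \<rho> p m t') * of_bool (Close 0 C (m * p) t t'))
        \<le> (Q * real m + 1) * (max (lam 0) (1 / real b) * exp \<eta>1) ^ (m * p)"
    using Full_weights[OF F' C e(2)] by blast
  have [measurable]: "Lsum \<rho> p m \<in> borel_measurable borel" for m by (intro bbd_measurable bbd_Lsum b\<rho>)
  define c where "c = \<eta>2 * real p"
  have c0: "c > 0" using e p by (simp add: c_def)
  define GG where "GG M = {t. \<not> (\<exists>m\<in>{1..M}. Lsum \<rho> p m t > c * real m)}" for M
  have GGm [measurable]: "GG M \<in> sets borel" for M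
  proof -
    have "Measurable.pred borel (\<lambda>t. \<exists>m\<in>{1..M}. Lsum \<rho> p m t > c * real m)"
      by (intro pred_intros_finite) auto
    then have "Measurable.pred borel (\<lambda>t. \<not> (\<exists>m\<in>{1..M}. Lsum \<rho> p m t > c * real m))" by (rule pred_intros_logic)
    then show ?thesis by (simp add: pred_def GG_def)
  qed
  have "\<exists>G\<in>sets borel. Av (b ^ (M * p)) (\<lambda>t. of_bool (t \<notin> G)) \<le> \<delta> \<and>
     (\<forall>m\<in>{1..M}. PA (b ^ (M * p)) (\<lambda>t t'. of_bool (t \<in> G \<and> t' \<in> G \<and> \<bar>HH 0 (M * p) t - HH 0 (M * p) t'\<bar> \<le> \<gamma> ^ (m * p)))
         \<le> (Q * real m + 1) * (max \<gamma> (1 / real b) * exp \<eta>) ^ (m * p))" for M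
  proof (intro bexI[where x="GG M"] conjI ballI GGm)
    have "Av (b ^ (M * p)) (\<lambda>t. of_bool (t \<notin> GG M)) = Av (b ^ (M * p)) (\<lambda>t. of_bool (\<exists>m\<in>{1..M}. Lsum \<rho> p m t > c * real m))"
      by (simp add: GG_def)
    also have "\<dots> \<le> Av (b ^ p) \<rho> / c" by (rule Av_maximal[OF b\<rho> \<rho>0 p\<rho> c0])
    also have "\<dots> \<le> \<eta>1 * real p / c" using av c0 by (intro divide_right_mono) auto
    also have "\<dots> = \<eta>1 / \<eta>2" using p by (simp add: c_def)
    also have "\<dots> \<le> \<delta>" using e by (simp add: field_simps)
    finally show "Av (b ^ (M * p)) (\<lambda>t. of_bool (t \<notin> GG M)) \<le> \<delta>" .
    fix m assume m: "m \<in> {1..M}"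
    define \<Phi> where "\<Phi> t t' = (of_bool (Lsum \<rho> p m t \<le> c * real m \<and> Lsum \<rho> p m t' \<le> c * real m \<and> Close 0 C (m * p) t t') :: real)" for t t'
    have Mm: "M * p = m * p + (M - m) * p" using m by (simp add: add_mult_distrib[symmetric])
    have "PA (b ^ (M * p)) (\<lambda>t t'. of_bool (t \<in> GG M \<and> t' \<in> GG M \<and> \<bar>HH 0 (M * p) t - HH 0 (M * p) t'\<bar> \<le> \<gamma> ^ (m * p))) \<le> PA (b ^ (M * p)) \<Phi>"
    proof (rule PA_mono)
      show "bbd (\<lambda>x. of_bool (x + real k \<in> GG M \<and> x + real k' \<in> GG M \<and> \<bar>HH 0 (M * p) (x + real k) - HH 0 (M * p) (x + real k')\<bar> \<le> \<gamma> ^ (m * p)))" for k k'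
        by (intro bbd_of_bool) measurable
      show "bbd (\<lambda>x. \<Phi> (x + real k) (x + real k'))" for k k'
        unfolding \<Phi>_def by (intro bbd_of_bool) measurable
      fix t t'
      show "of_bool (t \<in> GG M \<and> t' \<in> GG M \<and> \<bar>HH 0 (M * p) t - HH 0 (M * p) t'\<bar> \<le> \<gamma> ^ (m * p)) \<le> \<Phi> t t'"
      proof (cases "t \<in> GG M \<and> t' \<in> GG M \<and> \<bar>HH 0 (M * p) t - HH 0 (M * p) t'\<bar> \<le> \<gamma> ^ (m * p)")
        case True
        have l: "lam 0 = \<gamma>" by (simp add: lam_def)
        have "\<bar>\<gamma> ^ (m * p) * HH 0 ((M - m) * p) s\<bar> \<le> \<gamma> ^ (m * p) * Cb 0" for s
          unfolding abs_mult using HH_bound[of 0 "(M - m) * p" s] \<gamma>0 by (intro mult_mono) auto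
        from this[of "t / real b ^ (m * p)"] this[of "t' / real b ^ (m * p)"] True
        have "\<bar>HH 0 (m * p) t - HH 0 (m * p) t'\<bar> \<le> \<gamma> ^ (m * p) + 2 * (\<gamma> ^ (m * p) * Cb 0)"
          unfolding Mm HH_add l by linarith
        also have "\<dots> = C * \<gamma> ^ (m * p)" by (simp add: C_def algebra_simps)
        finally have "Close 0 C (m * p) t t'" by (simp add: Close_def l)
        moreover have "Lsum \<rho> p m t \<le> c * real m" "Lsum \<rho> p m t' \<le> c * real m"
          using True m unfolding GG_def by (auto simp: not_less)
        ultimately show ?thesis by (simp add: \<Phi>_def)
      next
        case False
        have "0 \<le> \<Phi> t t'" by (simp add: \<Phi>_def)
        then show ?thesis using False by (simp only: of_bool_eq)
      qed
    qed
    also have "PA (b ^ (M * p)) \<Phi> = PA (b ^ (m * p)) \<Phi>"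
    proof -
      have "Lsum \<rho> p m (t + real (b ^ (m * p))) = Lsum \<rho> p m t" for t using Lsum_per[of \<rho> p m t] p\<rho> by simp
      then show ?thesis unfolding Mm power_add
        by (intro PA_periodic) (simp_all add: \<Phi>_def Close_def HH_per)
    qed
    also have "\<dots> \<le> exp (2 * (c * real m)) * ((Q * real m + 1) * (max (lam 0) (1 / real b) * exp \<eta>1) ^ (m * p))"
      unfolding \<Phi>_def by (rule pair_count_good[OF b\<rho> Wm])
    also have "\<dots> = (Q * real m + 1) * (max \<gamma> (1 / real b) ^ (m * p) * (exp (2 * (c * real m)) * exp (real (m * p) * \<eta>1)))"
      by (simp only: power_mult_distrib exp_of_nat_mult[symmetric] lam_def power_0 div_by_1 mult_ac)
    also have "exp (2 * (c * real m)) * exp (real (m * p) * \<eta>1) = exp (real (m * p) * (2 * \<eta>2 + \<eta>1))"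
      by (simp add: exp_add[symmetric] c_def algebra_simps)
    finally have "PA (b ^ (M * p)) (\<lambda>t t'. of_bool (t \<in> GG M \<and> t' \<in> GG M \<and> \<bar>HH 0 (M * p) t - HH 0 (M * p) t'\<bar> \<le> \<gamma> ^ (m * p)))
       \<le> (Q * real m + 1) * (max \<gamma> (1 / real b) ^ (m * p) * exp (real (m * p) * (2 * \<eta>2 + \<eta>1)))" .
    also have "\<dots> \<le> (Q * real m + 1) * (max \<gamma> (1 / real b) ^ (m * p) * exp (real (m * p) * \<eta>))"
    proof -
      have "2 * \<eta>2 + \<eta>1 \<le> \<eta>" using e by (simp add: \<eta>2_def)
      then have "exp (real (m * p) * (2 * \<eta>2 + \<eta>1)) \<le> exp (real (m * p) * \<eta>)"
        unfolding exp_le_cancel_iff by (intro mult_left_mono) auto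
      then show ?thesis using Q \<gamma>0 by (intro mult_left_mono) (auto simp: le_max_iff_disj)
    qed
    finally have "PA (b ^ (M * p)) (\<lambda>t t'. of_bool (t \<in> GG M \<and> t' \<in> GG M \<and> \<bar>HH 0 (M * p) t - HH 0 (M * p) t'\<bar> \<le> \<gamma> ^ (m * p)))
       \<le> (Q * real m + 1) * (max \<gamma> (1 / real b) ^ (m * p) * exp (real (m * p) * \<eta>))" .
    then show "PA (b ^ (M * p)) (\<lambda>t t'. of_bool (t \<in> GG M \<and> t' \<in> GG M \<and> \<bar>HH 0 (M * p) t - HH 0 (M * p) t'\<bar> \<le> \<gamma> ^ (m * p)))
       \<le> (Q * real m + 1) * (max \<gamma> (1 / real b) * exp \<eta>) ^ (m * p)"
      by (simp only: power_mult_distrib exp_of_nat_mult)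
  qed
  then show ?thesis using p Q by blast
qed

end

section \<open>The SRB measure as a limit of lifted curves\<close>

lemma frac_measurable [measurable]: "(frac :: real \<Rightarrow> real) \<in> borel_measurable borel"
  unfolding frac_def[abs_def] by measurable

lemma fst_snd_borel [measurable]:
  "(fst :: real \<times> real \<Rightarrow> real) \<in> borel_measurable borel" "(snd :: real \<times> real \<Rightarrow> real) \<in> borel_measurable borel"
  by (intro borel_measurable_continuous_onI continuous_intros)+

lemma frac_add_nat: "frac (t + real k) = frac t"
  by (simp add: frac_def)

lemma integral_unit_square:
  fixes g :: "real \<Rightarrow> real"
  assumes g: "bbd g"
  shows "(\<integral>z. indicator ({0..<1} \<times> {0..<1}) z * g (fst z) \<partial>(lborel :: (real \<times> real) measure)) = integral\<^sup>L U01 g"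
proof -
  obtain B where B: "\<bar>g x\<bar> \<le> B" for x using g unfolding bbd_def by blast
  have [measurable]: "g \<in> borel_measurable borel" using g by (rule bbd_measurable)
  let ?S = "{0..<1} \<times> {0..<1} :: (real \<times> real) set"
  have S: "?S \<in> sets borel" by (intro borel_Times) auto
  have [measurable]: "?S \<in> sets (lborel :: (real \<times> real) measure)" using S by simp
  have eS: "emeasure (lborel :: (real \<times> real) measure) ?S = 1"
    unfolding lborel_prod[symmetric] by (subst lborel.emeasure_pair_measure_Times) auto
  have int: "integrable (lborel \<Otimes>\<^sub>M lborel) (\<lambda>z. indicator ?S z * g (fst z))"
    unfolding lborel_prod
  proof (rule Bochner_Integration.integrable_bound[of _ "\<lambda>z. B * indicator ?S z"])
    show "integrable lborel (\<lambda>z. B * indicator ?S z)"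
      using eS S by (intro integrable_mult_right integrable_real_indicator) auto
    show "AE z in lborel. norm (indicator ?S z * g (fst z)) \<le> norm (B * indicator ?S z)"
      using B by (auto simp: indicator_def intro!: AE_I2 intro: order_trans[OF _ abs_ge_self])
    show "(\<lambda>z. indicator ?S z * g (fst z)) \<in> borel_measurable lborel"
      unfolding lborel_prod[symmetric] by measurable
  qed
  have "(\<integral>z. indicator ?S z * g (fst z) \<partial>(lborel :: (real \<times> real) measure)) = (\<integral>x. (\<integral>y. indicator ?S (x, y) * g (fst (x, y)) \<partial>lborel) \<partial>lborel)"
    using lborel_pair.integral_fst'[OF int] by (simp add: lborel_prod)
  also have "\<dots> = (\<integral>x. indicator {0..<1} x * g x \<partial>lborel)"
  proof (rule Bochner_Integration.integral_cong[OF refl])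
    fix x :: real
    have "(\<integral>y. indicator ?S (x, y) * g (fst (x, y)) \<partial>lborel) = (\<integral>y. (indicator {0..<1} x * g x) * indicator {0..<1} (y::real) \<partial>lborel)"
      by (intro Bochner_Integration.integral_cong refl) (auto simp: indicator_def)
    also have "\<dots> = (indicator {0..<1} x * g x) * (\<integral>y. indicator {0..<1} (y::real) \<partial>lborel)"
      by (rule integral_mult_right_zero)
    finally show "(\<integral>y. indicator ?S (x, y) * g (fst (x, y)) \<partial>lborel) = indicator {0..<1} x * g x" by simp
  qed
  also have "\<dots> = integral\<^sup>L U01 g" by (simp add: integral_U01)
  finally show ?thesis .
qed

context skew_family
begin

text \<open>The integer part of \<open>t = b ^ n * x\<close> records the digits of \<open>x\<close>
  consumed so far, and periodicity of \<open>f 0\<close> allows every term of the orbit sum to be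
  read off from \<open>t\<close>. This is the origin of \<open>HH\<close>.\<close>

lemma skewT_iterate:
  assumes "0 \<le> x" "x < 1"
  shows "(skewT b \<gamma> (f 0) ^^ n) (x, y) = (frac (real b ^ n * x), \<gamma> ^ n * y + HH 0 n (real b ^ n * x))"
proof (induction n)
  case 0
  then show ?case using assms by (simp add: frac_eq)
next
  case (Suc n)
  define t where "t = real b ^ n * x"
  have t0: "t \<ge> 0" using assms by (simp add: t_def)
  have t: "t = frac t + real (nat \<lfloor>t\<rfloor>)" using t0 by (simp add: frac_def)
  have f1: "f 0 (frac t) = f 0 t" using per_nat[of 0 "frac t" "nat \<lfloor>t\<rfloor>"] t by simp
  have f2: "frac (real b * frac t) = frac (real b * t)"
  proof -
    have "real b * t = real b * frac t + real (b * nat \<lfloor>t\<rfloor>)" by (subst t) (simp add: algebra_simps)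
    then show ?thesis using frac_add_nat[of "real b * frac t" "b * nat \<lfloor>t\<rfloor>"] by (simp only:)
  qed
  have H: "HH 0 (Suc n) (real b * t) = f 0 t + \<gamma> * HH 0 n t"
    using HH_add[of 0 1 n "real b * t"] by (simp add: HH_def lam_def)
  have "(skewT b \<gamma> (f 0) ^^ Suc n) (x, y) = skewT b \<gamma> (f 0) (frac t, \<gamma> ^ n * y + HH 0 n t)"
    using Suc by (simp add: t_def)
  also have "\<dots> = (frac (real b * t), \<gamma> ^ Suc n * y + HH 0 (Suc n) (real b * t))"
    by (simp add: skewT_def f1 f2 H distrib_left)
  finally show ?case by (simp add: t_def mult.assoc)
qed

text \<open>Push-forward of Lebesgue measure on the unit interval at height 0 under the
  \<open>q\<close>-th iterate, kept as a functional on test functions so that its limit can be taken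
  number by number.\<close>

definition mu :: "nat \<Rightarrow> (real \<times> real \<Rightarrow> real) \<Rightarrow> real" where
  "mu q F = Av (b ^ q) (\<lambda>t. F (frac t, HH 0 q t))"

lemma bbd_mu:
  assumes "F \<in> borel_measurable borel" "\<And>z. \<bar>F z\<bar> \<le> B"
  shows "bbd (\<lambda>t. F (frac t, HH 0 q t))"
proof (rule bbdI)
  have "(\<lambda>t. (frac t, HH 0 q t)) \<in> borel_measurable borel" by (intro borel_measurable_Pair) auto
  then show "(\<lambda>t. F (frac t, HH 0 q t)) \<in> borel_measurable borel" by (rule measurable_compose) (rule assms)
qed (rule assms)

lemma mu_mono:
  assumes "F \<in> borel_measurable borel" "\<And>z. \<bar>F z\<bar> \<le> B" "G \<in> borel_measurable borel" "\<And>z. \<bar>G z\<bar> \<le> B'"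
    and "\<And>z. F z \<le> G z"
  shows "mu q F \<le> mu q G"
  unfolding mu_def using assms by (intro Av_mono bbd_mu) auto

lemma HH_tail: "\<bar>HH 0 (q + q') t - HH 0 q t\<bar> \<le> \<gamma> ^ q * Cb 0"
proof -
  have "\<bar>lam 0 ^ q * HH 0 q' (t / real b ^ q)\<bar> \<le> lam 0 ^ q * Cb 0"
    unfolding abs_mult using HH_bound[of 0 q' "t / real b ^ q"] by (intro mult_mono) auto
  then show ?thesis unfolding HH_add by (simp add: lam_def)
qed

text \<open>Both averages may be taken over \<open>[0, b ^ (q + q'))\<close> because
  \<open>HH 0 q\<close> has period \<open>b ^ q\<close>; pointwise the heights then differ by at
  most \<open>\<gamma> ^ q * Cb 0\<close>.\<close>

lemma mu_Cauchy:
  assumes "F \<in> borel_measurable borel" "\<And>z. \<bar>F z\<bar> \<le> B" "\<And>z w. \<bar>F z - F w\<bar> \<le> L * dist z w" and L: "L \<ge> 0"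
  shows "\<bar>mu (q + q') F - mu q F\<bar> \<le> L * Cb 0 * \<gamma> ^ q"
proof -
  have 1: "mu q F = Av (b ^ (q + q')) (\<lambda>t. F (frac t, HH 0 q t))"
    unfolding mu_def power_add
  proof (rule Av_periodic[symmetric])
    show "F (frac (t + real (b ^ q)), HH 0 q (t + real (b ^ q))) = F (frac t, HH 0 q t)" for t
      using frac_add_nat[of t "b ^ q"] HH_per[of 0 q t] by simp
  qed auto
  have pt: "\<bar>F (frac t, HH 0 (q + q') t) - F (frac t, HH 0 q t)\<bar> \<le> L * Cb 0 * \<gamma> ^ q" for t
  proof -
    have "\<bar>F (frac t, HH 0 (q + q') t) - F (frac t, HH 0 q t)\<bar> \<le> L * dist (frac t, HH 0 (q + q') t) (frac t, HH 0 q t)"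
      by (rule assms)
    also have "dist (frac t, HH 0 (q + q') t) (frac t, HH 0 q t) = \<bar>HH 0 (q + q') t - HH 0 q t\<bar>"
      by (simp add: dist_Pair_Pair dist_real_def)
    also have "L * \<dots> \<le> L * (\<gamma> ^ q * Cb 0)" using HH_tail L by (intro mult_left_mono)
    finally show ?thesis by (simp add: mult_ac)
  qed
  have b1: "bbd (\<lambda>t. F (frac t, HH 0 (q + q') t))" "bbd (\<lambda>t. F (frac t, HH 0 q t))" using assms by (auto intro!: bbd_mu)
  have "mu (q + q') F \<le> Av (b ^ (q + q')) (\<lambda>t. F (frac t, HH 0 q t) + L * Cb 0 * \<gamma> ^ q)"
    unfolding mu_def
  proof (intro Av_mono bbd_add bbd_const b1)
    show "F (frac x, HH 0 (q + q') x) \<le> F (frac x, HH 0 q x) + L * Cb 0 * \<gamma> ^ q" for x using pt[of x] by linarith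
  qed
  also have "\<dots> = mu q F + L * Cb 0 * \<gamma> ^ q"
    unfolding 1 by (subst Av_add[OF b1(2) bbd_const]) (simp add: Av_const)
  finally have up: "mu (q + q') F \<le> mu q F + L * Cb 0 * \<gamma> ^ q" .
  have "mu q F \<le> Av (b ^ (q + q')) (\<lambda>t. F (frac t, HH 0 (q + q') t) + L * Cb 0 * \<gamma> ^ q)"
    unfolding 1
  proof (intro Av_mono bbd_add bbd_const b1)
    show "F (frac x, HH 0 q x) \<le> F (frac x, HH 0 (q + q') x) + L * Cb 0 * \<gamma> ^ q" for x using pt[of x] by linarith
  qed
  also have "\<dots> = mu (q + q') F + L * Cb 0 * \<gamma> ^ q"
    unfolding mu_def by (subst Av_add[OF b1(1) bbd_const]) (simp add: Av_const)
  finally show ?thesis using up by linarith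
qed

text \<open>The form in which the SRB property is used from here on: the laws of the lifted curves
  converge to \<open>\<omega>\<close> on bounded Lipschitz test functions.\<close>

definition SRBlim :: "(real \<times> real) measure \<Rightarrow> bool" where
  "SRBlim \<omega> \<longleftrightarrow> prob_space \<omega> \<and> sets \<omega> = sets borel \<and> emeasure \<omega> dom01 = 1 \<and>
    (\<forall>F B L. continuous_on UNIV F \<longrightarrow> (\<forall>z. \<bar>F z\<bar> \<le> B) \<longrightarrow> (\<forall>z w. \<bar>F z - F w\<bar> \<le> L * dist z w) \<longrightarrow> L \<ge> 0 \<longrightarrow>
       (\<lambda>q. mu q F) \<longlonglongrightarrow> integral\<^sup>L \<omega> F)"

text \<open>The empirical averages converge to \<open>\<omega>\<close> at Lebesgue almost every
  point of a unit square. Integrated over the square they become Cesaro means of \<open>J k\<close>,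
  and \<open>J k\<close> is exponentially close to \<open>mu k F\<close>; since
  \<open>mu k F\<close> converges by itself, its limit must be the Cesaro limit.\<close>

lemma SRB_imp_SRBlim:
  assumes S: "SRB_measure (skewT b \<gamma> (f 0)) \<omega>"
  shows "SRBlim \<omega>"
proof -
  have ps: "prob_space \<omega>" and so: "sets \<omega> = sets borel" and ed: "emeasure \<omega> dom01 = 1"
    and ae: "AE z in lborel. z \<in> dom01 \<longrightarrow> empirical_weak_conv (skewT b \<gamma> (f 0)) z \<omega>"
    using S by (auto simp: SRB_measure_def borel_prob_on_dom_def)
  interpret \<omega>: prob_space \<omega> by (rule ps)
  have dm: "dom01 \<in> sets borel" unfolding dom01_def by (intro borel_Times) auto
  have aed: "AE z in \<omega>. z \<in> dom01"
    using ed dm so \<omega>.AE_in_set_eq_1[of dom01] by (simp add: \<omega>.emeasure_eq_measure)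
  have "(\<lambda>q. mu q F) \<longlonglongrightarrow> integral\<^sup>L \<omega> F"
    if cF: "continuous_on UNIV F" and B: "\<And>z. \<bar>F z\<bar> \<le> B" and L: "\<And>z w. \<bar>F z - F w\<bar> \<le> L * dist z w" and L0: "L \<ge> 0" for F B L
  proof -
    let ?T = "skewT b \<gamma> (f 0)"
    have Fm [measurable]: "F \<in> borel_measurable borel" by (intro borel_measurable_continuous_onI cF)
    have B0: "B \<ge> 0" using B[of 0] by linarith
    let ?S = "{0..<1} \<times> {0..<1} :: (real \<times> real) set"
    have Sm: "?S \<in> sets borel" by (intro borel_Times) auto
    have eS: "emeasure (lborel :: (real \<times> real) measure) ?S = 1"
      unfolding lborel_prod[symmetric] by (subst lborel.emeasure_pair_measure_Times) auto
    have intS: "integrable (lborel :: (real \<times> real) measure) (\<lambda>z. c * indicator ?S z)" for c :: real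
      using eS Sm by (intro integrable_mult_right integrable_real_indicator) auto
    define g where "g k x = F (frac (real b ^ k * x), HH 0 k (real b ^ k * x))" for k x
    have gm: "g k \<in> borel_measurable borel" for k
    proof -
      have "(\<lambda>x. (frac (real b ^ k * x), HH 0 k (real b ^ k * x))) \<in> borel_measurable borel"
        by (intro borel_measurable_Pair) measurable
      then show ?thesis unfolding g_def[abs_def] by (rule measurable_compose) (rule Fm)
    qed
    have gb: "bbd (g k)" for k by (rule bbdI[where B=B, OF gm]) (simp add: g_def B)
    have gmu: "integral\<^sup>L U01 (g k) = mu k F" for k
    proof -
      have "mu k F = Av (b ^ k * 1) (\<lambda>t. g k (t / real (b ^ k)))" by (simp add: mu_def g_def)
      also have "\<dots> = Av 1 (g k)" by (rule Av_scale[OF gb]) simp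
      finally show ?thesis by (simp add: Av_def)
    qed
    define G where "G k z = indicator ?S z * F (frac (real b ^ k * fst z), \<gamma> ^ k * snd z + HH 0 k (real b ^ k * fst z))" for k z
    have Gm: "G k \<in> borel_measurable borel" for k
    proof -
      have "(\<lambda>z::real\<times>real. (frac (real b ^ k * fst z), \<gamma> ^ k * snd z + HH 0 k (real b ^ k * fst z))) \<in> borel_measurable borel"
        by (intro borel_measurable_Pair) (auto intro!: borel_measurable_add borel_measurable_times measurable_compose[OF _ frac_measurable] measurable_compose[OF _ HH_measurable] fst_snd_borel)
      then have "(\<lambda>z::real\<times>real. F (frac (real b ^ k * fst z), \<gamma> ^ k * snd z + HH 0 k (real b ^ k * fst z))) \<in> borel_measurable borel"
        by (rule measurable_compose) (rule Fm)
      then show ?thesis unfolding G_def[abs_def] using Sm by (intro borel_measurable_times borel_measurable_indicator) auto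
    qed
    have GB: "\<bar>G k z\<bar> \<le> B * indicator ?S z" for k z using B B0 by (auto simp: G_def indicator_def)
    have Gint: "integrable lborel (G k)" for k
      by (rule Bochner_Integration.integrable_bound[OF intS[of B]]) (use Gm GB B0 in \<open>auto simp: abs_mult\<close>)
    define J where "J k = integral\<^sup>L lborel (G k)" for k
    \<comment> \<open>The initial height in \<open>[0, 1)\<close> is forgotten at rate
      \<open>\<gamma> ^ k\<close>.\<close>
    have Jmu: "\<bar>J k - mu k F\<bar> \<le> L * \<gamma> ^ k" for k
    proof -
      have m2: "(\<lambda>z::real\<times>real. indicator ?S z * g k (fst z)) \<in> borel_measurable borel"
        using Sm by (intro borel_measurable_times borel_measurable_indicator measurable_compose[OF _ gm] fst_snd_borel) auto
      have i2: "integrable lborel (\<lambda>z::real\<times>real. indicator ?S z * g k (fst z))"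
        by (rule Bochner_Integration.integrable_bound[OF intS[of B]]) (use m2 B B0 in \<open>auto simp: abs_mult g_def indicator_def\<close>)
      have "J k - mu k F = (\<integral>z. G k z - indicator ?S z * g k (fst z) \<partial>lborel)"
        unfolding J_def gmu[symmetric] integral_unit_square[OF gb, symmetric]
        by (rule Bochner_Integration.integral_diff[symmetric]) (rule Gint, rule i2)
      also have "\<bar>\<dots>\<bar> \<le> (\<integral>z. \<bar>G k z - indicator ?S z * g k (fst z)\<bar> \<partial>lborel)"
        by (rule integral_abs_bound)
      also have "\<dots> \<le> (\<integral>z. (L * \<gamma> ^ k) * indicator ?S z \<partial>lborel)"
      proof (rule integral_mono)
        show "integrable lborel (\<lambda>z. \<bar>G k z - indicator ?S z * g k (fst z)\<bar>)"
          by (intro integrable_abs Bochner_Integration.integrable_diff Gint i2)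
        fix z :: "real \<times> real"
        show "\<bar>G k z - indicator ?S z * g k (fst z)\<bar> \<le> (L * \<gamma> ^ k) * indicator ?S z"
        proof (cases "z \<in> ?S")
          case True
          let ?t = "real b ^ k * fst z"
          have "\<bar>F (frac ?t, \<gamma> ^ k * snd z + HH 0 k ?t) - F (frac ?t, HH 0 k ?t)\<bar>
             \<le> L * dist (frac ?t, \<gamma> ^ k * snd z + HH 0 k ?t) (frac ?t, HH 0 k ?t)" by (rule L)
          also have "dist (frac ?t, \<gamma> ^ k * snd z + HH 0 k ?t) (frac ?t, HH 0 k ?t) = \<bar>\<gamma> ^ k * snd z\<bar>"
            by (simp add: dist_Pair_Pair dist_real_def)
          also have "\<bar>\<gamma> ^ k * snd z\<bar> \<le> \<gamma> ^ k" using True \<gamma>0 by (auto simp: abs_mult mult_le_cancel_left1)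
          finally show ?thesis using True L0 by (simp add: G_def g_def mult_left_mono)
        qed (simp add: G_def)
      qed (rule intS)
      also have "\<dots> = L * \<gamma> ^ k" using eS by (simp add: measure_def)
      finally show ?thesis .
    qed
    have conv: "(\<lambda>n. (\<Sum>k<n. J k) / real n) \<longlonglongrightarrow> integral\<^sup>L \<omega> F"
    proof -
      have "(\<lambda>n. \<integral>z. (\<Sum>k<n. G k z) / real n \<partial>lborel) \<longlonglongrightarrow> (\<integral>z. indicator ?S z * integral\<^sup>L \<omega> F \<partial>lborel)"
      proof (rule integral_dominated_convergence[where w="\<lambda>z. B * indicator ?S z"])
        show "AE z in lborel. (\<lambda>n. (\<Sum>k<n. G k z) / real n) \<longlonglongrightarrow> indicator ?S z * integral\<^sup>L \<omega> F"
          using ae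
        proof eventually_elim
          case (elim z)
          show ?case
          proof (cases "z \<in> ?S")
            case True
            obtain x y where z: "z = (x, y)" by (cases z)
            have x: "0 \<le> x" "x < 1" using True z by auto
            have "empirical_weak_conv ?T z \<omega>" using elim True by (auto simp: dom01_def)
            moreover have "continuous_on dom01 F" using cF by (rule continuous_on_subset) simp
            moreover have "bounded (F ` dom01)" using B by (intro boundedI[of _ B]) auto
            ultimately have "(\<lambda>n. (\<Sum>k<n. F ((?T ^^ k) z)) / real n) \<longlonglongrightarrow> (\<integral>x. indicator dom01 x * F x \<partial>\<omega>)"
              unfolding empirical_weak_conv_def by blast
            also have "(\<integral>x. indicator dom01 x * F x \<partial>\<omega>) = integral\<^sup>L \<omega> F"
            proof (rule integral_cong_AE)
              show "(\<lambda>x. indicator dom01 x * F x) \<in> borel_measurable \<omega>"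
                using dm so by (intro borel_measurable_times borel_measurable_indicator) (auto simp: measurable_cong_sets[OF so refl])
              show "F \<in> borel_measurable \<omega>" using Fm by (simp add: measurable_cong_sets[OF so refl])
              show "AE x in \<omega>. indicator dom01 x * F x = F x" using aed by eventually_elim simp
            qed
            also have "(\<lambda>n. (\<Sum>k<n. F ((?T ^^ k) z)) / real n) = (\<lambda>n. (\<Sum>k<n. G k z) / real n)"
              unfolding z skewT_iterate[OF x] G_def using True z by simp
            finally show ?thesis using True by simp
          qed (simp add: G_def)
        qed
        show "AE z in lborel. norm ((\<Sum>k<n. G k z) / real n) \<le> B * indicator ?S z" for n
        proof (rule AE_I2)
          fix z :: "real \<times> real"
          have "\<bar>\<Sum>k<n. G k z\<bar> \<le> (\<Sum>k<n. B * indicator ?S z)"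
            by (rule order_trans[OF sum_abs sum_mono]) (rule GB)
          also have "\<dots> = real n * (B * indicator ?S z)" by simp
          finally show "norm ((\<Sum>k<n. G k z) / real n) \<le> B * indicator ?S z"
            using B0 by (cases "n = 0") (auto simp: field_simps)
        qed
        show "(\<lambda>z. (\<Sum>k<n. G k z) / real n) \<in> borel_measurable lborel" for n
          using Gm by (intro borel_measurable_divide borel_measurable_sum) auto
        show "(\<lambda>z. indicator ?S z * integral\<^sup>L \<omega> F) \<in> borel_measurable lborel"
          using Sm by (intro borel_measurable_times borel_measurable_indicator) auto
      qed (rule intS)
      moreover have "(\<integral>z. (\<Sum>k<n. G k z) / real n \<partial>lborel) = (\<Sum>k<n. J k) / real n" for n
        unfolding J_def using Gint by (simp add: Bochner_Integration.integral_sum)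
      moreover have "(\<integral>z. indicator ?S z * integral\<^sup>L \<omega> F \<partial>lborel) = integral\<^sup>L \<omega> F"
        using eS by (simp add: measure_def)
      ultimately show ?thesis by (simp only:)
    qed
    have Cau: "Cauchy (\<lambda>q. mu q F)"
    proof (rule metric_CauchyI)
      fix e :: real assume e: "e > 0"
      have "(\<lambda>q. L * Cb 0 * \<gamma> ^ q) \<longlonglongrightarrow> L * Cb 0 * 0" using \<gamma>0 \<gamma>1 by (intro tendsto_intros LIMSEQ_power_zero) auto
      then have "eventually (\<lambda>q. L * Cb 0 * \<gamma> ^ q < e / 2) sequentially" using e by (auto dest!: order_tendstoD(2)[where a="e/2"])
      then obtain M where M: "L * Cb 0 * \<gamma> ^ M < e / 2" by (auto simp: eventually_sequentially)
      have "\<bar>mu m F - mu M F\<bar> < e / 2" if "m \<ge> M" for m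
        using mu_Cauchy[OF Fm B L L0, of M "m - M"] that M by simp
      then have "dist (mu m F) (mu n F) < e" if "m \<ge> M" "n \<ge> M" for m n
        using that by (smt (verit, best) dist_real_def field_sum_of_halves)
      then show "\<exists>M. \<forall>m\<ge>M. \<forall>n\<ge>M. dist (mu m F) (mu n F) < e" by blast
    qed
    then obtain l where l: "(\<lambda>q. mu q F) \<longlonglongrightarrow> l" using Cauchy_convergent convergent_def by blast
    have ml: "\<bar>mu q F - l\<bar> \<le> L * Cb 0 * \<gamma> ^ q" for q
    proof -
      have "(\<lambda>q'. \<bar>mu (q' + q) F - mu q F\<bar>) \<longlonglongrightarrow> \<bar>l - mu q F\<bar>"
        using LIMSEQ_ignore_initial_segment[OF l, of q] by (intro tendsto_intros)
      then have "\<bar>l - mu q F\<bar> \<le> L * Cb 0 * \<gamma> ^ q"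
        by (rule LIMSEQ_le_const2) (use mu_Cauchy[OF Fm B L L0, of q] in \<open>auto simp: add.commute\<close>)
      then show ?thesis by (simp add: abs_minus_commute)
    qed
    have Jl: "\<bar>J k - l\<bar> \<le> (L + L * Cb 0) * \<gamma> ^ k" for k
      using Jmu[of k] ml[of k] by (simp add: algebra_simps)
    \<comment> \<open>Bound for the total error in the Cesaro sum: a geometric series, which
      division by \<open>n\<close> sends to 0.\<close>
    define K where "K = (L + L * Cb 0) / (1 - \<gamma>)"
    have "(\<lambda>n. (\<Sum>k<n. J k) / real n - l) \<longlonglongrightarrow> 0"
    proof (rule Lim_null_comparison)
      show "(\<lambda>n. K / real n) \<longlonglongrightarrow> 0" by (rule lim_const_over_n)
      show "\<forall>\<^sub>F n in sequentially. norm ((\<Sum>k<n. J k) / real n - l) \<le> K / real n"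
      proof (rule eventually_sequentiallyI[of 1])
        fix n :: nat assume n: "n \<ge> 1"
        have "(\<Sum>k<n. J k) / real n - l = (\<Sum>k<n. J k - l) / real n"
          using n by (simp add: sum_subtractf field_simps)
        then have "norm ((\<Sum>k<n. J k) / real n - l) = \<bar>\<Sum>k<n. J k - l\<bar> / real n" using n by simp
        also have "\<dots> \<le> (\<Sum>k<n. (L + L * Cb 0) * \<gamma> ^ k) / real n"
          by (intro divide_right_mono order_trans[OF sum_abs sum_mono] Jl) auto
        also have "(\<Sum>k<n. (L + L * Cb 0) * \<gamma> ^ k) = (L + L * Cb 0) * ((1 - \<gamma> ^ n) / (1 - \<gamma>))"
          using \<gamma>1 by (simp add: sum_distrib_left[symmetric] sum_gp_strict)
        also have "\<dots> \<le> (L + L * Cb 0) * (1 / (1 - \<gamma>))"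
          using L0 Cb_nonneg[of 0] \<gamma>0 \<gamma>1 by (intro mult_left_mono divide_right_mono) auto
        finally show "norm ((\<Sum>k<n. J k) / real n - l) \<le> K / real n" by (simp add: K_def divide_right_mono)
      qed
    qed
    then have "(\<lambda>n. (\<Sum>k<n. J k) / real n) \<longlonglongrightarrow> l" by (simp add: LIM_zero_iff)
    then have "integral\<^sup>L \<omega> F = l" using conv LIMSEQ_unique by blast
    then show ?thesis using l by simp
  qed
  then show ?thesis unfolding SRBlim_def using ps so ed by blast
qed

text \<open>Portmanteau inequality for open sets, obtained from the Lipschitz functions
  \<open>min 1 (n * infdist z (- V))\<close>, which increase to the indicator of \<open>V\<close>.
  Mass of \<open>\<omega>\<close> on open sets is thereby seen by the curves of finite
  depth.\<close>

lemma SRBlim_open: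
  assumes S: "SRBlim \<omega>" and V: "open V" and a: "a < measure \<omega> V"
  shows "eventually (\<lambda>q. a < mu q (indicator V)) sequentially"
proof -
  have ps: "prob_space \<omega>" and so: "sets \<omega> = sets borel" using S by (auto simp: SRBlim_def)
  interpret \<omega>: prob_space \<omega> by (rule ps)
  have Vm: "V \<in> sets borel" using V by simp
  show ?thesis
  \<comment> \<open>\<open>infdist\<close> to the empty set is 0 by convention, so the whole plane
    needs its own case.\<close>
  proof (cases "V = UNIV")
    case True
    have "mu q (indicator V) = 1" for q unfolding True mu_def by (simp add: Av_const)
    moreover have "a < 1" using a \<omega>.prob_le_1[of V] by linarith
    ultimately show ?thesis by simp
  next
    case False
    define F where "F n z = min 1 (real n * infdist z (- V))" for n z
    have ne: "- V \<noteq> {}" using False by auto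
    have cl: "closed (- V)" using V by auto
    have F01: "0 \<le> F n z" "F n z \<le> 1" for n z by (auto simp: F_def infdist_nonneg)
    have cF: "continuous_on UNIV (F n)" for n unfolding F_def[abs_def] by (intro continuous_intros)
    have LF: "\<bar>F n z - F n w\<bar> \<le> real n * dist z w" for n z w
    proof -
      have "\<bar>infdist z (- V) - infdist w (- V)\<bar> \<le> dist z w"
        using infdist_triangle[of z "-V" w] infdist_triangle[of w "-V" z] by (simp add: dist_commute)
      then have "\<bar>real n * infdist z (- V) - real n * infdist w (- V)\<bar> \<le> real n * dist z w"
        by (simp add: right_diff_distrib[symmetric] abs_mult mult_left_mono)
      then show ?thesis unfolding F_def by linarith
    qed
    have FV: "F n z \<le> indicator V z" for n z
      using F01(2)[of n z] ne cl by (cases "z \<in> V") (auto simp: F_def indicator_def)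
    have "(\<lambda>n. integral\<^sup>L \<omega> (F n)) \<longlonglongrightarrow> integral\<^sup>L \<omega> (indicator V)"
    proof (rule integral_dominated_convergence[where w="\<lambda>_. 1"])
      show "AE z in \<omega>. (\<lambda>n. F n z) \<longlonglongrightarrow> indicator V z"
      proof (rule AE_I2)
        fix z
        show "(\<lambda>n. F n z) \<longlonglongrightarrow> indicator V z"
        proof (cases "z \<in> V")
          case True
          then have d: "infdist z (- V) > 0" using ne cl by (simp add: infdist_pos_not_in_closed)
          obtain n0 :: nat where n0: "real n0 * infdist z (- V) > 1" using d ex_less_of_nat_mult by blast
          have "F n z = 1" if "n \<ge> n0" for n
          proof -
            have "real n0 * infdist z (- V) \<le> real n * infdist z (- V)" using that d by (intro mult_right_mono) auto
            then show ?thesis using n0 by (simp add: F_def)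
          qed
          then have "eventually (\<lambda>n. F n z = 1) sequentially" by (auto simp: eventually_sequentially)
          then show ?thesis using True by (simp add: tendsto_eventually)
        qed (simp add: F_def)
      qed
      show "AE z in \<omega>. norm (F n z) \<le> 1" for n using F01[of n] by (intro AE_I2) auto
      show "F n \<in> borel_measurable \<omega>" for n
        using borel_measurable_continuous_onI[OF cF] by (simp add: measurable_cong_sets[OF so refl])
      show "indicator V \<in> borel_measurable \<omega>" using Vm so by (intro borel_measurable_indicator) auto
    qed simp
    also have "integral\<^sup>L \<omega> (indicator V) = measure \<omega> V" using Vm so by simp
    finally have "eventually (\<lambda>n. a < integral\<^sup>L \<omega> (F n)) sequentially" using a by (auto dest: order_tendstoD)
    then obtain n where n: "a < integral\<^sup>L \<omega> (F n)" by (auto simp: eventually_sequentially)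
    have F1: "\<forall>z. \<bar>F n z\<bar> \<le> 1" using F01[of n] by auto
    have "(\<lambda>q. mu q (F n)) \<longlonglongrightarrow> integral\<^sup>L \<omega> (F n)"
      using S cF[of n] F1 LF[of n] unfolding SRBlim_def by (metis of_nat_0_le_iff)
    then have "eventually (\<lambda>q. a < mu q (F n)) sequentially" using n by (auto dest: order_tendstoD)
    then show ?thesis
    proof eventually_elim
      case (elim q)
      have "mu q (F n) \<le> mu q (indicator V)"
        by (rule mu_mono[where B=1 and B'=1])
           (use borel_measurable_continuous_onI[OF cF] F1 FV Vm in auto)
      then show ?case using elim by linarith
    qed
  qed
qed

end

section \<open>Local dimension and Hausdorff dimension\<close>

lemma scale_between:
  fixes g r \<rho> :: real
  assumes g: "0 < g" "g < 1" and r: "0 < r" "r < \<rho>"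
  obtains n where "n \<ge> 1" "\<rho> * g ^ n \<le> r" "r < \<rho> * g ^ (n - 1)"
proof -
  have "(\<lambda>n. \<rho> * g ^ n) \<longlonglongrightarrow> \<rho> * 0" using g by (intro tendsto_intros LIMSEQ_power_zero) auto
  then have "eventually (\<lambda>n. \<rho> * g ^ n < r) sequentially" by (rule order_tendstoD) (use r in simp)
  then have ex: "\<exists>n. \<rho> * g ^ n \<le> r" by (auto simp: eventually_sequentially intro: less_imp_le)
  define n where "n = (LEAST n. \<rho> * g ^ n \<le> r)"
  have n: "\<rho> * g ^ n \<le> r" unfolding n_def using ex by (rule LeastI_ex)
  have "n \<noteq> 0" using n r by (cases "n = 0") auto
  moreover have "\<not> \<rho> * g ^ (n - 1) \<le> r" unfolding n_def[symmetric]
    using not_less_Least[of "n - 1" "\<lambda>n. \<rho> * g ^ n \<le> r"] \<open>n \<noteq> 0\<close> unfolding n_def[symmetric] by simp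
  ultimately show ?thesis using that[of n] n by auto
qed

lemma powr_less_1:
  fixes g e :: real
  assumes "0 < g" "g < 1" "e > 0" shows "g powr e < 1"
  using powr_less_mono'[of g 0 e] assms by simp

text \<open>Multiplicative constants are absorbed by an arbitrarily small loss in the
  exponent.\<close>

lemma powr_eventually_le:
  fixes A a e :: real
  assumes "e > 0" "A > 0"
  shows "eventually (\<lambda>r. r powr (a + e) \<le> A * r powr a) (at_right 0)"
proof -
  have "((\<lambda>r. r powr e) \<longlongrightarrow> 0) (at_right (0::real))" using assms by real_asymp
  then have "eventually (\<lambda>r::real. r powr e < A) (at_right 0)" using assms by (auto dest: order_tendstoD)
  moreover have "eventually (\<lambda>r::real. r > 0) (at_right 0)" by (simp add: eventually_at_right_less)
  ultimately show ?thesis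
  proof eventually_elim
    case (elim r)
    have "r powr (a + e) = r powr e * r powr a" by (simp add: powr_add)
    also have "\<dots> \<le> A * r powr a" using elim by (intro mult_right_mono) auto
    finally show ?case .
  qed
qed

locale borel_prob = prob_space \<omega> for \<omega> :: "(real \<times> real) measure" +
  assumes so: "sets \<omega> = sets borel"
begin

lemma open_sets [simp]: "open A \<Longrightarrow> A \<in> sets \<omega>" and closed_sets [simp]: "closed A \<Longrightarrow> A \<in> sets \<omega>"
  by (simp_all add: so)

text \<open>A bound \<open>d\<close> on the upper box dimension in quantitative form, with one
  constant \<open>K\<close> and along the geometric scales \<open>g ^ n\<close> that suit the
  dynamics.\<close>

definition covering :: "real \<Rightarrow> real \<Rightarrow> (real \<times> real) set \<Rightarrow> bool" where
  "covering g d F \<longleftrightarrow> (\<exists>K>0. \<forall>n. \<exists>P. finite P \<and> real (card P) \<le> K * (g ^ n) powr (- d) \<and> F \<subseteq> (\<Union>c\<in>P. cball c (K * g ^ n)))"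

text \<open>At scale \<open>g ^ n\<close> the covering balls of mass below
  \<open>(g ^ n) powr (d + e)\<close> have total mass at most \<open>K * (g powr e) ^ n\<close>.
  This is summable, so by Borel-Cantelli almost every point eventually lies in heavy covering balls
  only.\<close>

lemma covering_local_dim:
  assumes g: "0 < g" "g < 1" and d: "d \<ge> 0" and F: "covering g d F" and ae: "AE z in \<omega>. z \<in> F" and \<epsilon>: "\<epsilon> > 0"
  shows "AE z in \<omega>. eventually (\<lambda>r. r powr (d + \<epsilon>) \<le> measure \<omega> (ball z r)) (at_right 0)"
proof -
  obtain K where K: "K > 0" and ex: "\<forall>n. \<exists>P. finite P \<and> real (card P) \<le> K * (g ^ n) powr (- d) \<and> F \<subseteq> (\<Union>c\<in>P. cball c (K * g ^ n))"
    using F unfolding covering_def by blast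
  obtain P where P: "\<And>n. finite (P n)" "\<And>n. real (card (P n)) \<le> K * (g ^ n) powr (- d)" "\<And>n. F \<subseteq> (\<Union>c\<in>P n. cball c (K * g ^ n))"
    using ex by metis
  \<comment> \<open>One half of \<open>\<epsilon>\<close> makes the series converge, the other half
    absorbs the constant \<open>A\<close> lost between \<open>r\<close> and the nearest
    scale.\<close>
  define e where "e = \<epsilon> / 2"
  have e: "e > 0" using \<epsilon> by (simp add: e_def)
  define th where "th n = (g ^ n) powr (d + e)" for n
  define Q where "Q n = {c \<in> P n. measure \<omega> (cball c (K * g ^ n)) < th n}" for n
  define N where "N n = (\<Union>c\<in>Q n. cball c (K * g ^ n))" for n
  have fQ: "finite (Q n)" for n unfolding Q_def using P(1) by simp
  have Nm: "N n \<in> sets \<omega>" for n unfolding N_def using fQ by (intro sets.finite_UN) auto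
  have Nb: "measure \<omega> (N n) \<le> K * (g powr e) ^ n" for n
  proof -
    have "measure \<omega> (N n) \<le> (\<Sum>c\<in>Q n. measure \<omega> (cball c (K * g ^ n)))"
      unfolding N_def using fQ by (intro finite_measure_subadditive_finite) auto
    also have "\<dots> \<le> (\<Sum>c\<in>Q n. th n)" by (intro sum_mono) (auto simp: Q_def)
    also have "\<dots> = real (card (Q n)) * th n" by simp
    also have "\<dots> \<le> (K * (g ^ n) powr (- d)) * th n"
    proof (rule mult_right_mono)
      have "real (card (Q n)) \<le> real (card (P n))" unfolding Q_def using P(1) by (intro of_nat_mono card_mono) auto
      then show "real (card (Q n)) \<le> K * (g ^ n) powr (- d)" using P(2)[of n] by linarith
    qed (simp add: th_def)
    also have "\<dots> = K * (g ^ n) powr e" by (simp add: th_def powr_add[symmetric])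
    also have "(g ^ n) powr e = (g powr e) ^ n"
      using g by (simp add: powr_realpow[symmetric] powr_powr mult.commute)
    finally show ?thesis .
  qed
  have "g powr e < 1" using g e by (intro powr_less_1)
  then have "summable (\<lambda>n. K * (g powr e) ^ n)" by (intro summable_mult summable_geometric) auto
  then have "summable (\<lambda>n. measure \<omega> (N n))"
    by (rule summable_comparison_test') (use Nb in auto)
  then have "AE z in \<omega>. eventually (\<lambda>n. z \<in> space \<omega> - N n) sequentially"
    by (intro borel_cantelli_AE1 Nm) (auto simp: emeasure_eq_measure)
  then show ?thesis using ae
  proof eventually_elim
    case (elim z)
    then obtain n0 where n0: "\<And>n. n \<ge> n0 \<Longrightarrow> z \<notin> N n" by (auto simp: eventually_sequentially)
    have low: "th n \<le> measure \<omega> (ball z (3 * K * g ^ n))" if n: "n \<ge> n0" for n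
    proof -
      obtain c where c: "c \<in> P n" "z \<in> cball c (K * g ^ n)" using P(3)[of n] elim by blast
      then have "c \<notin> Q n" using n0[OF n] by (auto simp: N_def)
      then have "th n \<le> measure \<omega> (cball c (K * g ^ n))" using c by (auto simp: Q_def)
      also have "\<dots> \<le> measure \<omega> (ball z (3 * K * g ^ n))"
      proof (rule finite_measure_mono)
        have pos: "K * g ^ n > 0" using K g by simp
        show "cball c (K * g ^ n) \<subseteq> ball z (3 * K * g ^ n)"
        proof
          fix y assume "y \<in> cball c (K * g ^ n)"
          then have "dist z y \<le> 2 * (K * g ^ n)" using c(2) dist_triangle[of z y c] by (simp add: dist_commute)
          then show "y \<in> ball z (3 * K * g ^ n)" using pos by simp
        qed
      qed simp
      finally show ?thesis .
    qed
    define A where "A = (g / (3 * K)) powr (d + e)"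
    have A: "A > 0" using g K by (simp add: A_def)
    have pos0: "3 * K * g ^ n0 > 0" using K g by simp
    have "eventually (\<lambda>r. r < 3 * K * g ^ n0) (at_right (0::real))"
      using pos0 by (intro eventually_at_rightI[of 0]) auto
    moreover have "eventually (\<lambda>r. r powr ((d + e) + e) \<le> A * r powr (d + e)) (at_right 0)"
      by (rule powr_eventually_le[OF e A])
    moreover have "eventually (\<lambda>r::real. r > 0) (at_right 0)" by (simp add: eventually_at_right_less)
    ultimately show ?case
    proof eventually_elim
      case (elim r)
      have "r < 3 * K * g ^ n0 * 1" using elim by simp
      obtain m where m: "m \<ge> 1" "(3 * K * g ^ n0) * g ^ m \<le> r" "r < (3 * K * g ^ n0) * g ^ (m - 1)"
        using scale_between[OF g, of r "3 * K * g ^ n0"] elim by auto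
      define n where "n = n0 + m"
      have n: "3 * K * g ^ n \<le> r" "r * g < 3 * K * g ^ n"
      proof -
        show "3 * K * g ^ n \<le> r" using m by (simp add: n_def power_add mult.assoc)
        have "r * g < (3 * K * g ^ n0) * g ^ (m - 1) * g" using m g by simp
        also have "\<dots> = 3 * K * g ^ n" using m(1) by (simp add: n_def power_add mult.assoc flip: power_Suc2)
        finally show "r * g < 3 * K * g ^ n" .
      qed
      have "r powr (d + \<epsilon>) \<le> A * r powr (d + e)" using elim by (simp add: e_def add.assoc)
      also have "\<dots> = (g / (3 * K) * r) powr (d + e)" unfolding A_def using g K elim by (intro powr_mult[symmetric])
      also have "\<dots> \<le> (g ^ n) powr (d + e)"
      proof (rule powr_mono2)
        show "g / (3 * K) * r \<le> g ^ n" using n K by (simp add: field_simps)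
      qed (use d e g K elim in auto)
      also have "\<dots> \<le> measure \<omega> (ball z (3 * K * g ^ n))" using low[of n] by (simp add: th_def n_def)
      also have "\<dots> \<le> measure \<omega> (ball z r)" using n by (intro finite_measure_mono) auto
      finally show ?case .
    qed
  qed
qed

lemma covering_hausdorff:
  assumes g: "0 < g" "g < 1" and F: "covering g d F" and s: "s > d" "s > 0"
  shows "hausdorff_measure s F = 0"
proof -
  obtain K where K: "K > 0" and ex: "\<forall>n. \<exists>P. finite P \<and> real (card P) \<le> K * (g ^ n) powr (- d) \<and> F \<subseteq> (\<Union>c\<in>P. cball c (K * g ^ n))"
    using F unfolding covering_def by blast
  have pre: "hausdorff_pre s \<delta> F = 0" if \<delta>: "\<delta> > 0" for \<delta>
  proof -
    have bound: "hausdorff_pre s \<delta> F \<le> ennreal (K * (2 * K) powr s * (g powr (s - d)) ^ n)" if n: "2 * K * g ^ n \<le> \<delta>" for n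
    proof -
      obtain P where P: "finite P" "real (card P) \<le> K * (g ^ n) powr (- d)" "F \<subseteq> (\<Union>c\<in>P. cball c (K * g ^ n))"
        using ex by blast
      obtain h where h: "bij_betw h {0..<card P} P" using ex_bij_betw_nat_finite[OF P(1)] by blast
      define C where "C i = (if i < card P then cball (h i) (K * g ^ n) else {})" for i
      have kg: "K * g ^ n \<ge> 0" using K g by simp
      have dC: "diameter (C i) \<le> (if i < card P then 2 * K * g ^ n else 0)" "diameter (C i) \<ge> 0" for i
        using diameter_cball[of "h i" "K * g ^ n"] kg by (auto simp: C_def diameter_ge_0)
      have "F \<subseteq> (\<Union>i. C i)"
      proof
        fix z assume "z \<in> F"
        then obtain c where c: "c \<in> P" "z \<in> cball c (K * g ^ n)" using P(3) by blast
        have "c \<in> h ` {0..<card P}" using h c(1) by (simp add: bij_betw_def)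
        then obtain i where "i < card P" "h i = c" by auto
        then show "z \<in> (\<Union>i. C i)" using c by (auto simp: C_def intro!: exI[of _ i])
      qed
      moreover have "bounded (C i) \<and> diameter (C i) \<le> \<delta>" for i
        using dC(1)[of i] n \<delta> by (auto simp: C_def split: if_splits)
      ultimately have "hausdorff_pre s \<delta> F \<le> (\<Sum>i. ennreal (diameter (C i) powr s))"
        unfolding hausdorff_pre_def by (intro INF_lower) auto
      also have "\<dots> = (\<Sum>i<card P. ennreal (diameter (C i) powr s))"
        using s by (intro suminf_finite) (auto simp: C_def)
      also have "\<dots> \<le> (\<Sum>i<card P. ennreal ((2 * K * g ^ n) powr s))"
      proof (rule sum_mono)
        fix i assume "i \<in> {..<card P}"
        then have "diameter (C i) \<le> 2 * K * g ^ n" using dC(1)[of i] by simp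
        then show "ennreal (diameter (C i) powr s) \<le> ennreal ((2 * K * g ^ n) powr s)"
          using dC(2) s by (intro ennreal_leI powr_mono2) auto
      qed
      also have "\<dots> = ennreal (real (card P) * (2 * K * g ^ n) powr s)"
        by (simp add: ennreal_mult ennreal_of_nat_eq_real_of_nat)
      also have "\<dots> \<le> ennreal ((K * (g ^ n) powr (- d)) * (2 * K * g ^ n) powr s)"
        using P(2) by (intro ennreal_leI mult_right_mono) auto
      also have "(K * (g ^ n) powr (- d)) * (2 * K * g ^ n) powr s = K * (2 * K) powr s * ((g ^ n) powr (- d) * (g ^ n) powr s)"
        using K g by (simp add: powr_mult)
      also have "(g ^ n) powr (- d) * (g ^ n) powr s = (g ^ n) powr (s - d)" by (simp add: powr_add[symmetric])
      also have "(g ^ n) powr (s - d) = (g powr (s - d)) ^ n"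
        using g by (simp add: powr_realpow[symmetric] powr_powr mult.commute)
      finally show ?thesis .
    qed
    have l1: "(\<lambda>n. K * (2 * K) powr s * (g powr (s - d)) ^ n) \<longlonglongrightarrow> K * (2 * K) powr s * 0"
      using g s by (intro tendsto_intros LIMSEQ_power_zero) (auto intro!: powr_less_1)
    have l2: "(\<lambda>n. 2 * K * g ^ n) \<longlonglongrightarrow> 2 * K * 0" using g by (intro tendsto_intros LIMSEQ_power_zero) auto
    have "eventually (\<lambda>n. 2 * K * g ^ n < \<delta>) sequentially" using l2 \<delta> by (auto dest: order_tendstoD)
    then have "eventually (\<lambda>n. hausdorff_pre s \<delta> F \<le> ennreal (K * (2 * K) powr s * (g powr (s - d)) ^ n)) sequentially"
      by eventually_elim (auto intro: bound)
    moreover have "(\<lambda>n. ennreal (K * (2 * K) powr s * (g powr (s - d)) ^ n)) \<longlonglongrightarrow> ennreal 0"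
      using l1 by (intro tendsto_ennrealI) simp
    ultimately have "hausdorff_pre s \<delta> F \<le> ennreal 0"
      by (intro tendsto_lowerbound[of "\<lambda>n. ennreal (K * (2 * K) powr s * (g powr (s - d)) ^ n)" _ sequentially]) auto
    then show ?thesis by simp
  qed
  then show ?thesis unfolding hausdorff_measure_def by (simp add: SUP_eq_const[of "{0<..}" _ 0])
qed

text \<open>The mass of an open ball is lower semicontinuous in its centre. This makes the sets of
  uniformly light points in \<open>mass_distribution\<close> measurable.\<close>

lemma closed_small_balls: "closed {z. measure \<omega> (ball z r) \<le> c}"
proof -
  have "open {z. measure \<omega> (ball z r) > c}"
  proof (rule openI)
    fix z assume "z \<in> {z. measure \<omega> (ball z r) > c}"
    then have z: "c < measure \<omega> (ball z r)" by simp
    define B where "B n = ball z (r - 1 / real (Suc n))" for n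
    have UB: "(\<Union>n. B n) = ball z r"
    proof (rule set_eqI)
      fix y
      show "y \<in> (\<Union>n. B n) \<longleftrightarrow> y \<in> ball z r"
      proof
        assume "y \<in> (\<Union>n. B n)"
        then obtain n where "dist z y < r - 1 / real (Suc n)" by (auto simp: B_def)
        moreover have "1 / real (Suc n) > 0" by simp
        ultimately show "y \<in> ball z r" unfolding mem_ball by linarith
      next
        assume "y \<in> ball z r"
        then obtain n where "inverse (real (Suc n)) < r - dist z y" using reals_Archimedean[of "r - dist z y"] by auto
        then have "y \<in> B n" by (simp add: B_def inverse_eq_divide)
        then show "y \<in> (\<Union>n. B n)" by blast
      qed
    qed
    have "incseq B" unfolding B_def
    proof (rule incseq_SucI, rule subset_ball)
      fix n show "r - 1 / real (Suc n) \<le> r - 1 / real (Suc (Suc n))" by (simp add: frac_le)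
    qed
    moreover have "range B \<subseteq> sets \<omega>" by (auto simp: B_def)
    ultimately have "(\<lambda>n. measure \<omega> (B n)) \<longlonglongrightarrow> measure \<omega> (\<Union>n. B n)"
      by (intro finite_Lim_measure_incseq)
    then have "eventually (\<lambda>n. c < measure \<omega> (B n)) sequentially" using z unfolding UB by (auto dest: order_tendstoD)
    then obtain n where n: "c < measure \<omega> (B n)" by (auto simp: eventually_sequentially)
    have "ball z (1 / real (Suc n)) \<subseteq> {z. measure \<omega> (ball z r) > c}"
    proof
      fix w assume w: "w \<in> ball z (1 / real (Suc n))"
      have "B n \<subseteq> ball w r"
      proof
        fix y assume "y \<in> B n"
        then show "y \<in> ball w r" using w dist_triangle[of w y z] by (simp add: B_def dist_commute)
      qed
      then have "measure \<omega> (B n) \<le> measure \<omega> (ball w r)" by (intro finite_measure_mono) auto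
      then show "w \<in> {z. measure \<omega> (ball z r) > c}" using n by simp
    qed
    then show "\<exists>e>0. ball z e \<subseteq> {z. measure \<omega> (ball z r) > c}" by (intro exI[of _ "1 / real (Suc n)"]) auto
  qed
  moreover have "- {z. measure \<omega> (ball z r) \<le> c} = {z. measure \<omega> (ball z r) > c}" by auto
  ultimately show ?thesis by (simp add: closed_def)
qed

text \<open>Mass distribution principle: a set of positive mass on which ball masses are uniformly
  at most \<open>r powr t\<close> cannot be covered cheaply. The truncation \<open>A k\<close>
  supplies the uniformity in the radius.\<close>

lemma mass_distribution:
  assumes low: "AE z in \<omega>. eventually (\<lambda>r. measure \<omega> (ball z r) \<le> r powr t) (at_right 0)"
    and Fm: "F \<in> sets \<omega>" and F1: "measure \<omega> F = 1" and s: "0 < s" "s < t"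
  shows "hausdorff_measure s F \<noteq> 0"
proof
  assume H0: "hausdorff_measure s F = 0"
  define A where "A k = {z\<in>F. \<forall>r\<in>{0<..1 / real (Suc k)}. measure \<omega> (ball z r) \<le> r powr t}" for k
  have Am: "A k \<in> sets \<omega>" for k
  proof -
    have "closed (\<Inter>r\<in>{0<..1 / real (Suc k)}. {z. measure \<omega> (ball z r) \<le> r powr t})"
      by (intro closed_INT ballI closed_small_balls)
    moreover have "A k = F \<inter> (\<Inter>r\<in>{0<..1 / real (Suc k)}. {z. measure \<omega> (ball z r) \<le> r powr t})"
      by (auto simp: A_def)
    ultimately show ?thesis using Fm by auto
  qed
  have "AE z in \<omega>. z \<in> (\<Union>k. A k)"
  proof -
    have "AE z in \<omega>. z \<in> F" using AE_in_set_eq_1[OF Fm] F1 by simp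
    then show ?thesis using low
    proof eventually_elim
      case (elim z)
      then obtain e where e: "e > 0" "\<And>r. 0 < r \<Longrightarrow> r < e \<Longrightarrow> measure \<omega> (ball z r) \<le> r powr t"
        unfolding eventually_at_right_field by blast
      obtain k where k: "inverse (real (Suc k)) < e" using reals_Archimedean[OF e(1)] by blast
      have "z \<in> A k" using elim(1) e(2) k by (auto simp: A_def inverse_eq_divide)
      then show ?case by blast
    qed
  qed
  then have U1: "measure \<omega> (\<Union>k. A k) = 1" using Am by (subst (asm) AE_in_set_eq_1) auto
  have "\<exists>k. measure \<omega> (A k) > 0"
  proof (rule ccontr)
    assume "\<not> (\<exists>k. measure \<omega> (A k) > 0)"
    then have "emeasure \<omega> (A k) = 0" for k by (auto simp: emeasure_eq_measure not_less measure_le_0_iff)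
    then have "emeasure \<omega> (\<Union>k. A k) = 0" using Am by (intro emeasure_UN_eq_0) auto
    then show False using U1 by (simp add: measure_def)
  qed
  then obtain k where k: "measure \<omega> (A k) > 0" by blast
  \<comment> \<open>Radii \<open>2 * diameter (C n)\<close> must stay below
    \<open>1 / Suc k\<close>, where the bound defining \<open>A k\<close> is valid, and diameters
    below 1, where the exponent \<open>t\<close> may be lowered to \<open>s\<close>.\<close>
  define \<delta> where "\<delta> = 1 / (4 * real (Suc k))"
  have \<delta>: "\<delta> > 0" "2 * \<delta> \<le> 1 / real (Suc k)" "2 * \<delta> \<le> 1" by (auto simp: \<delta>_def field_simps)
  have "hausdorff_pre s \<delta> F \<le> hausdorff_measure s F"
    unfolding hausdorff_measure_def using \<delta> by (intro SUP_upper) auto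
  then have pre0: "hausdorff_pre s \<delta> F = 0" using H0 by simp
  define e where "e = measure \<omega> (A k) / (2 * 2 powr t)"
  have e: "e > 0" using k by (simp add: e_def)
  have "\<exists>C. F \<subseteq> (\<Union>n. C n) \<and> (\<forall>n. bounded (C n) \<and> diameter (C n) \<le> \<delta>) \<and> (\<Sum>n. ennreal (diameter (C n) powr s)) < ennreal e"
  proof (rule ccontr)
    assume "\<not> ?thesis"
    then have "ennreal e \<le> hausdorff_pre s \<delta> F" unfolding hausdorff_pre_def by (intro INF_greatest) (auto simp: not_less)
    then show False using pre0 e by simp
  qed
  then obtain C where C: "F \<subseteq> (\<Union>n. C n)" "\<And>n. bounded (C n)" "\<And>n. diameter (C n) \<le> \<delta>"
    "(\<Sum>n. ennreal (diameter (C n) powr s)) < ennreal e" by blast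
  define zz where "zz n = (SOME z. z \<in> C n \<inter> A k)" for n
  have zz: "zz n \<in> C n \<inter> A k" if "C n \<inter> A k \<noteq> {}" for n
    unfolding zz_def using that by (intro someI_ex[of "\<lambda>z. z \<in> C n \<inter> A k"]) blast
  \<comment> \<open>The radius is twice the diameter since balls are open. A covering set of
    diameter 0 would give an empty ball, so it is replaced by its point, whose mass vanishes because
    \<open>r powr t\<close> tends to 0.\<close>
  define U where "U n = (if C n \<inter> A k = {} then {} else if diameter (C n) = 0 then {zz n} else ball (zz n) (2 * diameter (C n)))" for n
  have Um: "U n \<in> sets \<omega>" for n by (auto simp: U_def)
  have d0: "diameter (C n) \<ge> 0" for n using C(2) by (rule diameter_ge_0)
  have CU: "C n \<inter> A k \<subseteq> U n" for n
  proof
    fix y assume y: "y \<in> C n \<inter> A k"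
    then have z: "zz n \<in> C n" using zz[of n] by blast
    have "dist (zz n) y \<le> diameter (C n)" using diameter_bounded_bound[OF C(2) z] y by blast
    then show "y \<in> U n" using y d0[of n] by (auto simp: U_def)
  qed
  have Ub: "emeasure \<omega> (U n) \<le> ennreal (2 powr t) * ennreal (diameter (C n) powr s)" for n
  proof (cases "C n \<inter> A k = {}")
    case False
    then have zA: "zz n \<in> A k" using zz by blast
    show ?thesis
    proof (cases "diameter (C n) = 0")
      case True
      have "measure \<omega> {zz n} \<le> r powr t" if r: "0 < r" "r < 1 / real (Suc k)" for r
      proof -
        have "measure \<omega> {zz n} \<le> measure \<omega> (ball (zz n) r)" using r by (intro finite_measure_mono) auto
        then show ?thesis using zA r by (auto simp: A_def intro: order_trans)
      qed
      then have "eventually (\<lambda>r. measure \<omega> {zz n} \<le> r powr t) (at_right 0)"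
        by (intro eventually_at_rightI[of 0 "1 / real (Suc k)"]) auto
      moreover have "((\<lambda>r. r powr t) \<longlongrightarrow> 0) (at_right (0::real))" using s by real_asymp
      ultimately have "measure \<omega> {zz n} \<le> 0" by (intro tendsto_lowerbound[of _ 0 "at_right 0"]) auto
      then have "measure \<omega> {zz n} = 0" using measure_nonneg[of \<omega> "{zz n}"] by linarith
      then show ?thesis using False True by (simp add: U_def emeasure_eq_measure)
    next
      case F2: False
      then have dp: "diameter (C n) > 0" using d0[of n] by linarith
      have d2: "2 * diameter (C n) \<le> 1 / real (Suc k)" using C(3)[of n] \<delta> by linarith
      have d1: "diameter (C n) \<le> 1" using C(3)[of n] \<delta> by linarith
      have "measure \<omega> (U n) = measure \<omega> (ball (zz n) (2 * diameter (C n)))" using False F2 by (simp add: U_def)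
      also have "\<dots> \<le> (2 * diameter (C n)) powr t" using zA dp d2 by (auto simp: A_def)
      also have "\<dots> = 2 powr t * diameter (C n) powr t" using dp by (simp add: powr_mult)
      also have "\<dots> \<le> 2 powr t * diameter (C n) powr s"
        using dp d1 s by (intro mult_left_mono powr_mono') auto
      finally show ?thesis by (simp add: emeasure_eq_measure ennreal_mult[symmetric])
    qed
  qed (simp add: U_def)
  have "emeasure \<omega> (A k) \<le> emeasure \<omega> (\<Union>n. U n)"
  proof (rule emeasure_mono)
    show "A k \<subseteq> (\<Union>n. U n)"
    proof
      fix y assume y: "y \<in> A k"
      then have "y \<in> F" by (simp add: A_def)
      then obtain n where "y \<in> C n" using C(1) by blast
      then show "y \<in> (\<Union>n. U n)" using CU[of n] y by blast
    qed
  qed (use Um in auto)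
  also have "\<dots> \<le> (\<Sum>n. emeasure \<omega> (U n))" using Um by (intro emeasure_subadditive_countably) auto
  also have "\<dots> \<le> (\<Sum>n. ennreal (2 powr t) * ennreal (diameter (C n) powr s))" by (intro suminf_le Ub) auto
  also have "\<dots> = ennreal (2 powr t) * (\<Sum>n. ennreal (diameter (C n) powr s))" by simp
  also have "\<dots> \<le> ennreal (2 powr t) * ennreal e" using C(4) by (intro mult_left_mono) auto
  also have "\<dots> = ennreal (measure \<omega> (A k) / 2)" by (simp add: ennreal_mult[symmetric] e_def)
  finally have "measure \<omega> (A k) \<le> measure \<omega> (A k) / 2" by (simp add: emeasure_eq_measure)
  then show False using k by simp
qed

lemma exact_dimension:
  assumes d: "d > 0"
    and up: "\<And>\<epsilon>. \<epsilon> > 0 \<Longrightarrow> AE z in \<omega>. eventually (\<lambda>r. r powr (d + \<epsilon>) \<le> measure \<omega> (ball z r)) (at_right 0)"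
    and low: "\<And>\<epsilon>. \<epsilon> > 0 \<Longrightarrow> AE z in \<omega>. eventually (\<lambda>r. measure \<omega> (ball z r) \<le> r powr (d - \<epsilon>)) (at_right 0)"
  shows "exact_dimensional_with \<omega> d"
proof -
  have "AE z in \<omega>. \<forall>k::nat. eventually (\<lambda>r. r powr (d + 1 / real (Suc k)) \<le> measure \<omega> (ball z r)) (at_right 0)"
    unfolding AE_all_countable by (intro allI up) simp
  moreover have "AE z in \<omega>. \<forall>k::nat. eventually (\<lambda>r. measure \<omega> (ball z r) \<le> r powr (d - 1 / real (Suc k))) (at_right 0)"
    unfolding AE_all_countable by (intro allI low) simp
  ultimately have "AE z in \<omega>. ((\<lambda>r. ln (measure \<omega> (ball z r)) / ln r) \<longlongrightarrow> d) (at_right 0)"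
  proof eventually_elim
    case (elim z)
    show ?case
    proof (rule tendstoI)
      fix e :: real assume "e > 0"
      then obtain k where k: "inverse (real (Suc k)) < e" using reals_Archimedean by blast
      have a: "eventually (\<lambda>r::real. 0 < r) (at_right 0)" by (simp add: eventually_at_right_less)
      have b: "eventually (\<lambda>r::real. r < 1) (at_right 0)" by (intro eventually_at_rightI[of 0 1]) auto
      show "eventually (\<lambda>r. dist (ln (measure \<omega> (ball z r)) / ln r) d < e) (at_right 0)"
        using elim(1)[rule_format, of k] elim(2)[rule_format, of k] a b
      proof eventually_elim
        case (elim r)
        let ?m = "measure \<omega> (ball z r)"
        have lr: "ln r < 0" using elim by simp
        have rp: "r powr (d + 1 / real (Suc k)) > 0" using elim by simp
        have mp: "?m > 0" using elim(1) rp by linarith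
        have "ln (r powr (d + 1 / real (Suc k))) \<le> ln ?m" using elim(1) rp mp by (subst ln_le_cancel_iff) auto
        then have 1: "(d + 1 / real (Suc k)) * ln r \<le> ln ?m" using elim by (simp add: ln_powr)
        have "ln ?m \<le> ln (r powr (d - 1 / real (Suc k)))" using elim mp by (subst ln_le_cancel_iff) auto
        then have 2: "ln ?m \<le> (d - 1 / real (Suc k)) * ln r" using elim by (simp add: ln_powr)
        have 3: "ln ?m / ln r \<le> d + 1 / real (Suc k)" using 1 lr by (subst neg_divide_le_eq) auto
        have 4: "d - 1 / real (Suc k) \<le> ln ?m / ln r" using 2 lr by (subst neg_le_divide_eq) auto
        show ?case using 3 4 k unfolding dist_real_def inverse_eq_divide by linarith
      qed
    qed
  qed
  then show ?thesis using d by (simp add: exact_dimensional_with_def)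
qed

lemma measure_dim_eq:
  assumes "exact_dimensional_with \<omega> d" shows "measure_dim \<omega> = d"
proof -
  have uni: "\<beta> = d" if b: "exact_dimensional_with \<omega> \<beta>" for \<beta>
  proof -
    have 1: "AE x in \<omega>. ((\<lambda>r. ln (prob (ball x r)) / ln r) \<longlongrightarrow> d) (at_right 0)"
      using assms unfolding exact_dimensional_with_def by blast
    have 2: "AE x in \<omega>. ((\<lambda>r. ln (prob (ball x r)) / ln r) \<longlongrightarrow> \<beta>) (at_right 0)"
      using b unfolding exact_dimensional_with_def by blast
    have "AE x in \<omega>. \<beta> = d" using 1 2
      by eventually_elim (rule tendsto_unique[OF trivial_limit_at_right_real])
    then show ?thesis by (simp only: AE_const not_empty simp_thms)
  qed
  show ?thesis unfolding measure_dim_def by (rule the_equality[of "exact_dimensional_with \<omega>" d, OF assms uni])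
qed

lemma hausdorff_dim_eq:
  assumes d: "d > 0" and up: "\<And>s. s > d \<Longrightarrow> hausdorff_measure s F = 0"
    and low: "\<And>s. 0 < s \<Longrightarrow> s < d \<Longrightarrow> hausdorff_measure s F \<noteq> 0"
  shows "hausdorff_dim F = d"
  unfolding hausdorff_dim_def
proof (rule cInf_eq_non_empty)
  show "{s. 0 < s \<and> hausdorff_measure s F = 0} \<noteq> {}" using up[of "d + 1"] d by (auto intro!: exI[of _ "d + 1"])
  show "d \<le> x" if "x \<in> {s. 0 < s \<and> hausdorff_measure s F = 0}" for x using that low[of x] by force
  show "y \<le> d" if y: "\<And>x. x \<in> {s. 0 < s \<and> hausdorff_measure s F = 0} \<Longrightarrow> y \<le> x" for y
    by (rule field_le_epsilon) (use y up d in auto)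
qed

text \<open>The part of the domain off the support is covered by null balls, and the Lindelof
  property reduces them to countably many.\<close>

lemma support_full:
  assumes ed: "emeasure \<omega> dom01 = 1"
  shows "support_on_dom \<omega> \<in> sets \<omega>" "measure \<omega> (support_on_dom \<omega>) = 1"
proof -
  have dm: "dom01 \<in> sets \<omega>" unfolding so dom01_def by (intro borel_Times) auto
  define BB where "BB = {ball z r | z r. emeasure \<omega> (ball z r) = 0}"
  have eq: "support_on_dom \<omega> = dom01 - \<Union>BB"
  proof (intro set_eqI iffI)
    fix z assume z: "z \<in> support_on_dom \<omega>"
    have "z \<notin> \<Union>BB"
    proof
      assume "z \<in> \<Union>BB"
      then obtain w r where w: "z \<in> ball w r" "emeasure \<omega> (ball w r) = 0" by (auto simp: BB_def)
      then obtain e where e: "e > 0" "ball z e \<subseteq> ball w r" using open_contains_ball[of "ball w r"] open_ball by blast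
      then have "emeasure \<omega> (ball z e) \<le> emeasure \<omega> (ball w r)" by (intro emeasure_mono) auto
      moreover have "emeasure \<omega> (ball z e) > 0" using z e by (simp add: support_on_dom_def)
      ultimately show False using w by simp
    qed
    then show "z \<in> dom01 - \<Union>BB" using z by (simp add: support_on_dom_def)
  next
    fix z assume z: "z \<in> dom01 - \<Union>BB"
    have "emeasure \<omega> (ball z r) > 0" if "r > 0" for r
    proof (rule ccontr)
      assume "\<not> emeasure \<omega> (ball z r) > 0"
      then have "emeasure \<omega> (ball z r) = 0" by simp
      then have "ball z r \<in> BB" unfolding BB_def by blast
      then show False using z that by (metis DiffD2 UnionI centre_in_ball)
    qed
    then show "z \<in> support_on_dom \<omega>" using z by (simp add: support_on_dom_def)
  qed
  have op: "open B" if "B \<in> BB" for B using that by (auto simp: BB_def)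
  obtain B' where B': "B' \<subseteq> BB" "countable B'" "\<Union>B' = \<Union>BB" using Lindelof[of BB] op by blast
  have null: "emeasure \<omega> (\<Union>BB) = 0"
  proof -
    have "(\<Union>B') \<in> null_sets \<omega>"
    proof -
      have "B \<in> null_sets \<omega>" if "B \<in> BB" for B
        using that op[OF that] unfolding BB_def null_sets_def by auto
      then have "(\<Union>B\<in>B'. B) \<in> null_sets \<omega>" using B' by (intro null_sets_UN') auto
      then show ?thesis by simp
    qed
    then show ?thesis using B' by auto
  qed
  have om: "\<Union>BB \<in> sets \<omega>" using op by (intro open_sets open_Union) auto
  show "support_on_dom \<omega> \<in> sets \<omega>" unfolding eq using dm om by auto
  have "emeasure \<omega> (dom01 - \<Union>BB) = emeasure \<omega> dom01"
    using null om dm by (intro emeasure_Diff_null_set) auto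
  then show "measure \<omega> (support_on_dom \<omega>) = 1" unfolding eq measure_def using ed by simp
qed

end

section \<open>Upper and lower bounds for the local dimension\<close>

lemma dist_pair_le: "dist z w \<le> \<bar>fst z - fst w\<bar> + \<bar>snd z - snd w\<bar>" for z w :: "real \<times> real"
  unfolding dist_prod_def dist_real_def by (rule sqrt_sum_squares_le_sum) auto

lemma abs_fst_snd_le_dist: "\<bar>fst z - fst w\<bar> \<le> dist z w" "\<bar>snd z - snd w\<bar> \<le> dist z w" for z w :: "real \<times> real"
  using dist_fst_le[of z w] dist_snd_le[of z w] by (auto simp: dist_real_def)

text \<open>Open block of three by three grid cells around the cell \<open>s\<close>. Openness is
  what the weak limit can handle, and the block contains the \<open>r\<close>-ball about every point
  of the cell.\<close>

definition box3 :: "real \<Rightarrow> int \<times> int \<Rightarrow> (real \<times> real) set" where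
  "box3 r s = {of_int (fst s - 1) * r <..< of_int (fst s + 2) * r} \<times> {of_int (snd s - 1) * r <..< of_int (snd s + 2) * r}"

definition cell :: "real \<Rightarrow> real \<times> real \<Rightarrow> int \<times> int" where
  "cell r z = (\<lfloor>fst z / r\<rfloor>, \<lfloor>snd z / r\<rfloor>)"

definition nbrs :: "(int \<times> int) set \<Rightarrow> (int \<times> int) set" where
  "nbrs S = (\<lambda>(s, d). (fst s + fst d, snd s + snd d)) ` (S \<times> ({-1,0,1} \<times> {-1,0,1}))"

lemma open_box3: "open (box3 r s)"
  unfolding box3_def by (intro open_Times) auto

lemma finite_nbrs: "finite S \<Longrightarrow> finite (nbrs S)" and card_nbrs: "finite S \<Longrightarrow> card (nbrs S) \<le> 9 * card S"
proof -
  assume S: "finite S"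
  let ?D = "{-1,0,1} \<times> {-1,0,1} :: (int \<times> int) set"
  show "finite (nbrs S)" unfolding nbrs_def using S by (intro finite_imageI finite_cartesian_product) auto
  have "card (nbrs S) \<le> card (S \<times> ?D)" unfolding nbrs_def using S by (intro card_image_le finite_cartesian_product) auto
  also have "\<dots> = card S * 9" by (simp add: card_cartesian_product)
  finally show "card (nbrs S) \<le> 9 * card S" by simp
qed

lemma floor_in_nbr:
  fixes x r :: real
  assumes r: "r > 0" and x: "of_int (i - 1) * r < x" "x < of_int (i + 2) * r"
  shows "\<bar>\<lfloor>x / r\<rfloor> - i\<bar> \<le> 1"
proof -
  have "of_int (i - 1) < x / r" "x / r < of_int (i + 2)" using r x by (auto simp: field_simps)
  then have "i - 1 \<le> \<lfloor>x / r\<rfloor>" "\<lfloor>x / r\<rfloor> < i + 2" by (simp_all add: le_floor_iff floor_less_iff)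
  then show ?thesis by linarith
qed

lemma mem_nbrs: "\<bar>fst t - fst s\<bar> \<le> 1 \<Longrightarrow> \<bar>snd t - snd s\<bar> \<le> 1 \<Longrightarrow> t \<in> nbrs {s}"
proof -
  have m: "\<bar>d\<bar> \<le> 1 \<Longrightarrow> d \<in> {-1, 0, 1}" for d :: int by auto
  assume "\<bar>fst t - fst s\<bar> \<le> 1" "\<bar>snd t - snd s\<bar> \<le> 1"
  then have "(s, (fst t - fst s, snd t - snd s)) \<in> {s} \<times> ({-1, 0, 1} \<times> {-1, 0, 1})"
    using m by (simp only: mem_Times_iff fst_conv snd_conv singletonI simp_thms)
  moreover have "t = (\<lambda>(s, d). (fst s + fst d, snd s + snd d)) (s, (fst t - fst s, snd t - snd s))" by simp
  ultimately show ?thesis unfolding nbrs_def by (rule rev_image_eqI)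
qed

lemma box3_cell:
  assumes r: "r > 0" and z: "z \<in> box3 r s"
  shows "cell r z \<in> nbrs {s}" "s \<in> nbrs {cell r z}"
proof -
  have "\<bar>\<lfloor>fst z / r\<rfloor> - fst s\<bar> \<le> 1" "\<bar>\<lfloor>snd z / r\<rfloor> - snd s\<bar> \<le> 1"
    using z floor_in_nbr[OF r, of "fst s" "fst z"] floor_in_nbr[OF r, of "snd s" "snd z"]
    unfolding box3_def mem_Times_iff greaterThanLessThan_iff by blast+
  then show "cell r z \<in> nbrs {s}" "s \<in> nbrs {cell r z}"
    by (auto intro!: mem_nbrs simp: cell_def abs_minus_commute)
qed

lemma ball_box3:
  assumes r: "r > 0" shows "ball z r \<subseteq> box3 r (cell r z)" 
proof
  fix w assume "w \<in> ball z r"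
  then have d: "\<bar>fst z - fst w\<bar> < r" "\<bar>snd z - snd w\<bar> < r" using abs_fst_snd_le_dist[of z w] by auto
  have c: "of_int \<lfloor>x / r\<rfloor> * r \<le> x" "x < of_int \<lfloor>x / r\<rfloor> * r + r" for x
    using floor_divide_lower[OF r, of x] floor_divide_upper[OF r, of x] by (auto simp: distrib_right)
  show "w \<in> box3 r (cell r z)"
    using d c[of "fst z"] c[of "snd z"] unfolding box3_def cell_def mem_Times_iff greaterThanLessThan_iff
    by (simp add: algebra_simps) linarith
qed

context borel_prob
begin

text \<open>Every point lies in at most nine of the boxes, hence their masses add up to at most
  9.\<close>

lemma card_heavy_boxes:
  assumes r: "r > 0" and c: "c > 0"
  shows "finite {s. measure \<omega> (box3 r s) > c}" "real (card {s. measure \<omega> (box3 r s) > c}) \<le> 9 / c"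
proof -
  have fin: "real (card S) \<le> 9 / c" if S: "finite S" "S \<subseteq> {s. measure \<omega> (box3 r s) > c}" for S
  proof -
    have "c * real (card S) = (\<Sum>s\<in>S. c)" by simp
    also have "\<dots> \<le> (\<Sum>s\<in>S. measure \<omega> (box3 r s))" using S by (intro sum_mono) (auto intro: less_imp_le)
    also have "\<dots> = (\<Sum>s\<in>S. \<integral>z. indicator (box3 r s) z \<partial>\<omega>)" by (simp add: open_box3)
    also have "\<dots> = (\<integral>z. (\<Sum>s\<in>S. indicator (box3 r s) z) \<partial>\<omega>)"
      by (rule Bochner_Integration.integral_sum[symmetric]) (auto intro!: integrable_real_indicator simp: open_box3 emeasure_eq_measure)
    also have "\<dots> \<le> (\<integral>z. 9 \<partial>\<omega>)"
    proof (rule integral_mono)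
      show "integrable \<omega> (\<lambda>z. \<Sum>s\<in>S. indicator (box3 r s) z :: real)"
        by (auto intro!: Bochner_Integration.integrable_sum integrable_real_indicator simp: open_box3 emeasure_eq_measure)
      fix z
      have "(\<Sum>s\<in>S. indicator (box3 r s) z :: real) = (\<Sum>s\<in>S. of_bool (z \<in> box3 r s))"
        by (intro sum.cong refl) (simp add: indicator_def)
      also have "\<dots> = real (card (S \<inter> {s. z \<in> box3 r s}))" using S(1) by simp
      also have "\<dots> \<le> real (card (nbrs {cell r z}))"
      proof (intro of_nat_mono card_mono finite_nbrs)
        show "S \<inter> {s. z \<in> box3 r s} \<subseteq> nbrs {cell r z}" using box3_cell(2)[OF r] by blast
      qed simp
      also have "\<dots> \<le> 9" using card_nbrs[of "{cell r z}"] by simp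
      finally show "(\<Sum>s\<in>S. indicator (box3 r s) z :: real) \<le> 9" .
    qed simp
    also have "\<dots> = 9" by (simp add: prob_space)
    finally show ?thesis using c by (simp add: field_simps)
  qed
  show f: "finite {s. measure \<omega> (box3 r s) > c}"
  proof (rule ccontr)
    assume inf: "infinite {s. measure \<omega> (box3 r s) > c}"
    obtain n :: nat where n: "real n > 9 / c" using reals_Archimedean2 by blast
    obtain S where "S \<subseteq> {s. measure \<omega> (box3 r s) > c}" "finite S" "card S = n"
      using infinite_arbitrarily_large[OF inf, of n] by blast
    then show False using fin[of S] n by simp
  qed
  show "real (card {s. measure \<omega> (box3 r s) > c}) \<le> 9 / c" by (rule fin[OF f order_refl])
qed

end

context skew_family
begin

section \<open>The dimension formula and coverings of the support\<close>

definition sdim :: real where "sdim = ln (real b) / ln (1 / \<gamma>)"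
definition ddim :: real where "ddim = min 2 (1 + sdim)"

lemma ln_inv_pos: "ln (1 / \<gamma>) > 0"
  using \<gamma>0 \<gamma>1 by (simp add: ln_div)

lemma sdim_pos: "sdim > 0"
  unfolding sdim_def using b2 ln_inv_pos by simp

lemma ddim_gt1: "1 < ddim" "ddim \<le> 2"
  using sdim_pos by (auto simp: ddim_def)

lemma powr_sdim: "(\<gamma> ^ q) powr (- sdim) = real b ^ q"
proof -
  have "(\<gamma> ^ q) powr (- sdim) = exp (- sdim * (real q * ln \<gamma>))" using \<gamma>0 by (simp add: powr_def ln_realpow)
  also have "- sdim * (real q * ln \<gamma>) = real q * ln (real b)"
  proof -
    have "ln (1 / \<gamma>) = - ln \<gamma>" using \<gamma>0 by (simp add: ln_div)
    then show ?thesis using ln_inv_pos by (simp add: sdim_def field_simps)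
  qed
  finally show ?thesis by (simp add: exp_of_nat_mult)
qed

text \<open>Matches the formula to the pair count: \<open>max \<gamma> (1 / b)\<close> is the rate
  in \<open>good_sets\<close>, and the extra \<open>\<gamma>\<close> comes from the horizontal side
  of a cell.\<close>

lemma powr_ddim: "\<gamma> powr ddim = \<gamma> * max \<gamma> (1 / real b)"
proof -
  have s: "\<gamma> powr sdim = 1 / real b" using powr_sdim[of 1] \<gamma>0 by (simp add: powr_minus field_simps)
  show ?thesis
  proof (cases "sdim \<le> 1")
    case True
    have "\<gamma> powr 1 \<le> \<gamma> powr sdim" using True \<gamma>0 \<gamma>1 by (intro powr_mono') auto
    then have "max \<gamma> (1 / real b) = 1 / real b" using s \<gamma>0 by simp
    moreover have "ddim = 1 + sdim" using True by (simp add: ddim_def)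
    ultimately show ?thesis using s \<gamma>0 by (simp add: powr_add)
  next
    case False
    have "\<gamma> powr sdim \<le> \<gamma> powr 1" using False \<gamma>0 \<gamma>1 by (intro powr_mono') auto
    then have "max \<gamma> (1 / real b) = \<gamma>" using s \<gamma>0 by simp
    moreover have "ddim = 2" using False by (simp add: ddim_def)
    ultimately show ?thesis using \<gamma>0 by (simp add: powr_realpow[of \<gamma> 2, simplified] power2_eq_square)
  qed
qed

lemma HH_per_int: "HH j q (t + real b ^ q * of_int m) = HH j q t"
proof (cases "m \<ge> 0")
  case True
  then show ?thesis using HH_per_mult[of j q t "nat m"] by simp
next
  case False
  then show ?thesis using HH_per_mult[of j q "t + real b ^ q * of_int m" "nat (- m)"] by simp
qed

lemma HH_lipschitz: "\<bar>HH j q t - HH j q t'\<bar> \<le> Cb (Suc j) * \<bar>t - t'\<bar>"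
proof -
  have "norm (HH j q t - HH j q t') \<le> Cb (Suc j) * norm (t - t')"
    by (rule field_differentiable_bound[of UNIV _ "HH (Suc j) q"]) (auto simp: HH_deriv HH_bound)
  then show ?thesis by simp
qed

text \<open>Mass near \<open>z\<close> is seen by the curves at some large depth; cutting the sum
  back to \<open>q\<close> terms moves the point by at most
  \<open>Cb 0 * \<gamma> ^ q\<close>.\<close>

lemma support_near_curve:
  assumes S: "SRBlim \<omega>" and z: "z \<in> support_on_dom \<omega>"
  shows "\<exists>t. dist z (frac t, HH 0 q t) \<le> (Cb 0 + 1) * \<gamma> ^ q"
proof -
  interpret prob_space \<omega> using S by (simp add: SRBlim_def)
  have gq: "\<gamma> ^ q > 0" using \<gamma>0 by simp
  have "emeasure \<omega> (ball z (\<gamma> ^ q)) > 0" using z gq by (simp add: support_on_dom_def)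
  then have "measure \<omega> (ball z (\<gamma> ^ q)) > 0" by (simp add: emeasure_eq_measure)
  from SRBlim_open[OF S open_ball this]
  obtain Q where Q: "\<And>n. n \<ge> Q \<Longrightarrow> 0 < mu n (indicator (ball z (\<gamma> ^ q)))" by (auto simp: eventually_sequentially)
  have "\<exists>t. (frac t, HH 0 (q + Q) t) \<in> ball z (\<gamma> ^ q)"
  proof (rule ccontr)
    assume "\<not> ?thesis"
    then have "mu (q + Q) (indicator (ball z (\<gamma> ^ q))) = 0" unfolding mu_def by (simp add: Av_def)
    then show False using Q[of "q + Q"] by simp
  qed
  then obtain t where t: "dist z (frac t, HH 0 (q + Q) t) < \<gamma> ^ q" by auto
  have "dist (frac t, HH 0 (q + Q) t) (frac t, HH 0 q t) \<le> \<gamma> ^ q * Cb 0"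
    using HH_tail[of q Q t] by (simp add: dist_Pair_Pair dist_real_def)
  then have "dist z (frac t, HH 0 q t) \<le> (Cb 0 + 1) * \<gamma> ^ q"
    using t dist_triangle[of z "(frac t, HH 0 q t)" "(frac t, HH 0 (q + Q) t)"] by (simp add: algebra_simps)
  then show ?thesis by blast
qed

lemma floor_grid:
  assumes "0 \<le> x" "x < 1" "g > 0"
  shows "\<bar>x - real (nat \<lfloor>x / g\<rfloor>) * g\<bar> \<le> g" "nat \<lfloor>x / g\<rfloor> \<le> nat \<lfloor>1 / g\<rfloor>"
proof -
  have x0: "x / g \<ge> 0" using assms by simp
  then have "real (nat \<lfloor>x / g\<rfloor>) = of_int \<lfloor>x / g\<rfloor>" by simp
  then have "real (nat \<lfloor>x / g\<rfloor>) * g \<le> x" "x \<le> real (nat \<lfloor>x / g\<rfloor>) * g + g"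
    using floor_divide_lower[OF assms(3), of x] floor_divide_upper[OF assms(3), of x] by (auto simp: distrib_right)
  then show "\<bar>x - real (nat \<lfloor>x / g\<rfloor>) * g\<bar> \<le> g" by linarith
  have "x / g \<le> 1 / g" using assms by (intro divide_right_mono) auto
  then show "nat \<lfloor>x / g\<rfloor> \<le> nat \<lfloor>1 / g\<rfloor>" by (intro nat_mono floor_mono)
qed

text \<open>Two coverings compete: \<open>b ^ q\<close> curves cut into about
  \<open>1 / \<gamma> ^ q\<close> pieces each, or the full grid of a bounded strip. They give the
  exponents \<open>1 + sdim\<close> and 2, of which the smaller is used.\<close>

lemma covering_support:
  assumes S: "SRBlim \<omega>"
  shows "borel_prob.covering \<gamma> ddim (support_on_dom \<omega>)"
proof -
  interpret prob_space \<omega> using S by (simp add: SRBlim_def)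
  interpret borel_prob \<omega> by unfold_locales (use S in \<open>simp add: SRBlim_def\<close>)
  define Y where "Y = 2 * Cb 0 + 1"
  have Y: "Y > 0" using Cb_nonneg[of 0] by (simp add: Y_def)
  \<comment> \<open>One constant for both cases: \<open>4 * Y + 6\<close> covers the size of the
    grid, \<open>3 + Cb 0 + Cb 1\<close> the distance to a curve point.\<close>
  define K where "K = 4 * Y + 6 + 3 + Cb 0 + Cb 1"
  have K: "K > 0" using Y Cb_nonneg[of 0] Cb_nonneg[of 1] by (simp add: K_def)
  show ?thesis unfolding covering_def
  proof (intro exI[of _ K] conjI K allI)
    fix q
    define g where "g = \<gamma> ^ q"
    have g: "g > 0" "g \<le> 1" using \<gamma>0 \<gamma>1 by (auto simp: g_def power_le_one)
    have g1: "1 \<le> 1 / g" using g by simp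
    define n where "n = nat \<lfloor>1 / g\<rfloor>"
    have n: "real n \<le> 1 / g" using g by (simp add: n_def)
    have lift: "\<exists>P. finite P \<and> real (card P) \<le> K * g powr (- ddim) \<and> support_on_dom \<omega> \<subseteq> (\<Union>c\<in>P. cball c (K * g))"
      if h: "finite A" "real (card A) \<le> K * g powr (- ddim)" "\<And>z. z \<in> support_on_dom \<omega> \<Longrightarrow> \<exists>a\<in>A. dist z (h a) \<le> K * g"
      for A :: "'x set" and h
    proof (intro exI[of _ "h ` A"] conjI)
      show "finite (h ` A)" using h by simp
      have "real (card (h ` A)) \<le> real (card A)" using h(1) by (intro of_nat_mono card_image_le)
      then show "real (card (h ` A)) \<le> K * g powr (- ddim)" using h(2) by linarith
      show "support_on_dom \<omega> \<subseteq> (\<Union>c\<in>h ` A. cball c (K * g))"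
      proof
        fix z assume "z \<in> support_on_dom \<omega>"
        then obtain a where "a \<in> A" "dist z (h a) \<le> K * g" using h(3) by blast
        then show "z \<in> (\<Union>c\<in>h ` A. cball c (K * g))" by (intro UN_I[of "h a"]) (auto simp: dist_commute)
      qed
    qed
    show "\<exists>P. finite P \<and> real (card P) \<le> K * (\<gamma> ^ q) powr (- ddim) \<and> support_on_dom \<omega> \<subseteq> (\<Union>c\<in>P. cball c (K * \<gamma> ^ q))"
      unfolding g_def[symmetric]
    proof (cases "sdim \<le> 1")
      case True
      let ?A = "{..<b ^ q} \<times> {..n}"
      let ?h = "\<lambda>(k, i). (real i * g, HH 0 q (real k + real i * g))"
      show "\<exists>P. finite P \<and> real (card P) \<le> K * g powr (- ddim) \<and> support_on_dom \<omega> \<subseteq> (\<Union>c\<in>P. cball c (K * g))"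
      proof (rule lift[of ?A ?h])
        have "real (card ?A) = real b ^ q * (real n + 1)" by (simp add: card_cartesian_product algebra_simps)
        also have "\<dots> \<le> real b ^ q * (2 / g)" using n g1 by (intro mult_left_mono) auto
        also have "\<dots> = 2 * g powr (- ddim)"
        proof -
          have "- ddim = (- 1) + (- sdim)" using True by (simp add: ddim_def)
          then have "g powr (- ddim) = g powr (- 1) * g powr (- sdim)" by (simp only: powr_add)
          then show ?thesis using powr_sdim[of q] g by (simp add: g_def[symmetric] powr_minus field_simps)
        qed
        also have "\<dots> \<le> K * g powr (- ddim)" using Y Cb_nonneg[of 0] Cb_nonneg[of 1] by (intro mult_right_mono) (auto simp: K_def)
        finally show "real (card ?A) \<le> K * g powr (- ddim)" .
        fix z assume "z \<in> support_on_dom \<omega>"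
        from support_near_curve[OF S this, of q] obtain t where t: "dist z (frac t, HH 0 q t) \<le> (Cb 0 + 1) * g" by (auto simp: g_def)
        \<comment> \<open>The curve has period \<open>b ^ q\<close>, so \<open>t\<close> is
          represented by its integer part modulo \<open>b ^ q\<close> and the grid index
          \<open>i\<close> of its fractional part.\<close>
        define k where "k = nat (\<lfloor>t\<rfloor> mod int (b ^ q))"
        define i where "i = nat \<lfloor>frac t / g\<rfloor>"
        have k: "k < b ^ q"
        proof -
          have "\<lfloor>t\<rfloor> mod int (b ^ q) < int (b ^ q)" by (intro pos_mod_bound) simp
          moreover have "\<lfloor>t\<rfloor> mod int (b ^ q) \<ge> 0" by (intro pos_mod_sign) simp
          ultimately show ?thesis unfolding k_def by linarith
        qed
        have teq: "t = (real k + frac t) + real b ^ q * of_int (\<lfloor>t\<rfloor> div int (b ^ q))"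
        proof -
          have "int k = \<lfloor>t\<rfloor> mod int (b ^ q)" unfolding k_def by simp
          then have "\<lfloor>t\<rfloor> = int k + int (b ^ q) * (\<lfloor>t\<rfloor> div int (b ^ q))" by simp
          then have "real_of_int \<lfloor>t\<rfloor> = real_of_int (int k + int (b ^ q) * (\<lfloor>t\<rfloor> div int (b ^ q)))" by (rule arg_cong)
          then have "real_of_int \<lfloor>t\<rfloor> = real k + real b ^ q * of_int (\<lfloor>t\<rfloor> div int (b ^ q))"
            by (simp only: of_int_add of_int_mult of_int_of_nat_eq of_nat_power of_int_power)
          then show ?thesis by (simp add: frac_def)
        qed
        have Ht: "HH 0 q t = HH 0 q (real k + frac t)" using HH_per_int[of 0 q "real k + frac t" "\<lfloor>t\<rfloor> div int (b ^ q)"] teq by simp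
        have fr: "0 \<le> frac t" "frac t < 1" by (auto simp: frac_lt_1)
        have gr: "\<bar>frac t - real i * g\<bar> \<le> g" "i \<le> n" unfolding i_def n_def by (rule floor_grid[OF fr g(1)])+
        have "\<bar>HH 0 q (real k + frac t) - HH 0 q (real k + real i * g)\<bar> \<le> Cb 1 * \<bar>frac t - real i * g\<bar>"
          using HH_lipschitz[of 0 q "real k + frac t" "real k + real i * g"] by simp
        also have "\<dots> \<le> Cb 1 * g" using gr Cb_nonneg[of 1] by (intro mult_left_mono) auto
        finally have "dist (frac t, HH 0 q t) (?h (k, i)) \<le> g + Cb 1 * g"
          using dist_pair_le[of "(frac t, HH 0 q t)" "?h (k, i)"] gr Ht by simp
        then have "dist z (?h (k, i)) \<le> (Cb 0 + 1) * g + (g + Cb 1 * g)"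
          using t dist_triangle[of z "?h (k, i)" "(frac t, HH 0 q t)"] by linarith
        also have "\<dots> \<le> K * g"
        proof -
          have "(Cb 0 + 1) * g + (g + Cb 1 * g) = (Cb 0 + 2 + Cb 1) * g" by (simp add: algebra_simps)
          also have "\<dots> \<le> K * g" using g Y by (intro mult_right_mono) (auto simp: K_def)
          finally show ?thesis .
        qed
        finally show "\<exists>a\<in>?A. dist z (?h a) \<le> K * g" using k gr(2) by (intro bexI[of _ "(k, i)"]) auto
      qed simp
    next
      case False
      define m where "m = \<lceil>Y / g\<rceil>"
      have m: "m \<ge> 0" "of_int m \<le> Y / g + 1" "Y / g \<le> of_int m"
      proof -
        have "Y / g > 0" using Y g by simp
        then show "m \<ge> 0" "of_int m \<le> Y / g + 1" "Y / g \<le> of_int m" unfolding m_def by linarith+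
      qed
      let ?A = "{..n} \<times> {-m..m}"
      let ?h = "\<lambda>(i, j). (real i * g, of_int j * g)"
      show "\<exists>P. finite P \<and> real (card P) \<le> K * g powr (- ddim) \<and> support_on_dom \<omega> \<subseteq> (\<Union>c\<in>P. cball c (K * g))"
      proof (rule lift[of ?A ?h])
        have "real (card ?A) = (real n + 1) * (2 * of_int m + 1)" using m by (simp add: card_cartesian_product algebra_simps)
        also have "\<dots> \<le> (2 / g) * ((2 * Y + 3) / g)"
        proof (rule mult_mono)
          show "real n + 1 \<le> 2 / g" using n g1 by simp
          have "2 * of_int m + 1 \<le> 2 * (Y / g + 1) + 1" using m by simp
          also have "\<dots> \<le> 2 * (Y / g) + 3 * (1 / g)" using mult_left_mono[OF g1, of 3] by simp
          also have "\<dots> = (2 * Y + 3) / g" by (simp add: add_divide_distrib)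
          finally show "2 * of_int m + 1 \<le> (2 * Y + 3) / g" .
        qed (use g m in auto)
        also have "\<dots> = (4 * Y + 6) * g powr (- ddim)"
        proof -
          have "ddim = 2" using False by (simp add: ddim_def)
          then have eq: "g powr (- ddim) = 1 / g ^ 2" using g by (simp add: powr_minus powr_realpow[of g 2, simplified] divide_inverse)
          show ?thesis unfolding eq using g by (simp add: power2_eq_square field_simps)
        qed
        also have "\<dots> \<le> K * g powr (- ddim)" using Cb_nonneg[of 0] Cb_nonneg[of 1] by (intro mult_right_mono) (auto simp: K_def)
        finally show "real (card ?A) \<le> K * g powr (- ddim)" .
        fix z assume z: "z \<in> support_on_dom \<omega>"
        from support_near_curve[OF S this, of q] obtain t where t: "dist z (frac t, HH 0 q t) \<le> (Cb 0 + 1) * g" by (auto simp: g_def)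
        have fz: "0 \<le> fst z" "fst z < 1" using z by (auto simp: support_on_dom_def dom01_def mem_Times_iff)
        have "\<bar>snd z - HH 0 q t\<bar> \<le> (Cb 0 + 1) * g" using abs_fst_snd_le_dist(2)[of z "(frac t, HH 0 q t)"] t by simp
        also have "\<dots> \<le> (Cb 0 + 1) * 1" using g Cb_nonneg[of 0] by (intro mult_left_mono) auto
        finally have sz: "\<bar>snd z\<bar> \<le> Y" using HH_bound[of 0 q t] by (simp add: Y_def)
        define i where "i = nat \<lfloor>fst z / g\<rfloor>"
        define j where "j = \<lfloor>snd z / g\<rfloor>"
        have gr: "\<bar>fst z - real i * g\<bar> \<le> g" "i \<le> n" unfolding i_def n_def by (rule floor_grid[OF fz g(1)])+
        have "of_int j \<le> snd z / g" "snd z / g \<le> of_int j + 1" unfolding j_def by linarith+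
        then have "of_int j * g \<le> snd z" "snd z \<le> of_int j * g + g" using g by (simp_all add: field_simps)
        then have gr2: "\<bar>snd z - of_int j * g\<bar> \<le> g" by linarith
        have "- (Y / g) \<le> snd z / g" "snd z / g \<le> Y / g" using sz g by (auto simp: field_simps abs_le_iff)
        then have "- m \<le> j" "j \<le> m" using m(3) unfolding j_def by (auto simp: le_floor_iff floor_le_iff) 
        then have "(i, j) \<in> ?A" using gr by simp
        moreover have "dist z (?h (i, j)) \<le> K * g"
        proof -
          have "dist z (?h (i, j)) \<le> 2 * g" using dist_pair_le[of z "?h (i, j)"] gr gr2 by simp
          also have "\<dots> \<le> K * g" using g Y Cb_nonneg[of 0] Cb_nonneg[of 1] by (intro mult_right_mono) (auto simp: K_def)
          finally show ?thesis .
        qed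
        ultimately show "\<exists>a\<in>?A. dist z (?h a) \<le> K * g" by blast
      qed simp
    qed
  qed
qed

end

lemma summable_lin_exp:
  fixes c Q :: real assumes "c > 0"
  shows "summable (\<lambda>m. (41 + (Q * real m + 1) / 2) * exp (- c * real m))"
proof -
  have e: "exp (- c * real m) = exp (- c) ^ m" for m by (simp add: exp_of_nat_mult[symmetric] mult.commute)
  have "norm (exp (- c)) < 1" using assms by simp
  then have "summable (\<lambda>m. exp (- c) ^ m)" "summable (\<lambda>m. of_nat (Suc m) * exp (- c) ^ m)"
    by (rule summable_geometric, rule geometric_deriv_sums[THEN sums_summable])
  then have "summable (\<lambda>m. (41 + (1 - Q) / 2) * exp (- c) ^ m + Q / 2 * (of_nat (Suc m) * exp (- c) ^ m))"
    by (intro summable_add summable_mult)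
  moreover have "(41 + (1 - Q) / 2) * x + Q / 2 * (of_nat (Suc m) * x) = (41 + (Q * real m + 1) / 2) * x" for m and x :: real
    by (simp add: field_simps)
  ultimately show ?thesis unfolding e by (simp only:)
qed

context skew_family
begin

section \<open>Mass of heavy cells and the lower local dimension\<close>

lemma frac_HH_cell: "cell r (frac t, HH 0 q t) = (\<lfloor>frac t / r\<rfloor>, \<lfloor>HH 0 q t / r\<rfloor>)"
  by (simp add: cell_def)

text \<open>At scale \<open>r m\<close> at most \<open>9 / c m\<close> boxes have mass above
  \<open>c m\<close>, and the close-pair estimate bounds their joint mass by the summable
  \<open>a m\<close>. Off the union of these boxes over all late scales, every ball of radius
  \<open>r m\<close> has mass at most \<open>c m\<close>.\<close>

lemma small_bad_set:
  assumes F: "\<And>C. C > 0 \<Longrightarrow> Full 1 C" and S: "SRBlim \<omega>" and \<epsilon>: "0 < \<epsilon>" "\<epsilon> \<le> 1" and \<delta>: "\<delta> > 0"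
  shows "\<exists>U. open U \<and> measure \<omega> U \<le> \<delta> \<and>
     (\<forall>z. z \<notin> U \<longrightarrow> eventually (\<lambda>r. measure \<omega> (ball z r) \<le> r powr (ddim - \<epsilon>)) (at_right 0))"
proof -
  interpret prob_space \<omega> using S by (simp add: SRBlim_def)
  interpret borel_prob \<omega> by unfold_locales (use S in \<open>simp add: SRBlim_def\<close>)
  \<comment> \<open>The divisor 6 makes \<open>c m\<close> exceed
    \<open>r m * \<xi> ^ (m * p)\<close> by the factor \<open>exp (3 * \<eta> * (m * p))\<close>:
    one part of the exponent pays for the loss in the pair count, the other two give decay in the
    two terms of \<open>cells_bound\<close>.\<close>
  define \<eta> where "\<eta> = \<epsilon> * ln (1 / \<gamma>) / 6"
  have \<eta>: "\<eta> > 0" using \<epsilon> ln_inv_pos by (simp add: \<eta>_def)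
  define \<xi> where "\<xi> = max \<gamma> (1 / real b)"
  have \<xi>: "\<xi> > 0" using \<gamma>0 by (auto simp: \<xi>_def less_max_iff_disj)
  have d2: "\<delta> / 2 > 0" using \<delta> by simp
  obtain p Q where p: "p > 0" and Q: "0 \<le> Q" and
    G: "\<And>M. \<exists>G\<in>sets borel. Av (b ^ (M * p)) (\<lambda>t. of_bool (t \<notin> G)) \<le> \<delta> / 2 \<and>
     (\<forall>m\<in>{1..M}. PA (b ^ (M * p)) (\<lambda>t t'. of_bool (t \<in> G \<and> t' \<in> G \<and> \<bar>HH 0 (M * p) t - HH 0 (M * p) t'\<bar> \<le> \<gamma> ^ (m * p)))
         \<le> (Q * real m + 1) * (\<xi> * exp \<eta>) ^ (m * p))"
    using good_sets[OF F \<eta> d2] unfolding \<xi>_def by blast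
  define r where "r m = \<gamma> ^ (m * p)" for m
  have r: "r m > 0" for m using \<gamma>0 by (simp add: r_def)
  define c where "c m = r m powr (ddim - \<epsilon> / 2)" for m
  have c: "c m > 0" for m using r[of m] by (simp add: c_def)
  have ceq: "c m = r m * \<xi> ^ (m * p) * exp (3 * \<eta> * real (m * p))" for m
  proof -
    have "c m = r m powr ddim * r m powr (- (\<epsilon> / 2))" unfolding c_def by (simp add: powr_add[symmetric])
    also have "r m powr ddim = (\<gamma> powr ddim) ^ (m * p)"
      unfolding r_def using \<gamma>0 by (simp add: powr_realpow[symmetric] powr_powr mult.commute)
    also have "\<dots> = r m * \<xi> ^ (m * p)" unfolding powr_ddim \<xi>_def r_def by (simp add: power_mult_distrib)
    also have "r m powr (- (\<epsilon> / 2)) = exp (- (\<epsilon> / 2) * (real (m * p) * ln \<gamma>))"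
      using r[of m] \<gamma>0 by (simp add: powr_def r_def ln_realpow)
    also have "- (\<epsilon> / 2) * (real (m * p) * ln \<gamma>) = 3 * \<eta> * real (m * p)"
      using \<gamma>0 by (simp add: \<eta>_def ln_div)
    finally show ?thesis .
  qed
  \<comment> \<open>Bound for the mass of the heavy cells at scale \<open>m\<close>; 41 rounds up
    \<open>81 / 2\<close>, nine for the overlap of the boxes times nine for the neighbouring cells,
    halved.\<close>
  define a where "a m = (41 + (Q * real m + 1) / 2) * exp (- (\<eta> * real p) * real m)" for m
  have a0: "a m \<ge> 0" for m using Q by (simp add: a_def)
  have sa: "summable a" unfolding a_def[abs_def] using \<eta> p by (intro summable_lin_exp) simp
  obtain m0' where m0': "\<And>n. n \<ge> m0' \<Longrightarrow> norm (\<Sum>i. a (i + n)) < \<delta> / 2" using suminf_exist_split[OF d2 sa] by blast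
  define m0 where "m0 = max 1 m0'"
  have m0: "m0 \<ge> 1" "(\<Sum>i. a (i + m0)) < \<delta> / 2" using m0'[of m0] by (auto simp: m0_def)
  have tail: "sum a {m0..M} \<le> \<delta> / 2" for M
  proof -
    have sh: "summable (\<lambda>i. a (i + m0))" using sa by (rule summable_ignore_initial_segment)
    have "sum a {m0..M} = (\<Sum>i<Suc M - m0. a (i + m0))"
    proof (cases "m0 \<le> Suc M")
      case True
      then show ?thesis using sum.shift_bounds_nat_ivl[of a 0 m0 "Suc M - m0"]
        by (simp add: lessThan_atLeast0 atLeastLessThanSuc_atLeastAtMost)
    qed simp
    also have "\<dots> \<le> (\<Sum>i. a (i + m0))" by (rule sum_le_suminf[OF sh]) (use a0 in auto)
    finally show ?thesis using m0 by linarith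
  qed
  define Sm where "Sm m = {s. measure \<omega> (box3 (r m) s) > c m}" for m
  have Sf: "finite (Sm m)" "real (card (Sm m)) \<le> 9 / c m" for m
    unfolding Sm_def using card_heavy_boxes[OF r c] by auto
  define V where "V m = (\<Union>s\<in>Sm m. box3 (r m) s)" for m
  have Vo: "open (V m)" for m unfolding V_def by (intro open_UN ballI open_box3)
  have light: "measure \<omega> (ball z (r m)) \<le> c m" if "z \<notin> V m" for z m
  proof (rule ccontr)
    assume "\<not> ?thesis"
    moreover have "measure \<omega> (ball z (r m)) \<le> measure \<omega> (box3 (r m) (cell (r m) z))"
      by (intro finite_measure_mono ball_box3 r) (simp add: open_box3)
    ultimately have "cell (r m) z \<in> Sm m" by (simp add: Sm_def)
    moreover have "z \<in> box3 (r m) (cell (r m) z)" using ball_box3[OF r[of m], of z] r[of m] by (metis centre_in_ball subsetD)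
    ultimately show False using that by (auto simp: V_def)
  qed
  \<comment> \<open>The weak limit sees one fixed open set at a time, so only finitely many scales
    are united before a depth \<open>q\<close> is chosen.\<close>
  have fin: "measure \<omega> (\<Union>m\<in>{m0..M}. V m) \<le> \<delta>" for M
  proof (rule ccontr)
    assume "\<not> ?thesis"
    then have gt: "\<delta> < measure \<omega> (\<Union>m\<in>{m0..M}. V m)" by simp
    have op: "open (\<Union>m\<in>{m0..M}. V m)" using Vo by blast
    obtain q0 where q0: "\<And>q. q \<ge> q0 \<Longrightarrow> \<delta> < mu q (indicator (\<Union>m\<in>{m0..M}. V m))"
      using SRBlim_open[OF S op gt] by (auto simp: eventually_sequentially)
    \<comment> \<open>\<open>M'\<close> makes the depth a multiple of \<open>p\<close> that lies
      beyond \<open>q0\<close> and still covers all scales up to \<open>M\<close>.\<close>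
    define M' where "M' = max M q0"
    define q where "q = M' * p"
    have "q \<ge> q0" using p mult_le_mono[of q0 M' 1 p] by (auto simp: q_def M'_def)
    then have big: "\<delta> < mu q (indicator (\<Union>m\<in>{m0..M}. V m))" by (rule q0)
    obtain G where Gm: "G \<in> sets borel" and Gav: "Av (b ^ q) (\<lambda>t. of_bool (t \<notin> G)) \<le> \<delta> / 2"
      and GPA: "\<And>m. m \<in> {1..M'} \<Longrightarrow> PA (b ^ q) (\<lambda>t t'. of_bool (t \<in> G \<and> t' \<in> G \<and> \<bar>HH 0 q t - HH 0 q t'\<bar> \<le> r m))
         \<le> (Q * real m + 1) * (\<xi> * exp \<eta>) ^ (m * p)"
      using G[of M'] unfolding q_def r_def by blast
    note [measurable] = Gm
    define T where "T m t = (of_bool (t \<in> G \<and> (\<lfloor>frac t / r m\<rfloor>, \<lfloor>HH 0 q t / r m\<rfloor>) \<in> nbrs (Sm m)) :: real)" for m t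
    have mS: "Measurable.pred borel (\<lambda>t. (\<lfloor>frac t / r m\<rfloor>, \<lfloor>HH 0 q t / r m\<rfloor>) \<in> nbrs (Sm m))" for m
    proof -
      have "(\<lambda>t. (\<lfloor>frac t / r m\<rfloor>, \<lfloor>HH 0 q t / r m\<rfloor>) \<in> nbrs (Sm m)) = (\<lambda>t. \<exists>s\<in>nbrs (Sm m). \<lfloor>frac t / r m\<rfloor> = fst s \<and> \<lfloor>HH 0 q t / r m\<rfloor> = snd s)"
        by (force simp: fun_eq_iff)
      moreover have "Measurable.pred borel (\<lambda>t. \<exists>s\<in>nbrs (Sm m). \<lfloor>frac t / r m\<rfloor> = fst s \<and> \<lfloor>HH 0 q t / r m\<rfloor> = snd s)"
        using finite_nbrs[OF Sf(1)] by (intro pred_intros_finite) measurable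
      ultimately show ?thesis by simp
    qed
    have bT: "bbd (T m)" for m
    proof -
      note [measurable] = mS[of m]
      show ?thesis unfolding T_def[abs_def] by (intro bbd_of_bool) measurable
    qed
    have AvT: "Av (b ^ q) (T m) \<le> a m" if m: "m \<in> {m0..M}" for m
    proof -
      \<comment> \<open>Balances \<open>cells_bound\<close>: with this value both summands decay
        like \<open>exp (- \<eta> * (m * p))\<close>, up to a factor linear in
        \<open>m\<close>.\<close>
      define \<theta> where "\<theta> = exp (- 2 * \<eta> * real (m * p)) / \<xi> ^ (m * p)"
      have \<theta>: "\<theta> > 0" using \<xi> by (simp add: \<theta>_def)
      have mM: "m \<in> {1..M'}" using m m0 by (auto simp: M'_def)
      have "Av (b ^ q) (T m) \<le> real (card (nbrs (Sm m))) * r m / (2 * \<theta>)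
          + \<theta> / 2 * PA (b ^ q) (\<lambda>t t'. of_bool (t \<in> G \<and> t' \<in> G \<and> \<bar>HH 0 q t - HH 0 q t'\<bar> \<le> r m))"
        unfolding T_def by (rule cells_bound) (use Gm finite_nbrs[OF Sf(1)] r \<theta> in auto)
      also have "\<dots> \<le> 41 * exp (- \<eta> * real (m * p)) + (Q * real m + 1) / 2 * exp (- \<eta> * real (m * p))"
      proof (rule add_mono)
        have "real (card (nbrs (Sm m))) \<le> 9 * real (card (Sm m))"
          using card_nbrs[OF Sf(1)[of m]] by (metis of_nat_mono of_nat_mult of_nat_numeral)
        also have "\<dots> \<le> 81 / c m" using Sf(2)[of m] by simp
        finally have "real (card (nbrs (Sm m))) * r m / (2 * \<theta>) \<le> (81 / c m) * r m / (2 * \<theta>)"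
          using r[of m] \<theta> by (intro divide_right_mono mult_right_mono) auto
        also have "\<dots> = 81 / 2 * (r m * \<xi> ^ (m * p) / (c m * exp (- 2 * \<eta> * real (m * p))))"
          by (simp add: \<theta>_def)
        also have "r m * \<xi> ^ (m * p) / (c m * exp (- 2 * \<eta> * real (m * p))) = exp (- \<eta> * real (m * p))"
        proof -
          have "c m * exp (- 2 * \<eta> * real (m * p)) = r m * \<xi> ^ (m * p) * exp (\<eta> * real (m * p))"
            unfolding ceq mult.assoc exp_add[symmetric] by (simp add: algebra_simps)
          then show ?thesis using r[of m] \<xi> by (simp add: exp_minus field_simps)
        qed
        finally show "real (card (nbrs (Sm m))) * r m / (2 * \<theta>) \<le> 41 * exp (- \<eta> * real (m * p))"
          using exp_ge_zero[of "- \<eta> * real (m * p)"] by linarith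
        have "\<theta> / 2 * PA (b ^ q) (\<lambda>t t'. of_bool (t \<in> G \<and> t' \<in> G \<and> \<bar>HH 0 q t - HH 0 q t'\<bar> \<le> r m))
           \<le> \<theta> / 2 * ((Q * real m + 1) * (\<xi> * exp \<eta>) ^ (m * p))" using GPA[OF mM] \<theta> by (intro mult_left_mono) auto
        also have "\<dots> = (Q * real m + 1) / 2 * (exp (- 2 * \<eta> * real (m * p)) * exp \<eta> ^ (m * p))"
          using \<xi> by (simp add: \<theta>_def power_mult_distrib)
        also have "exp (- 2 * \<eta> * real (m * p)) * exp \<eta> ^ (m * p) = exp (- \<eta> * real (m * p))"
          unfolding exp_of_nat_mult[symmetric] exp_add[symmetric] by (simp add: algebra_simps)
        finally show "\<theta> / 2 * PA (b ^ q) (\<lambda>t t'. of_bool (t \<in> G \<and> t' \<in> G \<and> \<bar>HH 0 q t - HH 0 q t'\<bar> \<le> r m))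
           \<le> (Q * real m + 1) / 2 * exp (- \<eta> * real (m * p))" .
      qed
      also have "\<dots> = a m" by (simp add: a_def algebra_simps)
      finally show ?thesis .
    qed
    have "mu q (indicator (\<Union>m\<in>{m0..M}. V m)) \<le> Av (b ^ q) (\<lambda>t. of_bool (t \<notin> G) + (\<Sum>m\<in>{m0..M}. T m t))"
      unfolding mu_def
    proof (rule Av_mono)
      show "bbd (\<lambda>t. indicator (\<Union>m\<in>{m0..M}. V m) (frac t, HH 0 q t))"
        by (rule bbd_mu[where B=1]) (use borel_measurable_indicator[OF borel_open[OF op]] in auto)
      show "bbd (\<lambda>t. of_bool (t \<notin> G) + (\<Sum>m\<in>{m0..M}. T m t))" by (intro bbd_add bbd_sum bT bbd_of_bool) measurable
      fix t
      have Tnn: "0 \<le> T m t" for m by (simp add: T_def)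
      show "indicator (\<Union>m\<in>{m0..M}. V m) (frac t, HH 0 q t) \<le> of_bool (t \<notin> G) + (\<Sum>m\<in>{m0..M}. T m t)"
      proof (cases "t \<in> G \<and> (frac t, HH 0 q t) \<in> (\<Union>m\<in>{m0..M}. V m)")
        case True
        then obtain m s where m: "m \<in> {m0..M}" and s: "s \<in> Sm m" "(frac t, HH 0 q t) \<in> box3 (r m) s" by (auto simp: V_def)
        have "cell (r m) (frac t, HH 0 q t) \<in> nbrs {s}" by (rule box3_cell(1)[OF r s(2)])
        also have "nbrs {s} \<subseteq> nbrs (Sm m)" using s(1) unfolding nbrs_def by (intro image_mono Sigma_mono) auto
        finally have "T m t = 1" using True by (simp add: T_def frac_HH_cell)
        then have "1 \<le> (\<Sum>m\<in>{m0..M}. T m t)" using member_le_sum[of m "{m0..M}" "\<lambda>m. T m t"] m Tnn by auto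
        then show ?thesis by (simp add: indicator_def)
      next
        case False
        then show ?thesis using sum_nonneg[of "{m0..M}" "\<lambda>m. T m t"] Tnn by (auto simp: indicator_def)
      qed
    qed
    also have "\<dots> = Av (b ^ q) (\<lambda>t. of_bool (t \<notin> G)) + (\<Sum>m\<in>{m0..M}. Av (b ^ q) (T m))"
    proof -
      have 1: "bbd (\<lambda>t. of_bool (t \<notin> G))" by (intro bbd_of_bool) measurable
      show ?thesis unfolding Av_add[OF 1 bbd_sum[OF bT]] Av_sum[OF bT] ..
    qed
    also have "\<dots> \<le> \<delta> / 2 + (\<Sum>m\<in>{m0..M}. a m)" by (intro add_mono Gav sum_mono AvT)
    also have "\<dots> \<le> \<delta>" using tail[of M] by linarith
    finally show False using big by linarith
  qed
  define U where "U = (\<Union>M. \<Union>m\<in>{m0..M}. V m)"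
  have oU: "open U" unfolding U_def using Vo by blast
  have mU: "measure \<omega> U \<le> \<delta>"
  proof -
    have "range (\<lambda>M. \<Union>m\<in>{m0..M}. V m) \<subseteq> sets \<omega>" using Vo by (auto intro!: open_sets)
    moreover have "incseq (\<lambda>M. \<Union>m\<in>{m0..M}. V m)" by (rule monoI) (intro UN_mono, auto)
    ultimately have "(\<lambda>M. measure \<omega> (\<Union>m\<in>{m0..M}. V m)) \<longlonglongrightarrow> measure \<omega> U"
      unfolding U_def by (rule finite_Lim_measure_incseq)
    then show ?thesis by (rule LIMSEQ_le_const2) (use fin in auto)
  qed
  have ev: "eventually (\<lambda>\<rho>. measure \<omega> (ball z \<rho>) \<le> \<rho> powr (ddim - \<epsilon>)) (at_right 0)" if z: "z \<notin> U" for z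
  proof -
    define e where "e = ddim - \<epsilon> / 2"
    have e: "e > 0" using \<epsilon> ddim_gt1 by (simp add: e_def)
    have lt: "measure \<omega> (ball z (r m)) \<le> r m powr e" if "m \<ge> m0" for m
    proof -
      have "m \<in> {m0..m}" using that by simp
      then have "z \<notin> V m" using z unfolding U_def by blast
      then show ?thesis using light[of z m] by (simp add: c_def e_def)
    qed
    define g where "g = \<gamma> ^ p"
    have g: "0 < g" "g < 1" using \<gamma>0 \<gamma>1 p by (auto simp: g_def power_less_one_iff)
    have rg: "r m = g ^ m" for m by (simp add: r_def g_def power_mult[symmetric] mult.commute)
    define A where "A = g powr e"
    have A: "A > 0" using g by (simp add: A_def)
    have "eventually (\<lambda>\<rho>. \<rho> powr ((e - \<epsilon> / 2) + \<epsilon> / 2) \<le> A * \<rho> powr (e - \<epsilon> / 2)) (at_right 0)"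
      by (rule powr_eventually_le) (use \<epsilon> A in auto)
    moreover have "eventually (\<lambda>\<rho>. \<rho> < r m0) (at_right (0::real))"
      using r[of m0] by (intro eventually_at_rightI[of 0]) auto
    moreover have "eventually (\<lambda>\<rho>::real. \<rho> > 0) (at_right 0)" by (simp add: eventually_at_right_less)
    ultimately show ?thesis
    proof eventually_elim
      case (elim \<rho>)
      obtain n where n: "n \<ge> 1" "r m0 * g ^ n \<le> \<rho>" "\<rho> < r m0 * g ^ (n - 1)"
        using scale_between[OF g, of \<rho> "r m0"] elim by auto
      have rn: "r (m0 + (n - 1)) = r m0 * g ^ (n - 1)" by (simp add: rg power_add)
      have "measure \<omega> (ball z \<rho>) \<le> measure \<omega> (ball z (r (m0 + (n - 1))))"
        using n(3) rn by (intro finite_measure_mono) auto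
      also have "\<dots> \<le> r (m0 + (n - 1)) powr e" by (rule lt) simp
      also have "\<dots> \<le> (\<rho> / g) powr e"
      proof (rule powr_mono2)
        have "r m0 * g ^ (n - 1) * g \<le> \<rho>" using n by (simp add: mult.assoc flip: power_Suc2)
        then show "r (m0 + (n - 1)) \<le> \<rho> / g" using g rn by (simp add: field_simps)
      qed (use e r[of "m0 + (n - 1)"] in auto)
      also have "\<dots> = \<rho> powr e / A" using g elim by (simp add: A_def powr_divide)
      also have "\<dots> \<le> \<rho> powr (e - \<epsilon> / 2)" using elim(1) A by (simp add: field_simps)
      also have "e - \<epsilon> / 2 = ddim - \<epsilon>" by (simp add: e_def)
      finally show ?case .
    qed
  qed
  show ?thesis using oU mU ev by blast
qed

text \<open>Bad sets of mass at most \<open>1 / Suc n\<close> are intersected to a null set; a point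
  off the intersection is good for one of them, which suffices.\<close>

lemma lower_local_dim:
  assumes F: "\<And>C. C > 0 \<Longrightarrow> Full 1 C" and S: "SRBlim \<omega>" and \<epsilon>: "0 < \<epsilon>"
  shows "AE z in \<omega>. eventually (\<lambda>r. measure \<omega> (ball z r) \<le> r powr (ddim - \<epsilon>)) (at_right 0)"
proof -
  interpret prob_space \<omega> using S by (simp add: SRBlim_def)
  interpret borel_prob \<omega> by unfold_locales (use S in \<open>simp add: SRBlim_def\<close>)
  define e where "e = min \<epsilon> 1"
  have e: "0 < e" "e \<le> 1" "e \<le> \<epsilon>" using \<epsilon> by (auto simp: e_def)
  have "\<exists>U. open U \<and> measure \<omega> U \<le> 1 / real (Suc n) \<and>
     (\<forall>z. z \<notin> U \<longrightarrow> eventually (\<lambda>r. measure \<omega> (ball z r) \<le> r powr (ddim - e)) (at_right 0))" for n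
    by (rule small_bad_set[OF F S e(1,2)]) auto
  then obtain U where U: "\<And>n. open (U n)" "\<And>n. measure \<omega> (U n) \<le> 1 / real (Suc n)"
    "\<And>n z. z \<notin> U n \<Longrightarrow> eventually (\<lambda>r. measure \<omega> (ball z r) \<le> r powr (ddim - e)) (at_right 0)"
    by metis
  have Im: "(\<Inter>n. U n) \<in> sets \<omega>" using U(1) by (intro sets.countable_INT) (auto intro: open_sets)
  have "measure \<omega> (\<Inter>n. U n) \<le> 1 / real (Suc n)" for n
  proof -
    have "measure \<omega> (\<Inter>n. U n) \<le> measure \<omega> (U n)" using U(1) by (intro finite_measure_mono) (auto intro: open_sets)
    then show ?thesis using U(2)[of n] by linarith
  qed
  moreover have "(\<lambda>n. 1 / real (Suc n)) \<longlonglongrightarrow> 0" using LIMSEQ_inverse_real_of_nat by (simp add: inverse_eq_divide)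
  ultimately have "measure \<omega> (\<Inter>n. U n) \<le> 0" by (intro LIMSEQ_le_const[of "\<lambda>n. 1 / real (Suc n)"]) auto
  then have "measure \<omega> (\<Inter>n. U n) = 0" using measure_nonneg[of \<omega> "\<Inter>n. U n"] by linarith
  then have "(\<Inter>n. U n) \<in> null_sets \<omega>" using Im by (simp add: null_sets_def emeasure_eq_measure)
  then have "AE z in \<omega>. z \<notin> (\<Inter>n. U n)" by (rule AE_not_in)
  then show ?thesis
  proof eventually_elim
    case (elim z)
    then obtain n where "z \<notin> U n" by blast
    from U(3)[OF this] have "eventually (\<lambda>r. measure \<omega> (ball z r) \<le> r powr (ddim - e)) (at_right 0)" .
    moreover have "eventually (\<lambda>r::real. r > 0) (at_right 0)" by (simp add: eventually_at_right_less)
    moreover have "eventually (\<lambda>r::real. r < 1) (at_right 0)" by (intro eventually_at_rightI[of 0 1]) auto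
    ultimately show ?case
    proof eventually_elim
      case (elim r)
      have "r powr (ddim - e) \<le> r powr (ddim - \<epsilon>)" using elim e by (intro powr_mono') auto
      then show ?case using elim(1) by linarith
    qed
  qed
qed

end

section \<open>Real analytic functions\<close>

lemma diffs_iterate: "(diffs ^^ j) a n = fact (n + j) / fact n * a (n + j)" for a :: "nat \<Rightarrow> real"
proof (induction j arbitrary: n)
  case (Suc j)
  have "(diffs ^^ Suc j) a n = real (Suc n) * (diffs ^^ j) a (Suc n)" by (simp add: diffs_def)
  also have "\<dots> = real (Suc n) * (fact (Suc n + j) / fact (Suc n) * a (Suc n + j))" by (simp only: Suc)
  also have "\<dots> = fact (n + Suc j) / fact n * a (n + Suc j)"
    by (simp only: fact_Suc[of n] add_Suc add_Suc_right) (simp del: of_nat_Suc fact_Suc)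
  finally show ?case .
qed simp

lemma fact_ratio_le: "fact (n + j) / fact n \<le> (fact j * 2 ^ (n + j) :: real)"
proof -
  have "fact n * fact j * ((n + j) choose n) = (fact (n + j) :: nat)"
    using binomial_fact_lemma[of n "n + j"] by simp
  then have "real (fact n * fact j * ((n + j) choose n)) = real (fact (n + j))" by (simp only:)
  then have "fact (n + j) / fact n = fact j * real ((n + j) choose n)" by (simp add: field_simps)
  also have "\<dots> \<le> fact j * 2 ^ (n + j)"
  proof (rule mult_left_mono)
    have "((n + j) choose n) \<le> 2 ^ (n + j)" by (rule binomial_le_pow2)
    then show "real ((n + j) choose n) \<le> 2 ^ (n + j)" by (metis of_nat_le_iff of_nat_numeral of_nat_power)
  qed simp
  finally show ?thesis .
qed

text \<open>Termwise differentiation with \<open>diffs\<close> iterated. As \<open>deriv\<close> at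
  \<open>y\<close> depends only on values near \<open>y\<close>, the local expansion determines all
  iterated derivatives on its interval.\<close>

lemma power_series_local_derivs:
  fixes \<phi> :: "real \<Rightarrow> real"
  assumes r: "r > 0" and s: "\<And>y. \<bar>y - x0\<bar> < r \<Longrightarrow> (\<lambda>n. a n * (y - x0) ^ n) sums \<phi> y"
  shows "\<bar>y - x0\<bar> < r \<Longrightarrow> (\<lambda>n. (diffs ^^ j) a n * (y - x0) ^ n) sums (deriv ^^ j) \<phi> y"
    and "\<bar>y - x0\<bar> < r \<Longrightarrow> ((deriv ^^ j) \<phi> has_real_derivative (deriv ^^ Suc j) \<phi> y) (at y)"
proof -
  have step: "((deriv ^^ j) \<phi> has_real_derivative (\<Sum>n. diffs ((diffs ^^ j) a) n * (y - x0) ^ n)) (at y)"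
    if IH: "\<And>y. \<bar>y - x0\<bar> < r \<Longrightarrow> (\<lambda>n. (diffs ^^ j) a n * (y - x0) ^ n) sums (deriv ^^ j) \<phi> y" and y: "\<bar>y - x0\<bar> < r" for j y
  proof -
    let ?c = "(diffs ^^ j) a"
    have sm: "summable (\<lambda>n. ?c n * z ^ n)" if "norm z < r" for z
      using IH[of "x0 + z"] that by (auto dest: sums_summable)
    have "((\<lambda>z. \<Sum>n. ?c n * z ^ n) has_real_derivative (\<Sum>n. diffs ?c n * (y - x0) ^ n)) (at (y - x0))"
      by (rule termdiffs_strong'[where K=r]) (use sm y in auto)
    then have "((\<lambda>y. \<Sum>n. ?c n * (y - x0) ^ n) has_real_derivative (\<Sum>n. diffs ?c n * (y - x0) ^ n) * 1) (at y)"
      by (rule DERIV_chain2) (auto intro!: derivative_eq_intros)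
    then have d: "((\<lambda>y. \<Sum>n. ?c n * (y - x0) ^ n) has_real_derivative (\<Sum>n. diffs ?c n * (y - x0) ^ n)) (at y)" by simp
    show ?thesis
    proof (rule has_field_derivative_transform_within_open[OF d])
      show "open (ball x0 r)" "y \<in> ball x0 r" using y by (auto simp: dist_real_def abs_minus_commute)
      fix x assume "x \<in> ball x0 r"
      then have "\<bar>x - x0\<bar> < r" by (auto simp: dist_real_def abs_minus_commute)
      from IH[OF this] show "(\<Sum>n. ?c n * (x - x0) ^ n) = (deriv ^^ j) \<phi> x" by (simp add: sums_iff)
    qed
  qed
  have all: "\<forall>y. \<bar>y - x0\<bar> < r \<longrightarrow> (\<lambda>n. (diffs ^^ j) a n * (y - x0) ^ n) sums (deriv ^^ j) \<phi> y" for j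
  proof (induction j)
    case 0
    then show ?case using s by simp
  next
    case (Suc j)
    show ?case
    proof (intro allI impI)
      fix y assume y: "\<bar>y - x0\<bar> < r"
      have "(deriv ^^ Suc j) \<phi> y = (\<Sum>n. diffs ((diffs ^^ j) a) n * (y - x0) ^ n)"
        using step[of j y] Suc y by (auto intro: DERIV_imp_deriv)
      moreover have "summable (\<lambda>n. diffs ((diffs ^^ j) a) n * (y - x0) ^ n)"
      proof (rule termdiff_converges[where K=r])
        show "summable (\<lambda>n. (diffs ^^ j) a n * z ^ n)" if "norm z < r" for z
          using Suc[rule_format, of "x0 + z"] that by (auto dest: sums_summable)
      qed (use y in simp)
      ultimately show "(\<lambda>n. (diffs ^^ Suc j) a n * (y - x0) ^ n) sums (deriv ^^ Suc j) \<phi> y"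
        by (simp add: summable_sums)
    qed
  qed
  then show "\<bar>y - x0\<bar> < r \<Longrightarrow> (\<lambda>n. (diffs ^^ j) a n * (y - x0) ^ n) sums (deriv ^^ j) \<phi> y" by blast
  assume y: "\<bar>y - x0\<bar> < r"
  have d: "((deriv ^^ j) \<phi> has_real_derivative (\<Sum>n. diffs ((diffs ^^ j) a) n * (y - x0) ^ n)) (at y)"
    using step[of j y] all y by blast
  then show "((deriv ^^ j) \<phi> has_real_derivative (deriv ^^ Suc j) \<phi> y) (at y)"
    using DERIV_imp_deriv[OF d] by simp
qed

lemma analytic_deriv:
  assumes "real_analytic_on \<phi> UNIV"
  shows "((deriv ^^ j) \<phi> has_real_derivative (deriv ^^ Suc j) \<phi> y) (at y)"
proof -
  obtain r a where r: "r > 0" "\<And>z. \<bar>z - y\<bar> < r \<Longrightarrow> (\<lambda>n. a n * (z - y) ^ n) sums \<phi> z"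
    using assms unfolding real_analytic_on_def by blast
  show ?thesis by (rule power_series_local_derivs(2)[OF r]) (use r in auto)
qed

text \<open>Cauchy estimates in a real variable: the coefficients are at most
  \<open>A / \<rho> ^ n\<close> in modulus, and on \<open>ball x0 (\<rho> / 4)\<close> the factor
  \<open>2 ^ (n + j)\<close> from the quotient of factorials still leaves a geometric series of
  ratio 1/2.\<close>

lemma analytic_local_bound:
  assumes "real_analytic_on \<phi> UNIV"
  shows "\<exists>\<rho>>0. \<exists>K\<ge>0. \<exists>R>0. \<forall>y\<in>ball x0 \<rho>. \<forall>j. \<bar>(deriv ^^ j) \<phi> y\<bar> \<le> K * fact j / R ^ j"
proof -
  obtain r a where r: "r > 0" "\<And>z. \<bar>z - x0\<bar> < r \<Longrightarrow> (\<lambda>n. a n * (z - x0) ^ n) sums \<phi> z"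
    using assms unfolding real_analytic_on_def by blast
  define \<rho> where "\<rho> = r / 2"
  have \<rho>: "\<rho> > 0" "\<rho> < r" using r by (auto simp: \<rho>_def)
  have "summable (\<lambda>n. a n * \<rho> ^ n)" using r(2)[of "x0 + \<rho>"] \<rho> by (auto dest: sums_summable)
  then have "Bseq (\<lambda>n. a n * \<rho> ^ n)" using summable_LIMSEQ_zero convergent_imp_Bseq convergentI by blast
  then obtain A where A: "A > 0" "\<And>n. norm (a n * \<rho> ^ n) \<le> A" by (auto simp: Bseq_def)
  have an: "\<bar>a n\<bar> \<le> A / \<rho> ^ n" for n using A(2)[of n] \<rho> by (simp add: abs_mult field_simps)
  have "\<bar>(deriv ^^ j) \<phi> y\<bar> \<le> (2 * A) * fact j / (\<rho> / 2) ^ j" if y: "y \<in> ball x0 (\<rho> / 4)" for y j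
  proof -
    have y': "\<bar>y - x0\<bar> < \<rho> / 4" using y by (auto simp: dist_real_def abs_minus_commute)
    have "\<bar>y - x0\<bar> < r" using y' \<rho> by linarith
    from power_series_local_derivs(1)[OF r this, of j]
    have sums: "(\<lambda>n. (diffs ^^ j) a n * (y - x0) ^ n) sums (deriv ^^ j) \<phi> y" .
    have term_le: "norm ((diffs ^^ j) a n * (y - x0) ^ n) \<le> A * fact j / (\<rho> / 2) ^ j * (1 / 2) ^ n" for n
    proof -
      have "norm ((diffs ^^ j) a n * (y - x0) ^ n) = (fact (n + j) / fact n) * \<bar>a (n + j)\<bar> * \<bar>y - x0\<bar> ^ n"
        by (simp add: diffs_iterate abs_mult power_abs)
      also have "\<dots> \<le> (fact j * 2 ^ (n + j)) * (A / \<rho> ^ (n + j)) * (\<rho> / 4) ^ n"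
        using fact_ratio_le[of n j] an[of "n + j"] y' A \<rho>
        by (intro mult_mono power_mono) (auto intro!: mult_nonneg_nonneg)
      also have "\<dots> = A * fact j / (\<rho> / 2) ^ j * (1 / 2) ^ n"
      proof -
        have "(4::real) ^ n = 2 ^ n * 2 ^ n" by (simp flip: power_mult_distrib)
        then show ?thesis using \<rho> by (simp add: power_add power_divide field_simps)
      qed
      finally show ?thesis .
    qed
    have geo: "(\<lambda>n. A * fact j / (\<rho> / 2) ^ j * (1 / 2) ^ n) sums (A * fact j / (\<rho> / 2) ^ j * 2)"
      using geometric_sums[of "1/2::real"] by (intro sums_mult) simp
    have "norm (\<Sum>n. (diffs ^^ j) a n * (y - x0) ^ n) \<le> (\<Sum>n. A * fact j / (\<rho> / 2) ^ j * (1 / 2) ^ n)"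
      by (rule norm_suminf_le[OF term_le sums_summable[OF geo]])
    then show ?thesis unfolding sums_unique[OF sums, symmetric] sums_unique[OF geo, symmetric] by (simp add: mult.commute mult.left_commute)
  qed
  then show ?thesis using A(1) \<rho> by (intro exI[of _ "\<rho> / 4"] conjI exI[of _ "2 * A"] exI[of _ "\<rho> / 2"]) auto
qed

text \<open>Compactness: finitely many local estimates suffice, with the constants \<open>K\<close>
  added and the radii \<open>R\<close> minimised.\<close>

lemma analytic_unit_bound:
  assumes an: "real_analytic_on \<phi> UNIV"
  shows "\<exists>K R. R > 0 \<and> (\<forall>y\<in>{0..1}. \<forall>j. \<bar>(deriv ^^ j) \<phi> y\<bar> \<le> K * fact j / R ^ j)"
proof -
  obtain \<rho> K R where *: "\<And>x. \<rho> x > 0" "\<And>x. K x \<ge> 0" "\<And>x. R x > 0"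
    "\<And>x y j. y \<in> ball x (\<rho> x) \<Longrightarrow> \<bar>(deriv ^^ j) \<phi> y\<bar> \<le> K x * fact j / R x ^ j"
    using analytic_local_bound[OF an] by metis
  obtain T where T: "T \<subseteq> {0..1::real}" "finite T" "{0..1::real} \<subseteq> (\<Union>x\<in>T. ball x (\<rho> x))"
  proof (rule compactE_image[of "{0..1::real}" "{0..1}" "\<lambda>x. ball x (\<rho> x)"])
    show "{0..1} \<subseteq> (\<Union>x\<in>{0..1}. ball x (\<rho> x))" using *(1) by auto
  qed (use that in auto)
  have Tne: "T \<noteq> {}" using T(3) by auto
  define K' where "K' = (\<Sum>x\<in>T. K x)"
  define R' where "R' = Min (R ` T)"
  have R': "R' > 0" unfolding R'_def using T Tne *(3) by (subst Min_gr_iff) auto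
  have "\<bar>(deriv ^^ j) \<phi> y\<bar> \<le> K' * fact j / R' ^ j" if "y \<in> {0..1}" for y j
  proof -
    obtain x where x: "x \<in> T" "y \<in> ball x (\<rho> x)" using T(3) \<open>y \<in> {0..1}\<close> by blast
    have "\<bar>(deriv ^^ j) \<phi> y\<bar> \<le> K x * fact j / R x ^ j" by (rule *(4)[OF x(2)])
    also have "\<dots> \<le> K' * fact j / R' ^ j"
    proof (rule frac_le)
      have "K x \<le> K'" unfolding K'_def using x T *(2) by (intro member_le_sum) auto
      then show "K x * fact j \<le> K' * fact j" by (intro mult_right_mono) auto
      show "0 \<le> K' * fact j" unfolding K'_def using *(2) by (intro mult_nonneg_nonneg sum_nonneg) auto
      show "0 < R' ^ j" using R' by simp
      show "R' ^ j \<le> R x ^ j" using R' x T by (intro power_mono) (auto simp: R'_def)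
    qed
    finally show ?thesis .
  qed
  then show ?thesis using R' by blast
qed

lemma deriv_periodic:
  assumes an: "real_analytic_on \<phi> UNIV" and per: "\<And>x. \<phi> (x + 1) = \<phi> x"
  shows "(deriv ^^ j) \<phi> (t + 1) = (deriv ^^ j) \<phi> t"
proof (induction j arbitrary: t)
  case (Suc j)
  have "((\<lambda>t. (deriv ^^ j) \<phi> (t + 1)) has_real_derivative (deriv ^^ Suc j) \<phi> (t + 1) * 1) (at t)"
    by (rule DERIV_chain2[OF analytic_deriv[OF an]]) (auto intro!: derivative_eq_intros)
  then have "((deriv ^^ j) \<phi> has_real_derivative (deriv ^^ Suc j) \<phi> (t + 1)) (at t)" by (simp add: Suc)
  then show ?case using analytic_deriv[OF an, of j t] by (rule DERIV_unique)
qed (use per in simp)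

lemma analytic_periodic_bound:
  assumes an: "real_analytic_on \<phi> UNIV" and per: "\<And>x. \<phi> (x + 1) = \<phi> x"
  shows "\<exists>K R. R > 0 \<and> (\<forall>y j. \<bar>(deriv ^^ j) \<phi> y\<bar> \<le> K * fact j / R ^ j)"
proof -
  obtain K R where KR: "R > 0" "\<And>y j. y \<in> {0..1} \<Longrightarrow> \<bar>(deriv ^^ j) \<phi> y\<bar> \<le> K * fact j / R ^ j"
    using analytic_unit_bound[OF an] by blast
  have "(deriv ^^ j) \<phi> y = (deriv ^^ j) \<phi> (frac y)" for y j
  proof (cases "y \<ge> 0")
    case True
    have "y = frac y + 1 * real (nat \<lfloor>y\<rfloor>)" using True by (simp add: frac_def)
    then show ?thesis using periodic_mult_nat[of "(deriv ^^ j) \<phi>" 1 "frac y" "nat \<lfloor>y\<rfloor>"] deriv_periodic[OF an per] by metis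
  next
    case False
    have "frac y = y + 1 * real (nat (- \<lfloor>y\<rfloor>))" using False by (simp add: frac_def)
    then show ?thesis using periodic_mult_nat[of "(deriv ^^ j) \<phi>" 1 y "nat (- \<lfloor>y\<rfloor>)"] deriv_periodic[OF an per] by metis
  qed
  moreover have "frac y \<in> {0..1}" for y :: real using frac_lt_1[of y] by simp
  ultimately have "\<forall>y j. \<bar>(deriv ^^ j) \<phi> y\<bar> \<le> K * fact j / R ^ j" using KR(2) by metis
  then show ?thesis using KR(1) by blast
qed

lemma taylor_remainder:
  fixes f :: "nat \<Rightarrow> real \<Rightarrow> real"
  assumes der: "\<And>j t. (f j has_real_derivative f (Suc j) t) (at t)" and bd: "\<And>j t. \<bar>f j t\<bar> \<le> B j"
  shows "\<bar>f i (s + h) - (\<Sum>m<n. f (i + m) s / fact m * h ^ m)\<bar> \<le> B (i + n) * \<bar>h\<bar> ^ n / fact n"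
proof -
  have d: "((\<lambda>x. f j (s + x)) has_real_derivative f (Suc j) (s + x)) (at x)" for j x
  proof -
    have "((\<lambda>x. f j (s + x)) has_real_derivative f (Suc j) (s + x) * 1) (at x)"
      by (rule DERIV_chain2[OF der]) (auto intro!: derivative_eq_intros)
    then show ?thesis by simp
  qed
  obtain t where t: "f i (s + h) = (\<Sum>m<n. f (i + m) (s + 0) / fact m * h ^ m) + f (i + n) (s + t) / fact n * h ^ n"
    using Maclaurin_all_le[of "\<lambda>m x. f (i + m) (s + x)" "\<lambda>x. f i (s + x)" h n] d by auto
  then have "\<bar>f i (s + h) - (\<Sum>m<n. f (i + m) s / fact m * h ^ m)\<bar> = \<bar>f (i + n) (s + t)\<bar> * \<bar>h\<bar> ^ n / fact n"
    by (simp add: abs_mult power_abs)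
  also have "\<dots> \<le> B (i + n) * \<bar>h\<bar> ^ n / fact n" by (intro divide_right_mono mult_right_mono bd) auto
  finally show ?thesis .
qed

text \<open>Converse of the Cauchy estimates: the Taylor remainder at distance \<open>h\<close> is
  at most \<open>K * (\<bar>h\<bar> / R) ^ n\<close>.\<close>

lemma analytic_from_bounds:
  fixes f :: "nat \<Rightarrow> real \<Rightarrow> real"
  assumes der: "\<And>j t. (f j has_real_derivative f (Suc j) t) (at t)" and bd: "\<And>j t. \<bar>f j t\<bar> \<le> K * fact j / R ^ j" and R: "R > 0"
  shows "real_analytic_on (f 0) UNIV"
  unfolding real_analytic_on_def
proof (intro ballI exI conjI allI impI)
  fix x0 :: real
  show "R > 0" by (rule R)
  fix y assume y: "\<bar>y - x0\<bar> < R"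
  let ?h = "y - x0"
  have "(\<lambda>n. f 0 y - (\<Sum>m<n. f m x0 / fact m * ?h ^ m)) \<longlonglongrightarrow> 0"
  proof (rule Lim_null_comparison)
    show "\<forall>\<^sub>F n in sequentially. norm (f 0 y - (\<Sum>m<n. f m x0 / fact m * ?h ^ m)) \<le> K * (\<bar>?h\<bar> / R) ^ n"
    proof (rule always_eventually, rule allI)
      fix n
      have "\<bar>f 0 y - (\<Sum>m<n. f m x0 / fact m * ?h ^ m)\<bar> \<le> (K * fact n / R ^ n) * \<bar>?h\<bar> ^ n / fact n"
        using taylor_remainder[of f "\<lambda>j. K * fact j / R ^ j" 0 x0 ?h n, OF der bd] by simp
      then show "norm (f 0 y - (\<Sum>m<n. f m x0 / fact m * ?h ^ m)) \<le> K * (\<bar>?h\<bar> / R) ^ n" by (simp add: power_divide)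
    qed
    have "(\<lambda>n. K * (\<bar>?h\<bar> / R) ^ n) \<longlonglongrightarrow> K * 0" using y R by (intro tendsto_intros LIMSEQ_power_zero) auto
    then show "(\<lambda>n. K * (\<bar>?h\<bar> / R) ^ n) \<longlonglongrightarrow> 0" by simp
  qed
  then have "(\<lambda>n. \<Sum>m<n. f m x0 / fact m * ?h ^ m) \<longlonglongrightarrow> f 0 y"
    using tendsto_diff[OF tendsto_const[of "f 0 y"]] by fastforce
  then show "(\<lambda>n. f n x0 / fact n * (y - x0) ^ n) sums f 0 y" by (simp add: sums_def)
qed

section \<open>From separation of branches to separation of jets\<close>

text \<open>A class of analytic functions with common Cauchy bounds. The differences of two branches
  all belong to it with the same constants, which makes the propagation below uniform in the depth
  and in the pair.\<close>

definition jet_bounded :: "real \<Rightarrow> real \<Rightarrow> (nat \<Rightarrow> real \<Rightarrow> real) \<Rightarrow> bool" where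
  "jet_bounded K R D \<longleftrightarrow> (\<forall>j t. (D j has_real_derivative D (Suc j) t) (at t)) \<and> (\<forall>j t. \<bar>D j t\<bar> \<le> K * fact j / R ^ j)"

lemma sum_exp_bound:
  fixes x :: real assumes "x \<ge> 0"
  shows "(\<Sum>m<n. x ^ m / fact m) \<le> exp x"
proof -
  have s: "(\<lambda>m. x ^ m / fact m) sums exp x" using exp_converges[of x] by (simp add: divide_inverse mult.commute scaleR_conv_of_real)
  show ?thesis using sum_le_suminf[of "\<lambda>m. x ^ m / fact m" "{..<n}"] s assms by (auto simp: sums_iff)
qed

text \<open>Quantitative unique continuation: the Taylor polynomial at \<open>s\<close> is small
  because the jet is, and for \<open>\<bar>h\<bar> \<le> R / 4\<close> the remainder is at most
  \<open>B * (1 / 2) ^ n\<close>. The order \<open>N' + n\<close> and the smallness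
  \<open>\<eta>\<close> depend only on the class.\<close>

lemma jets_step:
  assumes R: "R > 0" and \<eta>': "\<eta>' > 0" and K: "K \<ge> 0"
  shows "\<exists>N. \<exists>\<eta>>0. \<forall>D s. jet_bounded K R D \<longrightarrow> (\<forall>j\<le>N. \<bar>D j s\<bar> \<le> \<eta>) \<longrightarrow> (\<forall>h. \<bar>h\<bar> \<le> R / 4 \<longrightarrow> (\<forall>i\<le>N'. \<bar>D i (s + h)\<bar> \<le> \<eta>'))"
proof -
  define B where "B = (\<Sum>i\<le>N'. K * fact i * (2 / R) ^ i)"
  have Bi: "K * fact i * (2 / R) ^ i \<le> B" if "i \<le> N'" for i
    unfolding B_def using that K R by (intro member_le_sum) auto
  have "(\<lambda>n. B * (1 / 2) ^ n) \<longlonglongrightarrow> B * 0" by (intro tendsto_intros LIMSEQ_power_zero) auto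
  then have "eventually (\<lambda>n. B * (1 / 2) ^ n < \<eta>' / 2) sequentially" by (rule order_tendstoD) (use \<eta>' in simp)
  then obtain n where n: "B * (1 / 2) ^ n < \<eta>' / 2" by (auto simp: eventually_sequentially)
  \<comment> \<open>The Taylor polynomial is bounded by \<open>\<eta>\<close> times a partial sum of
    the series for \<open>exp (R / 4)\<close>.\<close>
  define \<eta> where "\<eta> = \<eta>' / 2 / exp (R / 4)"
  have \<eta>: "\<eta> > 0" using \<eta>' by (simp add: \<eta>_def)
  have "\<bar>D i (s + h)\<bar> \<le> \<eta>'" if D: "jet_bounded K R D" and J: "\<forall>j\<le>N' + n. \<bar>D j s\<bar> \<le> \<eta>" and h: "\<bar>h\<bar> \<le> R / 4" and i: "i \<le> N'" for D s h i
  proof -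
    have der: "(D j has_real_derivative D (Suc j) t) (at t)" and bd: "\<bar>D j t\<bar> \<le> K * fact j / R ^ j" for j t
      using D by (auto simp: jet_bounded_def)
    have rem: "\<bar>D i (s + h) - (\<Sum>m<n. D (i + m) s / fact m * h ^ m)\<bar> \<le> (K * fact (i + n) / R ^ (i + n)) * \<bar>h\<bar> ^ n / fact n"
      by (rule taylor_remainder[of D "\<lambda>j. K * fact j / R ^ j", OF der bd])
    have "(K * fact (i + n) / R ^ (i + n)) * \<bar>h\<bar> ^ n / fact n = K * (fact (n + i) / fact n) * \<bar>h\<bar> ^ n / R ^ (i + n)"
      by (simp add: add.commute)
    also have "\<dots> \<le> K * (fact i * 2 ^ (n + i)) * (R / 4) ^ n / R ^ (i + n)"
      using fact_ratio_le[of n i] h K R by (intro divide_right_mono mult_mono power_mono) auto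
    also have "\<dots> = K * fact i * (2 / R) ^ i * (1 / 2) ^ n"
    proof -
      have "(4::real) ^ n = 2 ^ n * 2 ^ n" by (simp flip: power_mult_distrib)
      then show ?thesis using R by (simp add: power_add power_divide field_simps)
    qed
    also have "\<dots> \<le> B * (1 / 2) ^ n" using Bi[OF i] by (intro mult_right_mono) auto
    finally have 1: "\<bar>D i (s + h) - (\<Sum>m<n. D (i + m) s / fact m * h ^ m)\<bar> \<le> \<eta>' / 2" using rem n by linarith
    have "\<bar>\<Sum>m<n. D (i + m) s / fact m * h ^ m\<bar> \<le> (\<Sum>m<n. \<eta> * ((R / 4) ^ m / fact m))"
    proof (rule order_trans[OF sum_abs sum_mono])
      fix m assume "m \<in> {..<n}"
      then have "\<bar>D (i + m) s\<bar> \<le> \<eta>" using J i by auto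
      then have "\<bar>D (i + m) s\<bar> * \<bar>h\<bar> ^ m \<le> \<eta> * (R / 4) ^ m" using h \<eta> by (intro mult_mono power_mono) auto
      then show "\<bar>D (i + m) s / fact m * h ^ m\<bar> \<le> \<eta> * ((R / 4) ^ m / fact m)"
        by (simp add: abs_mult power_abs divide_right_mono)
    qed
    also have "\<dots> = \<eta> * (\<Sum>m<n. (R / 4) ^ m / fact m)" by (simp add: sum_distrib_left)
    also have "\<dots> \<le> \<eta> * exp (R / 4)" using \<eta> R by (intro mult_left_mono sum_exp_bound) auto
    also have "\<dots> = \<eta>' / 2" by (simp add: \<eta>_def)
    finally show ?thesis using 1 by linarith
  qed
  then show ?thesis using \<eta> by (intro exI[of _ "N' + n"] exI[of _ \<eta>]) blast
qed

text \<open>A chain of \<open>L\<close> steps. Each one asks for a higher order and a smaller jet at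
  its starting point, so the constants are chosen backwards from the end of the chain.\<close>

lemma jets_propagate:
  assumes R: "R > 0" and K: "K \<ge> 0" and \<eta>': "\<eta>' > 0"
  shows "\<exists>N. \<exists>\<eta>>0. \<forall>D s. jet_bounded K R D \<longrightarrow> (\<forall>j\<le>N. \<bar>D j s\<bar> \<le> \<eta>) \<longrightarrow> (\<forall>h. \<bar>h\<bar> \<le> real L * (R / 4) \<longrightarrow> (\<forall>i\<le>N'. \<bar>D i (s + h)\<bar> \<le> \<eta>'))"
  using \<eta>'
proof (induction L arbitrary: N' \<eta>')
  case 0
  then show ?case by (intro exI[of _ N'] exI[of _ \<eta>']) auto
next
  case (Suc L)
  obtain N1 \<eta>1 where 1: "\<eta>1 > 0" "\<And>D s h i. jet_bounded K R D \<Longrightarrow> (\<forall>j\<le>N1. \<bar>D j s\<bar> \<le> \<eta>1) \<Longrightarrow> \<bar>h\<bar> \<le> R / 4 \<Longrightarrow> i \<le> N' \<Longrightarrow> \<bar>D i (s + h)\<bar> \<le> \<eta>'"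
    using jets_step[OF R Suc.prems K, of N'] by blast
  obtain N2 \<eta>2 where 2: "\<eta>2 > 0" "\<And>D s h i. jet_bounded K R D \<Longrightarrow> (\<forall>j\<le>N2. \<bar>D j s\<bar> \<le> \<eta>2) \<Longrightarrow> \<bar>h\<bar> \<le> real L * (R / 4) \<Longrightarrow> i \<le> N1 \<Longrightarrow> \<bar>D i (s + h)\<bar> \<le> \<eta>1"
    using Suc.IH[OF 1(1), of N1] by blast
  have "\<bar>D i (s + h)\<bar> \<le> \<eta>'" if D: "jet_bounded K R D" and J: "\<forall>j\<le>N2. \<bar>D j s\<bar> \<le> \<eta>2" and h: "\<bar>h\<bar> \<le> real (Suc L) * (R / 4)" and i: "i \<le> N'" for D s h i
  proof -
    define h1 where "h1 = h * (real L / real (Suc L))"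
    define h2 where "h2 = h / real (Suc L)"
    have hh: "h = h1 + h2"
    proof -
      have "h1 + h2 = h * ((real L + 1) / real (Suc L))" by (simp add: h1_def h2_def add_divide_distrib distrib_left)
      also have "(real L + 1) / real (Suc L) = 1" by simp
      finally show ?thesis by simp
    qed
    have hd: "\<bar>h\<bar> / real (Suc L) \<le> R / 4" using h by (simp add: divide_le_eq mult.commute del: of_nat_Suc)
    have b2: "\<bar>h2\<bar> \<le> R / 4" using hd by (simp add: h2_def)
    have "\<bar>h1\<bar> = real L * (\<bar>h\<bar> / real (Suc L))" by (simp add: h1_def abs_mult)
    also have "\<dots> \<le> real L * (R / 4)" using hd by (intro mult_left_mono) auto
    finally have b1: "\<bar>h1\<bar> \<le> real L * (R / 4)" .
    have "\<forall>j\<le>N1. \<bar>D j (s + h1)\<bar> \<le> \<eta>1" using 2(2)[OF D J b1] by blast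
    from 1(2)[OF D this b2 i] show ?thesis by (simp add: hh add.assoc)
  qed
  then show ?case using 2(1) by (intro exI[of _ N2] exI[of _ \<eta>2]) blast
qed

lemma factor_out_base:
  fixes b k :: nat assumes "b \<ge> 2" "k > 0"
  shows "\<exists>n k'. k = b ^ n * k' \<and> \<not> b dvd k'"
  using assms(2)
proof (induction k rule: less_induct)
  case (less k)
  show ?case
  proof (cases "b dvd k")
    case True
    then obtain j where j: "k = b * j" by blast
    then have "j < k" "j > 0" using less.prems assms by auto
    then obtain n k' where "j = b ^ n * k'" "\<not> b dvd k'" using less.IH by blast
    then show ?thesis using j by (intro exI[of _ "Suc n"] exI[of _ k']) simp
  next
    case False
    then show ?thesis by (intro exI[of _ 0] exI[of _ k]) simp
  qed
qed

locale skew_analytic = skew_family b \<gamma> f "\<lambda>j. K * fact j / R ^ j" for b \<gamma> f K R +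
  assumes R: "R > 0"
begin

lemma K_nonneg: "K \<ge> 0"
  using Bd_nonneg[of 0] by simp

lemma jet_bounded_diff: "jet_bounded (2 * K / (1 - \<gamma>)) R (\<lambda>j t. HH j m t - HH j m (t + c))"
  unfolding jet_bounded_def
proof (intro conjI allI)
  fix j t
  have "((\<lambda>t. HH j m (t + c)) has_real_derivative HH (Suc j) m (t + c) * 1) (at t)"
    by (rule DERIV_chain2[OF HH_deriv]) (auto intro!: derivative_eq_intros)
  then show "((\<lambda>t. HH j m t - HH j m (t + c)) has_real_derivative HH (Suc j) m t - HH (Suc j) m (t + c)) (at t)"
    using HH_deriv[of j m t] by (auto intro!: derivative_eq_intros)
  have "\<bar>HH j m t - HH j m (t + c)\<bar> \<le> 2 * Cb j" using HH_bound[of j m t] HH_bound[of j m "t + c"] by linarith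
  also have "\<dots> = 2 * K / (1 - \<gamma>) * fact j / R ^ j" by (simp add: Cb_def mult_ac)
  finally show "\<bar>HH j m t - HH j m (t + c)\<bar> \<le> 2 * K / (1 - \<gamma>) * fact j / R ^ j" .
qed

lemma HH_tail_le: "l \<le> m \<Longrightarrow> \<bar>HH 0 m t - HH 0 l t\<bar> \<le> \<gamma> ^ l * Cb 0"
proof -
  assume "l \<le> m"
  have "\<bar>lam 0 ^ l * HH 0 (m - l) (t / real b ^ l)\<bar> \<le> lam 0 ^ l * Cb 0"
    unfolding abs_mult using HH_bound[of 0 "m - l" "t / real b ^ l"] by (intro mult_mono) auto
  then show ?thesis using HH_add[of 0 l "m - l" t] \<open>l \<le> m\<close> by (simp add: lam_def)
qed

text \<open>\<open>HH 0 m\<close> is \<open>b ^ l\<close>-periodic up to an error of order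
  \<open>\<gamma> ^ l\<close>. A tiny jet of the difference at one point propagates over a whole
  near-period, hence the difference is small everywhere, against \<open>sep\<close>.\<close>

lemma jet_separation:
  assumes c0: "c0 > 0" and sep: "\<And>m k. m \<ge> m1 \<Longrightarrow> \<not> b dvd k \<Longrightarrow> \<exists>y. \<bar>HH 0 m y - HH 0 m (y + real k)\<bar> \<ge> c0"
  shows "\<exists>N c m2. c > 0 \<and> (\<forall>m\<ge>m2. \<forall>s k. \<not> b dvd k \<longrightarrow> (\<exists>j\<le>N. \<bar>HH j m s - HH j m (s + real k)\<bar> > c))"
proof -
  have "(\<lambda>l. 4 * Cb 0 * \<gamma> ^ l) \<longlonglongrightarrow> 4 * Cb 0 * 0" using \<gamma>0 \<gamma>1 by (intro tendsto_intros LIMSEQ_power_zero) auto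
  then have "eventually (\<lambda>l. 4 * Cb 0 * \<gamma> ^ l < c0 / 2) sequentially" by (rule order_tendstoD) (use c0 in simp)
  \<comment> \<open>The near-period is used on both branches, with an error of
    \<open>2 * Cb 0 * \<gamma> ^ l\<close> each.\<close>
  then obtain l where l: "4 * Cb 0 * \<gamma> ^ l < c0 / 2" by (auto simp: eventually_sequentially)
  obtain L :: nat where L: "real L * (R / 4) > real b ^ l" using R ex_less_of_nat_mult[of "R / 4" "real b ^ l"] by auto
  have Kn: "2 * K / (1 - \<gamma>) \<ge> 0" using K_nonneg \<gamma>1 by simp
  have c4: "c0 / 4 > 0" using c0 by simp
  obtain N \<eta> where N: "\<eta> > 0" "\<forall>D s. jet_bounded (2 * K / (1 - \<gamma>)) R D \<longrightarrow> (\<forall>j\<le>N. \<bar>D j s\<bar> \<le> \<eta>) \<longrightarrow> (\<forall>h. \<bar>h\<bar> \<le> real L * (R / 4) \<longrightarrow> (\<forall>i\<le>0. \<bar>D i (s + h)\<bar> \<le> c0 / 4))"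
    using jets_propagate[OF R Kn c4, of L 0] by blast
  have key: "\<exists>j\<le>N. \<bar>HH j m s - HH j m (s + real k)\<bar> > \<eta>" if m: "m \<ge> max m1 l" and k: "\<not> b dvd k" for m s k
  proof (rule ccontr)
    assume "\<not> ?thesis"
    then have J: "\<forall>j\<le>N. \<bar>HH j m s - HH j m (s + real k)\<bar> \<le> \<eta>" by (auto simp: not_less)
    obtain y where y: "\<bar>HH 0 m y - HH 0 m (y + real k)\<bar> \<ge> c0" using sep[of m k] m k by auto
    \<comment> \<open>\<open>y\<close> is moved by a multiple of the near-period into the reach of
      the jet at \<open>s\<close>.\<close>
    define u where "u = \<lfloor>(y - s) / real b ^ l\<rfloor>"
    define h where "h = (y - s) - of_int u * real b ^ l"
    have h: "0 \<le> h" "h \<le> real b ^ l"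
      using floor_divide_lower[of "real b ^ l" "y - s"] floor_divide_upper[of "real b ^ l" "y - s"]
      by (auto simp: h_def u_def distrib_right)
    have per: "HH 0 l (t + real b ^ l * of_int u) = HH 0 l t" for t
    proof (cases "u \<ge> 0")
      case True
      then show ?thesis using HH_per_mult[of 0 l t "nat u"] by simp
    next
      case False
      then show ?thesis using HH_per_mult[of 0 l "t + real b ^ l * of_int u" "nat (- u)"] by simp
    qed
    have ys: "y = (s + h) + real b ^ l * of_int u" by (simp add: h_def)
    have sh: "\<bar>HH 0 m (t + real b ^ l * of_int u) - HH 0 m t\<bar> \<le> 2 * (\<gamma> ^ l * Cb 0)" for t
      using HH_tail_le[of l m "t + real b ^ l * of_int u"] HH_tail_le[of l m t] m per[of t] by simp
    have "\<bar>HH 0 m (s + h) - HH 0 m (s + h + real k)\<bar> \<le> c0 / 4"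
    proof -
      have "\<bar>h\<bar> \<le> real L * (R / 4)" using h L by linarith
      moreover have "\<forall>h. \<bar>h\<bar> \<le> real L * (R / 4) \<longrightarrow> (\<forall>i\<le>0. \<bar>HH i m (s + h) - HH i m (s + h + real k)\<bar> \<le> c0 / 4)"
        by (rule N(2)[THEN spec, THEN spec, THEN mp, THEN mp, OF jet_bounded_diff J])
      ultimately show ?thesis by blast
    qed
    moreover have "\<bar>HH 0 m y - HH 0 m (s + h)\<bar> \<le> 2 * (\<gamma> ^ l * Cb 0)" unfolding ys by (rule sh)
    moreover have "\<bar>HH 0 m (y + real k) - HH 0 m (s + h + real k)\<bar> \<le> 2 * (\<gamma> ^ l * Cb 0)"
    proof -
      have "y + real k = (s + h + real k) + real b ^ l * of_int u" using ys by simp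
      then show ?thesis using sh[of "s + h + real k"] by (simp only:)
    qed
    ultimately have "c0 \<le> c0 / 4 + 4 * (\<gamma> ^ l * Cb 0)" using y by linarith
    then show False using l c0 by (simp add: mult.commute mult.left_commute)
  qed
  show ?thesis
  proof (rule exI[of _ N], rule exI[of _ \<eta>], rule exI[of _ "max m1 l"], intro conjI allI impI)
    show "\<eta> > 0" by (rule N(1))
    fix m s k assume "max m1 l \<le> m" "\<not> b dvd k"
    then show "\<exists>j\<le>N. \<bar>HH j m s - HH j m (s + real k)\<bar> > \<eta>" by (rule key)
  qed
qed

text \<open>For \<open>k = b ^ n * k'\<close> with \<open>k'\<close> not divisible by
  \<open>b\<close>, the first \<open>n\<close> terms agree by periodicity and the remaining
  \<open>p - n\<close> terms form a rescaled difference with shift \<open>k'\<close>, whose jet is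
  separated. Closeness therefore forces \<open>n\<close> to be within a constant of
  \<open>p\<close>, and only boundedly many \<open>k < b ^ p\<close> remain.\<close>

lemma Full_of_jets:
  assumes c: "c > 0" and sep: "\<And>m s k. m \<ge> m2 \<Longrightarrow> \<not> b dvd k \<Longrightarrow> \<exists>j\<le>N. \<bar>HH j m s - HH j m (s + real k)\<bar> > c" and C: "C > 0"
  shows "Full N C"
  unfolding Full_def
proof (intro allI impI)
  fix \<epsilon> :: real and p0 assume \<epsilon>: "\<epsilon> > 0"
  have "(\<lambda>m. C * \<gamma> ^ m) \<longlonglongrightarrow> C * 0" using \<gamma>0 \<gamma>1 by (intro tendsto_intros LIMSEQ_power_zero) auto
  then have "eventually (\<lambda>m. C * \<gamma> ^ m < c) sequentially" by (rule order_tendstoD) (use c in simp)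
  then obtain m3 where m3: "\<And>m. m \<ge> m3 \<Longrightarrow> C * \<gamma> ^ m < c" by (auto simp: eventually_sequentially)
  define m4 where "m4 = max m2 m3"
  \<comment> \<open>Long enough that the constant number \<open>b ^ m4\<close> of close partners is
    below \<open>exp (\<epsilon> * p)\<close>.\<close>
  define p where "p = max (max p0 (Suc m4)) (nat \<lceil>real m4 * ln (real b) / \<epsilon>\<rceil>)"
  have p: "p \<ge> p0" "p > m4" "real p \<ge> real m4 * ln (real b) / \<epsilon>" 
  proof -
    show "p \<ge> p0" "p > m4" by (auto simp: p_def)
    have "real m4 * ln (real b) / \<epsilon> \<le> real (nat \<lceil>real m4 * ln (real b) / \<epsilon>\<rceil>)" by (rule real_nat_ceiling_ge)
    also have "\<dots> \<le> real p" unfolding p_def by (intro of_nat_mono) (rule max.cobounded2)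
    finally show "real p \<ge> real m4 * ln (real b) / \<epsilon>" .
  qed
  have "real b ^ m4 = exp (real m4 * ln (real b))" by (simp add: exp_of_nat_mult)
  also have "\<dots> \<le> exp (\<epsilon> * real p)"
    using p(3) \<epsilon> unfolding exp_le_cancel_iff by (simp add: pos_divide_le_eq mult.commute)
  finally have bm: "real b ^ m4 \<le> exp (\<epsilon> * real p)" .
  have dv: "b ^ (p - m4) dvd k" if k: "k < b ^ p" and cl: "Close N C p t (t + real k)" for k t
  proof (cases "k = 0")
    case False
    then obtain n k' where nk: "k = b ^ n * k'" "\<not> b dvd k'" using factor_out_base[OF b2] by blast
    have "k' > 0" using nk False by (cases "k' = 0") auto
    then have "b ^ n * 1 \<le> b ^ n * k'" by (intro mult_le_mono2) simp
    then have "b ^ n \<le> k" unfolding nk(1) by (simp only: mult_1_right)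
    then have "b ^ n < b ^ p" using k by (rule le_less_trans)
    then have np: "n < p" using b2 by (simp add: power_strict_increasing_iff)
    have "p - n < m4"
    proof (rule ccontr)
      assume "\<not> ?thesis"
      then have ge: "p - n \<ge> m2" "p - n \<ge> m3" by (auto simp: m4_def)
      obtain j where j: "j \<le> N" "\<bar>HH j (p - n) (t / real b ^ n) - HH j (p - n) (t / real b ^ n + real k')\<bar> > c"
        using sep[OF ge(1) nk(2)] by blast
      have pn: "p = n + (p - n)" using np by simp
      have kk: "real k = real b ^ n * real k'" using nk by simp
      have "HH j p t - HH j p (t + real k) = lam j ^ n * (HH j (p - n) (t / real b ^ n) - HH j (p - n) (t / real b ^ n + real k'))"
      proof -
        have "HH j p t = HH j n t + lam j ^ n * HH j (p - n) (t / real b ^ n)" by (subst pn) (rule HH_add)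
        moreover have "HH j p (t + real k) = HH j n t + lam j ^ n * HH j (p - n) (t / real b ^ n + real k')"
        proof -
          have "HH j p (t + real k) = HH j n (t + real k) + lam j ^ n * HH j (p - n) ((t + real k) / real b ^ n)" by (subst pn) (rule HH_add)
          then show ?thesis unfolding kk HH_per_mult by (simp add: add_divide_distrib)
        qed
        ultimately show ?thesis by (simp add: right_diff_distrib)
      qed
      then have "lam j ^ n * c < \<bar>HH j p t - HH j p (t + real k)\<bar>" using mult_strict_left_mono[OF j(2) lam_pow_pos(1)[of j n]] by (simp add: abs_mult)
      also have "\<dots> \<le> C * lam j ^ p" using cl j(1) by (simp add: Close_def)
      also have "\<dots> = lam j ^ n * (C * lam j ^ (p - n))" by (subst pn) (simp add: power_add)
      finally have "c < C * lam j ^ (p - n)" by simp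
      also have "\<dots> \<le> C * \<gamma> ^ (p - n)"
      proof -
        have "lam j \<le> \<gamma>" unfolding lam_def using \<gamma>0 bpow(4)[of j] by (simp add: divide_le_eq)
        then show ?thesis using C by (intro mult_left_mono power_mono) (auto intro: less_imp_le)
      qed
      finally show False using m3[OF ge(2)] by linarith
    qed
    then have "p - m4 \<le> n" by simp
    then have "b ^ (p - m4) dvd b ^ n" by (rule le_imp_power_dvd)
    then show ?thesis using nk by simp
  qed simp
  have cnt: "(\<Sum>k<b ^ p. of_bool (t + real k \<in> UNIV \<and> Close N C p t (t + real k))) \<le> exp (\<epsilon> * real p)" for t
  proof -
    have "(\<Sum>k<b ^ p. of_bool (t + real k \<in> UNIV \<and> Close N C p t (t + real k)) :: real) = real (card ({..<b ^ p} \<inter> {k. Close N C p t (t + real k)}))" by simp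
    also have "\<dots> \<le> real (card ((\<lambda>i. b ^ (p - m4) * i) ` {..<b ^ m4}))"
    proof (intro of_nat_mono card_mono)
      show "{..<b ^ p} \<inter> {k. Close N C p t (t + real k)} \<subseteq> (\<lambda>i. b ^ (p - m4) * i) ` {..<b ^ m4}"
      proof
        fix k assume k: "k \<in> {..<b ^ p} \<inter> {k. Close N C p t (t + real k)}"
        then have "b ^ (p - m4) dvd k" using dv[of k t] by blast
        then obtain i where i: "k = b ^ (p - m4) * i" by (rule dvdE)
        have "b ^ p = b ^ (p - m4) * b ^ m4" using p by (simp flip: power_add)
        then have "i < b ^ m4" using k i by simp
        then show "k \<in> (\<lambda>i. b ^ (p - m4) * i) ` {..<b ^ m4}" using i by blast
      qed
    qed simp
    also have "\<dots> \<le> real (b ^ m4)" using card_image_le[of "{..<b ^ m4}" "\<lambda>i. b ^ (p - m4) * i"] by (simp del: of_nat_power)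
    also have "\<dots> \<le> exp (\<epsilon> * real p)" using bm by simp
    finally show ?thesis .
  qed
  show "\<exists>p\<ge>p0. 0 < p \<and> (\<exists>G\<in>sets borel. (\<forall>t. (t + real b ^ p \<in> G) = (t \<in> G)) \<and> Av (b ^ p) (\<lambda>t. of_bool (t \<notin> G)) \<le> \<epsilon>
     \<and> (\<forall>t\<in>G. (\<Sum>k<b ^ p. of_bool (t + real k \<in> G \<and> Close N C p t (t + real k))) \<le> exp (\<epsilon> * real p)))"
  \<comment> \<open>At this order the count holds at every point, so the good set is the whole
    line.\<close>
  proof (intro exI[of _ p] conjI bexI[of _ UNIV] ballI allI)
    show "p0 \<le> p" "0 < p" using p by auto
    show "Av (b ^ p) (\<lambda>t. of_bool (t \<notin> UNIV)) \<le> \<epsilon>" using \<epsilon> by (simp add: Av_const)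
    fix t show "(\<Sum>k<b ^ p. of_bool (t + real k \<in> UNIV \<and> Close N C p t (t + real k))) \<le> exp (\<epsilon> * real p)"
      by (rule cnt)
  qed simp_all
qed

lemma Full_one_of_separation:
  assumes c0: "c0 > 0" and sep: "\<And>m k. m \<ge> m1 \<Longrightarrow> \<not> b dvd k \<Longrightarrow> \<exists>y. \<bar>HH 0 m y - HH 0 m (y + real k)\<bar> \<ge> c0" and C: "C > 0"
  shows "Full 1 C"
proof -
  obtain N c m2 where N: "c > 0" "\<forall>m\<ge>m2. \<forall>s k. \<not> b dvd k \<longrightarrow> (\<exists>j\<le>N. \<bar>HH j m s - HH j m (s + real k)\<bar> > c)"
    using jet_separation[OF c0 sep] by blast
  \<comment> \<open>The order is raised by one so that the descent starts at order at least 1, even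
    for \<open>N = 0\<close>.\<close>
  have "Full (Suc N) C" if "C > 0" for C
  proof (rule Full_of_jets[OF N(1) _ that, of m2])
    fix m s k assume "m \<ge> m2" "\<not> b dvd k"
    then show "\<exists>j\<le>Suc N. \<bar>HH j m s - HH j m (s + real k)\<bar> > c" using N(2) le_SucI by blast
  qed
  then show ?thesis using C by (rule Full_one)
qed

end

section \<open>Fourier coefficients\<close>

text \<open>The frequency is a real number because the truncated curves have period
  \<open>b ^ m\<close> and hence frequencies \<open>k / b ^ m\<close>.\<close>

definition wave :: "real \<Rightarrow> real \<Rightarrow> real \<Rightarrow> real" where
  "wave q \<theta> t = cos (2 * pi * q * t + \<theta>)"

lemma wave_le: "\<bar>wave q \<theta> t\<bar> \<le> 1"
  by (simp add: wave_def)

lemma wave_measurable [measurable]: "wave q \<theta> \<in> borel_measurable borel"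
  unfolding wave_def[abs_def] by (intro borel_measurable_continuous_onI continuous_intros)

lemma bbd_wave: "bbd (wave q \<theta>)"
  by (rule bbdI[where B=1]) (auto simp: wave_le)

lemma cos_plus_int: "cos (x + of_int n * (2 * pi)) = cos x"
  using cos.plus_of_int[of x n] by simp

lemma wave_int_shift: "wave (of_int k) \<theta> (t + of_int n) = wave (of_int k) \<theta> t"
proof -
  have "2 * pi * of_int k * (t + of_int n) + \<theta> = (2 * pi * of_int k * t + \<theta>) + of_int (k * n) * (2 * pi)"
    by (simp add: algebra_simps)
  then show ?thesis unfolding wave_def by (simp only: cos_plus_int)
qed

lemma wave_shift: "wave q \<theta> (t + a) = wave q (\<theta> + 2 * pi * q * a) t"
  unfolding wave_def by (simp add: algebra_simps)

lemma wave_split: "wave q \<theta> t = cos \<theta> * wave q 0 t - sin \<theta> * (- wave q (pi / 2) t)"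
  unfolding wave_def by (simp add: cos_add)

text \<open>The phase \<open>\<theta>\<close> encodes both the cosine and the sine coefficient of frequency \<open>k\<close>.\<close>

definition fcr :: "(real \<Rightarrow> real) \<Rightarrow> int \<Rightarrow> real \<Rightarrow> real" where
  "fcr F k \<theta> = (\<integral>t. F t * wave (of_int k) \<theta> t \<partial>U01)"

lemma continuous_bbd:
  assumes "continuous_on UNIV F" "\<And>t. \<bar>F t\<bar> \<le> B" shows "bbd F"
  using assms by (intro bbdI borel_measurable_continuous_onI)

text \<open>The product formula for cosines turns multiplication by \<open>1 + cos\<close> into
  shifts of the frequency by 1 with adjusted phases, so the vanishing of all coefficients is
  inherited by every power.\<close>

lemma fourier_kernel:
  assumes F: "bbd F" and z: "\<And>k \<theta>. fcr F k \<theta> = 0"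
  shows "(\<integral>t. F t * (1 + cos (2 * pi * (t - t0))) ^ n * wave (of_int k) \<theta> t \<partial>U01) = 0"
proof (induction n arbitrary: k \<theta>)
  case 0
  then show ?case using z[of k \<theta>] by (simp add: fcr_def)
next
  case (Suc n)
  let ?E = "\<lambda>t. 1 + cos (2 * pi * (t - t0))"
  have bE: "bbd (\<lambda>t. F t * ?E t ^ n)"
  proof (intro bbd_mult F continuous_bbd)
    show "continuous_on UNIV (\<lambda>t. ?E t ^ n)" by (intro continuous_intros)
    show "\<bar>?E t ^ n\<bar> \<le> 2 ^ n" for t
    proof -
      have "\<bar>?E t\<bar> \<le> 2" using cos_ge_minus_one[of "2 * pi * (t - t0)"] cos_le_one[of "2 * pi * (t - t0)"] by linarith
      then show ?thesis unfolding power_abs by (intro power_mono) auto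
    qed
  qed
  have bw: "integrable U01 (\<lambda>t. F t * ?E t ^ n * wave q \<theta> t)" for q \<theta> by (intro bbd_integrable bbd_mult bE bbd_wave)
  have id: "?E t * wave (of_int k) \<theta> t = wave (of_int k) \<theta> t + wave (of_int (k + 1)) (\<theta> - 2 * pi * t0) t / 2 + wave (of_int (k - 1)) (\<theta> + 2 * pi * t0) t / 2" for t
  proof -
    define A where "A = 2 * pi * (t - t0)" define B where "B = 2 * pi * of_int k * t + \<theta>"
    have "cos A * cos B = (cos (A + B) + cos (B - A)) / 2" by (simp add: cos_add cos_diff)
    moreover have "A + B = 2 * pi * of_int (k + 1) * t + (\<theta> - 2 * pi * t0)" by (simp add: A_def B_def algebra_simps)
    moreover have "B - A = 2 * pi * of_int (k - 1) * t + (\<theta> + 2 * pi * t0)" by (simp add: A_def B_def algebra_simps)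
    ultimately show ?thesis unfolding wave_def A_def[symmetric] B_def[symmetric] by (simp add: distrib_right add_divide_distrib)
  qed
  have "(\<integral>t. F t * ?E t ^ Suc n * wave (of_int k) \<theta> t \<partial>U01)
      = (\<integral>t. F t * ?E t ^ n * wave (of_int k) \<theta> t + (F t * ?E t ^ n * wave (of_int (k + 1)) (\<theta> - 2 * pi * t0) t / 2 + F t * ?E t ^ n * wave (of_int (k - 1)) (\<theta> + 2 * pi * t0) t / 2) \<partial>U01)"
  proof (rule Bochner_Integration.integral_cong[OF refl])
    fix t
    have "F t * ?E t ^ Suc n * wave (of_int k) \<theta> t = F t * ?E t ^ n * (?E t * wave (of_int k) \<theta> t)" by simp
    also have "\<dots> = F t * ?E t ^ n * wave (of_int k) \<theta> t + (F t * ?E t ^ n * wave (of_int (k + 1)) (\<theta> - 2 * pi * t0) t / 2 + F t * ?E t ^ n * wave (of_int (k - 1)) (\<theta> + 2 * pi * t0) t / 2)"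
      unfolding id by (simp add: distrib_left)
    finally show "F t * ?E t ^ Suc n * wave (of_int k) \<theta> t = \<dots>" .
  qed
  also have "\<dots> = (\<integral>t. F t * ?E t ^ n * wave (of_int k) \<theta> t \<partial>U01) + ((\<integral>t. F t * ?E t ^ n * wave (of_int (k + 1)) (\<theta> - 2 * pi * t0) t \<partial>U01) / 2 + (\<integral>t. F t * ?E t ^ n * wave (of_int (k - 1)) (\<theta> + 2 * pi * t0) t \<partial>U01) / 2)"
  proof -
    have i: "integrable U01 (\<lambda>t. F t * ?E t ^ n * wave q \<theta> t / 2)" for q \<theta> by (intro integrable_divide bw)
    show ?thesis
      unfolding Bochner_Integration.integral_add[OF bw Bochner_Integration.integrable_add[OF i i]]
        Bochner_Integration.integral_add[OF i i] by simp
  qed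
  also have "\<dots> = 0" unfolding Suc.IH by simp
  finally show ?case .
qed

text \<open>Powers of \<open>1 + cos (2 * pi * (t - t0))\<close> concentrate at \<open>t0\<close>:
  they are at least \<open>\<kappa>' ^ n\<close> within \<open>\<delta> / 2\<close> and at most
  \<open>\<kappa> ^ n\<close> beyond \<open>\<delta>\<close> on the circle, with
  \<open>\<kappa> < \<kappa>'\<close>. If \<open>F t0 > 0\<close>, the integral of \<open>F\<close>
  against a large power would be positive.\<close>

lemma fourier_unique_pos:
  assumes c: "continuous_on UNIV F" and per: "\<And>t. F (t + 1) = F t" and B: "\<And>t. \<bar>F t\<bar> \<le> B"
    and z: "\<And>k \<theta>. fcr F k \<theta> = 0" and t0: "0 \<le> t0" "t0 < 1"
  shows "F t0 \<le> 0"
proof (rule ccontr)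
  assume "\<not> F t0 \<le> 0"
  then have m: "F t0 > 0" by simp
  have bF: "bbd F" by (rule continuous_bbd[OF c B])
  have "isCont F t0" using c by (simp add: continuous_on_eq_continuous_at)
  then obtain d where d: "d > 0" "\<And>t. \<bar>t - t0\<bar> < d \<Longrightarrow> \<bar>F t - F t0\<bar> < F t0 / 2"
    unfolding continuous_at_eps_delta dist_real_def using m half_gt_zero[OF m] by metis
  define \<delta> where "\<delta> = min (d / 2) (1 / 4)"
  have \<delta>: "\<delta> > 0" "\<delta> \<le> 1 / 4" "\<delta> < d" using d by (auto simp: \<delta>_def)
  have near: "F t > F t0 / 2" if "\<bar>t - t0\<bar> \<le> \<delta>" for t
  proof -
    have "\<bar>t - t0\<bar> < d" using that \<delta> by linarith
    from d(2)[OF this] show ?thesis by linarith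
  qed
  define E where "E t = 1 + cos (2 * pi * (t - t0))" for t
  have E0: "0 \<le> E t" for t unfolding E_def using cos_ge_minus_one[of "2 * pi * (t - t0)"] by linarith
  define \<kappa> where "\<kappa> = 1 + cos (2 * pi * \<delta>)"
  define \<kappa>' where "\<kappa>' = 1 + cos (pi * \<delta>)"
  have \<kappa>0: "\<kappa> \<ge> 0" unfolding \<kappa>_def using cos_ge_minus_one[of "2 * pi * \<delta>"] by linarith
  have \<kappa>\<kappa>: "\<kappa> < \<kappa>'"
  proof -
    have "cos (2 * pi * \<delta>) < cos (pi * \<delta>)"
    proof (rule cos_monotone_0_pi)
      show "2 * pi * \<delta> \<le> pi" using \<delta> by simp
    qed (use \<delta> in auto)
    then show ?thesis by (simp add: \<kappa>_def \<kappa>'_def)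
  qed
  have far: "E t \<le> \<kappa>" if "\<delta> \<le> \<bar>t - t0\<bar>" "\<bar>t - t0\<bar> \<le> 1 - \<delta>" for t
  proof -
    define x where "x = \<bar>t - t0\<bar>"
    have x: "\<delta> \<le> x" "x \<le> 1 - \<delta>" using that by (auto simp: x_def)
    have cx: "cos (2 * pi * (t - t0)) = cos (2 * pi * x)"
      unfolding x_def by (metis abs_if cos_minus mult_minus_right)
    have "cos (2 * pi * x) \<le> cos (2 * pi * \<delta>)"
    proof (cases "x \<le> 1 / 2")
      case True
      show ?thesis by (rule cos_monotone_0_pi_le) (use True x \<delta> in auto)
    next
      case False
      have "cos (2 * pi * x) = cos (2 * pi * (1 - x))"
      proof -
        have "2 * pi * (1 - x) = 2 * pi - 2 * pi * x" by (simp add: algebra_simps)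
        then show ?thesis by (simp only: cos_2pi_minus)
      qed
      also have "\<dots> \<le> cos (2 * pi * \<delta>)" by (rule cos_monotone_0_pi_le) (use False x \<delta> in auto)
      finally show ?thesis .
    qed
    then show ?thesis by (simp add: E_def \<kappa>_def cx)
  qed
  have close: "\<kappa>' \<le> E t" if "\<bar>t - t0\<bar> \<le> \<delta> / 2" for t
  proof -
    have cx: "cos (2 * pi * (t - t0)) = cos (2 * pi * \<bar>t - t0\<bar>)" by (metis abs_if cos_minus mult_minus_right)
    have "cos (pi * \<delta>) \<le> cos (2 * pi * \<bar>t - t0\<bar>)"
    proof (rule cos_monotone_0_pi_le)
      show "2 * pi * \<bar>t - t0\<bar> \<le> pi * \<delta>" using that by simp
      show "pi * \<delta> \<le> pi" using \<delta> by simp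
    qed simp
    then show ?thesis by (simp add: E_def \<kappa>'_def cx)
  qed
  \<comment> \<open>One-sided interval at \<open>t0\<close>, on the side that stays inside the unit
    interval.\<close>
  define lo where "lo = (if t0 \<le> 1 / 2 then t0 else t0 - \<delta> / 2)"
  define J where "J = {lo<..<lo + \<delta> / 2}"
  have J: "J \<subseteq> {0..<1}" "\<And>t. t \<in> J \<Longrightarrow> \<bar>t - t0\<bar> \<le> \<delta> / 2"
    using t0 \<delta> by (auto simp: J_def lo_def split: if_splits)
  have mJ: "measure U01 J = \<delta> / 2"
  proof -
    have "measure U01 J = measure lborel (J \<inter> {0..<1})" by (rule measure_U01) (simp add: J_def)
    also have "J \<inter> {0..<1} = J" using J by blast
    finally show ?thesis using \<delta> by (simp add: J_def)
  qed
  have B0: "B \<ge> 0" using B[of 0] by linarith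
  have ineq: "F t0 / 2 * \<kappa>' ^ n * (\<delta> / 2) \<le> B * \<kappa> ^ n" for n
  proof -
    have low: "F t0 / 2 * \<kappa>' ^ n * indicator J t - B * \<kappa> ^ n \<le> F t * E t ^ n" if t: "0 \<le> t" "t < 1" for t
    proof -
      have En: "0 \<le> E t ^ n" using E0 by simp
      have Bk: "0 \<le> B * \<kappa> ^ n" using B0 \<kappa>0 by simp
      consider "t \<in> J" | "t \<notin> J" "F t \<ge> 0" | "t \<notin> J" "F t < 0" by linarith
      then show ?thesis
      proof cases
        case 1
        have "F t0 / 2 * \<kappa>' ^ n \<le> F t * E t ^ n"
          using near[of t] close[of t] J(2)[OF 1] \<delta> m \<kappa>\<kappa> \<kappa>0 by (intro mult_mono power_mono) auto
        then show ?thesis using 1 Bk by simp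
      next
        case 2
        then show ?thesis using Bk En by (simp add: mult_nonneg_nonneg order_trans[of _ 0])
      next
        case 3
        have "\<delta> \<le> \<bar>t - t0\<bar>" using near[of t] 3 m by (auto simp: not_le[symmetric])
        \<comment> \<open>Points near the opposite end of the unit interval may be close to
          \<open>t0\<close> on the circle; periodicity makes \<open>F\<close> positive
          there.\<close>
        moreover have "\<bar>t - t0\<bar> \<le> 1 - \<delta>"
        proof (rule ccontr)
          assume "\<not> ?thesis"
          then have "\<bar>(t + 1) - t0\<bar> \<le> \<delta> \<or> \<bar>(t - 1) - t0\<bar> \<le> \<delta>" using t t0 by (auto simp: abs_if split: if_splits)
          moreover have "F (t - 1) = F t" using per[of "t - 1"] by simp
          ultimately have "F t > F t0 / 2" using near[of "t + 1"] near[of "t - 1"] per[of t] by auto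
          then show False using 3 m by linarith
        qed
        ultimately have "E t ^ n \<le> \<kappa> ^ n" using far[of t] E0 by (intro power_mono) auto
        then have "\<bar>F t\<bar> * E t ^ n \<le> B * \<kappa> ^ n" using B[of t] B0 En by (intro mult_mono) auto
        then show ?thesis using 3 by simp
      qed
    qed
    have bE: "bbd (\<lambda>t. F t * E t ^ n)"
    proof (intro bbd_mult bF continuous_bbd)
      show "continuous_on UNIV (\<lambda>t. E t ^ n)" unfolding E_def by (intro continuous_intros)
      show "\<bar>E t ^ n\<bar> \<le> 2 ^ n" for t
      proof -
        have "\<bar>E t\<bar> \<le> 2" using E0[of t] cos_le_one[of "2 * pi * (t - t0)"] unfolding E_def by linarith
        then show ?thesis unfolding power_abs by (intro power_mono) auto
      qed
    qed
    have bI: "bbd (\<lambda>t. F t0 / 2 * \<kappa>' ^ n * indicator J t)" by (intro bbd_mult bbd_const bbdI[where B=1]) (auto simp: J_def indicator_def)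
    have "(\<integral>t. F t0 / 2 * \<kappa>' ^ n * indicator J t - B * \<kappa> ^ n \<partial>U01) \<le> (\<integral>t. F t * E t ^ n \<partial>U01)"
    proof (rule integral_mono_AE)
      show "AE t in U01. F t0 / 2 * \<kappa>' ^ n * indicator J t - B * \<kappa> ^ n \<le> F t * E t ^ n"
        using AE_U01 by eventually_elim (use low in auto)
    qed (intro Bochner_Integration.integrable_diff bbd_integrable bI bE bbd_const)+
    also have "(\<integral>t. F t * E t ^ n \<partial>U01) = 0"
      using fourier_kernel[OF bF z, of t0 n 0 0] by (simp add: E_def wave_def)
    also have "(\<integral>t. F t0 / 2 * \<kappa>' ^ n * indicator J t - B * \<kappa> ^ n \<partial>U01) = F t0 / 2 * \<kappa>' ^ n * (\<delta> / 2) - B * \<kappa> ^ n"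
    proof -
      have "(\<integral>t. indicator J t \<partial>U01) = \<delta> / 2" using mJ by (simp add: J_def)
      moreover have "(\<integral>t. F t0 / 2 * \<kappa>' ^ n * indicator J t - B * \<kappa> ^ n \<partial>U01) = F t0 / 2 * \<kappa>' ^ n * (\<integral>t. indicator J t \<partial>U01) - (\<integral>t. B * \<kappa> ^ n \<partial>U01)"
        by (subst Bochner_Integration.integral_diff[OF bbd_integrable[OF bI] bbd_integrable[OF bbd_const]]) simp
      moreover have "(\<integral>t. B * \<kappa> ^ n \<partial>U01) = B * \<kappa> ^ n" using U01.prob_space by simp
      ultimately show ?thesis by (simp only:)
    qed
    finally show ?thesis by linarith
  qed
  have k'0: "\<kappa>' > 0" using \<kappa>\<kappa> \<kappa>0 by linarith
  have "(\<lambda>n. B * (\<kappa> / \<kappa>') ^ n) \<longlonglongrightarrow> B * 0" using \<kappa>\<kappa> \<kappa>0 k'0 by (intro tendsto_intros LIMSEQ_power_zero) auto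
  moreover have "F t0 / 2 * (\<delta> / 2) \<le> B * (\<kappa> / \<kappa>') ^ n" for n
    using ineq[of n] k'0 by (simp add: power_divide field_simps)
  ultimately have "F t0 / 2 * (\<delta> / 2) \<le> B * 0" by (intro LIMSEQ_le_const[of "\<lambda>n. B * (\<kappa> / \<kappa>') ^ n"]) auto
  then show False using m \<delta> by (simp add: mult_le_0_iff)
qed

lemma periodic_frac:
  fixes F :: "real \<Rightarrow> 'a"
  assumes per: "\<And>t. F (t + 1) = F t" shows "F t = F (frac t)"
proof (cases "t \<ge> 0")
  case True
  have "t = frac t + 1 * real (nat \<lfloor>t\<rfloor>)" using True by (simp add: frac_def)
  then show ?thesis using periodic_mult_nat[of F 1 "frac t" "nat \<lfloor>t\<rfloor>", OF per] by metis
next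
  case False
  have "frac t = t + 1 * real (nat (- \<lfloor>t\<rfloor>))" using False by (simp add: frac_def)
  then show ?thesis using periodic_mult_nat[of F 1 t "nat (- \<lfloor>t\<rfloor>)", OF per] by metis
qed

lemma fourier_unique:
  assumes c: "continuous_on UNIV F" and per: "\<And>t. F (t + 1) = F t" and B: "\<And>t. \<bar>F t\<bar> \<le> B"
    and z: "\<And>k \<theta>. fcr F k \<theta> = 0"
  shows "F t = 0"
proof -
  have fr: "0 \<le> frac t" "frac t < 1" by (auto simp: frac_lt_1)
  have 1: "F (frac t) \<le> 0" by (rule fourier_unique_pos[OF c per B z fr])
  have "- F (frac t) \<le> 0"
  proof (rule fourier_unique_pos[of "\<lambda>t. - F t" B])
    show "continuous_on UNIV (\<lambda>t. - F t)" using c by (intro continuous_intros)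
    show "fcr (\<lambda>t. - F t) k \<theta> = 0" for k \<theta> using z[of k \<theta>] by (simp add: fcr_def)
  qed (use per B fr in auto)
  then show ?thesis using 1 periodic_frac[of F t, OF per] by simp
qed

text \<open>Translation by \<open>1 / N\<close> permutes the \<open>N\<close> pieces of the unit
  interval cyclically. This amount of translation invariance serves for \<open>N = b\<close> and for
  half a period of a wave.\<close>

lemma U01_shift_frac:
  fixes F :: "real \<Rightarrow> real"
  assumes F: "bbd F" and per: "\<And>t. F (t + 1) = F t" and N: "N > 0"
  shows "(\<integral>t. F (t + 1 / real N) \<partial>U01) = (\<integral>t. F t \<partial>U01)"
proof -
  have "real N * (\<integral>t. F (t + 1 / real N) \<partial>U01) = (\<Sum>w<N. \<integral>x. F ((x + real w) / real N + 1 / real N) \<partial>U01)"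
    by (rule U01_split[symmetric, OF bbd_shift[OF F] N])
  also have "\<dots> = (\<integral>x. (\<Sum>w<N. F ((x + real w) / real N + 1 / real N)) \<partial>U01)"
    by (rule Bochner_Integration.integral_sum[symmetric]) (intro bbd_integrable bbd_comp[OF F], measurable)
  also have "(\<lambda>x. \<Sum>w<N. F ((x + real w) / real N + 1 / real N)) = (\<lambda>x. \<Sum>w<N. F ((x + real w) / real N))"
  proof
    fix x
    have p: "F ((t + real N) / real N) = F (t / real N)" for t using per[of "t / real N"] N by (simp add: add_divide_distrib)
    have "(\<Sum>w<N. F ((x + real 1 + real w) / real N)) = (\<Sum>w<N. F ((x + real w) / real N))"
      by (rule sum_periodic_shift[of "\<lambda>t. F (t / real N)" N x 1]) (rule p)
    then show "(\<Sum>w<N. F ((x + real w) / real N + 1 / real N)) = (\<Sum>w<N. F ((x + real w) / real N))"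
      by (simp add: add_divide_distrib add_ac)
  qed
  also have "(\<integral>x. (\<Sum>w<N. F ((x + real w) / real N)) \<partial>U01) = (\<Sum>w<N. \<integral>x. F ((x + real w) / real N) \<partial>U01)"
    by (rule Bochner_Integration.integral_sum) (intro bbd_integrable bbd_comp[OF F], measurable)
  also have "\<dots> = real N * (\<integral>t. F t \<partial>U01)" by (rule U01_split[OF F N])
  finally show ?thesis using N by simp
qed

text \<open>Half a period reverses the sign of the wave, so the coefficient is governed by an
  increment of \<open>F\<close>. This yields decay for Lipschitz functions.\<close>

lemma fcr_half_shift:
  assumes F: "bbd F" and per: "\<And>t. F (t + 1) = F t" and k: "k \<noteq> 0"
  shows "fcr F k \<theta> = (\<integral>t. (F t - F (t + 1 / real (2 * nat \<bar>k\<bar>))) * wave (of_int k) \<theta> t \<partial>U01) / 2"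
proof -
  define N where "N = 2 * nat \<bar>k\<bar>"
  have N: "N > 0" using k by (simp add: N_def)
  have neg: "wave (of_int k) \<theta> (t + 1 / real N) = - wave (of_int k) \<theta> t" for t
  proof -
    have "2 * pi * of_int k * (1 / real N) = (if k > 0 then pi else - pi)" using k by (auto simp: N_def)
    then have "wave (of_int k) \<theta> (t + 1 / real N) = cos ((2 * pi * of_int k * t + \<theta>) + (if k > 0 then pi else - pi))"
      unfolding wave_def by (simp only: distrib_left) (simp add: add_ac)
    then show ?thesis unfolding wave_def by (auto simp: cos_add split: if_splits)
  qed
  have b1: "bbd (\<lambda>t. F t * wave (of_int k) \<theta> t)" by (intro bbd_mult F bbd_wave)
  have b2: "bbd (\<lambda>t. F (t + 1 / real N) * wave (of_int k) \<theta> t)" by (intro bbd_mult bbd_shift F bbd_wave)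
  have "fcr F k \<theta> = (\<integral>t. F (t + 1 / real N) * wave (of_int k) \<theta> (t + 1 / real N) \<partial>U01)"
    unfolding fcr_def
  proof (rule U01_shift_frac[symmetric, OF b1 _ N])
    show "F (t + 1) * wave (of_int k) \<theta> (t + 1) = F t * wave (of_int k) \<theta> t" for t
      using per[of t] wave_int_shift[of k \<theta> t 1] by simp
  qed
  also have "\<dots> = - (\<integral>t. F (t + 1 / real N) * wave (of_int k) \<theta> t \<partial>U01)" by (simp add: neg)
  finally have 1: "fcr F k \<theta> = - (\<integral>t. F (t + 1 / real N) * wave (of_int k) \<theta> t \<partial>U01)" .
  have "(\<integral>t. (F t - F (t + 1 / real N)) * wave (of_int k) \<theta> t \<partial>U01) = fcr F k \<theta> - (\<integral>t. F (t + 1 / real N) * wave (of_int k) \<theta> t \<partial>U01)"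
    unfolding fcr_def left_diff_distrib
    by (rule Bochner_Integration.integral_diff[OF bbd_integrable[OF b1] bbd_integrable[OF b2]])
  then show ?thesis using 1 unfolding N_def by simp
qed

text \<open>\<open>J\<close> is the real part of a complex amplitude turned by
  \<open>\<theta>\<close>. The hypotheses bound the real and imaginary parts of its change under
  rotation by \<open>\<omega>\<close>, and the squared modulus of
  \<open>1 - exp (i * \<omega>)\<close> is \<open>2 * (1 - cos \<omega>)\<close>.\<close>

lemma rotation_bound:
  fixes P Q \<omega> \<Delta> :: real
  assumes J: "\<And>\<theta>. J \<theta> = cos \<theta> * P - sin \<theta> * Q"
    and 1: "\<bar>J 0 - J \<omega>\<bar> \<le> \<Delta>" and 2: "\<bar>J (pi / 2) - J (pi / 2 + \<omega>)\<bar> \<le> \<Delta>"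
  shows "(P\<^sup>2 + Q\<^sup>2) * (1 - cos \<omega>) \<le> \<Delta>\<^sup>2"
proof -
  have "(J 0 - J \<omega>)\<^sup>2 \<le> \<Delta>\<^sup>2" "(J (pi / 2) - J (pi / 2 + \<omega>))\<^sup>2 \<le> \<Delta>\<^sup>2"
    using power_mono[OF 1, of 2] power_mono[OF 2, of 2] by auto
  moreover have "(J 0 - J \<omega>)\<^sup>2 + (J (pi / 2) - J (pi / 2 + \<omega>))\<^sup>2 = (P\<^sup>2 + Q\<^sup>2) * ((1 - cos \<omega>)\<^sup>2 + (sin \<omega>)\<^sup>2)"
  proof -
    have "J 0 = P" "J \<omega> = cos \<omega> * P - sin \<omega> * Q" "J (pi / 2) = - Q" "J (pi / 2 + \<omega>) = - sin \<omega> * P - cos \<omega> * Q"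
      by (simp_all add: J cos_add sin_add)
    moreover have "(P - (c * P - s * Q))\<^sup>2 + (- Q - (- s * P - c * Q))\<^sup>2 = (P\<^sup>2 + Q\<^sup>2) * ((1 - c)\<^sup>2 + s\<^sup>2)" for c s
      by (simp add: power2_eq_square algebra_simps)
    ultimately show ?thesis by (simp only:)
  qed
  moreover have e: "(1 - cos \<omega>)\<^sup>2 + (sin \<omega>)\<^sup>2 = 2 * (1 - cos \<omega>)"
    using sin_cos_squared_add[of \<omega>] by (simp add: power2_eq_square algebra_simps)
  ultimately have "(P\<^sup>2 + Q\<^sup>2) * (2 * (1 - cos \<omega>)) \<le> 2 * \<Delta>\<^sup>2" unfolding e by linarith
  then show ?thesis by (simp only: mult.left_commute[of _ 2])
qed

section \<open>Integer shifts and the arithmetic of frequencies\<close>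

lemma Av_shift_nat:
  assumes F: "bbd F" and per: "\<And>t. F (t + real N) = F t"
  shows "Av N (\<lambda>t. F (t + real k)) = Av N F"
proof -
  have "Av N (\<lambda>t. F (t + real k)) = (\<integral>x. (\<Sum>i<N. F (x + real i + real k)) \<partial>U01) / real N"
    by (rule Av_eq_integral_sum[OF bbd_shift[OF F]])
  also have "(\<lambda>x. \<Sum>i<N. F (x + real i + real k)) = (\<lambda>x. \<Sum>i<N. F (x + real i))"
    using sum_periodic_shift[of F N _ k, OF per] by (simp add: add_ac)
  also have "(\<integral>x. (\<Sum>i<N. F (x + real i)) \<partial>U01) / real N = Av N F" by (rule Av_eq_integral_sum[OF F, symmetric])
  finally show ?thesis .
qed

text \<open>\<open>gcd (b ^ j) K\<close> grows by divisibility and is bounded by \<open>K\<close>,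
  so some step leaves it unchanged, and there \<open>K\<close> cannot supply the extra factor
  \<open>b\<close>. The result is one denominator \<open>b ^ i\<close> for which all shifts by
  \<open>k\<close> not divisible by \<open>b\<close> act nontrivially on a wave of frequency
  \<open>K / b ^ i\<close>.\<close>

lemma gcd_power_stable:
  fixes b K :: nat assumes K: "K > 0"
  shows "\<exists>i\<ge>1. \<forall>k. b ^ i dvd K * k \<longrightarrow> b dvd k"
proof -
  define g where "g j = gcd (b ^ j) K" for j
  have gd: "g j dvd g (Suc j)" for j unfolding g_def by (intro gcd_greatest) (auto intro: dvd_trans[OF gcd_dvd1])
  have gK: "g j \<le> K" "g j > 0" for j using K by (auto simp: g_def gcd_le2_nat)
  have "\<exists>j. g j = g (Suc j)"
  proof (rule ccontr)
    assume "\<nexists>j. g j = g (Suc j)"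
    then have lt: "g j < g (Suc j)" for j using gd[of j] gK(2)[of "Suc j"] by (metis dvd_imp_le le_neq_implies_less)
    have "g j \<ge> j" for j
    proof (induction j)
      case (Suc j)
      then show ?case using lt[of j] by simp
    qed simp
    from this[of "Suc K"] show False using gK(1)[of "Suc K"] by simp
  qed
  then obtain j where j: "g j = g (Suc j)" by blast
  define d where "d = g j"
  have d0: "d > 0" using gK by (simp add: d_def)
  obtain u where u: "b ^ j = d * u" using gcd_dvd1[of "b ^ j" K] unfolding d_def g_def by (metis dvdE)
  obtain v where v: "K = d * v" using gcd_dvd2[of "b ^ j" K] unfolding d_def g_def by (metis dvdE)
  have bu: "b ^ Suc j = d * (b * u)" using u by simp
  have "gcd (d * (b * u)) (d * v) = d" using j unfolding d_def[symmetric] g_def bu[symmetric] v[symmetric] by (simp add: d_def g_def)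
  then have "d * gcd (b * u) v = d" by (simp only: gcd_mult_distrib_nat[symmetric])
  then have cop: "coprime (b * u) v" using d0 by (simp add: coprime_iff_gcd_eq_1)
  have "b dvd k" if "b ^ Suc j dvd K * k" for k
  proof -
    have "d * (b * u) dvd d * (v * k)" using that unfolding bu v by (simp add: mult.assoc)
    then have "b * u dvd v * k" using d0 by simp
    then have "b * u dvd k" using cop by (simp add: coprime_dvd_mult_right_iff)
    then show ?thesis by (rule dvd_mult_left)
  qed
  then show ?thesis by (intro exI[of _ "Suc j"]) auto
qed

text \<open>The fraction \<open>n / N\<close> has distance at least \<open>1 / N\<close> from the
  integers.\<close>

lemma cos_rational_le:
  fixes n :: int and N :: nat
  assumes N: "N \<ge> 2" and n: "\<not> int N dvd n"
  shows "cos (2 * pi * of_int n / real N) \<le> cos (2 * pi / real N)"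
proof -
  define m where "m = n mod int N"
  have m: "1 \<le> m" "m \<le> int N - 1"
  proof -
    have "m \<noteq> 0" using n unfolding m_def by (simp add: dvd_eq_mod_eq_0)
    moreover have "m \<ge> 0" unfolding m_def using N by (intro pos_mod_sign) simp
    ultimately show "1 \<le> m" by linarith
    have "m < int N" unfolding m_def using N by (intro pos_mod_bound) simp
    then show "m \<le> int N - 1" by linarith
  qed
  have "2 * pi * of_int n / real N = 2 * pi * of_int m / real N + of_int (n div int N) * (2 * pi)"
  proof -
    have "n = int N * (n div int N) + m" unfolding m_def by simp
    then have "real_of_int n = real N * of_int (n div int N) + of_int m" by (metis of_int_add of_int_mult of_int_of_nat_eq)
    then show ?thesis using N by (simp add: field_simps)
  qed
  then have "cos (2 * pi * of_int n / real N) = cos (2 * pi * of_int m / real N)" by (simp only: cos_plus_int)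
  also have "\<dots> \<le> cos (2 * pi / real N)"
  proof (cases "2 * m \<le> int N")
    case True
    then have t: "2 * real_of_int m \<le> real N" by linarith
    show ?thesis
    proof (rule cos_monotone_0_pi_le)
      have "2 * pi * 1 \<le> 2 * pi * of_int m" using m by (intro mult_left_mono) auto
      then show "2 * pi / real N \<le> 2 * pi * of_int m / real N" by (intro divide_right_mono) auto
      show "2 * pi * of_int m / real N \<le> pi" using t N by (simp add: field_simps)
    qed simp
  next
    case False
    then have t: "2 * real_of_int m \<ge> real N" by linarith
    have "cos (2 * pi * of_int m / real N) = cos (2 * pi - 2 * pi * of_int m / real N)" by (simp only: cos_2pi_minus)
    also have "2 * pi - 2 * pi * of_int m / real N = 2 * pi * (real N - of_int m) / real N" using N by (simp add: field_simps)
    also have "cos (2 * pi * (real N - of_int m) / real N) \<le> cos (2 * pi / real N)"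
    proof (rule cos_monotone_0_pi_le)
      have "real_of_int m \<le> real N - 1" using m by linarith
      then have "2 * pi * 1 \<le> 2 * pi * (real N - of_int m)" by (intro mult_left_mono) auto
      then show "2 * pi / real N \<le> 2 * pi * (real N - of_int m) / real N" by (intro divide_right_mono) auto
      show "2 * pi * (real N - of_int m) / real N \<le> pi" using t N by (simp add: field_simps)
    qed simp
    finally show ?thesis .
  qed
  finally show ?thesis .
qed

section \<open>The Fourier dichotomy\<close>

context skew_family
begin

lemma f_cont: "continuous_on A (f j)"
  using der by (auto intro!: continuous_at_imp_continuous_on DERIV_isCont)

lemma bbd_f0: "bbd (f 0)"
  by (rule continuous_bbd[OF f_cont bd])

lemma bbd_HH: "bbd (HH j q)"
  by (rule continuous_bbd[OF HH_cont HH_bound])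

section \<open>Fourier coefficients of the truncated curves\<close>

definition cc :: "int \<Rightarrow> real \<Rightarrow> real" where "cc k \<theta> = fcr (f 0) k \<theta>"

lemma cc_bound: "\<bar>cc k \<theta>\<bar> \<le> Bd 0"
proof -
  have "\<bar>cc k \<theta>\<bar> \<le> (\<integral>t. \<bar>f 0 t * wave (of_int k) \<theta> t\<bar> \<partial>U01)" unfolding cc_def fcr_def by (rule integral_abs_bound)
  also have "\<dots> \<le> (\<integral>t. Bd 0 \<partial>U01)"
  proof (rule integral_mono)
    show "integrable U01 (\<lambda>t. \<bar>f 0 t * wave (of_int k) \<theta> t\<bar>)" by (intro integrable_abs bbd_integrable bbd_mult bbd_f0 bbd_wave)
    show "\<bar>f 0 t * wave (of_int k) \<theta> t\<bar> \<le> Bd 0" for t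
      unfolding abs_mult using mult_mono[OF bd[of 0 t] wave_le[of "of_int k" \<theta> t]] Bd_nonneg[of 0] by simp
  qed simp
  finally show ?thesis using U01.prob_space by simp
qed

definition aa :: "nat \<Rightarrow> real \<Rightarrow> real \<Rightarrow> real" where
  "aa m q \<theta> = Av (b ^ m) (\<lambda>t. HH 0 m t * wave q \<theta> t)"

lemma HH_Suc: "HH 0 (Suc m) t = f 0 (t / real b) + \<gamma> * HH 0 m (t / real b)"
  using HH_add[of 0 1 m t] by (simp add: HH_def lam_def)

lemma aa_Suc: "aa (Suc m) q \<theta> = Av (b ^ m) (\<lambda>t. f 0 t * wave (q * real b) \<theta> t) + \<gamma> * aa m (q * real b) \<theta>"
proof -
  let ?G = "\<lambda>s. f 0 s * wave (q * real b) \<theta> s + \<gamma> * (HH 0 m s * wave (q * real b) \<theta> s)"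
  have bG: "bbd ?G" by (intro bbd_add bbd_mult bbd_const bbd_f0 bbd_wave bbd_HH)
  have w: "wave q \<theta> t = wave (q * real b) \<theta> (t / real b)" for t by (simp add: wave_def mult.assoc)
  have "aa (Suc m) q \<theta> = Av (b * b ^ m) (\<lambda>t. ?G (t / real b))"
    unfolding aa_def HH_Suc w by (simp add: algebra_simps)
  also have "\<dots> = Av (b ^ m) ?G" by (rule Av_scale[OF bG]) simp
  also have "\<dots> = Av (b ^ m) (\<lambda>t. f 0 t * wave (q * real b) \<theta> t) + \<gamma> * aa m (q * real b) \<theta>"
    unfolding aa_def Av_cmult[symmetric] by (rule Av_add) (intro bbd_mult bbd_const bbd_f0 bbd_wave bbd_HH)+
  finally show ?thesis .
qed

lemma Av_int: "Av (b ^ m) (\<lambda>t. f 0 t * wave (of_int k) \<theta> t) = cc k \<theta>"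
proof -
  have "Av (1 * b ^ m) (\<lambda>t. f 0 t * wave (of_int k) \<theta> t) = Av 1 (\<lambda>t. f 0 t * wave (of_int k) \<theta> t)"
  proof (rule Av_periodic)
    show "f 0 (t + real 1) * wave (of_int k) \<theta> (t + real 1) = f 0 t * wave (of_int k) \<theta> t" for t
      using per[of 0 t] wave_int_shift[of k \<theta> t 1] by simp
  qed simp
  then show ?thesis by (simp add: Av_def cc_def fcr_def)
qed

lemma wave_period:
  assumes "i \<le> m" shows "wave (of_int k / real b ^ i) \<theta> (t + real b ^ m) = wave (of_int k / real b ^ i) \<theta> t"
proof -
  have "real b ^ m = real b ^ i * real b ^ (m - i)" using assms by (simp flip: power_add)
  then have "2 * pi * (of_int k / real b ^ i) * real b ^ m = of_int (k * int (b ^ (m - i))) * (2 * pi)" by simp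
  then have "2 * pi * (of_int k / real b ^ i) * (t + real b ^ m) + \<theta> = (2 * pi * (of_int k / real b ^ i) * t + \<theta>) + of_int (k * int (b ^ (m - i))) * (2 * pi)"
    by (simp only: distrib_left)
  then show ?thesis unfolding wave_def by (simp only: cos_plus_int)
qed

lemma Av_wave_split:
  assumes "bbd F"
  shows "Av N (\<lambda>t. F t * wave q \<theta> t) = cos \<theta> * Av N (\<lambda>t. F t * wave q 0 t) - sin \<theta> * (- Av N (\<lambda>t. F t * wave q (pi / 2) t))"
proof -
  have "(\<lambda>t. F t * wave q \<theta> t) = (\<lambda>t. cos \<theta> * (F t * wave q 0 t) + sin \<theta> * (F t * wave q (pi / 2) t))"
  proof
    fix t show "F t * wave q \<theta> t = cos \<theta> * (F t * wave q 0 t) + sin \<theta> * (F t * wave q (pi / 2) t)"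
      by (subst wave_split) (simp add: algebra_simps)
  qed
  then have "Av N (\<lambda>t. F t * wave q \<theta> t) = Av N (\<lambda>t. cos \<theta> * (F t * wave q 0 t) + sin \<theta> * (F t * wave q (pi / 2) t))" by (simp only:)
  also have "\<dots> = Av N (\<lambda>t. cos \<theta> * (F t * wave q 0 t)) + Av N (\<lambda>t. sin \<theta> * (F t * wave q (pi / 2) t))"
    by (rule Av_add) (intro bbd_mult bbd_const assms bbd_wave)+
  finally show ?thesis by (simp add: Av_cmult)
qed

lemma cos_lt_one: "N \<ge> 2 \<Longrightarrow> cos (2 * pi / real N) < 1"
proof -
  assume N: "N \<ge> 2"
  have "cos (2 * pi / real N) < cos 0" by (rule cos_monotone_0_pi) (use N in \<open>auto simp: field_simps\<close>)
  then show ?thesis by simp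
qed

lemma base_power_ge2: "i \<ge> 1 \<Longrightarrow> b ^ i \<ge> 2"
  using b2 power_increasing[of 1 i b] by simp

text \<open>\<open>f 0\<close> has period 1, so a shift by 1 leaves the average unchanged while
  turning its phase by \<open>2 * pi * k / b ^ i\<close>, which is not a full turn. Only the
  amplitude 0 is invariant under such a rotation.\<close>

lemma Av_nonint:
  assumes i: "1 \<le> i" "i \<le> m" and k: "\<not> int b dvd k"
  shows "Av (b ^ m) (\<lambda>t. f 0 t * wave (of_int k / real b ^ i) \<theta> t) = 0"
proof -
  define q where "q = of_int k / real b ^ i"
  define J where "J \<theta> = Av (b ^ m) (\<lambda>t. f 0 t * wave q \<theta> t)" for \<theta>
  define P where "P = J 0" define Q where "Q = - J (pi / 2)"
  have JPQ: "J \<theta> = cos \<theta> * P - sin \<theta> * Q" for \<theta>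
    unfolding P_def Q_def J_def by (rule Av_wave_split[OF bbd_f0])
  have sh: "J (\<theta> + 2 * pi * q) = J \<theta>" for \<theta>
  proof -
    let ?F = "\<lambda>t. f 0 t * wave q \<theta> t"
    have "Av (b ^ m) (\<lambda>t. ?F (t + real 1)) = Av (b ^ m) ?F"
    proof (rule Av_shift_nat)
      show "bbd ?F" by (intro bbd_mult bbd_f0 bbd_wave)
      show "?F (t + real (b ^ m)) = ?F t" for t
        using per_nat[of 0 t "b ^ m"] wave_period[OF i(2), of k \<theta> t] unfolding q_def by simp
    qed
    then show ?thesis unfolding J_def using per[of 0] by (simp add: wave_shift)
  qed
  have "(P\<^sup>2 + Q\<^sup>2) * (1 - cos (2 * pi * q)) \<le> 0\<^sup>2"
    by (rule rotation_bound[OF JPQ]) (use sh[of 0] sh[of "pi / 2"] in auto)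
  moreover have "cos (2 * pi * q) < 1"
  proof -
    have "\<not> int (b ^ i) dvd k"
    proof
      assume "int (b ^ i) dvd k"
      moreover have "int b dvd int (b ^ i)" using i(1) by (simp add: dvd_power)
      ultimately show False using k dvd_trans by blast
    qed
    then have "cos (2 * pi * of_int k / real (b ^ i)) \<le> cos (2 * pi / real (b ^ i))"
      by (rule cos_rational_le[OF base_power_ge2[OF i(1)]])
    then show ?thesis using cos_lt_one[OF base_power_ge2[OF i(1)]] by (simp add: q_def)
  qed
  ultimately have "P\<^sup>2 + Q\<^sup>2 \<le> 0" by (simp add: mult_le_0_iff)
  then have "P = 0" "Q = 0" by (simp_all add: sum_power2_le_zero_iff)
  then have "J \<theta> = 0" unfolding JPQ by simp
  then show ?thesis by (simp add: J_def q_def)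
qed

definition SS :: "nat \<Rightarrow> int \<Rightarrow> real \<Rightarrow> real" where
  "SS m k \<theta> = (\<Sum>j<m. \<gamma> ^ j * cc (k * int b ^ j) \<theta>)"

lemma aa_int: "aa m (of_int k) \<theta> = (\<Sum>j<m. \<gamma> ^ j * cc (k * int b ^ Suc j) \<theta>)"
proof (induction m arbitrary: k)
  case 0
  then show ?case by (simp add: aa_def Av_const)
next
  case (Suc m)
  have kb: "of_int k * real b = of_int (k * int b)" by simp
  have "aa (Suc m) (of_int k) \<theta> = cc (k * int b) \<theta> + \<gamma> * aa m (of_int (k * int b)) \<theta>"
    unfolding aa_Suc kb Av_int ..
  also have "\<dots> = cc (k * int b) \<theta> + \<gamma> * (\<Sum>j<m. \<gamma> ^ j * cc (k * int b * int b ^ Suc j) \<theta>)" by (simp only: Suc)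
  also have "\<dots> = (\<Sum>j<Suc m. \<gamma> ^ j * cc (k * int b ^ Suc j) \<theta>)"
    unfolding sum.lessThan_Suc_shift by (simp add: sum_distrib_left mult.assoc)
  finally show ?case .
qed

lemma aa_base: "aa (Suc m) (of_int k / real b) \<theta> = SS (Suc m) k \<theta>"
proof -
  have "aa (Suc m) (of_int k / real b) \<theta> = cc k \<theta> + \<gamma> * aa m (of_int k) \<theta>"
    unfolding aa_Suc using Av_int[of m k \<theta>] by simp
  also have "\<dots> = SS (Suc m) k \<theta>" unfolding SS_def sum.lessThan_Suc_shift aa_int by (simp add: sum_distrib_left mult.assoc)
  finally show ?thesis .
qed

text \<open>Each use of the recursion \<open>aa_Suc\<close> multiplies the frequency by
  \<open>b\<close>. As long as the new frequency is not an integer, \<open>f 0\<close> contributes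
  nothing, so \<open>i\<close> steps only produce the factor \<open>\<gamma> ^ i\<close>.\<close>

lemma aa_frac:
  assumes k: "\<not> int b dvd k"
  shows "aa (Suc i + m) (of_int k / real b ^ Suc i) \<theta> = \<gamma> ^ i * SS (Suc m) k \<theta>"
proof (induction i)
  case 0
  then show ?case using aa_base[of m k \<theta>] by simp
next
  case (Suc i)
  have q: "of_int k / real b ^ Suc (Suc i) * real b = of_int k / real b ^ Suc i" by simp
  have "aa (Suc (Suc i) + m) (of_int k / real b ^ Suc (Suc i)) \<theta>
      = Av (b ^ (Suc i + m)) (\<lambda>t. f 0 t * wave (of_int k / real b ^ Suc i) \<theta> t) + \<gamma> * aa (Suc i + m) (of_int k / real b ^ Suc i) \<theta>"
    using aa_Suc[of "Suc i + m" "of_int k / real b ^ Suc (Suc i)" \<theta>] unfolding q by simp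
  also have "Av (b ^ (Suc i + m)) (\<lambda>t. f 0 t * wave (of_int k / real b ^ Suc i) \<theta> t) = 0"
    by (rule Av_nonint[OF _ _ k]) auto
  finally show ?case unfolding Suc by (simp only: add_0 power_Suc mult.assoc)
qed

definition S :: "int \<Rightarrow> real \<Rightarrow> real" where "S k \<theta> = (\<Sum>j. \<gamma> ^ j * cc (k * int b ^ j) \<theta>)"

lemma S_summable: "summable (\<lambda>j. \<gamma> ^ j * cc (k * int b ^ j) \<theta>)"
proof (rule summable_comparison_test')
  show "summable (\<lambda>j. \<gamma> ^ j * Bd 0)" using \<gamma>0 \<gamma>1 by (intro summable_mult2 summable_geometric) auto
  show "norm (\<gamma> ^ j * cc (k * int b ^ j) \<theta>) \<le> \<gamma> ^ j * Bd 0" for j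
    using cc_bound \<gamma>0 by (simp add: abs_mult mult_left_mono)
qed

lemma SS_lim: "(\<lambda>m. SS m k \<theta>) \<longlonglongrightarrow> S k \<theta>"
  unfolding SS_def S_def by (rule summable_LIMSEQ[OF S_summable])

text \<open>If a shift by \<open>k\<close> changed \<open>HH 0 m\<close> by at most
  \<open>c0\<close> everywhere, its coefficient at frequency \<open>k0 / b ^ Suc i\<close> would be
  almost fixed by a rotation through \<open>2 * pi * k0 * k / b ^ Suc i\<close>, an angle kept away
  from full turns by the choice of \<open>i\<close>. But that coefficient is
  \<open>\<gamma> ^ i\<close> times a partial sum close to \<open>S k0 \<theta>0\<close>.\<close>

lemma separation_of_nondegenerate:
  assumes k0: "\<not> int b dvd k0" and nz: "S k0 \<theta>0 \<noteq> 0"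
  shows "\<exists>c0>0. \<exists>m1. \<forall>m\<ge>m1. \<forall>k. \<not> b dvd k \<longrightarrow> (\<exists>y. \<bar>HH 0 m y - HH 0 m (y + real k)\<bar> \<ge> c0)"
proof -
  define \<sigma> where "\<sigma> = \<bar>S k0 \<theta>0\<bar> / 2"
  have \<sigma>: "\<sigma> > 0" using nz by (simp add: \<sigma>_def)
  have "(\<lambda>m. \<bar>SS m k0 \<theta>0\<bar>) \<longlonglongrightarrow> \<bar>S k0 \<theta>0\<bar>" by (intro tendsto_intros SS_lim)
  then have "eventually (\<lambda>m. \<bar>SS m k0 \<theta>0\<bar> > \<sigma>) sequentially" by (rule order_tendstoD) (use \<sigma> in \<open>simp add: \<sigma>_def\<close>)
  then obtain M where M: "\<And>m. m \<ge> M \<Longrightarrow> \<bar>SS m k0 \<theta>0\<bar> > \<sigma>" by (auto simp: eventually_sequentially)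
  have "k0 \<noteq> 0" using k0 by auto
  then have "nat \<bar>k0\<bar> > 0" by simp
  then obtain i' where i': "i' \<ge> 1" "\<And>k. b ^ i' dvd nat \<bar>k0\<bar> * k \<Longrightarrow> b dvd k" using gcd_power_stable[of "nat \<bar>k0\<bar>" b] by blast
  define i where "i = i' - 1"
  have ii: "i' = Suc i" using i' by (simp add: i_def)
  define N where "N = b ^ Suc i"
  have N: "N \<ge> 2" unfolding N_def by (rule base_power_ge2) simp
  define q where "q = of_int k0 / real b ^ Suc i"
  define A where "A = (\<gamma> ^ i * \<sigma>)\<^sup>2 * (1 - cos (2 * pi / real N))"
  have A: "A > 0" using \<sigma> \<gamma>0 cos_lt_one[OF N] by (simp add: A_def)
  \<comment> \<open>Half the root of \<open>A\<close>, the lower bound for squared amplitude times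
    \<open>1 - cos \<omega>\<close>, so that \<open>A \<le> c0\<^sup>2\<close> is absurd.\<close>
  define c0 where "c0 = sqrt A / 2"
  have c0: "c0 > 0" "c0\<^sup>2 = A / 4" using A by (auto simp: c0_def power_divide)
  have "\<exists>y. \<bar>HH 0 m y - HH 0 m (y + real k)\<bar> \<ge> c0" if m: "m \<ge> Suc i + M" and k: "\<not> b dvd k" for m k
  proof (rule ccontr)
    assume "\<not> ?thesis"
    then have lt: "\<bar>HH 0 m y - HH 0 m (y + real k)\<bar> \<le> c0" for y by (meson not_le less_imp_le)
    define m' where "m' = m - Suc i"
    have mm: "m = Suc i + m'" "m' \<ge> M" using m by (auto simp: m'_def)
    define J where "J = aa m q"
    define P where "P = J 0" define Q where "Q = - J (pi / 2)"
    have JPQ: "J \<theta> = cos \<theta> * P - sin \<theta> * Q" for \<theta>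
      unfolding P_def Q_def J_def aa_def by (rule Av_wave_split[OF bbd_HH])
    define \<omega> where "\<omega> = - (2 * pi * q * real k)"
    have dJ: "\<bar>J \<theta> - J (\<theta> + \<omega>)\<bar> \<le> c0" for \<theta>
    proof -
      let ?F = "\<lambda>t. HH 0 m t * wave q (\<theta> + \<omega>) t"
      have bF: "bbd ?F" by (intro bbd_mult bbd_HH bbd_wave)
      have "J (\<theta> + \<omega>) = Av (b ^ m) (\<lambda>t. ?F (t + real k))" unfolding J_def aa_def
      proof (rule Av_shift_nat[symmetric, OF bF])
        show "?F (t + real (b ^ m)) = ?F t" for t
          using HH_per[of 0 m t] wave_period[of "Suc i" m k0 "\<theta> + \<omega>" t] mm unfolding q_def by simp
      qed
      also have "(\<lambda>t. ?F (t + real k)) = (\<lambda>t. HH 0 m (t + real k) * wave q \<theta> t)"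
        by (simp add: wave_shift \<omega>_def)
      finally have J2: "J (\<theta> + \<omega>) = Av (b ^ m) (\<lambda>t. HH 0 m (t + real k) * wave q \<theta> t)" .
      have b2: "bbd (\<lambda>t. HH 0 m (t + real k) * wave q \<theta> t)" by (intro bbd_mult bbd_shift bbd_HH bbd_wave)
      have b1: "bbd (\<lambda>t. HH 0 m t * wave q \<theta> t)" by (intro bbd_mult bbd_HH bbd_wave)
      have pt: "\<bar>HH 0 m t * wave q \<theta> t - HH 0 m (t + real k) * wave q \<theta> t\<bar> \<le> c0" for t
      proof -
        have "\<bar>HH 0 m t * wave q \<theta> t - HH 0 m (t + real k) * wave q \<theta> t\<bar> = \<bar>HH 0 m t - HH 0 m (t + real k)\<bar> * \<bar>wave q \<theta> t\<bar>"
          by (simp flip: left_diff_distrib add: abs_mult)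
        also have "\<dots> \<le> c0 * 1" using lt[of t] wave_le[of q \<theta> t] c0 by (intro mult_mono) auto
        finally show ?thesis by simp
      qed
      have "J \<theta> \<le> Av (b ^ m) (\<lambda>t. HH 0 m (t + real k) * wave q \<theta> t + c0)"
        unfolding J_def aa_def
      proof (intro Av_mono b1 bbd_add b2 bbd_const)
        show "HH 0 m t * wave q \<theta> t \<le> HH 0 m (t + real k) * wave q \<theta> t + c0" for t using pt[of t] by linarith
      qed
      also have "\<dots> = J (\<theta> + \<omega>) + c0" unfolding J2 by (subst Av_add[OF b2 bbd_const]) (simp add: Av_const)
      finally have 1: "J \<theta> \<le> J (\<theta> + \<omega>) + c0" .
      have "J (\<theta> + \<omega>) \<le> Av (b ^ m) (\<lambda>t. HH 0 m t * wave q \<theta> t + c0)"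
        unfolding J2
      proof (intro Av_mono b2 bbd_add b1 bbd_const)
        show "HH 0 m (t + real k) * wave q \<theta> t \<le> HH 0 m t * wave q \<theta> t + c0" for t using pt[of t] by linarith
      qed
      also have "\<dots> = J \<theta> + c0" unfolding J_def aa_def by (subst Av_add[OF b1 bbd_const]) (simp add: Av_const)
      finally show ?thesis using 1 by linarith
    qed
    have "(P\<^sup>2 + Q\<^sup>2) * (1 - cos \<omega>) \<le> c0\<^sup>2"
      by (rule rotation_bound[OF JPQ]) (use dJ[of 0] dJ[of "pi / 2"] in auto)
    moreover have "cos \<omega> \<le> cos (2 * pi / real N)"
    proof -
      have "\<not> int N dvd k0 * int k"
      proof
        assume "int N dvd k0 * int k"
        then have "int N dvd \<bar>k0 * int k\<bar>" by simp
        also have "\<bar>k0 * int k\<bar> = int (nat \<bar>k0\<bar> * k)" by (simp add: abs_mult)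
        finally have "N dvd nat \<bar>k0\<bar> * k" by (simp only: int_dvd_int_iff)
        then show False using i'(2)[of k] k unfolding N_def ii by blast
      qed
      then have "cos (2 * pi * of_int (k0 * int k) / real N) \<le> cos (2 * pi / real N)" by (rule cos_rational_le[OF N])
      moreover have "cos \<omega> = cos (2 * pi * of_int (k0 * int k) / real N)"
        unfolding \<omega>_def q_def N_def cos_minus by (simp add: mult.assoc)
      ultimately show ?thesis by simp
    qed
    moreover have PQ: "(\<gamma> ^ i * \<sigma>)\<^sup>2 \<le> P\<^sup>2 + Q\<^sup>2"
    proof -
      have "J \<theta>0 = \<gamma> ^ i * SS (Suc m') k0 \<theta>0" unfolding J_def q_def mm(1) by (rule aa_frac[OF k0])
      then have "\<bar>J \<theta>0\<bar> = \<gamma> ^ i * \<bar>SS (Suc m') k0 \<theta>0\<bar>" using \<gamma>0 by (simp add: abs_mult)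
      also have "\<dots> \<ge> \<gamma> ^ i * \<sigma>" using M[of "Suc m'"] mm(2) \<gamma>0 by (intro mult_left_mono) auto
      finally have "(\<gamma> ^ i * \<sigma>)\<^sup>2 \<le> \<bar>J \<theta>0\<bar>\<^sup>2" using \<gamma>0 \<sigma> by (intro power_mono) auto
      also have "\<bar>J \<theta>0\<bar>\<^sup>2 \<le> P\<^sup>2 + Q\<^sup>2"
      proof -
        have cs: "(c * P - s * Q)\<^sup>2 + (c * Q + s * P)\<^sup>2 = (c\<^sup>2 + s\<^sup>2) * (P\<^sup>2 + Q\<^sup>2)" for c s
          by (simp add: power2_eq_square algebra_simps)
        have "(J \<theta>0)\<^sup>2 + (cos \<theta>0 * Q + sin \<theta>0 * P)\<^sup>2 = P\<^sup>2 + Q\<^sup>2"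
          unfolding JPQ cs by simp
        then show ?thesis using zero_le_power2[of "cos \<theta>0 * Q + sin \<theta>0 * P"] unfolding power2_abs by linarith
      qed
      finally show ?thesis .
    qed
    ultimately have "A \<le> c0\<^sup>2"
      unfolding A_def using cos_lt_one[OF N]
      by (intro order_trans[OF mult_mono[OF PQ, of "1 - cos (2 * pi / real N)" "1 - cos \<omega>"]]) auto
    then show False using c0 A by linarith
  qed
  then show ?thesis using c0(1) by blast
qed

text \<open>Averaging over the preimages under multiplication by \<open>b\<^sup>j\<close> turns the \<open>k\<close>-th Fourier coefficient
  into the one at \<open>k b\<^sup>j\<close>.\<close>

definition LL :: "nat \<Rightarrow> real \<Rightarrow> real" where
  "LL j t = (\<Sum>u<b ^ j. f 0 ((t + real u) / real b ^ j)) / real b ^ j"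

lemma LL_bound: "\<bar>LL j t\<bar> \<le> Bd 0"
proof -
  have "\<bar>\<Sum>u<b ^ j. f 0 ((t + real u) / real b ^ j)\<bar> \<le> (\<Sum>u<b ^ j. Bd 0)"
    by (rule order_trans[OF sum_abs sum_mono]) (rule bd)
  also have "\<dots> = real b ^ j * Bd 0" by simp
  finally show ?thesis unfolding LL_def by (simp add: divide_le_eq mult.commute)
qed

lemma LL_cont: "continuous_on A (LL j)"
  unfolding LL_def[abs_def]
  by (intro continuous_intros continuous_on_compose2[OF f_cont[of UNIV]]) auto

lemma LL_per: "LL j (t + 1) = LL j t"
proof -
  have p: "f 0 ((t + real (b ^ j)) / real b ^ j) = f 0 (t / real b ^ j)" for t
    using per[of 0 "t / real b ^ j"] by (simp add: add_divide_distrib)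
  have "(\<Sum>u<b ^ j. f 0 ((t + real 1 + real u) / real b ^ j)) = (\<Sum>u<b ^ j. f 0 ((t + real u) / real b ^ j))"
    by (rule sum_periodic_shift[of "\<lambda>t. f 0 (t / real b ^ j)" "b ^ j" t 1]) (rule p)
  then show ?thesis by (simp add: LL_def)
qed

lemma LL_Suc: "LL (Suc j) t = (\<Sum>i<b. LL j ((t + real i) / real b)) / real b"
proof -
  have "(\<Sum>k<b * b ^ j. f 0 ((t + real k) / real b ^ Suc j)) = (\<Sum>u<b ^ j. \<Sum>i<b. f 0 ((t + real (i + b * u)) / real b ^ Suc j))"
    by (rule sum_lessThan_split)
  also have "\<dots> = (\<Sum>i<b. \<Sum>u<b ^ j. f 0 ((t + real (i + b * u)) / real b ^ Suc j))" by (rule sum.swap)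
  also have "\<dots> = (\<Sum>i<b. \<Sum>u<b ^ j. f 0 (((t + real i) / real b + real u) / real b ^ j))"
    by (intro sum.cong refl arg_cong[of _ _ "f 0"]) (simp add: field_simps)
  finally show ?thesis unfolding LL_def by (simp add: sum_divide_distrib mult.commute)
qed

lemma fcr_LL: "fcr (LL j) k \<theta> = cc (k * int b ^ j) \<theta>"
proof -
  let ?F = "\<lambda>s. f 0 s * wave (of_int (k * int b ^ j)) \<theta> s"
  have bF: "bbd ?F" by (intro bbd_mult bbd_f0 bbd_wave)
  have e: "LL j t * wave (of_int k) \<theta> t = (\<Sum>u<b ^ j. ?F ((t + real u) / real (b ^ j))) / real (b ^ j)" for t
  proof -
    have "wave (of_int (k * int b ^ j)) \<theta> ((t + real u) / real (b ^ j)) = wave (of_int k) \<theta> (t + of_int (int u))" for u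
      unfolding wave_def by (simp add: mult.assoc)
    then have "wave (of_int (k * int b ^ j)) \<theta> ((t + real u) / real (b ^ j)) = wave (of_int k) \<theta> t" for u
      by (simp only: wave_int_shift)
    then show ?thesis unfolding LL_def by (simp add: sum_distrib_right)
  qed
  have "fcr (LL j) k \<theta> = (\<integral>t. (\<Sum>u<b ^ j. ?F ((t + real u) / real (b ^ j))) \<partial>U01) / real (b ^ j)"
    unfolding fcr_def e by simp
  also have "(\<integral>t. (\<Sum>u<b ^ j. ?F ((t + real u) / real (b ^ j))) \<partial>U01) = (\<Sum>u<b ^ j. \<integral>t. ?F ((t + real u) / real (b ^ j)) \<partial>U01)"
    by (rule Bochner_Integration.integral_sum) (intro bbd_integrable bbd_comp[OF bF], measurable)
  also have "\<dots> = real (b ^ j) * integral\<^sup>L U01 ?F" by (rule U01_split[OF bF]) simp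
  finally show ?thesis by (simp add: cc_def fcr_def)
qed

text \<open>\<open>G\<close>, the sum of \<open>\<gamma> ^ j * LL j\<close>, has the Fourier
  coefficients \<open>S k \<theta>\<close>, so degeneracy leaves only multiples of \<open>b\<close>
  and \<open>G\<close> has period \<open>1 / b\<close>. Hence \<open>G t = g (b * t)\<close>,
  averaging \<open>G\<close> over preimages gives back \<open>g\<close>, and splitting off the term
  \<open>j = 0\<close> of the series is the cohomological equation.\<close>

lemma coboundary_of_degenerate:
  assumes deg: "\<And>k \<theta>. \<not> int b dvd k \<Longrightarrow> S k \<theta> = 0"
  shows "\<exists>g B. continuous_on UNIV g \<and> (\<forall>t. g (t + 1) = g t) \<and> (\<forall>t. \<bar>g t\<bar> \<le> B) \<and> (\<forall>t. g (real b * t) = f 0 t + \<gamma> * g t)"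
proof -
  define G where "G t = (\<Sum>j. \<gamma> ^ j * LL j t)" for t
  have tb: "norm (\<gamma> ^ j * LL j t) \<le> \<gamma> ^ j * Bd 0" for j t using LL_bound \<gamma>0 by (simp add: abs_mult mult_left_mono)
  have sg: "summable (\<lambda>j. \<gamma> ^ j * Bd 0)" using \<gamma>0 \<gamma>1 by (intro summable_mult2 summable_geometric) auto
  have sm: "summable (\<lambda>j. \<gamma> ^ j * LL j t)" for t by (rule summable_comparison_test'[OF sg]) (rule tb)
  define B where "B = (\<Sum>j. \<gamma> ^ j * Bd 0)"
  have GB: "\<bar>G t\<bar> \<le> B" for t unfolding G_def B_def using norm_suminf_le[where f="\<lambda>j. \<gamma> ^ j * LL j t", OF tb sg] by simp
  have ul: "uniform_limit UNIV (\<lambda>n t. \<Sum>j<n. \<gamma> ^ j * LL j t) G sequentially"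
    unfolding G_def[abs_def] by (rule Weierstrass_m_test[OF tb sg])
  have Gc: "continuous_on UNIV G"
    by (rule uniform_limit_theorem[OF always_eventually ul]) (auto intro!: continuous_intros LL_cont)
  have Gp: "G (t + 1) = G t" for t unfolding G_def by (simp add: LL_per)
  have bG: "bbd G" by (rule continuous_bbd[OF Gc GB])
  have fG: "fcr G k \<theta> = S k \<theta>" for k \<theta>
  proof -
    have bt: "bbd (\<lambda>t. \<gamma> ^ j * LL j t * wave (of_int k) \<theta> t)" for j
      by (intro bbd_mult bbd_const bbd_wave continuous_bbd[OF LL_cont LL_bound])
    have "(\<integral>t. (\<Sum>j. \<gamma> ^ j * LL j t * wave (of_int k) \<theta> t) \<partial>U01) = (\<Sum>j. \<integral>t. \<gamma> ^ j * LL j t * wave (of_int k) \<theta> t \<partial>U01)"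
    proof (rule integral_suminf)
      show "integrable U01 (\<lambda>t. \<gamma> ^ j * LL j t * wave (of_int k) \<theta> t)" for j by (rule bbd_integrable[OF bt])
      have le: "norm (\<gamma> ^ j * LL j t * wave (of_int k) \<theta> t) \<le> \<gamma> ^ j * Bd 0" for j t
        using mult_mono[OF tb[of j t] wave_le[of "of_int k" \<theta> t]] Bd_nonneg[of 0] \<gamma>0 by (simp add: abs_mult)
      show "AE t in U01. summable (\<lambda>j. norm (\<gamma> ^ j * LL j t * wave (of_int k) \<theta> t))"
        by (intro AE_I2 summable_comparison_test'[OF sg]) (use le in simp)
      have "(\<integral>t. norm (\<gamma> ^ j * LL j t * wave (of_int k) \<theta> t) \<partial>U01) \<le> \<gamma> ^ j * Bd 0" for j
      proof -
        have "(\<integral>t. norm (\<gamma> ^ j * LL j t * wave (of_int k) \<theta> t) \<partial>U01) \<le> (\<integral>t. \<gamma> ^ j * Bd 0 \<partial>U01)"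
          by (intro integral_mono integrable_norm bbd_integrable bt bbd_const le)
        then show ?thesis using U01.prob_space by simp
      qed
      then show "summable (\<lambda>j. \<integral>t. norm (\<gamma> ^ j * LL j t * wave (of_int k) \<theta> t) \<partial>U01)"
        by (intro summable_comparison_test'[OF sg]) (simp add: integral_nonneg_AE)
    qed
    moreover have "(\<Sum>j. \<gamma> ^ j * LL j t * wave (of_int k) \<theta> t) = G t * wave (of_int k) \<theta> t" for t
      unfolding G_def by (rule suminf_mult2[OF sm, symmetric])
    moreover have "(\<integral>t. \<gamma> ^ j * LL j t * wave (of_int k) \<theta> t \<partial>U01) = \<gamma> ^ j * cc (k * int b ^ j) \<theta>" for j
      unfolding fcr_LL[symmetric] fcr_def by (simp add: mult.assoc)
    ultimately show ?thesis by (simp add: fcr_def S_def)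
  qed
  \<comment> \<open>A shift by \<open>1 / b\<close> turns the phase at frequency \<open>k\<close> by
    \<open>2 * pi * k / b\<close>: full turns if \<open>b\<close> divides \<open>k\<close>, and
    otherwise the coefficient is 0.\<close>
  have zero: "G (t + 1 / real b) - G t = 0" for t
  proof (rule fourier_unique[of "\<lambda>t. G (t + 1 / real b) - G t" "2 * B"])
    show "continuous_on UNIV (\<lambda>t. G (t + 1 / real b) - G t)"
      by (intro continuous_intros continuous_on_compose2[OF Gc]) auto
    show "G (t + 1 + 1 / real b) - G (t + 1) = G (t + 1 / real b) - G t" for t
      using Gp[of "t + 1 / real b"] Gp[of t] by (simp add: add_ac)
    show "\<bar>G (t + 1 / real b) - G t\<bar> \<le> 2 * B" for t using GB[of "t + 1 / real b"] GB[of t] by linarith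
    fix k \<theta>
    have b1: "bbd (\<lambda>t. G (t + 1 / real b) * wave (of_int k) \<theta> t)" by (intro bbd_mult bbd_shift bG bbd_wave)
    have b2: "bbd (\<lambda>t. G t * wave (of_int k) \<theta> t)" by (intro bbd_mult bG bbd_wave)
    have "fcr (\<lambda>t. G (t + 1 / real b) - G t) k \<theta> = (\<integral>t. G (t + 1 / real b) * wave (of_int k) \<theta> t \<partial>U01) - fcr G k \<theta>"
      unfolding fcr_def left_diff_distrib by (rule Bochner_Integration.integral_diff[OF bbd_integrable[OF b1] bbd_integrable[OF b2]])
    also have "(\<integral>t. G (t + 1 / real b) * wave (of_int k) \<theta> t \<partial>U01) = fcr G k (\<theta> - 2 * pi * of_int k / real b)"
    proof -
      let ?H = "\<lambda>t. G t * wave (of_int k) (\<theta> - 2 * pi * of_int k / real b) t"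
      have "(\<integral>t. ?H (t + 1 / real b) \<partial>U01) = (\<integral>t. ?H t \<partial>U01)"
      proof (rule U01_shift_frac)
        show "bbd ?H" by (intro bbd_mult bG bbd_wave)
        show "?H (t + 1) = ?H t" for t using Gp[of t] wave_int_shift[of k _ t 1] by simp
      qed simp
      then show ?thesis unfolding fcr_def by (simp add: wave_shift)
    qed
    also have "fcr G k (\<theta> - 2 * pi * of_int k / real b) - fcr G k \<theta> = 0"
    proof (cases "int b dvd k")
      case True
      then obtain l where l: "k = int b * l" by blast
      have "wave (of_int k) (\<theta> - 2 * pi * of_int k / real b) t = wave (of_int k) \<theta> t" for t
      proof -
        have "2 * pi * of_int k * t + (\<theta> - 2 * pi * of_int k / real b) = (2 * pi * of_int k * t + \<theta>) + of_int (- l) * (2 * pi)"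
          using l by simp
        then show ?thesis unfolding wave_def by (simp only: cos_plus_int)
      qed
      then show ?thesis by (simp add: fcr_def)
    next
      case False
      then show ?thesis unfolding fG using deg by simp
    qed
    finally show "fcr (\<lambda>t. G (t + 1 / real b) - G t) k \<theta> = 0" .
  qed
  have Gb: "G (t + real i / real b) = G t" for t i
    using periodic_mult_nat[of G "1 / real b" t i] zero by simp
  define g where "g t = G (t / real b)" for t
  have LG: "(\<Sum>i<b. G ((t + real i) / real b)) / real b = g t" for t
    using Gb[of "t / real b"] by (simp add: g_def add_divide_distrib)
  have GG: "G t = f 0 t + \<gamma> * g t" for t
  proof -
    have "G t = \<gamma> ^ 0 * LL 0 t + (\<Sum>j. \<gamma> ^ Suc j * LL (Suc j) t)"
      unfolding G_def using suminf_split_head[OF sm[of t]] by simp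
    also have "\<gamma> ^ 0 * LL 0 t = f 0 t" by (simp add: LL_def)
    also have "(\<Sum>j. \<gamma> ^ Suc j * LL (Suc j) t) = \<gamma> * g t"
    proof -
      have "(\<lambda>j. \<Sum>i<b. \<gamma> ^ j * LL j ((t + real i) / real b)) sums (\<Sum>i<b. G ((t + real i) / real b))"
        unfolding G_def by (intro sums_sum summable_sums sm)
      then have "(\<lambda>j. (\<gamma> / real b) * (\<Sum>i<b. \<gamma> ^ j * LL j ((t + real i) / real b))) sums ((\<gamma> / real b) * (\<Sum>i<b. G ((t + real i) / real b)))"
        by (rule sums_mult)
      moreover have "(\<gamma> / real b) * (\<Sum>i<b. \<gamma> ^ j * LL j ((t + real i) / real b)) = \<gamma> ^ Suc j * LL (Suc j) t" for j
        unfolding LL_Suc by (simp add: sum_distrib_left[symmetric])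
      moreover have "(\<gamma> / real b) * (\<Sum>i<b. G ((t + real i) / real b)) = \<gamma> * g t" unfolding LG[symmetric] by simp
      ultimately show ?thesis by (simp add: sums_iff)
    qed
    finally show ?thesis .
  qed
  show ?thesis
  proof (intro exI[of _ g] exI[of _ B] conjI allI)
    show "continuous_on UNIV g" unfolding g_def[abs_def] by (intro continuous_on_compose2[OF Gc] continuous_intros) auto
    show "g (t + 1) = g t" for t unfolding g_def using Gb[of "t / real b" 1] by (simp add: add_divide_distrib)
    show "\<bar>g t\<bar> \<le> B" for t unfolding g_def by (rule GB)
    show "g (real b * t) = f 0 t + \<gamma> * g t" for t using GG[of t] by (simp add: g_def)
  qed
qed

text \<open>The coboundary telescopes along \<open>t\<close>, \<open>t / b\<close>, and so on down
  to \<open>t / b ^ q\<close>.\<close>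

lemma HH_coboundary:
  assumes g: "\<And>t. g (real b * t) = f 0 t + \<gamma> * g t"
  shows "HH 0 q t = g t - \<gamma> ^ q * g (t / real b ^ q)"
proof (induction q arbitrary: t)
  case (Suc q)
  have "HH 0 (Suc q) t = f 0 (t / real b) + \<gamma> * (g (t / real b) - \<gamma> ^ q * g (t / real b / real b ^ q))"
    unfolding HH_Suc Suc ..
  also have "f 0 (t / real b) = g t - \<gamma> * g (t / real b)" using g[of "t / real b"] by simp
  finally show ?case by (simp add: algebra_simps)
qed simp

end

section \<open>Dimension in the two cases\<close>

lemma Av_frac:
  assumes h: "bbd h" and N: "N > 0"
  shows "Av N (\<lambda>t. h (frac t)) = (\<integral>x. h x \<partial>U01)"
proof -
  have b: "bbd (\<lambda>t. h (frac t))" by (rule bbd_comp[OF h]) simp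
  have "Av (1 * N) (\<lambda>t. h (frac t)) = Av 1 (\<lambda>t. h (frac t))"
    using frac_add_nat[of _ 1] N by (intro Av_periodic) auto
  also have "\<dots> = (\<integral>x. h (frac x) \<partial>U01)" by (simp add: Av_def)
  also have "\<dots> = (\<integral>x. h x \<partial>U01)"
  proof (rule integral_cong_AE)
    show "(\<lambda>x. h (frac x)) \<in> borel_measurable U01" "h \<in> borel_measurable U01"
      using bbd_measurable[OF b] bbd_measurable[OF h] by (simp_all add: measurable_cong_sets[OF sets_U01 refl])
    show "AE x in U01. h (frac x) = h x"
      using AE_U01 by eventually_elim (simp add: frac_eq)
  qed
  finally show ?thesis by simp
qed

context skew_family
begin

lemma borel_prob_SRBlim: "SRBlim \<omega> \<Longrightarrow> borel_prob \<omega>"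
  unfolding borel_prob_def borel_prob_axioms_def by (simp add: SRBlim_def)

lemma graph_covering:
  assumes S: "SRBlim \<omega>" and L: "L \<ge> 0"
    and lip: "\<And>x y. x \<in> {0..1} \<Longrightarrow> y \<in> {0..1} \<Longrightarrow> \<bar>g x - g y\<bar> \<le> L * \<bar>x - y\<bar>"
  shows "borel_prob.covering \<gamma> 1 {(x, g x) | x. 0 \<le> x \<and> x < 1}"
proof -
  interpret borel_prob \<omega> by (rule borel_prob_SRBlim[OF S])
  have K: "2 + L > 0" using L by simp
  show ?thesis unfolding covering_def
  proof (intro exI[of _ "2 + L"] conjI K allI)
    fix q
    define e where "e = \<gamma> ^ q"
    have e: "e > 0" "e \<le> 1" using \<gamma>0 \<gamma>1 by (auto simp: e_def power_le_one)
    define n where "n = nat \<lfloor>1 / e\<rfloor>"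
    have n: "real n \<le> 1 / e" using e by (simp add: n_def)
    let ?h = "\<lambda>i. (real i * e, g (real i * e))"
    have "real (card (?h ` {..n})) \<le> real (card {..n})" by (intro of_nat_mono card_image_le) simp
    also have "\<dots> = real n + 1" by simp
    also have "\<dots> \<le> 2 * (1 / e)"
    proof -
      have "1 \<le> 1 / e" using e by simp
      then show ?thesis using n by linarith
    qed
    also have "\<dots> \<le> (2 + L) * (1 / e)" using L e by (intro mult_right_mono) auto
    also have "1 / e = e powr (- 1)" using e by (simp add: powr_minus field_simps)
    finally have c: "real (card (?h ` {..n})) \<le> (2 + L) * e powr (- 1)" .
    have "{(x, g x) | x. 0 \<le> x \<and> x < 1} \<subseteq> (\<Union>c\<in>?h ` {..n}. cball c ((2 + L) * e))"
    proof
      fix z assume "z \<in> {(x, g x) | x. 0 \<le> x \<and> x < 1}"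
      then obtain x where x: "0 \<le> x" "x < 1" and z: "z = (x, g x)" by auto
      define i where "i = nat \<lfloor>x / e\<rfloor>"
      have gr: "\<bar>x - real i * e\<bar> \<le> e" "i \<le> n" unfolding i_def n_def by (rule floor_grid[OF x e(1)])+
      have "real i * e \<le> (1 / e) * e" using gr(2) n e by (intro mult_right_mono) auto
      then have "real i * e \<in> {0..1}" using e by simp
      then have "\<bar>g x - g (real i * e)\<bar> \<le> L * \<bar>x - real i * e\<bar>" using x by (intro lip) auto
      also have "\<dots> \<le> L * e" using gr L by (intro mult_left_mono)
      finally have "dist z (?h i) \<le> (1 + L) * e"
        using dist_pair_le[of z "?h i"] gr(1) by (simp add: z algebra_simps)
      then have "z \<in> cball (?h i) ((2 + L) * e)" using e by (simp add: dist_commute algebra_simps)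
      then show "z \<in> (\<Union>c\<in>?h ` {..n}. cball c ((2 + L) * e))" using gr(2) by blast
    qed
    then show "\<exists>P. finite P \<and> real (card P) \<le> (2 + L) * (\<gamma> ^ q) powr (- 1) \<and>
        {(x, g x) | x. 0 \<le> x \<and> x < 1} \<subseteq> (\<Union>c\<in>P. cball c ((2 + L) * \<gamma> ^ q))"
      using c unfolding e_def[symmetric] by (intro exI[of _ "?h ` {..n}"]) simp
  qed
qed

text \<open>\<open>g\<close> is analytic on the line without being assumed periodic, so its
  Lipschitz constant is taken from compactness of the unit interval.\<close>

lemma analytic_graph_covering:
  assumes S: "SRBlim \<omega>" and an: "real_analytic_on g UNIV"
  shows "borel_prob.covering \<gamma> 1 {(x, g x) | x. 0 \<le> x \<and> x < 1}"
proof -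
  obtain K R where KR: "R > 0" "\<And>y j. y \<in> {0..1} \<Longrightarrow> \<bar>(deriv ^^ j) g y\<bar> \<le> K * fact j / R ^ j"
    using analytic_unit_bound[OF an] by blast
  have d: "(g has_real_derivative deriv g y) (at y)" for y using analytic_deriv[OF an, of 0 y] by simp
  have bd: "\<bar>deriv g y\<bar> \<le> K / R" if "y \<in> {0..1}" for y using KR(2)[OF that, of 1] by simp
  have "\<bar>g x - g y\<bar> \<le> (K / R) * \<bar>x - y\<bar>" if "x \<in> {0..1}" "y \<in> {0..1}" for x y
    using field_differentiable_bound[of "{0..1}" g "deriv g" "K / R" x y] d bd that
    by (auto intro: DERIV_subset)
  moreover have "K / R \<ge> 0" using bd[of 0] by (simp del: zero_le_divide_iff) 
  ultimately show ?thesis by (intro graph_covering[OF S])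
qed

lemma ae_support:
  assumes S: "SRBlim \<omega>"
  shows "support_on_dom \<omega> \<in> sets \<omega>" "measure \<omega> (support_on_dom \<omega>) = 1" "AE z in \<omega>. z \<in> support_on_dom \<omega>"
proof -
  interpret borel_prob \<omega> by (rule borel_prob_SRBlim[OF S])
  have "emeasure \<omega> dom01 = 1" using S by (simp add: SRBlim_def)
  from support_full[OF this] show s: "support_on_dom \<omega> \<in> sets \<omega>" "measure \<omega> (support_on_dom \<omega>) = 1" by auto
  then show "AE z in \<omega>. z \<in> support_on_dom \<omega>" using prob_eq_1 by blast
qed

text \<open>\<open>covering_support\<close> bounds the local dimension from above,
  \<open>lower_local_dim\<close> from below. The graph of an analytic function would admit coverings
  of exponent 1, hence local dimension at most 1 almost everywhere, whereas
  \<open>ddim > 1\<close>.\<close>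

lemma nondegenerate_dimension:
  assumes S: "SRBlim \<omega>" and F: "\<And>C. C > 0 \<Longrightarrow> Full 1 C"
  shows "exact_dimensional_with \<omega> ddim" "measure_dim \<omega> = ddim" "hausdorff_dim (support_on_dom \<omega>) = ddim"
    "\<nexists>g. real_analytic_on g UNIV \<and> support_on_dom \<omega> = {(x, g x) | x. 0 \<le> x \<and> x < 1}"
proof -
  interpret borel_prob \<omega> by (rule borel_prob_SRBlim[OF S])
  have low: "AE z in \<omega>. eventually (\<lambda>r. measure \<omega> (ball z r) \<le> r powr (ddim - \<epsilon>)) (at_right 0)" if "\<epsilon> > 0" for \<epsilon>
    by (rule lower_local_dim[OF F S that])
  have dd: "ddim > 0" using ddim_gt1 by simp
  note up = covering_local_dim[OF \<gamma>0 \<gamma>1 less_imp_le[OF dd] covering_support[OF S] ae_support(3)[OF S]]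
  show ex: "exact_dimensional_with \<omega> ddim" by (rule exact_dimension[OF dd up low])
  then show "measure_dim \<omega> = ddim" by (rule measure_dim_eq)
  show "hausdorff_dim (support_on_dom \<omega>) = ddim"
  proof (rule hausdorff_dim_eq[OF dd])
    fix s assume "s > ddim"
    then show "hausdorff_measure s (support_on_dom \<omega>) = 0"
      using dd by (intro covering_hausdorff[OF \<gamma>0 \<gamma>1 covering_support[OF S]]) auto
  next
    fix s assume s: "0 < s" "s < ddim"
    show "hausdorff_measure s (support_on_dom \<omega>) \<noteq> 0"
    proof (rule mass_distribution[OF low ae_support(1,2)[OF S] s(1)])
      show "0 < (ddim - s) / 2" "s < ddim - (ddim - s) / 2" using s by (auto simp: field_simps)
    qed
  qed
  show "\<nexists>g. real_analytic_on g UNIV \<and> support_on_dom \<omega> = {(x, g x) | x. 0 \<le> x \<and> x < 1}"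
  proof
    assume "\<exists>g. real_analytic_on g UNIV \<and> support_on_dom \<omega> = {(x, g x) | x. 0 \<le> x \<and> x < 1}"
    then obtain g where an: "real_analytic_on g UNIV" and gr: "support_on_dom \<omega> = {(x, g x) | x. 0 \<le> x \<and> x < 1}" by blast
    have cov: "covering \<gamma> 1 (support_on_dom \<omega>)" unfolding gr by (rule analytic_graph_covering[OF S an])
    \<comment> \<open>A third of the gap, so that
      \<open>1 + \<epsilon> < ddim - \<epsilon>\<close>.\<close>
    define \<epsilon> where "\<epsilon> = (ddim - 1) / 3"
    have \<epsilon>: "\<epsilon> > 0" using ddim_gt1 by (simp add: \<epsilon>_def)
    have "AE z in \<omega>. eventually (\<lambda>r. r powr (1 + \<epsilon>) \<le> measure \<omega> (ball z r)) (at_right 0)"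
      by (rule covering_local_dim[OF \<gamma>0 \<gamma>1 _ cov ae_support(3)[OF S] \<epsilon>]) simp
    moreover have "AE z in \<omega>. eventually (\<lambda>r. measure \<omega> (ball z r) \<le> r powr (ddim - \<epsilon>)) (at_right 0)"
      by (rule low[OF \<epsilon>])
    ultimately have "AE z in \<omega>. False"
    proof eventually_elim
      case (elim z)
      have "eventually (\<lambda>r::real. r > 0) (at_right 0)" "eventually (\<lambda>r::real. r < 1) (at_right 0)"
        by (auto simp: eventually_at_right_less eventually_at_right[of 0 1] intro!: exI[of _ 1])
      with elim have "eventually (\<lambda>r::real. False) (at_right 0)"
      proof eventually_elim
        case (elim r)
        have "r powr (ddim - \<epsilon>) < r powr (1 + \<epsilon>)" using elim(3,4) \<epsilon> by (intro powr_less_mono') (auto simp: \<epsilon>_def field_simps)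
        then show ?case using elim by linarith
      qed
      then show ?case by simp
    qed
    then show False by simp
  qed
qed

text \<open>The first marginal of every \<open>mu q\<close> is Lebesgue measure on the unit
  interval, so a ball weighs at most as much as its projection.\<close>

lemma measure_ball_le:
  assumes S: "SRBlim \<omega>" and r: "r > 0"
  shows "measure \<omega> (ball z r) \<le> 2 * r"
proof (rule ccontr)
  assume "\<not> ?thesis"
  then have "2 * r < measure \<omega> (ball z r)" by simp
  from SRBlim_open[OF S open_ball this] obtain q where q: "2 * r < mu q (indicator (ball z r))"
    by (auto simp: eventually_sequentially)
  let ?I = "{fst z - r<..<fst z + r}"
  have bI: "bbd (indicator ?I)" by (rule bbdI[where B=1]) (auto simp: indicator_def)
  have "mu q (indicator (ball z r)) \<le> Av (b ^ q) (\<lambda>t. indicator ?I (frac t))"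
    unfolding mu_def
  proof (rule Av_mono)
    show "bbd (\<lambda>t. indicator (ball z r) (frac t, HH 0 q t))" by (rule bbd_mu[where B=1]) (auto simp: indicator_def)
    show "bbd (\<lambda>t. indicator ?I (frac t) :: real)" by (rule bbd_comp[OF bI]) simp
    fix t
    have "\<bar>fst z - frac t\<bar> < r" if "(frac t, HH 0 q t) \<in> ball z r"
      using that abs_fst_snd_le_dist(1)[of z "(frac t, HH 0 q t)"] by simp
    then show "indicator (ball z r) (frac t, HH 0 q t) \<le> (indicator ?I (frac t) :: real)"
      by (auto simp: indicator_def abs_less_iff)
  qed
  also have "\<dots> = (\<integral>x. indicator ?I x \<partial>U01)" by (rule Av_frac[OF bI]) simp
  also have "\<dots> = measure lborel (?I \<inter> {0..<1})" by (simp add: measure_U01)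
  also have "\<dots> \<le> measure lborel ?I" using r by (intro measure_mono_fmeasurable) (auto simp: fmeasurable_def)
  also have "\<dots> = 2 * r" using r by simp
  finally show False using q by simp
qed

section \<open>The degenerate case\<close>

lemma limit_analytic_lipschitz:
  assumes lim: "\<And>t. (\<lambda>q. HH 0 q t) \<longlonglongrightarrow> g t"
  shows "\<bar>g s - g t\<bar> \<le> Cb 1 * \<bar>s - t\<bar>"
proof (rule LIMSEQ_le_const2)
  show "(\<lambda>q. \<bar>HH 0 q s - HH 0 q t\<bar>) \<longlonglongrightarrow> \<bar>g s - g t\<bar>" by (intro tendsto_intros lim)
  show "\<exists>N. \<forall>n\<ge>N. \<bar>HH 0 n s - HH 0 n t\<bar> \<le> Cb 1 * \<bar>s - t\<bar>" using HH_lipschitz[of 0] by auto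
qed

text \<open>The truncated curves converge uniformly to the graph, and the support stays near them,
  so it lies on the graph. Conversely the curves over a short window to the right of
  \<open>x\<close> lie in a given ball about \<open>(x, g x)\<close>, and the window carries
  Lebesgue mass.\<close>

lemma degenerate_support:
  assumes S: "SRBlim \<omega>" and per: "\<And>t. g (t + 1) = g t" and B: "\<And>t. \<bar>g t\<bar> \<le> B"
    and g: "\<And>t. g (real b * t) = f 0 t + \<gamma> * g t"
    and lip: "\<And>s t. \<bar>g s - g t\<bar> \<le> L * \<bar>s - t\<bar>"
  shows "support_on_dom \<omega> = {(x, g x) | x. 0 \<le> x \<and> x < 1}"
proof -
  interpret borel_prob \<omega> by (rule borel_prob_SRBlim[OF S])
  have L0: "L \<ge> 0" using lip[of 1 0] by simp
  have B0: "B \<ge> 0" using B[of 0] by linarith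
  have near: "\<bar>HH 0 q t - g (frac t)\<bar> \<le> \<gamma> ^ q * B" for q t
  proof -
    have "g (frac t) = g t" using periodic_frac[of g, OF per] by simp
    then have "\<bar>HH 0 q t - g (frac t)\<bar> = \<gamma> ^ q * \<bar>g (t / real b ^ q)\<bar>"
      unfolding HH_coboundary[OF g] using \<gamma>0 by (simp add: abs_mult)
    also have "\<dots> \<le> \<gamma> ^ q * B" using B \<gamma>0 by (intro mult_left_mono) auto
    finally show ?thesis .
  qed
  have gq: "(\<lambda>q. c * \<gamma> ^ q) \<longlonglongrightarrow> 0" for c
    using tendsto_mult_left[OF LIMSEQ_power_zero[of \<gamma>], of c] \<gamma>0 \<gamma>1 by simp
  show ?thesis
  proof (intro equalityI subsetI)
    fix z assume z: "z \<in> support_on_dom \<omega>"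
    define c where "c = (1 + L) * (Cb 0 + 1) + B"
    have "\<bar>snd z - g (fst z)\<bar> \<le> c * \<gamma> ^ q" for q
    proof -
      obtain t where t: "dist z (frac t, HH 0 q t) \<le> (Cb 0 + 1) * \<gamma> ^ q" using support_near_curve[OF S z] by blast
      have 1: "\<bar>fst z - frac t\<bar> \<le> (Cb 0 + 1) * \<gamma> ^ q" "\<bar>snd z - HH 0 q t\<bar> \<le> (Cb 0 + 1) * \<gamma> ^ q"
        using abs_fst_snd_le_dist[of z "(frac t, HH 0 q t)"] t by auto
      have "\<bar>g (fst z) - g (frac t)\<bar> \<le> L * \<bar>fst z - frac t\<bar>" by (rule lip)
      also have "\<dots> \<le> L * ((Cb 0 + 1) * \<gamma> ^ q)" using 1 L0 by (intro mult_left_mono)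
      finally have "\<bar>snd z - g (fst z)\<bar> \<le> (Cb 0 + 1) * \<gamma> ^ q + \<gamma> ^ q * B + L * ((Cb 0 + 1) * \<gamma> ^ q)"
        using 1(2) near[of q t] by linarith
      also have "\<dots> = c * \<gamma> ^ q" by (simp add: c_def algebra_simps)
      finally show ?thesis .
    qed
    then have "\<bar>snd z - g (fst z)\<bar> \<le> 0" by (intro LIMSEQ_le_const[OF gq]) auto
    then have "z = (fst z, g (fst z))" by (simp add: prod_eq_iff)
    moreover have "0 \<le> fst z" "fst z < 1" using z by (auto simp: support_on_dom_def dom01_def)
    ultimately show "z \<in> {(x, g x) | x. 0 \<le> x \<and> x < 1}" by blast
  next
    fix z assume "z \<in> {(x, g x) | x. 0 \<le> x \<and> x < 1}"
    then obtain x where x: "0 \<le> x" "x < 1" and z: "z = (x, g x)" by auto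
    have "emeasure \<omega> (ball z r) > 0" if r: "r > 0" for r
    proof (rule ccontr)
      assume "\<not> ?thesis"
      then have e0: "measure \<omega> (ball z r) = 0" by (simp add: measure_def)
      \<comment> \<open>The closed half ball has an open complement, which is what
        \<open>SRBlim_open\<close> accepts.\<close>
      let ?C = "cball z (r / 2)"
      have "measure \<omega> ?C \<le> measure \<omega> (ball z r)" using r by (intro finite_measure_mono) auto
      then have "measure \<omega> ?C = 0" using e0 by (simp add: measure_le_0_iff)
      moreover have "space \<omega> = UNIV" using sets_eq_imp_space_eq[OF so] by simp
      ultimately have V1: "measure \<omega> (- ?C) = 1" using prob_compl[of ?C] by (simp add: Compl_eq_Diff_UNIV)
      \<comment> \<open>Window length: it stays inside the unit interval, and horizontal and
        Lipschitz errors together use at most an eighth of \<open>r\<close>.\<close>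
      define \<delta> where "\<delta> = min (1 - x) (r / (8 * (1 + L)))"
      have \<delta>: "\<delta> > 0" "x + \<delta> \<le> 1" using x r L0 by (auto simp: \<delta>_def)
      have \<delta>r: "(1 + L) * \<delta> \<le> r / 8"
      proof -
        have "(1 + L) * \<delta> \<le> (1 + L) * (r / (8 * (1 + L)))" using L0 by (intro mult_left_mono) (auto simp: \<delta>_def)
        also have "\<dots> = r / 8" using L0 by (simp add: field_simps add_nonneg_eq_0_iff)
        finally show ?thesis .
      qed
      have "1 - \<delta> < measure \<omega> (- ?C)" using V1 \<delta> by simp
      from SRBlim_open[OF S _ this] have ev: "eventually (\<lambda>q. 1 - \<delta> < mu q (indicator (- ?C))) sequentially" by auto
      have "eventually (\<lambda>q. B * \<gamma> ^ q < r / 8) sequentially" by (rule order_tendstoD(2)[OF gq]) (use r in simp)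
      then have "eventually (\<lambda>q. 1 - \<delta> < mu q (indicator (- ?C)) \<and> B * \<gamma> ^ q < r / 8) sequentially"
        using ev by eventually_elim simp
      then obtain q where q: "1 - \<delta> < mu q (indicator (- ?C))" "B * \<gamma> ^ q < r / 8" by (auto simp: eventually_sequentially)
      let ?h = "\<lambda>y. 1 + (- 1) * indicator {x..<x + \<delta>} y :: real"
      have bh: "bbd ?h" by (rule bbdI[where B=1]) (auto simp: indicator_def)
      have "mu q (indicator (- ?C)) \<le> Av (b ^ q) (\<lambda>t. ?h (frac t))"
        unfolding mu_def
      proof (rule Av_mono)
        show "bbd (\<lambda>t. indicator (- ?C) (frac t, HH 0 q t))" by (rule bbd_mu[where B=1]) (auto simp: indicator_def)
        show "bbd (\<lambda>t. ?h (frac t))" by (rule bbd_comp[OF bh]) simp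
        fix t
        have "(frac t, HH 0 q t) \<in> ?C" if t: "frac t \<in> {x..<x + \<delta>}"
        proof -
          have 1: "\<bar>x - frac t\<bar> \<le> \<delta>" using t by auto
          have "\<bar>g x - g (frac t)\<bar> \<le> L * \<delta>" using lip[of x "frac t"] mult_left_mono[OF 1 L0] by linarith
          then have "dist z (frac t, HH 0 q t) \<le> \<delta> + (L * \<delta> + B * \<gamma> ^ q)"
            using dist_pair_le[of z "(frac t, HH 0 q t)"] 1 near[of q t] by (simp add: z mult.commute)
          then show ?thesis using \<delta>r q(2) r by (simp add: algebra_simps)
        qed
        then show "indicator (- ?C) (frac t, HH 0 q t) \<le> ?h (frac t)" by (auto simp: indicator_def)
      qed
      also have "\<dots> = (\<integral>y. ?h y \<partial>U01)" by (rule Av_frac[OF bh]) simp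
      also have "\<dots> = 1 - measure U01 {x..<x + \<delta>}"
        by (subst Bochner_Integration.integral_add) (auto simp: U01.prob_space[unfolded space_U01] intro!: U01.integrable_const_bound[of _ 1])
      also have "measure U01 {x..<x + \<delta>} = \<delta>"
      proof -
        have "{x..<x + \<delta>} \<inter> {0..<1} = {x..<x + \<delta>}" using x \<delta> by auto
        then show ?thesis using \<delta> by (simp add: measure_U01)
      qed
      finally show False using q(1) by simp
    qed
    then show "z \<in> support_on_dom \<omega>" using x by (simp add: support_on_dom_def dom01_def z)
  qed
qed

end

context skew_analytic
begin

text \<open>All derivative series converge uniformly, so the limit may be differentiated term by
  term, and the bounds of \<open>HH_bound\<close> pass to the limit as Cauchy estimates.\<close>

lemma limit_analytic:
  assumes lim: "\<And>t. (\<lambda>q. HH 0 q t) \<longlonglongrightarrow> g t"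
  shows "real_analytic_on g UNIV"
proof -
  define u where "u j n t = \<gamma> ^ n / real b ^ (j * Suc n) * f j (t / real b ^ Suc n)" for j n t
  define G where "G j t = (\<Sum>n. u j n t)" for j t
  have ub: "norm (u j n t) \<le> \<gamma> ^ n * (K * fact j / R ^ j)" for j n t
  proof -
    have "norm (u j n t) = \<gamma> ^ n * (\<bar>f j (t / real b ^ Suc n)\<bar> / real b ^ (j * Suc n))"
      using \<gamma>0 by (simp add: u_def abs_mult)
    also have "\<dots> \<le> \<gamma> ^ n * ((K * fact j / R ^ j) / 1)"
      using \<gamma>0 bd[of j "t / real b ^ Suc n"] order_trans[OF abs_ge_zero bd]
      by (intro mult_left_mono frac_le) auto
    finally show ?thesis by simp
  qed
  have sg: "summable (\<lambda>n. \<gamma> ^ n * (K * fact j / R ^ j))" for j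
    using \<gamma>0 \<gamma>1 by (intro summable_mult2 summable_geometric) auto
  have su: "summable (\<lambda>n. u j n t)" for j t by (rule summable_comparison_test'[OF sg ub])
  have uc: "uniformly_convergent_on UNIV (\<lambda>n t. \<Sum>i<n. u j i t)" for j
    using Weierstrass_m_test[OF _ sg, of UNIV "u j" j] ub by (auto simp: uniformly_convergent_on_def)
  have du: "(u j n has_field_derivative u (Suc j) n t) (at t)" for j n t
  proof -
    have "((\<lambda>t. f j (t / real b ^ Suc n)) has_real_derivative f (Suc j) (t / real b ^ Suc n) * (1 / real b ^ Suc n)) (at t)"
      by (rule DERIV_chain2[OF der]) (auto intro!: derivative_eq_intros)
    from DERIV_cmult[OF this, of "\<gamma> ^ n / real b ^ (j * Suc n)"]
    have "(u j n has_field_derivative \<gamma> ^ n / real b ^ (j * Suc n) * (f (Suc j) (t / real b ^ Suc n) * (1 / real b ^ Suc n))) (at t)"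
      unfolding u_def .
    moreover have "\<gamma> ^ n / real b ^ (j * Suc n) * (f (Suc j) (t / real b ^ Suc n) * (1 / real b ^ Suc n)) = u (Suc j) n t"
      by (simp add: u_def power_add mult_ac)
    ultimately show ?thesis by simp
  qed
  have dG: "(G j has_real_derivative G (Suc j) t) (at t)" for j t
    using has_field_derivative_series'(2)[of UNIV "u j" "u (Suc j)" 0 t, OF _ _ uc _ su] du
    unfolding G_def[abs_def] by simp
  have HG: "(\<lambda>q. HH j q t) \<longlonglongrightarrow> G j t" for j t
    using summable_LIMSEQ[OF su[of j t]] by (simp add: HH_def u_def G_def)
  have "\<bar>G j t\<bar> \<le> (K / (1 - \<gamma>)) * fact j / R ^ j" for j t
  proof (rule LIMSEQ_le_const2)
    show "(\<lambda>q. \<bar>HH j q t\<bar>) \<longlonglongrightarrow> \<bar>G j t\<bar>" by (intro tendsto_intros HG)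
    have "\<bar>HH j n t\<bar> \<le> (K / (1 - \<gamma>)) * fact j / R ^ j" for n using HH_bound[of j n t] by (simp add: Cb_def mult_ac)
    then show "\<exists>N. \<forall>n\<ge>N. \<bar>HH j n t\<bar> \<le> (K / (1 - \<gamma>)) * fact j / R ^ j" by blast
  qed
  then have "real_analytic_on (G 0) UNIV" by (intro analytic_from_bounds[of G "K / (1 - \<gamma>)" R] dG R)
  moreover have "G 0 = g" using LIMSEQ_unique[OF HG lim] by auto
  ultimately show ?thesis by simp
qed

text \<open>Dimension 1 from both sides: the graph has coverings of exponent 1, and balls have mass
  at most \<open>2 * r\<close>.\<close>

lemma degenerate_dimension:
  assumes S: "SRBlim \<omega>" and deg: "\<And>k \<theta>. \<not> int b dvd k \<Longrightarrow> S k \<theta> = 0"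
  shows "exact_dimensional_with \<omega> 1" "measure_dim \<omega> = 1"
    "\<exists>g. real_analytic_on g UNIV \<and> support_on_dom \<omega> = {(x, g x) | x. 0 \<le> x \<and> x < 1}"
proof -
  interpret borel_prob \<omega> by (rule borel_prob_SRBlim[OF S])
  obtain g B where g: "\<And>t. g (t + 1) = g t" "\<And>t. \<bar>g t\<bar> \<le> B" "\<And>t. g (real b * t) = f 0 t + \<gamma> * g t"
    using coboundary_of_degenerate[OF deg] by metis
  have lim: "(\<lambda>q. HH 0 q t) \<longlonglongrightarrow> g t" for t
  proof -
    have "(\<lambda>q. \<gamma> ^ q * g (t / real b ^ q)) \<longlonglongrightarrow> 0"
    proof (rule Lim_null_comparison)
      show "(\<lambda>q. \<gamma> ^ q * B) \<longlonglongrightarrow> 0" using tendsto_mult_right[OF LIMSEQ_power_zero[of \<gamma>], of B] \<gamma>0 \<gamma>1 by simp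
      show "eventually (\<lambda>q. norm (\<gamma> ^ q * g (t / real b ^ q)) \<le> \<gamma> ^ q * B) sequentially"
        using g(2) \<gamma>0 by (auto simp: abs_mult intro!: mult_left_mono)
    qed
    then have "(\<lambda>q. g t - \<gamma> ^ q * g (t / real b ^ q)) \<longlonglongrightarrow> g t - 0" by (intro tendsto_intros)
    then show ?thesis unfolding HH_coboundary[OF g(3)] by simp
  qed
  have an: "real_analytic_on g UNIV" by (rule limit_analytic[OF lim])
  have gr: "support_on_dom \<omega> = {(x, g x) | x. 0 \<le> x \<and> x < 1}"
    by (rule degenerate_support[OF S g limit_analytic_lipschitz[OF lim]])
  then show "\<exists>g. real_analytic_on g UNIV \<and> support_on_dom \<omega> = {(x, g x) | x. 0 \<le> x \<and> x < 1}" using an by blast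
  have cov: "covering \<gamma> 1 (support_on_dom \<omega>)" unfolding gr by (rule analytic_graph_covering[OF S an])
  show "exact_dimensional_with \<omega> 1"
  proof (rule exact_dimension)
    fix \<epsilon> :: real assume \<epsilon>: "\<epsilon> > 0"
    show "AE z in \<omega>. eventually (\<lambda>r. r powr (1 + \<epsilon>) \<le> measure \<omega> (ball z r)) (at_right 0)"
      by (rule covering_local_dim[OF \<gamma>0 \<gamma>1 _ cov ae_support(3)[OF S] \<epsilon>]) simp
    show "AE z in \<omega>. eventually (\<lambda>r. measure \<omega> (ball z r) \<le> r powr (1 - \<epsilon>)) (at_right 0)"
    proof (rule AE_I2)
      fix z
      have "eventually (\<lambda>r::real. r > 0) (at_right 0)" by (simp add: eventually_at_right_less)
      moreover have "eventually (\<lambda>r. r powr ((1 - \<epsilon>) + \<epsilon>) \<le> (1 / 2) * r powr (1 - \<epsilon>)) (at_right 0)"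
        by (rule powr_eventually_le[OF \<epsilon>]) simp
      ultimately show "eventually (\<lambda>r. measure \<omega> (ball z r) \<le> r powr (1 - \<epsilon>)) (at_right 0)"
      proof eventually_elim
        case (elim r)
        then show ?case using measure_ball_le[OF S, of r z] by simp
      qed
    qed
  qed simp
  then show "measure_dim \<omega> = 1" by (rule measure_dim_eq)
qed

end

section \<open>Finiteness of the exceptional parameters\<close>

text \<open>The coefficient bound gives radius of convergence at least 2, so the closed unit disc is
  a compact part of the domain. Infinitely many zeros there would make the holomorphic extension
  constant, hence zero, against \<open>a i \<noteq> 0\<close>.\<close>

lemma finite_zeros_power_series:
  fixes a :: "nat \<Rightarrow> real"
  assumes a: "\<And>j. \<bar>a j\<bar> \<le> M / 2 ^ j" and nz: "a i \<noteq> 0"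
  shows "finite {x \<in> {0<..<1}. (\<Sum>j. x ^ j * a j) = 0}"
proof (rule ccontr)
  assume inf: "\<not> ?thesis"
  define c where "c j = complex_of_real (a j)" for j
  define h where "h z = (\<Sum>j. c j * z ^ j)" for z
  have s: "(\<lambda>j. c j * z ^ j) sums h z" if z: "norm z < 2" for z
  proof -
    have nb: "norm (c j * z ^ j) \<le> M * (norm z / 2) ^ j" for j
      using mult_right_mono[OF a[of j], of "norm z ^ j"] by (simp add: c_def norm_mult norm_power power_divide)
    have sg: "summable (\<lambda>j. M * (norm z / 2) ^ j)" using z by (intro summable_mult summable_geometric) simp
    have "summable (\<lambda>j. c j * z ^ j)" by (rule summable_comparison_test'[OF sg nb])
    then show ?thesis unfolding h_def by (rule summable_sums)
  qed
  have hol: "h holomorphic_on ball 0 2"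
    by (rule power_series_holomorphic[of 0 2 c]) (use s in simp)
  have real: "h (complex_of_real x) = complex_of_real (\<Sum>j. x ^ j * a j)" if "x \<in> {0<..<1}" for x
  proof -
    have "(\<lambda>j. c j * complex_of_real x ^ j) sums h (complex_of_real x)" using that by (intro s) simp
    moreover have "(\<lambda>j. c j * complex_of_real x ^ j) = (\<lambda>j. complex_of_real (x ^ j * a j))" by (simp add: c_def mult.commute)
    ultimately have "(\<lambda>j. complex_of_real (x ^ j * a j)) sums h (complex_of_real x)" by simp
    then have "(\<lambda>j. Re (complex_of_real (x ^ j * a j))) sums Re (h (complex_of_real x))"
      "(\<lambda>j. Im (complex_of_real (x ^ j * a j))) sums Im (h (complex_of_real x))"
      by (rule sums_Re, rule sums_Im)
    then have "(\<lambda>j. x ^ j * a j) sums Re (h (complex_of_real x))" "Im (h (complex_of_real x)) = 0"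
      unfolding Re_complex_of_real Im_complex_of_real using sums_unique2[OF _ sums_zero] by blast+
    then show ?thesis by (simp add: complex_eq_iff sums_iff)
  qed
  have "infinite (complex_of_real ` {x \<in> {0<..<1}. (\<Sum>j. x ^ j * a j) = 0})"
    using inf by (subst finite_image_iff) (auto simp: inj_on_def)
  moreover have sub: "complex_of_real ` {x \<in> {0<..<1}. (\<Sum>j. x ^ j * a j) = 0} \<subseteq> {z \<in> cball 0 1. h z = 0}"
    using real by auto
  ultimately have infz: "infinite {z \<in> cball 0 1. h z = 0}" using finite_subset by blast
  have "h constant_on ball 0 2"
  proof (rule ccontr)
    assume nc: "\<not> h constant_on ball 0 2"
    have "cball 0 1 \<subseteq> ball (0::complex) 2" by auto
    from holomorphic_compact_finite_zeros[OF hol open_ball connected_ball compact_cball this nc] infz show False by simp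
  qed
  then obtain k where k: "\<And>z. z \<in> ball 0 2 \<Longrightarrow> h z = k" by (auto simp: constant_on_def)
  have "{z \<in> cball 0 1. h z = 0} \<noteq> {}" using infz by (metis finite.emptyI)
  then obtain w where w: "norm w \<le> 1" "h w = 0" by auto
  then have "k = 0" using k[of w] by simp
  then have h0: "h z = 0" if "z \<in> ball 0 2" for z using k that by blast
  have ci: "c i \<noteq> 0" using nz by (simp add: c_def)
  show False
  proof (cases "i = 0")
    case True
    have "c 0 = h 0" using sums_unique2[OF powser_sums_zero[of c] s[of 0]] by simp
    then show False using ci True h0[of 0] by simp
  next
    case False
    obtain e where e: "0 < e" "\<And>z. z \<in> cball 0 e - {0} \<Longrightarrow> h z \<noteq> 0"
      by (rule powser_0_nonzero[of 2 0 c h i]) (use s h0[of 0] ci False in simp_all)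
    define w where "w = complex_of_real (min e 1)"
    have "w \<in> cball 0 e - {0}" "w \<in> ball 0 2" using e(1) by (auto simp: w_def)
    then show False using e(2) h0 by blast
  qed
qed

text \<open>Subtracting the mean removes the coefficient at frequency 0; if all others vanished,
  \<open>F\<close> would equal its mean.\<close>

lemma nonconstant_fourier:
  assumes c: "continuous_on UNIV F" and per: "\<And>t. F (t + 1) = F t" and B: "\<And>t. \<bar>F t\<bar> \<le> B" and ne: "F x \<noteq> F y"
  shows "\<exists>k \<theta>. k \<noteq> 0 \<and> fcr F k \<theta> \<noteq> 0"
proof (rule ccontr)
  assume "\<not> ?thesis"
  then have z: "fcr F k \<theta> = 0" if "k \<noteq> 0" for k \<theta> using that by blast
  define m where "m = integral\<^sup>L U01 F"
  define G where "G t = F t - m" for t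
  have bF: "bbd F" by (rule continuous_bbd[OF c B])
  have Gz: "fcr G k \<theta> = 0" for k \<theta>
  proof -
    have "fcr G k \<theta> = (\<integral>t. F t * wave (of_int k) \<theta> t - m * (1 * wave (of_int k) \<theta> t) \<partial>U01)"
      unfolding fcr_def G_def by (simp add: left_diff_distrib)
    also have "\<dots> = fcr F k \<theta> - m * fcr (\<lambda>_. 1) k \<theta>"
      unfolding fcr_def by (subst Bochner_Integration.integral_diff) (auto intro!: bbd_integrable bbd_intros bF bbd_wave)
    also have "\<dots> = 0"
    proof (cases "k = 0")
      case True
      have "fcr F 0 \<theta> = m * cos \<theta>" "fcr (\<lambda>_. 1) 0 \<theta> = cos \<theta>"
        using U01.prob_space by (simp_all add: fcr_def wave_def m_def)
      then show ?thesis using True by simp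
    next
      case False
      have "fcr (\<lambda>_. 1) k \<theta> = 0" by (subst fcr_half_shift) (use False in auto)
      then show ?thesis using z[OF False] by simp
    qed
    finally show ?thesis .
  qed
  have GB: "\<bar>G t\<bar> \<le> B + \<bar>m\<bar>" for t using B[of t] unfolding G_def by linarith
  have Gc: "continuous_on UNIV G" unfolding G_def[abs_def] by (intro continuous_intros c)
  have Gp: "G (t + 1) = G t" for t by (simp add: G_def per)
  have "G t = 0" for t by (rule fourier_unique[OF Gc Gp GB Gz])
  then have "F x = m" "F y = m" by (auto simp: G_def)
  then show False using ne by simp
qed

text \<open>A shift by half a period changes a Lipschitz function by at most
  \<open>M / (2 * \<bar>k\<bar>)\<close>. The integer \<open>N\<close> stands for any lower bound of
  the frequency, later \<open>2 ^ j\<close>.\<close>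

lemma fcr_decay:
  assumes c: "continuous_on UNIV F" and per: "\<And>t. F (t + 1) = F t" and B: "\<And>t. \<bar>F t\<bar> \<le> B"
    and lip: "\<And>s t. \<bar>F s - F t\<bar> \<le> M * \<bar>s - t\<bar>" and k: "k \<noteq> 0" and N: "N > 0" "N \<le> \<bar>k\<bar>"
  shows "\<bar>fcr F k \<theta>\<bar> \<le> M / real_of_int N"
proof -
  have bF: "bbd F" by (rule continuous_bbd[OF c B])
  have M: "M \<ge> 0" using lip[of 1 0] by simp
  define d where "d = 1 / real (2 * nat \<bar>k\<bar>)"
  have d: "0 \<le> d" "d \<le> 1 / real_of_int N"
  proof -
    have "real_of_int N \<le> real (2 * nat \<bar>k\<bar>)" using N by simp
    then show "d \<le> 1 / real_of_int N" unfolding d_def using N by (intro divide_left_mono mult_pos_pos) auto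
  qed (simp add: d_def)
  let ?I = "\<integral>t. (F t - F (t + d)) * wave (of_int k) \<theta> t \<partial>U01"
  have "\<bar>?I\<bar> \<le> (\<integral>t. \<bar>(F t - F (t + d)) * wave (of_int k) \<theta> t\<bar> \<partial>U01)" by (rule integral_abs_bound)
  also have "\<dots> \<le> (\<integral>t. M * d \<partial>U01)"
  proof (rule integral_mono_AE')
    show "AE t in U01. 0 \<le> M * d" using M d by simp
    show "AE t in U01. \<bar>(F t - F (t + d)) * wave (of_int k) \<theta> t\<bar> \<le> M * d"
    proof (rule AE_I2)
      fix t
      have "\<bar>F t - F (t + d)\<bar> \<le> M * d" using lip[of t "t + d"] d by simp
      then show "\<bar>(F t - F (t + d)) * wave (of_int k) \<theta> t\<bar> \<le> M * d"
        unfolding abs_mult using mult_mono[OF _ wave_le[of "of_int k" \<theta> t], of "\<bar>F t - F (t + d)\<bar>" "M * d"] mult_nonneg_nonneg[OF M d(1)] by simp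
    qed
  qed simp
  also have "(\<integral>t. M * d \<partial>U01) = M * d" using U01.prob_space by simp
  finally have "\<bar>fcr F k \<theta>\<bar> \<le> M * d / 2"
    unfolding fcr_half_shift[OF bF per k] d_def[symmetric] by simp
  also have "\<dots> \<le> M * d" using M d by simp
  also have "\<dots> \<le> M * (1 / real_of_int N)" using M d by (intro mult_left_mono)
  finally show ?thesis by simp
qed

lemma factor_out_base_int:
  fixes b :: nat and k :: int assumes b: "b \<ge> 2" and k: "k \<noteq> 0"
  obtains n k' where "k = k' * int b ^ n" "\<not> int b dvd k'"
proof -
  obtain n m where m: "nat \<bar>k\<bar> = b ^ n * m" "\<not> b dvd m" using factor_out_base[OF b, of "nat \<bar>k\<bar>"] k by auto
  have "\<bar>k\<bar> = int (b ^ n * m)" using m(1) by linarith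
  then have "k = (sgn k * int m) * int b ^ n" using sgn_mult_abs[of k] by (simp add: mult_ac)
  moreover have "\<not> int b dvd sgn k * int m" using m(2) k by (auto simp: sgn_if)
  ultimately show thesis by (rule that)
qed

text \<open>One nonzero coefficient, at \<open>k = k' * b ^ n\<close>, suffices: every degenerate
  \<open>\<gamma>\<close> is a zero of the single power series with the coefficients at
  \<open>k' * b ^ j\<close>. Since \<open>2 ^ j \<le> \<bar>k' * b ^ j\<bar>\<close>, these are at
  most \<open>M / 2 ^ j\<close> in modulus.\<close>

lemma finite_degenerate:
  fixes b :: nat
  assumes b: "b \<ge> 2" and c: "continuous_on UNIV F" and per: "\<And>t. F (t + 1) = F t" and B: "\<And>t. \<bar>F t\<bar> \<le> B"
    and lip: "\<And>s t. \<bar>F s - F t\<bar> \<le> M * \<bar>s - t\<bar>" and ne: "F x \<noteq> F y"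
  shows "finite {\<gamma> \<in> {0<..<1}. \<forall>k \<theta>. \<not> int b dvd k \<longrightarrow> (\<Sum>j. \<gamma> ^ j * fcr F (k * int b ^ j) \<theta>) = 0}"
proof -
  obtain k \<theta> where k: "k \<noteq> 0" "fcr F k \<theta> \<noteq> 0" using nonconstant_fourier[OF c per B ne] by blast
  obtain n k' where k': "k = k' * int b ^ n" "\<not> int b dvd k'" by (rule factor_out_base_int[OF b k(1)])
  have k'0: "k' \<noteq> 0" using k' by auto
  have M: "M \<ge> 0" using lip[of 1 0] by simp
  have "\<bar>fcr F (k' * int b ^ j) \<theta>\<bar> \<le> M / 2 ^ j" for j
  proof -
    have "(2::int) ^ j \<le> int b ^ j" using b by (intro power_mono) auto
    also have "\<dots> \<le> \<bar>k'\<bar> * int b ^ j" using mult_right_mono[of 1 "\<bar>k'\<bar>" "int b ^ j"] k'0 by simp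
    finally have "2 ^ j \<le> \<bar>k' * int b ^ j\<bar>" by (simp add: abs_mult)
    then have "\<bar>fcr F (k' * int b ^ j) \<theta>\<bar> \<le> M / real_of_int (2 ^ j)"
      using k'0 b by (intro fcr_decay[OF c per B lip]) auto
    then show ?thesis by simp
  qed
  then have "finite {\<gamma> \<in> {0<..<1}. (\<Sum>j. \<gamma> ^ j * fcr F (k' * int b ^ j) \<theta>) = 0}"
    by (rule finite_zeros_power_series) (use k k' in auto)
  then show ?thesis by (rule rev_finite_subset) (use k' in auto)
qed

text \<open>The degeneracy \<open>D\<close> is recorded along with the graph alternative; this later
  places the parameters with a graph inside the finite set of degenerate ones.\<close>

lemma (in skew_analytic) dichotomy:
  assumes S: "SRBlim \<omega>"
  defines "P1 \<equiv> \<exists>g. real_analytic_on g UNIV \<and> support_on_dom \<omega> = {(x, g x) | x. 0 \<le> x \<and> x < 1}"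
    and "P2 \<equiv> hausdorff_dim (support_on_dom \<omega>) = measure_dim \<omega> \<and>
      measure_dim \<omega> = min 2 (1 + ln (real b) / ln (1 / \<gamma>))"
    and "D \<equiv> \<forall>k \<theta>. \<not> int b dvd k \<longrightarrow> S k \<theta> = 0"
  shows "exact_dimensional \<omega>" "P1 \<and> \<not> P2 \<and> D \<or> \<not> P1 \<and> P2"
proof -
  have "exact_dimensional \<omega> \<and> (P1 \<and> \<not> P2 \<and> D \<or> \<not> P1 \<and> P2)"
  proof (cases D)
    case True
    then have deg: "S k \<theta> = 0" if "\<not> int b dvd k" for k \<theta> using that by (simp add: D_def)
    note dd = degenerate_dimension[OF S deg]
    have "measure_dim \<omega> \<noteq> ddim" using dd(2) ddim_gt1 by simp
    then show ?thesis using dd True unfolding exact_dimensional_def P1_def P2_def ddim_def sdim_def by blast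
  next
    case False
    then obtain k0 \<theta>0 where "\<not> int b dvd k0" "S k0 \<theta>0 \<noteq> 0" unfolding D_def by blast
    from separation_of_nondegenerate[OF this] obtain c0 m1 where c0: "c0 > 0"
      and sep: "\<And>m k. m \<ge> m1 \<Longrightarrow> \<not> b dvd k \<Longrightarrow> \<exists>y. \<bar>HH 0 m y - HH 0 m (y + real k)\<bar> \<ge> c0" by blast
    have "Full 1 C" if "C > 0" for C by (rule Full_one_of_separation[OF c0 sep that])
    note nd = nondegenerate_dimension[OF S this]
    show ?thesis using nd unfolding exact_dimensional_def P1_def P2_def ddim_def sdim_def by auto
  qed
  then show "exact_dimensional \<omega>" "P1 \<and> \<not> P2 \<and> D \<or> \<not> P1 \<and> P2" by blast+
qed

theorem mainTheorem1:
  fixes b :: nat and \<gamma> :: real and \<phi> :: "real \<Rightarrow> real"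
  assumes "b \<ge> 2"
    and "0 < \<gamma>" and "\<gamma> < 1"
    and "real_analytic_on \<phi> UNIV"
    and "\<forall>x. \<phi> (x + 1) = \<phi> x"
  shows "(\<forall>\<omega>. SRB_measure (skewT b \<gamma> \<phi>) \<omega> \<longrightarrow>
            exact_dimensional \<omega> \<and>
            (let F = support_on_dom \<omega>;
                 P1 = (\<exists>g. real_analytic_on g UNIV \<and> F = {(x, g x) | x. 0 \<le> x \<and> x < 1});
                 P2 = (hausdorff_dim F = measure_dim \<omega> \<and>
                       measure_dim \<omega> = min 2 (1 + ln (real b) / ln (1 / \<gamma>)))
             in (P1 \<and> \<not> P2) \<or> (\<not> P1 \<and> P2)))
       \<and> ((\<exists>x y. \<phi> x \<noteq> \<phi> y) \<longrightarrow>
            finite {\<gamma>' \<in> {0<..<1}. \<exists>\<omega>. SRB_measure (skewT b \<gamma>' \<phi>) \<omega> \<and>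
               (\<exists>g. real_analytic_on g UNIV \<and>
                  support_on_dom \<omega> = {(x, g x) | x. 0 \<le> x \<and> x < 1})})"
proof -
  have per: "\<phi> (x + 1) = \<phi> x" for x using assms by simp
  define f where "f j = (deriv ^^ j) \<phi>" for j
  obtain K R where R: "R > 0" and KR: "\<And>y j. \<bar>f j y\<bar> \<le> K * fact j / R ^ j"
    unfolding f_def using analytic_periodic_bound[OF assms(4) per] by blast
  have f0: "f 0 = \<phi>" by (simp add: f_def)
  \<comment> \<open>\<open>K\<close> and \<open>R\<close> come from \<open>\<phi>\<close> alone, so
    every parameter in the open unit interval is an instance with the same derivative
    bounds.\<close>
  have fam: "skew_analytic b \<gamma>' f K R" if "\<gamma>' \<in> {0<..<1}" for \<gamma>'
  proof unfold_locales
    show "f j (t + 1) = f j t" for j t unfolding f_def by (rule deriv_periodic[OF assms(4) per])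
    show "(f j has_real_derivative f (Suc j) t) (at t)" for j t unfolding f_def by (rule analytic_deriv[OF assms(4)])
  qed (use that assms(1) R KR in auto)
  define A where "A \<omega> \<longleftrightarrow> (\<exists>g. real_analytic_on g UNIV \<and> support_on_dom \<omega> = {(x, g x) | x. 0 \<le> x \<and> x < 1})" for \<omega>
  define Q where "Q \<gamma>' \<omega> \<longleftrightarrow> hausdorff_dim (support_on_dom \<omega>) = measure_dim \<omega> \<and>
    measure_dim \<omega> = min 2 (1 + ln (real b) / ln (1 / \<gamma>'))" for \<gamma>' \<omega>
  define D where "D \<gamma>' \<longleftrightarrow> (\<forall>k \<theta>. \<not> int b dvd k \<longrightarrow> (\<Sum>j. \<gamma>' ^ j * fcr \<phi> (k * int b ^ j) \<theta>) = 0)" for \<gamma>'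
  have main: "exact_dimensional \<omega>" "A \<omega> \<and> \<not> Q \<gamma>' \<omega> \<and> D \<gamma>' \<or> \<not> A \<omega> \<and> Q \<gamma>' \<omega>"
    if g': "\<gamma>' \<in> {0<..<1}" and S: "SRB_measure (skewT b \<gamma>' \<phi>) \<omega>" for \<gamma>' \<omega>
  proof -
    interpret skew_analytic b \<gamma>' f K R by (rule fam[OF g'])
    have "SRBlim \<omega>" using S by (intro SRB_imp_SRBlim) (simp add: f0)
    from dichotomy[OF this, unfolded S_def cc_def f0]
    show "exact_dimensional \<omega>" "A \<omega> \<and> \<not> Q \<gamma>' \<omega> \<and> D \<gamma>' \<or> \<not> A \<omega> \<and> Q \<gamma>' \<omega>"
      unfolding A_def Q_def D_def .
  qed
  have fin: "finite {\<gamma>' \<in> {0<..<1}. \<exists>\<omega>. SRB_measure (skewT b \<gamma>' \<phi>) \<omega> \<and> A \<omega>}" if ne: "\<phi> x \<noteq> \<phi> y" for x y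
  proof (rule finite_subset)
    have d: "(\<phi> has_real_derivative f 1 t) (at t)" for t
      using analytic_deriv[OF assms(4), of 0 t] by (simp add: f_def)
    have lip: "\<bar>\<phi> s - \<phi> t\<bar> \<le> (K / R) * \<bar>s - t\<bar>" for s t
      using field_differentiable_bound[of UNIV \<phi> "f 1" "K / R" s t] d KR[of 1] by simp
    have cont: "continuous_on UNIV \<phi>" using d by (intro DERIV_continuous_on) auto
    have "\<bar>\<phi> t\<bar> \<le> K" for t using KR[of 0 t] by (simp add: f0)
    from finite_degenerate[OF assms(1) cont per this lip ne]
    show "finite {\<gamma>' \<in> {0<..<1}. D \<gamma>'}" unfolding D_def .
    show "{\<gamma>' \<in> {0<..<1}. \<exists>\<omega>. SRB_measure (skewT b \<gamma>' \<phi>) \<omega> \<and> A \<omega>} \<subseteq> {\<gamma>' \<in> {0<..<1}. D \<gamma>'}"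
      using main(2) by blast
  qed
  have g01: "\<gamma> \<in> {0<..<1}" using assms by simp
  show ?thesis unfolding Let_def A_def[symmetric] Q_def[symmetric]
    using main[OF g01] fin by blast
qed

end
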